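(* Let $\mathcal{C}$ be a locally Jordan--Hölder category with a full collection of pairwise non-isomorphic simple objects $\{S_i\}_{i\in I}$ (every simple object of $\mathcal{C}$ is isomorphic to exactly one $S_i$). If $\mathcal{C}$ admits locally finite direct sums of $\{S_i\}_{i\in I}$, then its asymptotic Grothendieck group is $$\boldsymbol{G}_0(\mathcal{C})\;\cong\;\prod_{i\in I}\mathbb{Z}\cdot[S_i],$$ a free $\mathbb{Z}$-module with basis $\{[S_i]\}_{i\in I}$ in the sense of this product (each element is uniquely a possibly infinite formal combination $\sum_i a_i[S_i]$, $a_i\in\mathbb{Z}$). Moreover, for all $X\in\mathcal{C}$, $$[X]=\sum_{i\in I}S_i^*(X)\,[S_i]\in\boldsymbol{G}_0(\mathcal{C}).$$
   Context: Standing assumption: $\mathcal{C}$ is a full abelian subcategory of an abelian category $\mathcal{A}$ that is AB4 and AB4* (arbitrary coproducts and products exist and preserve short exact sequences). The symbol $\bigoplus$ denotes a possibly infinite biproduct, i.e. a coproduct $\coprod_i Y_i$ for which the canonical map $\operatorname{Hom}(-,\coprod_i Y_i)\to\prod_i\operatorname{Hom}(-,Y_i)$ is an isomorphism. A locally finite direct sum of $\{S_i\}_{i\in I}$ is a biproduct $\bigoplus_{i\in I}S_i^{\oplus n_i}$ with all $n_i\in\mathbb{N}$; $\mathcal{C}$ admits them if all of these exist in $\mathcal{C}$. $G_0(\mathcal{C})$ is the usual Grothendieck group (isomorphism classes modulo short exact sequences). If $\bigoplus_i X_i\in\mathcal{C}$, put $\sum_i[X_i]:=[\bigoplus_i X_i]\in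 G_0(\mathcal{C})$. For a sequence $\cdots\xrightarrow{f_1}X_1\xrightarrow{f_0}X_0$, the filtered limit $\lim$ and derived limit $\lim^1$ are the kernel and cokernel (in $\mathcal{A}$) of $1-f_\bullet:\prod_{r\ge0}X_r\to\prod_{r\ge0}X_r$. Dually, for $X_0\xrightarrow{f_0}X_1\xrightarrow{f_1}\cdots$, $\operatorname{colim}$ and $\operatorname{colim}^1$ are the cokernel and kernel of $1-f_\bullet:\coprod_{r\ge0}X_r\to\coprod_{r\ge0}X_r$. Any of these (for a sequence in $\mathcal{C}$) is acceptable if $\bigoplus_{r\ge0}\operatorname{cok}f_r\in\mathcal{C}$ and $\bigoplus_{r\ge0}\ker f_r\in\mathcal{C}$. Asymptotic Grothendieck group: $\boldsymbol{G}_0(\mathcal{C}):=G_0(\mathcal{C})/(J(\mathcal{C})+J^*(\mathcal{C}))$. Here $J(\mathcal{C})$ is generated by the relations $[Y]-[\tilde Y]=[X]+\sum_{r\ge0}([C_r]-[K_r])$ whenever $Y,\tilde Y,X,\bigoplus_r C_r,\bigoplus_r K_r\in\mathcal{C}$, $Y\cong\operatorname{colim}(X\xrightarrow{f_0}Y_1\xrightarrow{f_1}\cdots)$ and $\tilde Y\cong\operatorname{colim}^1$ of the same sequence are acceptable, and $[K_r]=[\ker f_r]$, $[C_r]=[\operatorname{cok}f_r]$ in $G_0(\mathcal{C})$ for all $r$. Dually, $J^*(\mathcal{C})$ is generated by $[X]-[\tilde X]=[Y]+\sum_{r\ge0}([K_r]-[C_r])$ whenever all these objects and direct sums are in $\mathcal{C}$,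 $X\cong\lim(\cdots\xrightarrow{f_1}X_1\xrightarrow{f_0}Y)$ and $\tilde X\cong\lim^1$ of the same sequence are acceptable, and $[K_r]=[\ker f_r]$, $[C_r]=[\operatorname{cok}f_r]$ in $G_0(\mathcal{C})$ for all $r$. $\mathcal{C}$ is locally AB5 if acceptable filtered colimits preserve kernels: for acceptable filtered colimits $X=\operatorname{colim}X_r$, $Y=\operatorname{colim}Y_r$ and commuting maps $u_\bullet:X_\bullet\to Y_\bullet$ inducing $u:X\to Y$, one has $\ker u\cong\operatorname{colim}(\ker u_0\to\ker u_1\to\cdots)$. Dually, locally AB5* means acceptable filtered limits preserve cokernels. An $\mathbb{N}$-filtration of $X$ is a sequence of subobjects $\cdots\subset X_2\subset X_1\subset X_0=X$. It is an $\mathbb{N}$-composition series if $\varprojlim_i X_i\cong0$ and each $X_i/X_{i+1}$ is zero or simple; the nonzero quotients are the composition factors. It is locally finite if each simple object occurs (up to isomorphism) finitely many times among the composition factors; this number is its multiplicity. $X$ is stable for the filtrations if for every pair of $\mathbb{N}$-composition series $X_\bullet$, $X'_\bullet$ of $X$ and every $i$ there is $k$ with $X'_k\subset X_i$. $\mathcal{C}$ is locally Jordan--Hölder if it is locally AB5 and locally AB5*, and every object is stable for the filtrations and admits a locally finite $\mathbb{N}$-composition series. In this case multiplicities do not depend on the chosen series, and $S^*(X)\in\mathbb{N}$ denotes the multiplicity of the simple object $S$ in $X$. *)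

theory Defs
  imports "HOL-Algebra.Free_Abelian_Groups"
begin

section \<open>Preadditive and abelian categories\<close>

record ('o, 'm) cat =
  Ob :: "'o set"
  Ar :: "'m set"
  Dom :: "'m \<Rightarrow> 'o"
  Cod :: "'m \<Rightarrow> 'o"
  Idn :: "'o \<Rightarrow> 'm"
  Cmp :: "'m \<Rightarrow> 'm \<Rightarrow> 'm" (infixr \<open>\<bullet>\<index>\<close> 70)
  Nul :: "'o \<Rightarrow> 'o \<Rightarrow> 'm"
  Add :: "'m \<Rightarrow> 'm \<Rightarrow> 'm"

text \<open>Composition is in the usual order: \<open>g \<bullet> f\<close> is \<open>g\<close> after \<open>f\<close>.  Composites and sums are
  only meaningful for composable, respectively parallel, arrows.\<close>

definition Hom :: "('o, 'm) cat \<Rightarrow> 'o \<Rightarrow> 'o \<Rightarrow> 'm set" where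
  "Hom A X Y = {f \<in> Ar A. Dom A f = X \<and> Cod A f = Y}"

definition hom_group :: "('o, 'm) cat \<Rightarrow> 'o \<Rightarrow> 'o \<Rightarrow> 'm monoid" where
  "hom_group A X Y = \<lparr>carrier = Hom A X Y, mult = Add A, one = Nul A X Y\<rparr>"

definition Diff :: "('o, 'm) cat \<Rightarrow> 'm \<Rightarrow> 'm \<Rightarrow> 'm" where
  "Diff A f g = Add A f (inv\<^bsub>hom_group A (Dom A f) (Cod A f)\<^esub> g)"

locale preadditive_category =
  fixes A :: "('o, 'm) cat" (structure)
  assumes dom_ob: "f \<in> Ar A \<Longrightarrow> Dom A f \<in> Ob A"
    and cod_ob: "f \<in> Ar A \<Longrightarrow> Cod A f \<in> Ob A"
    and idn_hom: "X \<in> Ob A \<Longrightarrow> Idn A X \<in> Hom A X X"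
    and cmp_hom: "f \<in> Hom A X Y \<Longrightarrow> g \<in> Hom A Y Z \<Longrightarrow> g \<bullet> f \<in> Hom A X Z"
    and cmp_idn: "f \<in> Hom A X Y \<Longrightarrow> f \<bullet> Idn A X = f"
    and idn_cmp: "f \<in> Hom A X Y \<Longrightarrow> Idn A Y \<bullet> f = f"
    and cmp_assoc: "f \<in> Hom A W X \<Longrightarrow> g \<in> Hom A X Y \<Longrightarrow> h \<in> Hom A Y Z
      \<Longrightarrow> (h \<bullet> g) \<bullet> f = h \<bullet> (g \<bullet> f)"
    and hom_comm_group: "X \<in> Ob A \<Longrightarrow> Y \<in> Ob A \<Longrightarrow> comm_group (hom_group A X Y)"
    and cmp_add: "f \<in> Hom A X Y \<Longrightarrow> f' \<in> Hom A X Y \<Longrightarrow> g \<in> Hom A Y Z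
      \<Longrightarrow> g \<bullet> Add A f f' = Add A (g \<bullet> f) (g \<bullet> f')"
    and add_cmp: "f \<in> Hom A X Y \<Longrightarrow> g \<in> Hom A Y Z \<Longrightarrow> g' \<in> Hom A Y Z
      \<Longrightarrow> Add A g g' \<bullet> f = Add A (g \<bullet> f) (g' \<bullet> f)"

definition monic :: "('o, 'm) cat \<Rightarrow> 'm \<Rightarrow> bool" where
  "monic A f \<longleftrightarrow> f \<in> Ar A \<and> (\<forall>T\<in>Ob A. \<forall>g\<in>Hom A T (Dom A f). \<forall>h\<in>Hom A T (Dom A f).
     f \<bullet>\<^bsub>A\<^esub> g = f \<bullet>\<^bsub>A\<^esub> h \<longrightarrow> g = h)"

definition epic :: "('o, 'm) cat \<Rightarrow> 'm \<Rightarrow> bool" where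
  "epic A f \<longleftrightarrow> f \<in> Ar A \<and> (\<forall>T\<in>Ob A. \<forall>g\<in>Hom A (Cod A f) T. \<forall>h\<in>Hom A (Cod A f) T.
     g \<bullet>\<^bsub>A\<^esub> f = h \<bullet>\<^bsub>A\<^esub> f \<longrightarrow> g = h)"

definition isomorphism :: "('o, 'm) cat \<Rightarrow> 'm \<Rightarrow> bool" where
  "isomorphism A f \<longleftrightarrow> f \<in> Ar A \<and> (\<exists>g\<in>Hom A (Cod A f) (Dom A f).
     g \<bullet>\<^bsub>A\<^esub> f = Idn A (Dom A f) \<and> f \<bullet>\<^bsub>A\<^esub> g = Idn A (Cod A f))"

definition isomorphic :: "('o, 'm) cat \<Rightarrow> 'o \<Rightarrow> 'o \<Rightarrow> bool" where
  "isomorphic A X Y \<longleftrightarrow> (\<exists>f\<in>Hom A X Y. isomorphism A f)"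

definition zero_object :: "('o, 'm) cat \<Rightarrow> 'o \<Rightarrow> bool" where
  "zero_object A Z \<longleftrightarrow> Z \<in> Ob A \<and>
     (\<forall>X\<in>Ob A. (\<exists>!f. f \<in> Hom A X Z) \<and> (\<exists>!f. f \<in> Hom A Z X))"

text \<open>All limits and colimits below are given by their universal property, so each of these
  predicates holds for every representative of the isomorphism class.  Kernels and cokernels are
  arrows; the kernel object of \<open>k\<close> is \<open>Dom A k\<close>, the cokernel object of \<open>c\<close> is \<open>Cod A c\<close>.\<close>

definition is_kernel :: "('o, 'm) cat \<Rightarrow> 'm \<Rightarrow> 'm \<Rightarrow> bool" where
  "is_kernel A f k \<longleftrightarrow> f \<in> Ar A \<and> k \<in> Ar A \<and> Cod A k = Dom A f \<and>
     f \<bullet>\<^bsub>A\<^esub> k = Nul A (Dom A k) (Cod A f) \<and>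
     (\<forall>T\<in>Ob A. \<forall>g\<in>Hom A T (Dom A f). f \<bullet>\<^bsub>A\<^esub> g = Nul A T (Cod A f) \<longrightarrow>
       (\<exists>!h. h \<in> Hom A T (Dom A k) \<and> k \<bullet>\<^bsub>A\<^esub> h = g))"

definition is_cokernel :: "('o, 'm) cat \<Rightarrow> 'm \<Rightarrow> 'm \<Rightarrow> bool" where
  "is_cokernel A f c \<longleftrightarrow> f \<in> Ar A \<and> c \<in> Ar A \<and> Dom A c = Cod A f \<and>
     c \<bullet>\<^bsub>A\<^esub> f = Nul A (Dom A f) (Cod A c) \<and>
     (\<forall>T\<in>Ob A. \<forall>g\<in>Hom A (Cod A f) T. g \<bullet>\<^bsub>A\<^esub> f = Nul A (Dom A f) T \<longrightarrow>
       (\<exists>!h. h \<in> Hom A (Cod A c) T \<and> h \<bullet>\<^bsub>A\<^esub> c = g))"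

definition short_exact :: "('o, 'm) cat \<Rightarrow> 'm \<Rightarrow> 'm \<Rightarrow> bool" where
  "short_exact A f g \<longleftrightarrow> is_kernel A g f \<and> is_cokernel A f g"

definition is_product ::
  "('o, 'm) cat \<Rightarrow> 'i set \<Rightarrow> ('i \<Rightarrow> 'o) \<Rightarrow> 'o \<Rightarrow> ('i \<Rightarrow> 'm) \<Rightarrow> bool" where
  "is_product A J X P \<pi> \<longleftrightarrow> (\<forall>j\<in>J. X j \<in> Ob A) \<and> P \<in> Ob A \<and> (\<forall>j\<in>J. \<pi> j \<in> Hom A P (X j)) \<and>
     (\<forall>T\<in>Ob A. \<forall>q. (\<forall>j\<in>J. q j \<in> Hom A T (X j)) \<longrightarrow>
       (\<exists>!h. h \<in> Hom A T P \<and> (\<forall>j\<in>J. \<pi> j \<bullet>\<^bsub>A\<^esub> h = q j)))"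

definition is_coproduct ::
  "('o, 'm) cat \<Rightarrow> 'i set \<Rightarrow> ('i \<Rightarrow> 'o) \<Rightarrow> 'o \<Rightarrow> ('i \<Rightarrow> 'm) \<Rightarrow> bool" where
  "is_coproduct A J X P \<iota> \<longleftrightarrow> (\<forall>j\<in>J. X j \<in> Ob A) \<and> P \<in> Ob A \<and> (\<forall>j\<in>J. \<iota> j \<in> Hom A (X j) P) \<and>
     (\<forall>T\<in>Ob A. \<forall>q. (\<forall>j\<in>J. q j \<in> Hom A (X j) T) \<longrightarrow>
       (\<exists>!h. h \<in> Hom A P T \<and> (\<forall>j\<in>J. h \<bullet>\<^bsub>A\<^esub> \<iota> j = q j)))"

locale abelian_category = preadditive_category +
  assumes zero_ex: "\<exists>Z. zero_object A Z"
    and binary_product_ex: "X \<in> Ob A \<Longrightarrow> Y \<in> Ob A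
      \<Longrightarrow> \<exists>P \<pi>. is_product A (UNIV :: bool set) (case_bool X Y) P \<pi>"
    and binary_coproduct_ex: "X \<in> Ob A \<Longrightarrow> Y \<in> Ob A
      \<Longrightarrow> \<exists>P \<iota>. is_coproduct A (UNIV :: bool set) (case_bool X Y) P \<iota>"
    and kernel_ex: "f \<in> Ar A \<Longrightarrow> \<exists>k. is_kernel A f k"
    and cokernel_ex: "f \<in> Ar A \<Longrightarrow> \<exists>c. is_cokernel A f c"
    and monic_is_kernel: "monic A m \<Longrightarrow> \<exists>f. is_kernel A f m"
    and epic_is_cokernel: "epic A e \<Longrightarrow> \<exists>f. is_cokernel A f e"

text \<open>HOL has no class of all sets, and no nonzero abelian category has products indexed by
  arbitrarily large sets.  The type \<open>'u\<close> therefore plays the role of the universe of index sets: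
  ``arbitrary'' families are those indexed by an arbitrary set of elements of \<open>'u\<close>.\<close>

definition AB4 :: "'u itself \<Rightarrow> ('o, 'm) cat \<Rightarrow> bool" where
  "AB4 _ A \<longleftrightarrow>
     (\<forall>(J :: 'u set) X. (\<forall>j\<in>J. X j \<in> Ob A) \<longrightarrow> (\<exists>P \<iota>. is_coproduct A J X P \<iota>)) \<and>
     (\<forall>(J :: 'u set) f g P \<iota> Q \<kappa> R \<rho> F G.
       (\<forall>j\<in>J. short_exact A (f j) (g j)) \<and>
       is_coproduct A J (\<lambda>j. Dom A (f j)) P \<iota> \<and>
       is_coproduct A J (\<lambda>j. Cod A (f j)) Q \<kappa> \<and>
       is_coproduct A J (\<lambda>j. Cod A (g j)) R \<rho> \<and>
       F \<in> Hom A P Q \<and> (\<forall>j\<in>J. F \<bullet>\<^bsub>A\<^esub> \<iota> j = \<kappa> j \<bullet>\<^bsub>A\<^esub> f j) \<and>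
       G \<in> Hom A Q R \<and> (\<forall>j\<in>J. G \<bullet>\<^bsub>A\<^esub> \<kappa> j = \<rho> j \<bullet>\<^bsub>A\<^esub> g j)
       \<longrightarrow> short_exact A F G)"

definition AB4_star :: "'u itself \<Rightarrow> ('o, 'm) cat \<Rightarrow> bool" where
  "AB4_star _ A \<longleftrightarrow>
     (\<forall>(J :: 'u set) X. (\<forall>j\<in>J. X j \<in> Ob A) \<longrightarrow> (\<exists>P \<pi>. is_product A J X P \<pi>)) \<and>
     (\<forall>(J :: 'u set) f g P \<pi> Q \<kappa> R \<rho> F G.
       (\<forall>j\<in>J. short_exact A (f j) (g j)) \<and>
       is_product A J (\<lambda>j. Dom A (f j)) P \<pi> \<and>
       is_product A J (\<lambda>j. Cod A (f j)) Q \<kappa> \<and>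
       is_product A J (\<lambda>j. Cod A (g j)) R \<rho> \<and>
       F \<in> Hom A P Q \<and> (\<forall>j\<in>J. \<kappa> j \<bullet>\<^bsub>A\<^esub> F = f j \<bullet>\<^bsub>A\<^esub> \<pi> j) \<and>
       G \<in> Hom A Q R \<and> (\<forall>j\<in>J. \<rho> j \<bullet>\<^bsub>A\<^esub> G = g j \<bullet>\<^bsub>A\<^esub> \<kappa> j)
       \<longrightarrow> short_exact A F G)"

definition full_subcategory :: "('o, 'm) cat \<Rightarrow> 'o set \<Rightarrow> ('o, 'm) cat" where
  "full_subcategory A K = A\<lparr>Ob := K, Ar := {f \<in> Ar A. Dom A f \<in> K \<and> Cod A f \<in> K}\<rparr>"

text \<open>As usual, an abelian subcategory is one that is abelian with exact inclusion functor.
  Closure under isomorphism in the ambient category is not required.\<close>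

definition full_abelian_subcategory :: "('o, 'm) cat \<Rightarrow> ('o, 'm) cat \<Rightarrow> bool" where
  "full_abelian_subcategory C A \<longleftrightarrow> Ob C \<subseteq> Ob A \<and> C = full_subcategory A (Ob C) \<and>
     abelian_category C \<and> (\<forall>f g. short_exact C f g \<longrightarrow> short_exact A f g)"


section \<open>Infinite biproducts\<close>

text \<open>The arrow \<open>p j\<close> is the canonical projection of the coproduct \<open>B\<close> onto \<open>Y j\<close>.\<close>

definition is_biproduct ::
  "('o, 'm) cat \<Rightarrow> 'i set \<Rightarrow> ('i \<Rightarrow> 'o) \<Rightarrow> 'o \<Rightarrow> ('i \<Rightarrow> 'm) \<Rightarrow> ('i \<Rightarrow> 'm) \<Rightarrow> bool" where
  "is_biproduct A J Y B \<iota> p \<longleftrightarrow> is_coproduct A J Y B \<iota> \<and>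
     (\<forall>j\<in>J. p j \<in> Hom A B (Y j)) \<and>
     (\<forall>i\<in>J. \<forall>j\<in>J. p j \<bullet>\<^bsub>A\<^esub> \<iota> i = (if i = j then Idn A (Y j) else Nul A (Y i) (Y j))) \<and>
     (\<forall>T\<in>Ob A. bij_betw (\<lambda>g. \<lambda>j\<in>J. p j \<bullet>\<^bsub>A\<^esub> g) (Hom A T B) (\<Pi>\<^sub>E j\<in>J. Hom A T (Y j)))"

text \<open>\<open>biproduct_in A C J Y B\<close>: the biproduct of the \<open>Y j\<close>, formed in \<open>A\<close>, is \<open>B\<close> and belongs
  to \<open>C\<close>.\<close>

definition biproduct_in ::
  "('o, 'm) cat \<Rightarrow> ('o, 'm) cat \<Rightarrow> 'i set \<Rightarrow> ('i \<Rightarrow> 'o) \<Rightarrow> 'o \<Rightarrow> bool" where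
  "biproduct_in A C J Y B \<longleftrightarrow> B \<in> Ob C \<and> (\<exists>\<iota> p. is_biproduct A J Y B \<iota> p)"

definition locally_finite_sum ::
  "('o, 'm) cat \<Rightarrow> ('o, 'm) cat \<Rightarrow> 'u set \<Rightarrow> ('u \<Rightarrow> 'o) \<Rightarrow> ('u \<Rightarrow> nat) \<Rightarrow> 'o \<Rightarrow> bool" where
  "locally_finite_sum A C I S n B \<longleftrightarrow>
     (\<exists>Y. (\<forall>i\<in>I. \<exists>\<iota> p. is_biproduct A {..<n i} (\<lambda>_. S i) (Y i) \<iota> p) \<and> biproduct_in A C I Y B)"

definition admits_locally_finite_sums ::
  "('o, 'm) cat \<Rightarrow> ('o, 'm) cat \<Rightarrow> 'u set \<Rightarrow> ('u \<Rightarrow> 'o) \<Rightarrow> bool" where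
  "admits_locally_finite_sums A C I S \<longleftrightarrow> (\<forall>n. \<exists>B. locally_finite_sum A C I S n B)"


section \<open>Limits and colimits of sequences\<close>

definition inverse_sequence :: "('o, 'm) cat \<Rightarrow> (nat \<Rightarrow> 'o) \<Rightarrow> (nat \<Rightarrow> 'm) \<Rightarrow> bool" where
  "inverse_sequence A X f \<longleftrightarrow> (\<forall>r. X r \<in> Ob A \<and> f r \<in> Hom A (X (Suc r)) (X r))"

definition direct_sequence :: "('o, 'm) cat \<Rightarrow> (nat \<Rightarrow> 'o) \<Rightarrow> (nat \<Rightarrow> 'm) \<Rightarrow> bool" where
  "direct_sequence A X f \<longleftrightarrow> (\<forall>r. X r \<in> Ob A \<and> f r \<in> Hom A (X r) (X (Suc r)))"

text \<open>The endomorphism \<open>1 - f\<close> of the product, respectively of the coproduct.\<close>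

definition one_minus_prod ::
  "('o, 'm) cat \<Rightarrow> (nat \<Rightarrow> 'm) \<Rightarrow> 'o \<Rightarrow> (nat \<Rightarrow> 'm) \<Rightarrow> 'm \<Rightarrow> bool" where
  "one_minus_prod A f P \<pi> d \<longleftrightarrow> d \<in> Hom A P P \<and>
     (\<forall>r. \<pi> r \<bullet>\<^bsub>A\<^esub> d = Diff A (\<pi> r) (f r \<bullet>\<^bsub>A\<^esub> \<pi> (Suc r)))"

definition one_minus_coprod ::
  "('o, 'm) cat \<Rightarrow> (nat \<Rightarrow> 'm) \<Rightarrow> 'o \<Rightarrow> (nat \<Rightarrow> 'm) \<Rightarrow> 'm \<Rightarrow> bool" where
  "one_minus_coprod A f P \<iota> d \<longleftrightarrow> d \<in> Hom A P P \<and>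
     (\<forall>r. d \<bullet>\<^bsub>A\<^esub> \<iota> r = Diff A (\<iota> r) (\<iota> (Suc r) \<bullet>\<^bsub>A\<^esub> f r))"

text \<open>\<open>is_lim A X f L p\<close>: \<open>L\<close> is the limit and \<open>p r\<close> is its canonical arrow to \<open>X r\<close>.\<close>

definition is_lim ::
  "('o, 'm) cat \<Rightarrow> (nat \<Rightarrow> 'o) \<Rightarrow> (nat \<Rightarrow> 'm) \<Rightarrow> 'o \<Rightarrow> (nat \<Rightarrow> 'm) \<Rightarrow> bool" where
  "is_lim A X f L p \<longleftrightarrow> inverse_sequence A X f \<and>
     (\<exists>P \<pi> d k. is_product A UNIV X P \<pi> \<and> one_minus_prod A f P \<pi> d \<and>
       is_kernel A d k \<and> Dom A k = L \<and> (\<forall>r. p r = \<pi> r \<bullet>\<^bsub>A\<^esub> k))"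

definition is_lim1 :: "('o, 'm) cat \<Rightarrow> (nat \<Rightarrow> 'o) \<Rightarrow> (nat \<Rightarrow> 'm) \<Rightarrow> 'o \<Rightarrow> bool" where
  "is_lim1 A X f L \<longleftrightarrow> inverse_sequence A X f \<and>
     (\<exists>P \<pi> d c. is_product A UNIV X P \<pi> \<and> one_minus_prod A f P \<pi> d \<and>
       is_cokernel A d c \<and> Cod A c = L)"

definition is_colim ::
  "('o, 'm) cat \<Rightarrow> (nat \<Rightarrow> 'o) \<Rightarrow> (nat \<Rightarrow> 'm) \<Rightarrow> 'o \<Rightarrow> (nat \<Rightarrow> 'm) \<Rightarrow> bool" where
  "is_colim A X f L i \<longleftrightarrow> direct_sequence A X f \<and>
     (\<exists>P \<iota> d c. is_coproduct A UNIV X P \<iota> \<and> one_minus_coprod A f P \<iota> d \<and>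
       is_cokernel A d c \<and> Cod A c = L \<and> (\<forall>r. i r = c \<bullet>\<^bsub>A\<^esub> \<iota> r))"

definition is_colim1 :: "('o, 'm) cat \<Rightarrow> (nat \<Rightarrow> 'o) \<Rightarrow> (nat \<Rightarrow> 'm) \<Rightarrow> 'o \<Rightarrow> bool" where
  "is_colim1 A X f L \<longleftrightarrow> direct_sequence A X f \<and>
     (\<exists>P \<iota> d k. is_coproduct A UNIV X P \<iota> \<and> one_minus_coprod A f P \<iota> d \<and>
       is_kernel A d k \<and> Dom A k = L)"

definition summable_ker_cok :: "('o, 'm) cat \<Rightarrow> ('o, 'm) cat \<Rightarrow> (nat \<Rightarrow> 'm) \<Rightarrow> bool" where
  "summable_ker_cok A C f \<longleftrightarrow>
     (\<exists>c B. (\<forall>r. is_cokernel C (f r) (c r)) \<and> biproduct_in A C UNIV (\<lambda>r. Cod C (c r)) B) \<and>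
     (\<exists>k B. (\<forall>r. is_kernel C (f r) (k r)) \<and> biproduct_in A C UNIV (\<lambda>r. Dom C (k r)) B)"

definition acceptable_inverse ::
  "('o, 'm) cat \<Rightarrow> ('o, 'm) cat \<Rightarrow> (nat \<Rightarrow> 'o) \<Rightarrow> (nat \<Rightarrow> 'm) \<Rightarrow> bool" where
  "acceptable_inverse A C X f \<longleftrightarrow> inverse_sequence C X f \<and> summable_ker_cok A C f"

definition acceptable_direct ::
  "('o, 'm) cat \<Rightarrow> ('o, 'm) cat \<Rightarrow> (nat \<Rightarrow> 'o) \<Rightarrow> (nat \<Rightarrow> 'm) \<Rightarrow> bool" where
  "acceptable_direct A C X f \<longleftrightarrow> direct_sequence C X f \<and> summable_ker_cok A C f"

text \<open>Preservation is stated for the canonical comparison arrow: the arrow \<open>v\<close> from the colimit of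
  the kernels \<open>\<kappa> r\<close> of \<open>u r\<close>, with transition arrows \<open>h r\<close>, is a kernel of the induced \<open>w\<close>.\<close>

definition locally_AB5 :: "('o, 'm) cat \<Rightarrow> ('o, 'm) cat \<Rightarrow> bool" where
  "locally_AB5 A C \<longleftrightarrow>
     (\<forall>X f Y g u L i M j w \<kappa> h N n v.
       acceptable_direct A C X f \<and> acceptable_direct A C Y g \<and>
       (\<forall>r. u r \<in> Hom C (X r) (Y r) \<and> u (Suc r) \<bullet>\<^bsub>C\<^esub> f r = g r \<bullet>\<^bsub>C\<^esub> u r) \<and>
       is_colim A X f L i \<and> is_colim A Y g M j \<and>
       w \<in> Hom A L M \<and> (\<forall>r. w \<bullet>\<^bsub>A\<^esub> i r = j r \<bullet>\<^bsub>A\<^esub> u r) \<and>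
       (\<forall>r. is_kernel C (u r) (\<kappa> r) \<and> h r \<in> Hom C (Dom C (\<kappa> r)) (Dom C (\<kappa> (Suc r))) \<and>
            \<kappa> (Suc r) \<bullet>\<^bsub>C\<^esub> h r = f r \<bullet>\<^bsub>C\<^esub> \<kappa> r) \<and>
       is_colim A (\<lambda>r. Dom C (\<kappa> r)) h N n \<and>
       v \<in> Hom A N L \<and> (\<forall>r. v \<bullet>\<^bsub>A\<^esub> n r = i r \<bullet>\<^bsub>A\<^esub> \<kappa> r)
       \<longrightarrow> is_kernel A w v)"

definition locally_AB5_star :: "('o, 'm) cat \<Rightarrow> ('o, 'm) cat \<Rightarrow> bool" where
  "locally_AB5_star A C \<longleftrightarrow>
     (\<forall>X f Y g u L p M q w \<gamma> h N n v.
       acceptable_inverse A C X f \<and> acceptable_inverse A C Y g \<and>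
       (\<forall>r. u r \<in> Hom C (X r) (Y r) \<and> u r \<bullet>\<^bsub>C\<^esub> f r = g r \<bullet>\<^bsub>C\<^esub> u (Suc r)) \<and>
       is_lim A X f L p \<and> is_lim A Y g M q \<and>
       w \<in> Hom A L M \<and> (\<forall>r. q r \<bullet>\<^bsub>A\<^esub> w = u r \<bullet>\<^bsub>A\<^esub> p r) \<and>
       (\<forall>r. is_cokernel C (u r) (\<gamma> r) \<and> h r \<in> Hom C (Cod C (\<gamma> (Suc r))) (Cod C (\<gamma> r)) \<and>
            h r \<bullet>\<^bsub>C\<^esub> \<gamma> (Suc r) = \<gamma> r \<bullet>\<^bsub>C\<^esub> g r) \<and>
       is_lim A (\<lambda>r. Cod C (\<gamma> r)) h N n \<and>
       v \<in> Hom A M N \<and> (\<forall>r. n r \<bullet>\<^bsub>A\<^esub> v = \<gamma> r \<bullet>\<^bsub>A\<^esub> q r)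
       \<longrightarrow> is_cokernel A w v)"


section \<open>Grothendieck groups\<close>

text \<open>Groups are written multiplicatively, as in \<open>HOL-Algebra\<close>; the free abelian group on a set is
  a group of finitely supported functions and its elements are combined with \<open>+\<close> and \<open>-\<close>.\<close>

definition G0_relations :: "('o, 'm) cat \<Rightarrow> ('o \<Rightarrow>\<^sub>0 int) set" where
  "G0_relations C =
     {frag_of X - frag_of Y | X Y. X \<in> Ob C \<and> Y \<in> Ob C \<and> isomorphic C X Y} \<union>
     {frag_of (Cod C f) - (frag_of (Dom C f) + frag_of (Cod C g)) | f g. short_exact C f g}"

definition G0_kernel :: "('o, 'm) cat \<Rightarrow> ('o \<Rightarrow>\<^sub>0 int) set" where
  "G0_kernel C = generate (free_Abelian_group (Ob C)) (G0_relations C)"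

definition G0 :: "('o, 'm) cat \<Rightarrow> ('o \<Rightarrow>\<^sub>0 int) set monoid" where
  "G0 C = free_Abelian_group (Ob C) Mod G0_kernel C"

definition G0_class :: "('o, 'm) cat \<Rightarrow> 'o \<Rightarrow> ('o \<Rightarrow>\<^sub>0 int) set" where
  "G0_class C X = G0_kernel C #>\<^bsub>free_Abelian_group (Ob C)\<^esub> frag_of X"

text \<open>The element \<open>[P] - [P'] - ([Q] + [R] - [R'])\<close> of \<open>G0 C\<close>.\<close>

definition G0_rel :: "('o, 'm) cat \<Rightarrow> 'o \<Rightarrow> 'o \<Rightarrow> 'o \<Rightarrow> 'o \<Rightarrow> 'o \<Rightarrow> ('o \<Rightarrow>\<^sub>0 int) set" where
  "G0_rel C P P' Q R R' =
     (G0_class C P \<otimes>\<^bsub>G0 C\<^esub> inv\<^bsub>G0 C\<^esub> G0_class C P') \<otimes>\<^bsub>G0 C\<^esub>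
     inv\<^bsub>G0 C\<^esub> (G0_class C Q \<otimes>\<^bsub>G0 C\<^esub> (G0_class C R \<otimes>\<^bsub>G0 C\<^esub> inv\<^bsub>G0 C\<^esub> G0_class C R'))"

text \<open>\<open>ker_cok_sums A C f BK BC\<close>: there are families \<open>K\<close>, \<open>D\<close> with the same classes in \<open>G0 C\<close> as the
  kernels, respectively cokernels, of the \<open>f r\<close>, and \<open>BK\<close>, \<open>BC\<close> are their biproducts, so that
  \<open>[BK]\<close> is the infinite sum of the \<open>[K r]\<close> and \<open>[BC]\<close> that of the \<open>[D r]\<close>.\<close>

definition ker_cok_sums ::
  "('o, 'm) cat \<Rightarrow> ('o, 'm) cat \<Rightarrow> (nat \<Rightarrow> 'm) \<Rightarrow> 'o \<Rightarrow> 'o \<Rightarrow> bool" where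
  "ker_cok_sums A C f BK BC \<longleftrightarrow> (\<exists>K D k c.
     (\<forall>r. K r \<in> Ob C \<and> is_kernel C (f r) (k r) \<and> G0_class C (K r) = G0_class C (Dom C (k r))) \<and>
     (\<forall>r. D r \<in> Ob C \<and> is_cokernel C (f r) (c r) \<and> G0_class C (D r) = G0_class C (Cod C (c r))) \<and>
     biproduct_in A C UNIV K BK \<and> biproduct_in A C UNIV D BC)"

definition J_colim :: "('o, 'm) cat \<Rightarrow> ('o, 'm) cat \<Rightarrow> ('o \<Rightarrow>\<^sub>0 int) set set" where
  "J_colim A C = generate (G0 C)
     {G0_rel C Y Y' (X 0) BC BK | X f Y i Y' BK BC.
        acceptable_direct A C X f \<and> is_colim A X f Y i \<and> is_colim1 A X f Y' \<and>
        Y \<in> Ob C \<and> Y' \<in> Ob C \<and> ker_cok_sums A C f BK BC}"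

definition J_lim :: "('o, 'm) cat \<Rightarrow> ('o, 'm) cat \<Rightarrow> ('o \<Rightarrow>\<^sub>0 int) set set" where
  "J_lim A C = generate (G0 C)
     {G0_rel C X X' (Y 0) BK BC | Y f X p X' BK BC.
        acceptable_inverse A C Y f \<and> is_lim A Y f X p \<and> is_lim1 A Y f X' \<and>
        X \<in> Ob C \<and> X' \<in> Ob C \<and> ker_cok_sums A C f BK BC}"

definition asymptotic_G0 :: "('o, 'm) cat \<Rightarrow> ('o, 'm) cat \<Rightarrow> ('o \<Rightarrow>\<^sub>0 int) set set monoid" where
  "asymptotic_G0 A C = G0 C Mod (J_colim A C <#>\<^bsub>G0 C\<^esub> J_lim A C)"

definition asymptotic_class :: "('o, 'm) cat \<Rightarrow> ('o, 'm) cat \<Rightarrow> 'o \<Rightarrow> ('o \<Rightarrow>\<^sub>0 int) set set" where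
  "asymptotic_class A C X = (J_colim A C <#>\<^bsub>G0 C\<^esub> J_lim A C) #>\<^bsub>G0 C\<^esub> G0_class C X"

text \<open>The possibly infinite combination of the \<open>[S i]\<close> with integer coefficients \<open>a i\<close>.  For
  nonnegative coefficients it is the class of the biproduct of the \<open>S i\<close> with multiplicities
  \<open>a i\<close>; in general it is the difference of the combinations for the positive and negative parts
  of \<open>a\<close>.  Biproducts are unique up to isomorphism, so the choice of representatives is
  immaterial.\<close>

definition class_combination ::
  "('o, 'm) cat \<Rightarrow> ('o, 'm) cat \<Rightarrow> 'u set \<Rightarrow> ('u \<Rightarrow> 'o) \<Rightarrow> ('u \<Rightarrow> int) \<Rightarrow> ('o \<Rightarrow>\<^sub>0 int) set set" where
  "class_combination A C I S a =
     asymptotic_class A C (SOME B. locally_finite_sum A C I S (\<lambda>i. nat (a i)) B)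
     \<otimes>\<^bsub>asymptotic_G0 A C\<^esub> inv\<^bsub>asymptotic_G0 A C\<^esub>
     asymptotic_class A C (SOME B. locally_finite_sum A C I S (\<lambda>i. nat (- a i)) B)"


section \<open>Composition series\<close>

definition simple_object :: "('o, 'm) cat \<Rightarrow> 'o \<Rightarrow> bool" where
  "simple_object C S \<longleftrightarrow> S \<in> Ob C \<and> \<not> zero_object C S \<and>
     (\<forall>m. monic C m \<and> Cod C m = S \<longrightarrow> zero_object C (Dom C m) \<or> isomorphism C m)"

text \<open>A subobject of \<open>X\<close> is a monic arrow into \<open>X\<close>.\<close>

definition subobject_le :: "('o, 'm) cat \<Rightarrow> 'm \<Rightarrow> 'm \<Rightarrow> bool" where
  "subobject_le C m n \<longleftrightarrow> (\<exists>h\<in>Hom C (Dom C m) (Dom C n). n \<bullet>\<^bsub>C\<^esub> h = m)"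

definition subobject_incl :: "('o, 'm) cat \<Rightarrow> 'm \<Rightarrow> 'm \<Rightarrow> 'm" where
  "subobject_incl C m n = (THE h. h \<in> Hom C (Dom C m) (Dom C n) \<and> n \<bullet>\<^bsub>C\<^esub> h = m)"

definition N_filtration :: "('o, 'm) cat \<Rightarrow> 'o \<Rightarrow> (nat \<Rightarrow> 'm) \<Rightarrow> bool" where
  "N_filtration C X m \<longleftrightarrow> (\<forall>i. monic C (m i) \<and> Cod C (m i) = X) \<and> isomorphism C (m 0) \<and>
     (\<forall>i. subobject_le C (m (Suc i)) (m i))"

definition filtration_quotient :: "('o, 'm) cat \<Rightarrow> (nat \<Rightarrow> 'm) \<Rightarrow> nat \<Rightarrow> 'o \<Rightarrow> bool" where
  "filtration_quotient C m i Q \<longleftrightarrow>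
     (\<exists>c. is_cokernel C (subobject_incl C (m (Suc i)) (m i)) c \<and> Cod C c = Q)"

definition N_composition_series ::
  "('o, 'm) cat \<Rightarrow> ('o, 'm) cat \<Rightarrow> 'o \<Rightarrow> (nat \<Rightarrow> 'm) \<Rightarrow> bool" where
  "N_composition_series A C X m \<longleftrightarrow> N_filtration C X m \<and>
     (\<exists>Z p. is_lim A (\<lambda>i. Dom C (m i)) (\<lambda>i. subobject_incl C (m (Suc i)) (m i)) Z p \<and>
            zero_object A Z) \<and>
     (\<forall>i Q. filtration_quotient C m i Q \<longrightarrow> zero_object C Q \<or> simple_object C Q)"

definition occurrences :: "('o, 'm) cat \<Rightarrow> (nat \<Rightarrow> 'm) \<Rightarrow> 'o \<Rightarrow> nat set" where
  "occurrences C m S = {i. \<exists>Q. filtration_quotient C m i Q \<and> isomorphic C Q S}"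

definition locally_finite_series :: "('o, 'm) cat \<Rightarrow> (nat \<Rightarrow> 'm) \<Rightarrow> bool" where
  "locally_finite_series C m \<longleftrightarrow> (\<forall>S. simple_object C S \<longrightarrow> finite (occurrences C m S))"

definition stable_for_filtrations :: "('o, 'm) cat \<Rightarrow> ('o, 'm) cat \<Rightarrow> 'o \<Rightarrow> bool" where
  "stable_for_filtrations A C X \<longleftrightarrow>
     (\<forall>m m'. N_composition_series A C X m \<and> N_composition_series A C X m' \<longrightarrow>
       (\<forall>i. \<exists>k. subobject_le C (m' k) (m i)))"

definition locally_Jordan_Hoelder :: "('o, 'm) cat \<Rightarrow> ('o, 'm) cat \<Rightarrow> bool" where
  "locally_Jordan_Hoelder A C \<longleftrightarrow> locally_AB5 A C \<and> locally_AB5_star A C \<and>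
     (\<forall>X\<in>Ob C. stable_for_filtrations A C X \<and>
       (\<exists>m. N_composition_series A C X m \<and> locally_finite_series C m))"

text \<open>In a locally Jordan--Hoelder category the multiplicity does not depend on the chosen
  series.\<close>

definition simple_multiplicity :: "('o, 'm) cat \<Rightarrow> ('o, 'm) cat \<Rightarrow> 'o \<Rightarrow> 'o \<Rightarrow> nat" where
  "simple_multiplicity A C S X =
     card (occurrences C (SOME m. N_composition_series A C X m \<and> locally_finite_series C m) S)"

definition full_simple_collection :: "('o, 'm) cat \<Rightarrow> 'u set \<Rightarrow> ('u \<Rightarrow> 'o) \<Rightarrow> bool" where
  "full_simple_collection C I S \<longleftrightarrow> (\<forall>i\<in>I. simple_object C (S i)) \<and>
     (\<forall>T. simple_object C T \<longrightarrow> (\<exists>!i. i \<in> I \<and> isomorphic C T (S i)))"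

end

theory Submission
  imports Defs "HOL-Library.Extended_Nat"
begin

text \<open>For a simple object \<open>S\<close> let \<open>len\<close> count, with values in the extended naturals, how often \<open>S\<close> can
  occur as a factor of finite filtrations of an object.  This function is additive on short exact
  sequences.  Local AB5* shows that an \<open>\<nat>\<close>-composition series with vanishing limit sees
  every occurrence of \<open>S\<close>, so \<open>len\<close> is finite and equal to the multiplicity.  It respects the
  relations \<open>J*\<close>: \<open>lim\<^sup>1\<close> of an acceptable sequence vanishes, finitely many arrows are peeled off using
  additivity, and if all kernels and cokernels are free of \<open>S\<close>, then so are the kernel and the cokernel
  of the arrow from the limit to the first term.  The relations \<open>J\<close> are dual.  Hence the
  multiplicities are homomorphisms on the asymptotic Grothendieck group.

  Conversely, the sequence of inclusions of a composition series of \<open>X\<close> is acceptable, with zero \<open>lim\<close> and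
  \<open>lim\<^sup>1\<close>, zero kernels and the composition factors as cokernels, so the corresponding relation in \<open>J*\<close> identifies
  \<open>[X]\<close> with the class of the locally finite sum of its composition factors.\<close>

section \<open>Preadditive and abelian categories\<close>

text \<open>Local AB5* lets finite stages control the cokernel of \<open>lim Y -> Y 0\<close>, but
  not its kernel: an occurrence of a simple \<open>S\<close> there can only be read off from the
  images of the kernel in the \<open>Y r\<close>, a jointly monic sequence of quotients without
  factor \<open>S\<close>. That such a sequence cannot hide \<open>S\<close> is the main obstacle.
  It is overcome by a second filtration adapted to the quotients, which must itself be shown locally
  finite before it is acceptable. Composition series descend, so the colimit side is not formally
  dual to the limit side. Only local AB5 is dualised; the cokernel of \<open>X 0 -> colim X\<close>
  is treated with a descending chain of that cokernel and a jointly epic sequence of arrows. Lengths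
  live in \<open>enat\<close> because additivity must precede finiteness. The same function, taken
  for the class of all simple objects, bounds the quotients of a chain at each finite stage, and
  this makes sequences of quotients become stationary. Diagram chases use generalised elements, that
  is, arrows that may be composed with an epic; \<open>cover\<close> provides the lifts.\<close>

lemma in_Hom [simp]: "f \<in> Hom A X Y \<longleftrightarrow> f \<in> Ar A \<and> Dom A f = X \<and> Cod A f = Y"
  by (simp add: Hom_def)

context preadditive_category
begin

lemma ob_dom [simp]: "f \<in> Ar A \<Longrightarrow> Dom A f \<in> Ob A"
  by (rule dom_ob)

lemma ob_cod [simp]: "f \<in> Ar A \<Longrightarrow> Cod A f \<in> Ob A"
  by (rule cod_ob)

lemma ob_dom_eq: "f \<in> Ar A \<Longrightarrow> Dom A f = X \<Longrightarrow> X \<in> Ob A"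
  by auto

lemma idn_ar [simp]: "X \<in> Ob A \<Longrightarrow> Idn A X \<in> Ar A"
  and dom_idn [simp]: "X \<in> Ob A \<Longrightarrow> Dom A (Idn A X) = X"
  and cod_idn [simp]: "X \<in> Ob A \<Longrightarrow> Cod A (Idn A X) = X"
  using idn_hom by auto

lemma cmp_ar [simp]: "f \<in> Ar A \<Longrightarrow> g \<in> Ar A \<Longrightarrow> Dom A g = Cod A f \<Longrightarrow> g \<bullet> f \<in> Ar A"
  and dom_cmp [simp]: "f \<in> Ar A \<Longrightarrow> g \<in> Ar A \<Longrightarrow> Dom A g = Cod A f \<Longrightarrow> Dom A (g \<bullet> f) = Dom A f"
  and cod_cmp [simp]: "f \<in> Ar A \<Longrightarrow> g \<in> Ar A \<Longrightarrow> Dom A g = Cod A f \<Longrightarrow> Cod A (g \<bullet> f) = Cod A g"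
  using cmp_hom by auto

lemma cmp_idn' [simp]: "f \<in> Ar A \<Longrightarrow> Dom A f = X \<Longrightarrow> f \<bullet> Idn A X = f"
  by (rule cmp_idn) auto

lemma idn_cmp' [simp]: "f \<in> Ar A \<Longrightarrow> Cod A f = X \<Longrightarrow> Idn A X \<bullet> f = f"
  by (rule idn_cmp) auto

lemma cmp_assoc' [simp]:
  "f \<in> Ar A \<Longrightarrow> g \<in> Ar A \<Longrightarrow> h \<in> Ar A \<Longrightarrow> Dom A g = Cod A f \<Longrightarrow> Dom A h = Cod A g
    \<Longrightarrow> (h \<bullet> g) \<bullet> f = h \<bullet> (g \<bullet> f)"
  by (rule cmp_assoc) auto

text \<open>The simplifier nests composites to the right, so the left side of a known equation
  \<open>k \<bullet> h = g\<close> is no longer a subterm of a longer composite. This is the form in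
  which such an equation is applied to a further arrow.\<close>

lemma cmp_eq:
  "k \<bullet> h = g \<Longrightarrow> e \<in> Ar A \<Longrightarrow> h \<in> Ar A \<Longrightarrow> k \<in> Ar A \<Longrightarrow> Dom A h = Cod A e \<Longrightarrow> Dom A k = Cod A h
    \<Longrightarrow> k \<bullet> (h \<bullet> e) = g \<bullet> e"
  by (metis cmp_assoc')

lemma carrier_hom_group [simp]: "carrier (hom_group A X Y) = Hom A X Y"
  and mult_hom_group [simp]: "x \<otimes>\<^bsub>hom_group A X Y\<^esub> y = Add A x y"
  and one_hom_group [simp]: "\<one>\<^bsub>hom_group A X Y\<^esub> = Nul A X Y"
  by (simp_all add: hom_group_def)

lemma nul_ar [simp]: "X \<in> Ob A \<Longrightarrow> Y \<in> Ob A \<Longrightarrow> Nul A X Y \<in> Ar A"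
  and dom_nul [simp]: "X \<in> Ob A \<Longrightarrow> Y \<in> Ob A \<Longrightarrow> Dom A (Nul A X Y) = X"
  and cod_nul [simp]: "X \<in> Ob A \<Longrightarrow> Y \<in> Ob A \<Longrightarrow> Cod A (Nul A X Y) = Y"
  using monoid.one_closed[OF group.is_monoid[OF comm_group.axioms(2)[OF hom_comm_group]], of X Y]
  by auto

lemma add_ar [simp]: "f \<in> Ar A \<Longrightarrow> g \<in> Ar A \<Longrightarrow> Dom A f = Dom A g \<Longrightarrow> Cod A f = Cod A g \<Longrightarrow> Add A f g \<in> Ar A"
  and dom_add [simp]: "f \<in> Ar A \<Longrightarrow> g \<in> Ar A \<Longrightarrow> Dom A f = Dom A g \<Longrightarrow> Cod A f = Cod A g \<Longrightarrow> Dom A (Add A f g) = Dom A g"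
  and cod_add [simp]: "f \<in> Ar A \<Longrightarrow> g \<in> Ar A \<Longrightarrow> Dom A f = Dom A g \<Longrightarrow> Cod A f = Cod A g \<Longrightarrow> Cod A (Add A f g) = Cod A g"
  using monoid.m_closed[OF group.is_monoid[OF comm_group.axioms(2)[OF hom_comm_group]],
      of "Dom A g" "Cod A g" f g]
  by auto

lemma add_commute:
  "f \<in> Hom A X Y \<Longrightarrow> g \<in> Hom A X Y \<Longrightarrow> Add A f g = Add A g f"
  using comm_monoid.m_comm[OF comm_group.axioms(1)[OF hom_comm_group], of X Y f g] by auto

lemma add_assoc:
  "f \<in> Hom A X Y \<Longrightarrow> g \<in> Hom A X Y \<Longrightarrow> h \<in> Hom A X Y \<Longrightarrow> Add A (Add A f g) h = Add A f (Add A g h)"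
  using monoid.m_assoc[OF group.is_monoid[OF comm_group.axioms(2)[OF hom_comm_group]], of X Y f g h]
  by auto

lemma add_nul [simp]: "f \<in> Ar A \<Longrightarrow> Dom A f = X \<Longrightarrow> Cod A f = Y \<Longrightarrow> Add A f (Nul A X Y) = f"
  and nul_add [simp]: "f \<in> Ar A \<Longrightarrow> Dom A f = X \<Longrightarrow> Cod A f = Y \<Longrightarrow> Add A (Nul A X Y) f = f"
  using monoid.r_one[OF group.is_monoid[OF comm_group.axioms(2)[OF hom_comm_group]], of X Y f]
    monoid.l_one[OF group.is_monoid[OF comm_group.axioms(2)[OF hom_comm_group]], of X Y f]
  by auto

lemma add_left_cancel:
  assumes "f \<in> Hom A X Y" "g \<in> Hom A X Y" "h \<in> Hom A X Y"
  shows "Add A f g = Add A f h \<longleftrightarrow> g = h"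
proof -
  have "X \<in> Ob A" "Y \<in> Ob A" using assms(1) by auto
  then interpret comm_group "hom_group A X Y" by (rule hom_comm_group)
  have "f \<otimes>\<^bsub>hom_group A X Y\<^esub> g = f \<otimes>\<^bsub>hom_group A X Y\<^esub> h \<longleftrightarrow> g = h"
    by (rule Units_l_cancel) (use assms in \<open>auto simp: Units_eq simp del: mult_hom_group\<close>)
  then show ?thesis by simp
qed

text \<open>Composition is additive, so the composite \<open>z\<close> satisfies
  \<open>z + z = z\<close>, and cancellation gives zero.\<close>

lemma nul_cmp [simp]:
  assumes "f \<in> Ar A" "Cod A f = Y" "Z \<in> Ob A"
  shows "Nul A Y Z \<bullet> f = Nul A (Dom A f) Z"
proof -
  let ?z = "Nul A Y Z"
  have Y: "Y \<in> Ob A" using assms by auto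
  have z: "?z \<in> Hom A Y Z" using assms Y by simp
  have "Add A ?z ?z \<bullet> f = Add A (?z \<bullet> f) (?z \<bullet> f)"
    using assms by (intro add_cmp[OF _ z z]) auto
  then have "Add A (?z \<bullet> f) (?z \<bullet> f) = Add A (?z \<bullet> f) (Nul A (Dom A f) Z)"
    using assms Y by simp
  then show ?thesis using assms Y by (subst (asm) add_left_cancel[of _ "Dom A f" Z]) auto
qed

lemma cmp_nul [simp]:
  assumes "f \<in> Ar A" "Dom A f = Y" "X \<in> Ob A"
  shows "f \<bullet> Nul A X Y = Nul A X (Cod A f)"
proof -
  let ?z = "Nul A X Y"
  have Y: "Y \<in> Ob A" using assms by auto
  have z: "?z \<in> Hom A X Y" using assms Y by simp
  have "f \<bullet> Add A ?z ?z = Add A (f \<bullet> ?z) (f \<bullet> ?z)"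
    using assms by (intro cmp_add[OF z z]) auto
  then have "Add A (f \<bullet> ?z) (f \<bullet> ?z) = Add A (f \<bullet> ?z) (Nul A X (Cod A f))"
    using assms Y by simp
  then show ?thesis using assms Y by (subst (asm) add_left_cancel[of _ X "Cod A f"]) auto
qed

lemma Diff_hom: 
  assumes "f \<in> Hom A X Y" "g \<in> Hom A X Y"
  shows "Diff A f g \<in> Hom A X Y" and "Add A (Diff A f g) g = f"
proof -
  have "X \<in> Ob A" "Y \<in> Ob A" using assms(1) by auto
  then interpret comm_group "hom_group A X Y" by (rule hom_comm_group)
  have D: "Diff A f g = f \<otimes>\<^bsub>hom_group A X Y\<^esub> inv\<^bsub>hom_group A X Y\<^esub> g"
    using assms by (simp add: Diff_def)
  have c: "f \<in> carrier (hom_group A X Y)" "g \<in> carrier (hom_group A X Y)" using assms by auto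
  have "Diff A f g \<in> carrier (hom_group A X Y)" unfolding D using c by blast
  then show "Diff A f g \<in> Hom A X Y" by simp
  have "Diff A f g \<otimes>\<^bsub>hom_group A X Y\<^esub> g = f" unfolding D using c
    by (metis inv_closed l_inv m_assoc r_one)
  then show "Add A (Diff A f g) g = f" by simp
qed

lemma Diff_ar [simp]: "f \<in> Ar A \<Longrightarrow> g \<in> Ar A \<Longrightarrow> Dom A f = Dom A g \<Longrightarrow> Cod A f = Cod A g \<Longrightarrow> Diff A f g \<in> Ar A"
  and dom_Diff [simp]: "f \<in> Ar A \<Longrightarrow> g \<in> Ar A \<Longrightarrow> Dom A f = Dom A g \<Longrightarrow> Cod A f = Cod A g \<Longrightarrow> Dom A (Diff A f g) = Dom A g"
  and cod_Diff [simp]: "f \<in> Ar A \<Longrightarrow> g \<in> Ar A \<Longrightarrow> Dom A f = Dom A g \<Longrightarrow> Cod A f = Cod A g \<Longrightarrow> Cod A (Diff A f g) = Cod A g"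
  using Diff_hom(1)[of f "Dom A g" "Cod A g" g] by auto

lemma add_right_cancel:
  assumes "f \<in> Hom A X Y" "g \<in> Hom A X Y" "h \<in> Hom A X Y"
  shows "Add A g f = Add A h f \<longleftrightarrow> g = h"
  using add_left_cancel[OF assms] add_commute[OF assms(1,2)] add_commute[OF assms(1,3)] by simp

lemma Diff_eq_iff:
  assumes "f \<in> Hom A X Y" "g \<in> Hom A X Y" "h \<in> Hom A X Y"
  shows "Diff A f g = h \<longleftrightarrow> f = Add A h g"
  using Diff_hom[OF assms(1,2)] add_right_cancel[OF assms(2) Diff_hom(1)[OF assms(1,2)] assms(3)] by auto

lemma Diff_nul_iff:
  assumes "f \<in> Hom A X Y" "g \<in> Hom A X Y"
  shows "Diff A f g = Nul A X Y \<longleftrightarrow> f = g"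
proof -
  have "X \<in> Ob A" "Y \<in> Ob A" using assms(1) by auto
  then show ?thesis using assms by (subst Diff_eq_iff[OF assms]) auto
qed

lemma Diff_self [simp]: "f \<in> Ar A \<Longrightarrow> Diff A f f = Nul A (Dom A f) (Cod A f)"
  using Diff_nul_iff[of f "Dom A f" "Cod A f" f] by simp

lemma Diff_nul [simp]: "f \<in> Ar A \<Longrightarrow> Dom A f = X \<Longrightarrow> Cod A f = Y \<Longrightarrow> Diff A f (Nul A X Y) = f"
  using Diff_eq_iff[of f X Y "Nul A X Y" f] by auto

lemma cmp_Diff:
  assumes "f \<in> Hom A X Y" "f' \<in> Hom A X Y" "g \<in> Hom A Y Z"
  shows "g \<bullet> Diff A f f' = Diff A (g \<bullet> f) (g \<bullet> f')"
proof -
  have "Add A (g \<bullet> Diff A f f') (g \<bullet> f') = g \<bullet> f"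
    using cmp_add[OF Diff_hom(1)[OF assms(1,2)] assms(2,3)] Diff_hom(2)[OF assms(1,2)] by simp
  then show ?thesis using assms Diff_hom(1)[OF assms(1,2)]
    by (subst eq_commute, subst Diff_eq_iff[of _ X Z]) auto
qed

lemma Diff_cmp:
  assumes "f \<in> Hom A X Y" "g \<in> Hom A Y Z" "g' \<in> Hom A Y Z"
  shows "Diff A g g' \<bullet> f = Diff A (g \<bullet> f) (g' \<bullet> f)"
proof -
  have "Add A (Diff A g g' \<bullet> f) (g' \<bullet> f) = g \<bullet> f"
    using add_cmp[OF assms(1) Diff_hom(1)[OF assms(2,3)] assms(3)] Diff_hom(2)[OF assms(2,3)] by simp
  then show ?thesis using assms Diff_hom(1)[OF assms(2,3)]
    by (subst eq_commute, subst Diff_eq_iff[of _ X Z]) auto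
qed

text \<open>Testing against zero suffices: two arrows with the same composite differ by an arrow
  that \<open>f\<close> kills.\<close>

lemma monicI:
  assumes "f \<in> Ar A" 
    and "\<And>T g. T \<in> Ob A \<Longrightarrow> g \<in> Hom A T (Dom A f) \<Longrightarrow> f \<bullet> g = Nul A T (Cod A f) \<Longrightarrow> g = Nul A T (Dom A f)"
  shows "monic A f"
  unfolding monic_def
proof (intro conjI ballI impI)
  fix T g h assume T: "T \<in> Ob A" and g: "g \<in> Hom A T (Dom A f)" and h: "h \<in> Hom A T (Dom A f)"
    and e: "f \<bullet> g = f \<bullet> h"
  have f: "f \<in> Hom A (Dom A f) (Cod A f)" using assms(1) by simp
  have "f \<bullet> Diff A g h = Nul A T (Cod A f)"
    using cmp_Diff[OF g h f] e assms(1) h by simp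
  then have "Diff A g h = Nul A T (Dom A f)" using assms(2)[OF T Diff_hom(1)[OF g h]] by simp
  then show "g = h" using Diff_nul_iff[OF g h] by simp
qed (use assms in simp)

lemma monic_ar [simp]: "monic A f \<Longrightarrow> f \<in> Ar A"
  by (simp add: monic_def)

lemma monicD:
  "monic A f \<Longrightarrow> g \<in> Ar A \<Longrightarrow> h \<in> Ar A \<Longrightarrow> Cod A g = Dom A f \<Longrightarrow> Cod A h = Dom A f \<Longrightarrow> Dom A g = Dom A h
    \<Longrightarrow> f \<bullet> g = f \<bullet> h \<Longrightarrow> g = h"
  unfolding monic_def by (metis in_Hom ob_dom)

lemma monic_nulD:
  "monic A f \<Longrightarrow> g \<in> Ar A \<Longrightarrow> Cod A g = Dom A f \<Longrightarrow> f \<bullet> g = Nul A (Dom A g) (Cod A f) \<Longrightarrow> g = Nul A (Dom A g) (Dom A f)"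
  by (rule monicD[of f]) auto

lemma monic_cmp: "monic A f \<Longrightarrow> monic A g \<Longrightarrow> Dom A g = Cod A f \<Longrightarrow> monic A (g \<bullet> f)"
proof (rule monicI)
  fix T h assume a: "monic A f" "monic A g" "Dom A g = Cod A f" "h \<in> Hom A T (Dom A (g \<bullet> f))"
    "(g \<bullet> f) \<bullet> h = Nul A T (Cod A (g \<bullet> f))"
  have "f \<bullet> h = Nul A T (Cod A f)" using a monic_nulD[of g "f \<bullet> h"] by simp
  then show "h = Nul A T (Dom A (g \<bullet> f))" using a monic_nulD[of f h] by simp
qed simp

lemma monic_cmpD: "monic A (g \<bullet> f) \<Longrightarrow> f \<in> Ar A \<Longrightarrow> g \<in> Ar A \<Longrightarrow> Dom A g = Cod A f \<Longrightarrow> monic A f"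
  using monic_nulD[of "g \<bullet> f"] by (intro monicI) auto

lemma zero_object_iff: "zero_object A Z \<longleftrightarrow> Z \<in> Ob A \<and> Idn A Z = Nul A Z Z"
proof
  assume "zero_object A Z" then show "Z \<in> Ob A \<and> Idn A Z = Nul A Z Z"
    unfolding zero_object_def by (metis cod_idn cod_nul dom_idn dom_nul idn_ar in_Hom nul_ar)
next
  assume Z: "Z \<in> Ob A \<and> Idn A Z = Nul A Z Z"
  show "zero_object A Z" unfolding zero_object_def
  proof (intro conjI ballI)
    fix X assume X: "X \<in> Ob A"
    show "\<exists>!f. f \<in> Hom A X Z"
      by (rule ex1I[of _ "Nul A X Z"])
         (use X Z in simp, metis Z cod_idn idn_cmp' in_Hom nul_cmp)
    show "\<exists>!f. f \<in> Hom A Z X"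
      by (rule ex1I[of _ "Nul A Z X"])
         (use X Z in simp, metis Z cmp_idn' cmp_nul in_Hom)
  qed (use Z in simp)
qed

lemma to_zero: "zero_object A Z \<Longrightarrow> f \<in> Ar A \<Longrightarrow> Cod A f = Z \<Longrightarrow> f = Nul A (Dom A f) Z"
  unfolding zero_object_iff by (metis idn_cmp' nul_cmp)

lemma from_zero: "zero_object A Z \<Longrightarrow> f \<in> Ar A \<Longrightarrow> Dom A f = Z \<Longrightarrow> f = Nul A Z (Cod A f)"
  unfolding zero_object_iff by (metis cmp_idn' cmp_nul)

lemma zero_monic: "monic A m \<Longrightarrow> zero_object A (Cod A m) \<Longrightarrow> zero_object A (Dom A m)"
  unfolding zero_object_iff
proof (intro conjI)
  assume m: "monic A m" and z: "Cod A m \<in> Ob A \<and> Idn A (Cod A m) = Nul A (Cod A m) (Cod A m)"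
  have "m = Nul A (Dom A m) (Cod A m)" using to_zero[of "Cod A m" m] z m zero_object_iff by simp
  then have "m \<bullet> Idn A (Dom A m) = m \<bullet> Nul A (Dom A m) (Dom A m)" using m by simp
  then show "Idn A (Dom A m) = Nul A (Dom A m) (Dom A m)" using monicD[OF m] m by simp
qed simp

lemma isomorphism_monic: "isomorphism A f \<Longrightarrow> monic A f"
proof -
  assume "isomorphism A f"
  then obtain g where g: "g \<in> Hom A (Cod A f) (Dom A f)" "g \<bullet> f = Idn A (Dom A f)" and f: "f \<in> Ar A"
    unfolding isomorphism_def by auto
  show "monic A f"
  proof (rule monicI[OF f])
    fix T h assume "T \<in> Ob A" and h: "h \<in> Hom A T (Dom A f)" "f \<bullet> h = Nul A T (Cod A f)"
    have "h = g \<bullet> (f \<bullet> h)" using g f h(1) cmp_eq[OF g(2), of h] by simp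
    then show "h = Nul A T (Dom A f)" using h g f \<open>T \<in> Ob A\<close> by simp
  qed
qed

lemma isomorphism_ar [simp]: "isomorphism A f \<Longrightarrow> f \<in> Ar A"
  by (simp add: isomorphism_def)

lemma isomorphism_inverse:
  assumes "isomorphism A f"
  obtains g where "g \<in> Hom A (Cod A f) (Dom A f)" "g \<bullet> f = Idn A (Dom A f)" "f \<bullet> g = Idn A (Cod A f)"
    "isomorphism A g"
proof -
  obtain g where g: "g \<in> Hom A (Cod A f) (Dom A f)" "g \<bullet> f = Idn A (Dom A f)" "f \<bullet> g = Idn A (Cod A f)"
    using assms unfolding isomorphism_def by auto
  have "isomorphism A g" unfolding isomorphism_def using g assms isomorphism_ar by auto
  then show thesis using that g by blast
qed

lemma isomorphism_idn: "X \<in> Ob A \<Longrightarrow> isomorphism A (Idn A X)"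
  unfolding isomorphism_def by (auto intro!: bexI[of _ "Idn A X"])

lemma isomorphism_cmp:
  assumes "isomorphism A f" "isomorphism A g" "Dom A g = Cod A f"
  shows "isomorphism A (g \<bullet> f)"
proof -
  obtain f' where f': "f' \<in> Hom A (Cod A f) (Dom A f)" "f' \<bullet> f = Idn A (Dom A f)" "f \<bullet> f' = Idn A (Cod A f)"
    using assms(1) isomorphism_inverse by metis
  obtain g' where g': "g' \<in> Hom A (Cod A g) (Dom A g)" "g' \<bullet> g = Idn A (Dom A g)" "g \<bullet> g' = Idn A (Cod A g)"
    using assms(2) isomorphism_inverse by metis
  have fg: "f \<in> Ar A" "g \<in> Ar A" using assms by auto
  show ?thesis unfolding isomorphism_def
    using f' g' fg assms(3) cmp_eq[OF g'(2), of f] cmp_eq[OF f'(3), of g']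
    by (auto intro!: bexI[of _ "f' \<bullet> g'"])
qed

lemma isomorphicI: "isomorphism A f \<Longrightarrow> isomorphic A (Dom A f) (Cod A f)"
  unfolding isomorphic_def by (rule bexI[of _ f]) auto

lemma isomorphic_refl: "X \<in> Ob A \<Longrightarrow> isomorphic A X X"
  unfolding isomorphic_def by (rule bexI[of _ "Idn A X"]) (auto simp: isomorphism_idn)

lemma isomorphicE:
  assumes "isomorphic A X Y"
  obtains f where "f \<in> Hom A X Y" "isomorphism A f"
  using assms unfolding isomorphic_def by blast

lemma isomorphic_sym:
  assumes "isomorphic A X Y" shows "isomorphic A Y X"
proof -
  obtain f where f: "f \<in> Hom A X Y" "isomorphism A f" using assms by (rule isomorphicE)
  then obtain g where "g \<in> Hom A Y X" "isomorphism A g" by (metis in_Hom isomorphism_inverse)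
  then show ?thesis unfolding isomorphic_def by blast
qed

lemma isomorphic_trans:
  assumes "isomorphic A X Y" "isomorphic A Y Z" shows "isomorphic A X Z"
proof -
  obtain f where f: "f \<in> Hom A X Y" "isomorphism A f" using assms(1) by (rule isomorphicE)
  obtain g where g: "g \<in> Hom A Y Z" "isomorphism A g" using assms(2) by (rule isomorphicE)
  have "g \<bullet> f \<in> Hom A X Z" using f(1) g(1) by simp
  moreover have "isomorphism A (g \<bullet> f)" using f g by (intro isomorphism_cmp) auto
  ultimately show ?thesis unfolding isomorphic_def by blast
qed

lemma is_kernelD:
  assumes "is_kernel A f k"
  shows "f \<in> Ar A" "k \<in> Ar A" "Cod A k = Dom A f" "f \<bullet> k = Nul A (Dom A k) (Cod A f)"
  using assms unfolding is_kernel_def by blast+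

lemma kernel_ex1:
  "is_kernel A f k \<Longrightarrow> T \<in> Ob A \<Longrightarrow> g \<in> Hom A T (Dom A f) \<Longrightarrow> f \<bullet> g = Nul A T (Cod A f)
    \<Longrightarrow> \<exists>!h. h \<in> Hom A T (Dom A k) \<and> k \<bullet> h = g"
  unfolding is_kernel_def by blast

lemma kernel_lift:
  assumes "is_kernel A f k" "g \<in> Ar A" "Cod A g = Dom A f" "f \<bullet> g = Nul A (Dom A g) (Cod A f)"
  obtains h where "h \<in> Hom A (Dom A g) (Dom A k)" "k \<bullet> h = g"
  using kernel_ex1[OF assms(1) ob_dom[OF assms(2)], of g] assms by simp blast

lemma kernel_monic: assumes k: "is_kernel A f k" shows "monic A k"
proof (rule monicI)
  note D = is_kernelD[OF k]
  show "k \<in> Ar A" by (rule D)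
  fix T g assume g: "T \<in> Ob A" "g \<in> Hom A T (Dom A k)" "k \<bullet> g = Nul A T (Cod A k)"
  have "\<exists>!h. h \<in> Hom A T (Dom A k) \<and> k \<bullet> h = Nul A T (Cod A k)"
    by (rule kernel_ex1[OF k g(1)]) (use D g(1) in simp_all)
  moreover have "Nul A T (Dom A k) \<in> Hom A T (Dom A k) \<and> k \<bullet> Nul A T (Dom A k) = Nul A T (Cod A k)"
    using D g(1) by simp
  ultimately show "g = Nul A T (Dom A k)" using g by blast
qed

lemma kernelI:
  assumes "monic A k" "f \<in> Ar A" "Cod A k = Dom A f" "f \<bullet> k = Nul A (Dom A k) (Cod A f)"
    and "\<And>g. g \<in> Ar A \<Longrightarrow> Cod A g = Dom A f \<Longrightarrow> f \<bullet> g = Nul A (Dom A g) (Cod A f)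
      \<Longrightarrow> \<exists>h. h \<in> Hom A (Dom A g) (Dom A k) \<and> k \<bullet> h = g"
  shows "is_kernel A f k"
  unfolding is_kernel_def
proof (intro conjI ballI impI)
  fix T g assume g: "T \<in> Ob A" "g \<in> Hom A T (Dom A f)" "f \<bullet> g = Nul A T (Cod A f)"
  then obtain h where h: "h \<in> Hom A T (Dom A k) \<and> k \<bullet> h = g" using assms(5)[of g] by auto
  show "\<exists>!h. h \<in> Hom A T (Dom A k) \<and> k \<bullet> h = g"
    by (rule ex1I[of _ h]) (use h monicD[OF assms(1), of _ h] g assms(1) in simp_all)
qed (use assms(1-4) in simp_all)

end

section \<open>Opposite categories and dual statements\<close>

definition op_cat :: "('o, 'm) cat \<Rightarrow> ('o, 'm) cat" where
  "op_cat A = A\<lparr>Dom := Cod A, Cod := Dom A, Cmp := (\<lambda>g f. Cmp A f g), Nul := (\<lambda>X Y. Nul A Y X)\<rparr>"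

lemma op_cat_simps [simp]:
  "Ob (op_cat A) = Ob A" "Ar (op_cat A) = Ar A" "Dom (op_cat A) = Cod A" "Cod (op_cat A) = Dom A"
  "Idn (op_cat A) = Idn A" "Cmp (op_cat A) g f = Cmp A f g" "Nul (op_cat A) X Y = Nul A Y X"
  "Add (op_cat A) = Add A"
  by (simp_all add: op_cat_def)

text \<open>This is an equality of records, so a dualised lemma read in the opposite category
  returns to \<open>A\<close> itself by simplification.\<close>

lemma op_op_cat [simp]: "op_cat (op_cat A) = A"
  by (simp add: op_cat_def)

lemma Hom_op [simp]: "Hom (op_cat A) X Y = Hom A Y X"
  by (auto simp: Hom_def)

lemma hom_group_op [simp]: "hom_group (op_cat A) X Y = hom_group A Y X"
  by (simp add: hom_group_def)

lemma Diff_op [simp]: "Diff (op_cat A) f g = Diff A f g"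
  by (simp add: Diff_def)

lemma monic_op [simp]: "monic (op_cat A) f \<longleftrightarrow> epic A f"
  by (simp add: monic_def epic_def)

lemma epic_op [simp]: "epic (op_cat A) f \<longleftrightarrow> monic A f"
  by (simp add: monic_def epic_def)

lemma isomorphism_op [simp]: "isomorphism (op_cat A) f \<longleftrightarrow> isomorphism A f"
  by (simp add: isomorphism_def conj_commute)

lemma is_kernel_op [simp]: "is_kernel (op_cat A) f k \<longleftrightarrow> is_cokernel A f k"
  by (simp add: is_kernel_def is_cokernel_def)

lemma is_cokernel_op [simp]: "is_cokernel (op_cat A) f k \<longleftrightarrow> is_kernel A f k"
  by (simp add: is_kernel_def is_cokernel_def)

lemma short_exact_op [simp]: "short_exact (op_cat A) f g \<longleftrightarrow> short_exact A g f"
  by (auto simp: short_exact_def)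

lemma is_product_op [simp]: "is_product (op_cat A) J X P q \<longleftrightarrow> is_coproduct A J X P q"
  by (simp add: is_product_def is_coproduct_def)

lemma is_coproduct_op [simp]: "is_coproduct (op_cat A) J X P q \<longleftrightarrow> is_product A J X P q"
  by (simp add: is_product_def is_coproduct_def)

lemma zero_object_op [simp]: "zero_object (op_cat A) Z \<longleftrightarrow> zero_object A Z"
  by (auto simp: zero_object_def)

lemma preadditive_category_op:
  assumes "preadditive_category A" shows "preadditive_category (op_cat A)"
proof -
  interpret preadditive_category A by fact
  show ?thesis
  proof (rule preadditive_category.intro)
    fix f X Y f' g Z
    show "f \<in> Hom (op_cat A) X Y \<Longrightarrow> f' \<in> Hom (op_cat A) X Y \<Longrightarrow> g \<in> Hom (op_cat A) Y Z
      \<Longrightarrow> g \<bullet>\<^bsub>op_cat A\<^esub> Add (op_cat A) f f' = Add (op_cat A) (g \<bullet>\<^bsub>op_cat A\<^esub> f) (g \<bullet>\<^bsub>op_cat A\<^esub> f')"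
      using add_cmp[of g Z Y f X f'] by simp
    fix g'
    show "f \<in> Hom (op_cat A) X Y \<Longrightarrow> g \<in> Hom (op_cat A) Y Z \<Longrightarrow> g' \<in> Hom (op_cat A) Y Z
      \<Longrightarrow> Add (op_cat A) g g' \<bullet>\<^bsub>op_cat A\<^esub> f = Add (op_cat A) (g \<bullet>\<^bsub>op_cat A\<^esub> f) (g' \<bullet>\<^bsub>op_cat A\<^esub> f)"
      using cmp_add[of g Z Y g' f X] by simp
  qed (auto simp: hom_comm_group)
qed

lemma abelian_category_op:
  assumes "abelian_category A" shows "abelian_category (op_cat A)"
proof -
  interpret abelian_category A by fact
  interpret op: preadditive_category "op_cat A" 
    by (rule preadditive_category_op) unfold_locales
  show ?thesis
    by unfold_locales
      (simp_all add: zero_ex binary_product_ex binary_coproduct_ex kernel_ex cokernel_ex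
        monic_is_kernel epic_is_cokernel)
qed

context preadditive_category
begin

lemma op: "preadditive_category (op_cat A)"
  by (rule preadditive_category_op) (rule preadditive_category_axioms)

lemma epic_ar [simp]: "epic A f \<Longrightarrow> f \<in> Ar A"
  by (simp add: epic_def)

lemma epicI:
  assumes "f \<in> Ar A" 
    and "\<And>T g. T \<in> Ob A \<Longrightarrow> g \<in> Hom A (Cod A f) T \<Longrightarrow> g \<bullet> f = Nul A (Dom A f) T \<Longrightarrow> g = Nul A (Cod A f) T"
  shows "epic A f"
  using preadditive_category.monicI[OF op, of f] assms by simp

lemma epicD:
  "epic A f \<Longrightarrow> g \<in> Ar A \<Longrightarrow> h \<in> Ar A \<Longrightarrow> Dom A g = Cod A f \<Longrightarrow> Dom A h = Cod A f \<Longrightarrow> Cod A g = Cod A h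
    \<Longrightarrow> g \<bullet> f = h \<bullet> f \<Longrightarrow> g = h"
  using preadditive_category.monicD[OF op, of f g h] by simp

lemma epic_nulD:
  "epic A f \<Longrightarrow> g \<in> Ar A \<Longrightarrow> Dom A g = Cod A f \<Longrightarrow> g \<bullet> f = Nul A (Dom A f) (Cod A g) \<Longrightarrow> g = Nul A (Cod A f) (Cod A g)"
  using preadditive_category.monic_nulD[OF op, of f g] by simp

lemma epic_cmp: "epic A f \<Longrightarrow> epic A g \<Longrightarrow> Dom A g = Cod A f \<Longrightarrow> epic A (g \<bullet> f)"
  using preadditive_category.monic_cmp[OF op, of g f] by simp

lemma epic_cmpD: "epic A (g \<bullet> f) \<Longrightarrow> f \<in> Ar A \<Longrightarrow> g \<in> Ar A \<Longrightarrow> Dom A g = Cod A f \<Longrightarrow> epic A g"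
  using preadditive_category.monic_cmpD[OF op, of f g] by simp

lemma zero_epic: "epic A m \<Longrightarrow> zero_object A (Dom A m) \<Longrightarrow> zero_object A (Cod A m)"
  using preadditive_category.zero_monic[OF op, of m] by simp

lemma isomorphism_epic: "isomorphism A f \<Longrightarrow> epic A f"
  using preadditive_category.isomorphism_monic[OF op, of f] by simp

lemma is_cokernelD:
  assumes "is_cokernel A f k"
  shows "f \<in> Ar A" "k \<in> Ar A" "Dom A k = Cod A f" "k \<bullet> f = Nul A (Dom A f) (Cod A k)"
  using preadditive_category.is_kernelD[OF op, of f k] assms by simp_all

lemma cokernel_desc:
  assumes "is_cokernel A f k" "g \<in> Ar A" "Dom A g = Cod A f" "g \<bullet> f = Nul A (Dom A f) (Cod A g)"
  obtains h where "h \<in> Hom A (Cod A k) (Cod A g)" "h \<bullet> k = g"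
  using preadditive_category.kernel_lift[OF op, of f k g] assms by auto

lemma cokernel_epic: "is_cokernel A f k \<Longrightarrow> epic A k"
  using preadditive_category.kernel_monic[OF op, of f k] by simp

lemma cokernelI:
  assumes "epic A k" "f \<in> Ar A" "Dom A k = Cod A f" "k \<bullet> f = Nul A (Dom A f) (Cod A k)"
    and "\<And>g. g \<in> Ar A \<Longrightarrow> Dom A g = Cod A f \<Longrightarrow> g \<bullet> f = Nul A (Dom A f) (Cod A g)
      \<Longrightarrow> \<exists>h. h \<in> Hom A (Cod A k) (Cod A g) \<and> h \<bullet> k = g"
  shows "is_cokernel A f k"
proof -
  have "is_kernel (op_cat A) f k"
  proof (rule preadditive_category.kernelI[OF op])
    fix g assume "g \<in> Ar (op_cat A)" "Cod (op_cat A) g = Dom (op_cat A) f"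
      "f \<bullet>\<^bsub>op_cat A\<^esub> g = Nul (op_cat A) (Dom (op_cat A) g) (Cod (op_cat A) f)"
    then obtain h where "h \<in> Hom A (Cod A k) (Cod A g)" "h \<bullet> k = g" using assms(5)[of g] by auto
    then show "\<exists>h. h \<in> Hom (op_cat A) (Dom (op_cat A) g) (Dom (op_cat A) k) \<and> k \<bullet>\<^bsub>op_cat A\<^esub> h = g"
      by (intro exI[of _ h]) simp
  qed (use assms(1-4) in simp_all)
  then show ?thesis by simp
qed

lemma kernel_lift_unique:
  assumes "is_kernel A f k" "is_kernel A f k'"
  obtains h where "h \<in> Hom A (Dom A k) (Dom A k')" "isomorphism A h" "k' \<bullet> h = k"
proof -
  note k = is_kernelD[OF assms(1)] note k' = is_kernelD[OF assms(2)]
  obtain h where h: "h \<in> Hom A (Dom A k) (Dom A k')" "k' \<bullet> h = k"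
    using kernel_lift[OF assms(2), of k] k k' by auto
  obtain g where g: "g \<in> Hom A (Dom A k') (Dom A k)" "k \<bullet> g = k'"
    using kernel_lift[OF assms(1), of k'] k k' by auto
  have "g \<bullet> h = Idn A (Dom A k)"
    by (rule monicD[OF kernel_monic[OF assms(1)]]) (use g h k cmp_eq[OF g(2), of h] in simp_all)
  moreover have "h \<bullet> g = Idn A (Dom A k')"
    by (rule monicD[OF kernel_monic[OF assms(2)]]) (use g h k' cmp_eq[OF h(2), of g] in simp_all)
  ultimately have "isomorphism A h"
    unfolding isomorphism_def using g(1) h(1) by (intro conjI bexI[of _ g]) simp_all
  then show thesis using that h by blast
qed

lemma cokernel_desc_unique:
  assumes "is_cokernel A f k" "is_cokernel A f k'"
  obtains h where "h \<in> Hom A (Cod A k) (Cod A k')" "isomorphism A h" "h \<bullet> k = k'"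
  using preadditive_category.kernel_lift_unique[OF op, of f k' k] assms by auto

lemma kernel_isomorphic: "is_kernel A f k \<Longrightarrow> is_kernel A f k' \<Longrightarrow> isomorphic A (Dom A k) (Dom A k')"
  by (erule kernel_lift_unique) (assumption, unfold isomorphic_def, blast)

lemma cokernel_isomorphic: "is_cokernel A f k \<Longrightarrow> is_cokernel A f k' \<Longrightarrow> isomorphic A (Cod A k) (Cod A k')"
  by (erule cokernel_desc_unique) (assumption, unfold isomorphic_def, blast)

lemma short_exactD:
  assumes "short_exact A f g"
  shows "is_kernel A g f" "is_cokernel A f g" "monic A f" "epic A g" "f \<in> Ar A" "g \<in> Ar A" "Cod A f = Dom A g"
    "g \<bullet> f = Nul A (Dom A f) (Cod A g)"
  using assms kernel_monic[of g f] cokernel_epic[of f g] is_kernelD[of g f] 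
  unfolding short_exact_def by simp_all

lemma monic_iff_kernel_zero:
  assumes "is_kernel A f k" shows "monic A f \<longleftrightarrow> zero_object A (Dom A k)"
proof
  note k = is_kernelD[OF assms]
  assume "monic A f"
  then have "k = Nul A (Dom A k) (Dom A f)" using monic_nulD[of f k] k by simp
  then have "k \<bullet> Idn A (Dom A k) = k \<bullet> Nul A (Dom A k) (Dom A k)" using k by simp
  then show "zero_object A (Dom A k)" unfolding zero_object_iff
    using monicD[OF kernel_monic[OF assms]] k by simp
next
  note k = is_kernelD[OF assms]
  assume z: "zero_object A (Dom A k)"
  show "monic A f"
  proof (rule monicI)
    fix T g assume g: "T \<in> Ob A" "g \<in> Hom A T (Dom A f)" "f \<bullet> g = Nul A T (Cod A f)"
    then obtain h where h: "h \<in> Hom A T (Dom A k)" "k \<bullet> h = g"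
      using kernel_lift[OF assms, of g] by auto
    have "h = Nul A T (Dom A k)" using to_zero[OF z, of h] h by simp
    then show "g = Nul A T (Dom A f)" using h k g by simp
  qed (rule k)
qed

lemma epic_iff_cokernel_zero:
  "is_cokernel A f k \<Longrightarrow> epic A f \<longleftrightarrow> zero_object A (Cod A k)"
  using preadditive_category.monic_iff_kernel_zero[OF op, of f k] by simp

end

section \<open>Abelian categories: images, biproducts and generalised elements\<close>

context abelian_category
begin

lemma op_abelian: "abelian_category (op_cat A)"
  by (rule abelian_category_op) (rule abelian_category_axioms)

text \<open>A monic \<open>m\<close> is the kernel of some \<open>f\<close>, and \<open>f\<close>
  factors through the cokernel \<open>c\<close> of \<open>m\<close>. So whatever \<open>c\<close>
  kills is killed by \<open>f\<close> and lifts to \<open>m\<close>.\<close>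

lemma monic_short_exact:
  assumes m: "monic A m" and c: "is_cokernel A m c" shows "short_exact A m c"
proof -
  note c' = is_cokernelD[OF c]
  obtain f where f: "is_kernel A f m" using monic_is_kernel[OF m] by blast
  note f' = is_kernelD[OF f]
  obtain h where h: "h \<in> Hom A (Cod A c) (Cod A f)" "h \<bullet> c = f"
    using cokernel_desc[OF c, of f] f' by auto
  have "is_kernel A c m"
  proof (rule kernelI[OF m])
    fix g assume g: "g \<in> Ar A" "Cod A g = Dom A c" "c \<bullet> g = Nul A (Dom A g) (Cod A c)"
    have "f \<bullet> g = h \<bullet> c \<bullet> g" using cmp_eq[OF h(2), of g] g h c' by simp
    also have "\<dots> = Nul A (Dom A g) (Cod A f)" using g h by simp
    finally show "\<exists>h. h \<in> Hom A (Dom A g) (Dom A m) \<and> m \<bullet> h = g"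
      using kernel_lift[OF f, of g] g f' c' by (metis in_Hom)
  qed (use c' in simp_all)
  then show ?thesis using c by (simp add: short_exact_def)
qed

lemma epic_short_exact:
  assumes "epic A e" "is_kernel A e k" shows "short_exact A k e"
  using abelian_category.monic_short_exact[OF op_abelian, of e k] assms by simp

text \<open>An epic \<open>f\<close> is the cokernel of some \<open>k\<close>. Since
  \<open>f\<close> is also monic, \<open>k\<close> is zero, so the identity of
  \<open>Dom A f\<close> descends along \<open>f\<close> and gives the inverse.\<close>

lemma monic_epic_iso:
  assumes "monic A f" "epic A f" shows "isomorphism A f"
proof -
  obtain k where "is_cokernel A k f" using epic_is_cokernel[OF assms(2)] by blast
  note k = this is_cokernelD[OF this]
  have "k = Nul A (Dom A k) (Dom A f)" using monic_nulD[OF assms(1), of k] k by simp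
  then have "Idn A (Dom A f) \<bullet> k = Nul A (Dom A k) (Cod A (Idn A (Dom A f)))" using k by simp
  then obtain h where h: "h \<in> Hom A (Cod A f) (Dom A f)" "h \<bullet> f = Idn A (Dom A f)"
    using cokernel_desc[OF k(1), of "Idn A (Dom A f)"] k by auto
  have "f \<bullet> h = Idn A (Cod A f)"
    by (rule epicD[OF assms(2)]) (use h k in simp_all)
  then show ?thesis unfolding isomorphism_def using h k by blast
qed

text \<open>The image \<open>m\<close> is the kernel of the cokernel of \<open>f\<close>. If
  \<open>g\<close> kills \<open>e\<close>, then \<open>f\<close> factors through
  \<open>m \<bullet> j\<close> with \<open>j\<close> the kernel of \<open>g\<close>. The cokernel of
  \<open>m \<bullet> j\<close> therefore kills \<open>f\<close>, hence also \<open>m\<close>, so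
  \<open>m\<close> factors through \<open>m \<bullet> j\<close>. Thus \<open>j\<close> has a right
  inverse and \<open>g\<close> is zero.\<close>

lemma image_factorization:
  assumes f: "f \<in> Ar A"
  obtains e m where "epic A e" "monic A m" "Dom A e = Dom A f" "Cod A m = Cod A f" "Cod A e = Dom A m" "m \<bullet> e = f"
proof -
  obtain c where c: "is_cokernel A f c" using cokernel_ex[OF f] by blast
  note c' = is_cokernelD[OF c]
  obtain m where m: "is_kernel A c m" using kernel_ex[OF c'(2)] by blast
  note m' = is_kernelD[OF m] note mm = kernel_monic[OF m]
  obtain e where e: "e \<in> Hom A (Dom A f) (Dom A m)" "m \<bullet> e = f"
    using kernel_lift[OF m, of f] c' m' by auto
  have "epic A e"
  proof (rule epicI)
    fix T g assume g: "T \<in> Ob A" "g \<in> Hom A (Cod A e) T" "g \<bullet> e = Nul A (Dom A e) T"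
    have gA: "g \<in> Ar A" using g by simp
    obtain j where j: "is_kernel A g j" using kernel_ex[OF gA] by blast
    note j' = is_kernelD[OF j]
    obtain e' where e': "e' \<in> Hom A (Dom A f) (Dom A j)" "j \<bullet> e' = e"
      using kernel_lift[OF j, of e] e g by auto
    have mj: "monic A (m \<bullet> j)" by (rule monic_cmp[OF kernel_monic[OF j] mm]) (use j' e g in simp)
    have jm: "Cod A j = Dom A m" using j' g e by simp
    have mjA: "m \<bullet> j \<in> Ar A" using mj by simp
    obtain t where t: "is_cokernel A (m \<bullet> j) t" using cokernel_ex[OF mjA] by blast
    note t' = is_cokernelD[OF t]
    have "t \<bullet> f = (t \<bullet> (m \<bullet> j)) \<bullet> e'"
      using e e'(1) j'(2) m'(2) jm t'(2,3) by (simp add: e'(2))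
    then have "t \<bullet> f = Nul A (Dom A f) (Cod A t)" unfolding t'(4) using t'(2) e'(1) jm m'(2) j'(2) by simp
    then obtain t2 where t2: "t2 \<in> Hom A (Cod A c) (Cod A t)" "t2 \<bullet> c = t"
      using cokernel_desc[OF c, of t] t' m' jm j' c' by auto
    have "t \<bullet> m = t2 \<bullet> (c \<bullet> m)" using cmp_eq[OF t2(2), of m] t2 m' c' by simp
    then have "t \<bullet> m = Nul A (Dom A m) (Cod A t)" using t2 m' by simp
    then obtain s where s: "s \<in> Hom A (Dom A m) (Dom A (m \<bullet> j))" "(m \<bullet> j) \<bullet> s = m"
      using kernel_lift[OF short_exactD(1)[OF monic_short_exact[OF mj t]], of m] t' m' jm j' by auto
    have "j \<bullet> s = Idn A (Dom A m)"
      by (rule monicD[OF mm]) (use s jm j' m' in simp_all)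
    then have "g = g \<bullet> (j \<bullet> s)" using g e by simp
    also have "\<dots> = Nul A (Cod A e) T" using cmp_eq[OF j'(4), of s] s jm j' g e m' by simp
    finally show "g = Nul A (Cod A e) T" .
  qed (use e in simp)
  then show thesis using that[of e m] mm e m' c' by simp
qed

text \<open>Only the product is taken from the category. The injections are the tuples (1, 0) and
  (0, 1), and arrows into a product are determined by their components.\<close>

lemma binary_biproduct:
  assumes "X \<in> Ob A" "Y \<in> Ob A"
  obtains P p q i j where "P \<in> Ob A" "p \<in> Hom A P X" "q \<in> Hom A P Y" "i \<in> Hom A X P" "j \<in> Hom A Y P"
    "p \<bullet> i = Idn A X" "q \<bullet> i = Nul A X Y" "p \<bullet> j = Nul A Y X" "q \<bullet> j = Idn A Y"
    "\<And>T f g. f \<in> Hom A P T \<Longrightarrow> g \<in> Hom A T P \<Longrightarrow> p \<bullet> g = Nul A T X \<Longrightarrow> g = j \<bullet> q \<bullet> g"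
    "is_kernel A q i"
proof -
  obtain P \<pi> where P: "is_product A (UNIV :: bool set) (case_bool X Y) P \<pi>"
    using binary_product_ex[OF assms] by blast
  define p q where "p = \<pi> True" and "q = \<pi> False"
  have Pob: "P \<in> Ob A" and \<pi>: "\<forall>c\<in>UNIV. \<pi> c \<in> Hom A P (case_bool X Y c)"
    using P unfolding is_product_def by blast+
  have pq: "p \<in> Hom A P X" "q \<in> Hom A P Y"
    using \<pi>[rule_format, of True] \<pi>[rule_format, of False] by (simp_all add: p_def q_def)
  have ex: "\<exists>!h. h \<in> Hom A T P \<and> p \<bullet> h = a \<and> q \<bullet> h = b" if "a \<in> Hom A T X" "b \<in> Hom A T Y" for T a b
  proof -
    have T: "T \<in> Ob A" using that(1) ob_dom_eq by auto
    have "\<exists>!h. h \<in> Hom A T P \<and> (\<forall>c\<in>UNIV. \<pi> c \<bullet> h = case_bool a b c)"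
      by (rule P[unfolded is_product_def, THEN conjunct2, THEN conjunct2, THEN conjunct2, rule_format, OF T])
         (use that in \<open>simp split: bool.split\<close>)
    then show ?thesis by (simp add: p_def q_def UNIV_bool conj_commute)
  qed
  obtain i where i: "i \<in> Hom A X P" "p \<bullet> i = Idn A X" "q \<bullet> i = Nul A X Y"
    using ex[of "Idn A X" X "Nul A X Y"] assms by auto
  obtain j where j: "j \<in> Hom A Y P" "p \<bullet> j = Nul A Y X" "q \<bullet> j = Idn A Y"
    using ex[of "Nul A Y X" Y "Idn A Y"] assms by auto
  have uniq: "g = h" if "g \<in> Hom A T P" "h \<in> Hom A T P" "p \<bullet> g = p \<bullet> h" "q \<bullet> g = q \<bullet> h" for T g h
    using ex[of "p \<bullet> h" T "q \<bullet> h"] that pq by simp blast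
  have 1: "g = j \<bullet> q \<bullet> g" if "g \<in> Hom A T P" "p \<bullet> g = Nul A T X" for T g
  proof (rule uniq[of _ T])
    show "p \<bullet> g = p \<bullet> j \<bullet> q \<bullet> g" using that pq j assms cmp_eq[OF j(2), of "q \<bullet> g"] by simp
    show "q \<bullet> g = q \<bullet> j \<bullet> q \<bullet> g" using that pq j assms cmp_eq[OF j(3), of "q \<bullet> g"] by simp
  qed (use that j pq in simp_all)
  have 2: "g = i \<bullet> p \<bullet> g" if "g \<in> Hom A T P" "q \<bullet> g = Nul A T Y" for T g
  proof (rule uniq[of _ T])
    show "p \<bullet> g = p \<bullet> i \<bullet> p \<bullet> g" using that pq i assms cmp_eq[OF i(2), of "p \<bullet> g"] by simp
    show "q \<bullet> g = q \<bullet> i \<bullet> p \<bullet> g" using that pq i assms cmp_eq[OF i(3), of "p \<bullet> g"] by simp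
  qed (use that i pq in simp_all)
  have "is_kernel A q i"
  proof (rule kernelI)
    show "monic A i"
      by (rule monic_cmpD[of p]) (use i pq assms in \<open>simp_all add: isomorphism_monic isomorphism_idn\<close>)
    fix g assume g: "g \<in> Ar A" "Cod A g = Dom A q" "q \<bullet> g = Nul A (Dom A g) (Cod A q)"
    have "g = i \<bullet> p \<bullet> g" using 2[of g] g pq by simp
    moreover have "p \<bullet> g \<in> Hom A (Dom A g) (Dom A i)" using g pq i by simp
    ultimately show "\<exists>h. h \<in> Hom A (Dom A g) (Dom A i) \<and> i \<bullet> h = g" by metis
  qed (use i pq assms in simp_all)
  then show thesis using that[OF Pob pq i(1) j(1) i(2,3) j(2,3)] 1 by blast
qed

text \<open>The basis of all element chases: an element of the target of an epic lifts after passing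
  to an epic cover of its domain. The cover is the pullback of \<open>e\<close> along
  \<open>z\<close>, realised as the kernel of \<open>e \<bullet> q - z \<bullet> p\<close> on the
  biproduct.\<close>

lemma cover:
  assumes e: "epic A e" and z: "z \<in> Ar A" "Cod A z = Cod A e"
  obtains e' y where "epic A e'" "Cod A e' = Dom A z" "y \<in> Hom A (Dom A e') (Dom A e)" "e \<bullet> y = z \<bullet> e'"
proof -
  let ?T = "Dom A z" and ?Y = "Dom A e" and ?Z = "Cod A e"
  have ob: "?T \<in> Ob A" "?Y \<in> Ob A" using e z by auto
  have eA: "e \<in> Ar A" using e by simp
  obtain P p q i j where P: "P \<in> Ob A" "p \<in> Hom A P ?T" "q \<in> Hom A P ?Y" "i \<in> Hom A ?T P" "j \<in> Hom A ?Y P"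
    "p \<bullet> i = Idn A ?T" "q \<bullet> i = Nul A ?T ?Y" "p \<bullet> j = Nul A ?Y ?T" "q \<bullet> j = Idn A ?Y"
    using binary_biproduct[OF ob] by metis
  define f where "f = Diff A (e \<bullet> q) (z \<bullet> p)"
  have f: "f \<in> Hom A P ?Z" using P z eA by (simp add: f_def)
  have fj: "f \<bullet> j = e" unfolding f_def
    using P z eA ob Diff_cmp[of j ?Y P "e \<bullet> q" ?Z "z \<bullet> p"] by simp
  have fe: "epic A f" by (rule epic_cmpD[of f j]) (use fj e f P in simp_all)
  have fA: "f \<in> Ar A" using f by simp
  obtain k where k: "is_kernel A f k" using kernel_ex[OF fA] by blast
  note k' = is_kernelD[OF k]
  have cok: "is_cokernel A k f" using epic_short_exact[OF fe k] short_exactD(2) by blast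
  \<comment> \<open>If \<open>g\<close> kills \<open>p \<bullet> k\<close>, then
    \<open>g \<bullet> p\<close> factors as \<open>h \<bullet> f\<close>, because \<open>f\<close>
    is the cokernel of \<open>k\<close>. Restriction to the summand \<open>j\<close> gives
    \<open>h \<bullet> e = 0\<close>, so \<open>h\<close> is zero, and restriction to
    \<open>i\<close> gives \<open>g = 0\<close>.\<close>
  have "epic A (p \<bullet> k)"
  proof (rule epicI)
    show "p \<bullet> k \<in> Ar A" using P k' f by simp
    fix U g assume g: "U \<in> Ob A" "g \<in> Hom A (Cod A (p \<bullet> k)) U" "g \<bullet> p \<bullet> k = Nul A (Dom A (p \<bullet> k)) U"
    have "(g \<bullet> p) \<bullet> k = Nul A (Dom A k) (Cod A (g \<bullet> p))" using g P k' f by simp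
    then obtain h where h: "h \<in> Hom A (Cod A f) (Cod A (g \<bullet> p))" "h \<bullet> f = g \<bullet> p"
      using cokernel_desc[OF cok, of "g \<bullet> p"] g P k' f by auto
    have "h \<bullet> e = (h \<bullet> f) \<bullet> j" using fj h(1) P f g k' by simp
    also have "\<dots> = Nul A ?Y U" unfolding h(2) using P g k' f ob by simp
    finally have "h = Nul A ?Z U" using epic_nulD[OF e, of h] h f g P k' by simp
    then have "g \<bullet> p = Nul A P U" using h f g by simp
    then have "(g \<bullet> p) \<bullet> i = Nul A ?T U" using P g by simp
    then show "g = Nul A (Cod A (p \<bullet> k)) U" using P g k' f by simp
  qed
  moreover have "e \<bullet> q \<bullet> k = z \<bullet> p \<bullet> k"
  proof -
    have "Diff A (e \<bullet> q \<bullet> k) (z \<bullet> p \<bullet> k) = f \<bullet> k" unfolding f_def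
      using P z eA ob k' f Diff_cmp[of k "Dom A k" P "e \<bullet> q" ?Z "z \<bullet> p"] by simp
    also have "\<dots> = Nul A (Dom A k) ?Z" using k' f by simp
    finally show ?thesis using Diff_nul_iff[of "e \<bullet> q \<bullet> k" "Dom A k" ?Z "z \<bullet> p \<bullet> k"] P z eA k' f by simp
  qed
  ultimately show thesis using that[of "p \<bullet> k" "q \<bullet> k"] P k' f by simp
qed

text \<open>Lifting after an epic cover is enough for a monic \<open>m\<close>: \<open>m\<close> is
  the kernel of its cokernel \<open>c\<close>, and \<open>c \<bullet> x\<close> vanishes as soon as
  it vanishes on a cover.\<close>

lemma kernel_local:
  assumes m: "monic A m" and f: "f \<in> Ar A" "Dom A f = Cod A m" "f \<bullet> m = Nul A (Dom A m) (Cod A f)"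
    and loc: "\<And>x. x \<in> Ar A \<Longrightarrow> Cod A x = Dom A f \<Longrightarrow> f \<bullet> x = Nul A (Dom A x) (Cod A f)
      \<Longrightarrow> \<exists>e y. epic A e \<and> Cod A e = Dom A x \<and> y \<in> Hom A (Dom A e) (Dom A m) \<and> m \<bullet> y = x \<bullet> e"
  shows "is_kernel A f m"
proof (rule kernelI[OF m f(1)])
  have mA: "m \<in> Ar A" using m by simp
  obtain c where c: "is_cokernel A m c" using cokernel_ex[OF mA] by blast
  note c' = is_cokernelD[OF c]
  have k: "is_kernel A c m" using monic_short_exact[OF m c] short_exactD by blast
  fix x assume x: "x \<in> Ar A" "Cod A x = Dom A f" "f \<bullet> x = Nul A (Dom A x) (Cod A f)"
  obtain e y where e: "epic A e" "Cod A e = Dom A x" "y \<in> Hom A (Dom A e) (Dom A m)" "m \<bullet> y = x \<bullet> e"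
    using loc[OF x] by blast
  have eA: "e \<in> Ar A" using e by simp
  have "(c \<bullet> x) \<bullet> e = c \<bullet> m \<bullet> y" using e(1-3) x(1,2) c'(2,3) f(2) mA eA by (simp add: e(4))
  also have "\<dots> = Nul A (Dom A e) (Cod A c)" using cmp_eq[OF c'(4), of y] c'(2,3) e(3) mA eA by simp
  finally have "c \<bullet> x = Nul A (Dom A x) (Cod A c)"
    using epic_nulD[OF e(1), of "c \<bullet> x"] x c' e f by simp
  then show "\<exists>h. h \<in> Hom A (Dom A x) (Dom A m) \<and> m \<bullet> h = x"
    using kernel_lift[OF k, of x] x c' f by (metis)
qed (use f in simp_all)

lemma epic_of_local:
  assumes f: "f \<in> Ar A" and e: "epic A e" and y: "y \<in> Hom A (Dom A e) (Dom A f)" "f \<bullet> y = e"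
  shows "epic A f"
  by (rule epic_cmpD[of f y]) (use assms in simp_all)

end

section \<open>Lengths\<close>

text \<open>\<open>flt A P n X\<close>: some finite filtration of \<open>X\<close> has \<open>n\<close> factors satisfying \<open>P\<close>, the other factors
  being arbitrary.\<close>

inductive flt :: "('o, 'm) cat \<Rightarrow> ('o \<Rightarrow> bool) \<Rightarrow> nat \<Rightarrow> 'o \<Rightarrow> bool" for A P where
  zero: "X \<in> Ob A \<Longrightarrow> flt A P 0 X"
| one: "X \<in> Ob A \<Longrightarrow> P X \<Longrightarrow> flt A P 1 X"
| ext: "short_exact A f g \<Longrightarrow> flt A P n (Dom A f) \<Longrightarrow> flt A P m (Cod A g) \<Longrightarrow> flt A P (n + m) (Cod A f)"

text \<open>A supremum in the extended naturals, so that additivity can be proved before finiteness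
  is known. The set is nonempty for every object of \<open>A\<close>, since the trivial filtration
  counts 0. The class \<open>P\<close> will be either the objects isomorphic to one simple object or
  all simple objects.\<close>

definition len :: "('o, 'm) cat \<Rightarrow> ('o \<Rightarrow> bool) \<Rightarrow> 'o \<Rightarrow> enat" where
  "len A P X = (SUP n\<in>{n. flt A P n X}. enat n)"

definition simple_class :: "('o, 'm) cat \<Rightarrow> ('o \<Rightarrow> bool) \<Rightarrow> bool" where
  "simple_class A P \<longleftrightarrow> (\<forall>X. P X \<longrightarrow> simple_object A X) \<and> (\<forall>X Y. P X \<longrightarrow> isomorphic A X Y \<longrightarrow> P Y)"

text \<open>A finite supremum of a nonempty set of extended naturals is a maximum.\<close>

lemma len_finite_attained:
  assumes "len A P X = enat n" "X \<in> Ob A" shows "flt A P n X"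
proof -
  have ne: "enat ` {n. flt A P n X} \<noteq> {}" using flt.zero[OF assms(2)] by blast
  have S: "Sup (enat ` {n. flt A P n X}) = enat n" using assms(1) by (simp only: len_def)
  then have fin: "finite (enat ` {n. flt A P n X})"
    using ne unfolding Sup_enat_def by (metis enat.distinct(1))
  then have "Max (enat ` {n. flt A P n X}) = enat n"
    using S ne unfolding Sup_enat_def by (simp only: if_False if_True)
  then have "enat n \<in> enat ` {n. flt A P n X}" using Max_in[OF fin ne] by simp
  then show ?thesis by blast
qed

lemma len_infinite_attained:
  assumes "len A P X = \<infinity>" shows "\<exists>m\<ge>n. flt A P m X"
proof (rule ccontr)
  assume "\<not> ?thesis"
  then have "len A P X \<le> enat n" unfolding len_def by (intro SUP_least) (auto simp: not_le intro: less_imp_le)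
  then show False using assms by simp
qed

lemma flt_le_len: "flt A P n X \<Longrightarrow> enat n \<le> len A P X"
  unfolding len_def by (rule SUP_upper) simp

context abelian_category
begin

lemma simple_iso:
  assumes "simple_object A X" "isomorphic A X Y" shows "simple_object A Y"
proof -
  obtain f where "f \<in> Hom A Y X" "isomorphism A f" using isomorphicE[OF isomorphic_sym[OF assms(2)]] .
  then have f: "isomorphism A f" "f \<in> Ar A" "Dom A f = Y" "Cod A f = X" by auto
  obtain g where g: "g \<in> Hom A X Y" "g \<bullet> f = Idn A Y" "isomorphism A g"
    using isomorphism_inverse[OF f(1), unfolded f(3,4)] by blast
  note X = assms(1)[unfolded simple_object_def]
  show ?thesis unfolding simple_object_def
  proof (intro conjI allI impI)
    show "Y \<in> Ob A" using f by auto
    show "\<not> zero_object A Y" using X zero_monic[OF isomorphism_monic[OF g(3)]] g(1) by auto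
    fix m assume m: "monic A m \<and> Cod A m = Y"
    then have "monic A (f \<bullet> m)" "Cod A (f \<bullet> m) = X"
      using monic_cmp[of m f] isomorphism_monic[OF f(1)] f by auto
    then have "zero_object A (Dom A (f \<bullet> m)) \<or> isomorphism A (f \<bullet> m)" using X by blast
    then show "zero_object A (Dom A m) \<or> isomorphism A m"
    proof
      assume "isomorphism A (f \<bullet> m)"
      then have "isomorphism A (g \<bullet> f \<bullet> m)" using isomorphism_cmp[OF _ g(3)] g f m by simp
      then show ?thesis using cmp_eq[OF g(2), of m] f g m by simp
    qed (use f m in simp)
  qed
qed

lemma simple_classD:
  assumes "simple_class A P" "P X"
  shows "simple_object A X" "X \<in> Ob A" "\<not> zero_object A X" "isomorphic A X Y \<Longrightarrow> P Y"
  using assms unfolding simple_class_def simple_object_def by blast+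

lemma simple_class_iso: "simple_object A S \<Longrightarrow> simple_class A (\<lambda>X. isomorphic A X S)"
  unfolding simple_class_def using isomorphic_sym isomorphic_trans simple_iso by meson

lemma simple_class_simple: "simple_class A (simple_object A)"
  unfolding simple_class_def using simple_iso by blast

lemma zero_epic_kernel:
  assumes "short_exact A f g" 
  shows "zero_object A (Dom A f) \<Longrightarrow> isomorphism A g" "zero_object A (Cod A g) \<Longrightarrow> isomorphism A f"
  using short_exactD[OF assms] monic_epic_iso monic_iff_kernel_zero epic_iff_cokernel_zero by blast+

lemma isomorphism_short_exact:
  assumes "isomorphism A f"
  obtains g where "short_exact A f g" "zero_object A (Cod A g)"
proof -
  have fA: "f \<in> Ar A" using assms by simp
  obtain g where g: "is_cokernel A f g" using cokernel_ex[OF fA] by blast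
  show thesis using that[OF monic_short_exact[OF isomorphism_monic[OF assms] g]]
    epic_iff_cokernel_zero[OF g] isomorphism_epic[OF assms] by blast
qed

text \<open>An isomorphism is the first arrow of a short exact sequence with zero quotient, so it
  adds one extension step and no factor.\<close>

lemma flt_iso:
  assumes "flt A P n X" "isomorphic A X Y" shows "flt A P n Y"
proof -
  obtain f where f: "f \<in> Hom A X Y" "isomorphism A f" using isomorphicE[OF assms(2)] .
  obtain g where g: "short_exact A f g" "zero_object A (Cod A g)" using isomorphism_short_exact[OF f(2)] .
  have "flt A P (n + 0) (Cod A f)"
    by (rule flt.ext[OF g(1)]) (use assms(1) f(1) g(2) in \<open>simp_all add: flt.zero zero_object_iff\<close>)
  then show ?thesis using f by simp
qed

lemma flt_zero: "flt A P n X \<Longrightarrow> simple_class A P \<Longrightarrow> zero_object A X \<Longrightarrow> n = 0"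
proof (induction rule: flt.induct)
  case (one X) then show ?case using simple_classD(3) by blast
next
  case (ext f g n m)
  note D = short_exactD[OF ext.hyps(1)]
  have "zero_object A (Dom A f)" using zero_monic[OF D(3)] ext.prems by simp
  moreover have "zero_object A (Cod A g)" using zero_epic[OF D(4)] ext.prems D(7) by simp
  ultimately show ?case using ext.IH ext.prems by simp
qed simp

text \<open>An extension with simple middle term is degenerate: one end is zero and the other is
  isomorphic to the middle.\<close>

lemma flt_simple: 
  "flt A P n X \<Longrightarrow> simple_class A P \<Longrightarrow> simple_object A X \<Longrightarrow> n \<le> (if P X then 1 else 0)"
proof (induction rule: flt.induct)
  case (ext f g n m)
  note D = short_exactD[OF ext.hyps(1)]
  have "zero_object A (Dom A f) \<or> isomorphism A f"
    using ext.prems(2) D(3) unfolding simple_object_def by blast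
  then show ?case
  proof
    assume z: "zero_object A (Dom A f)"
    then have i: "isomorphic A (Cod A f) (Cod A g)" using isomorphicI[OF zero_epic_kernel(1)[OF ext.hyps(1) z]] D(7) by simp
    then have "m \<le> (if P (Cod A g) then 1 else 0)" using ext.IH(2) ext.prems simple_iso by blast
    moreover have "P (Cod A g) \<Longrightarrow> P (Cod A f)" using simple_classD(4)[OF ext.prems(1) _ isomorphic_sym[OF i]] .
    moreover have "n = 0" using flt_zero[OF ext.hyps(2) ext.prems(1) z] .
    ultimately show ?case by (auto split: if_splits)
  next
    assume i': "isomorphism A f"
    then have i: "isomorphic A (Dom A f) (Cod A f)" by (rule isomorphicI)
    then have "n \<le> (if P (Dom A f) then 1 else 0)" using ext.IH(1) ext.prems simple_iso[OF _ isomorphic_sym[OF i]] by blast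
    moreover have "P (Dom A f) \<Longrightarrow> P (Cod A f)" using simple_classD(4)[OF ext.prems(1) _ i] .
    moreover have "zero_object A (Cod A g)" using epic_iff_cokernel_zero[OF D(2)] isomorphism_epic[OF i'] by blast
    then have "m = 0" using flt_zero[OF ext.hyps(3) ext.prems(1)] by blast
    ultimately show ?case by (auto split: if_splits)
  qed
qed auto

text \<open>A subobject \<open>X\<^sub>1\<close> of \<open>X\<close> cuts a short exact sequence \<open>Y \<rightarrow> X \<rightarrow> Z\<close> into two.\<close>

lemma nine:
  assumes yz: "short_exact A y z" and ab: "short_exact A a b" and X: "Cod A y = Cod A a"
  obtains y1 e n c m d s t where
    "short_exact A y1 e" "Cod A y1 = Dom A a"
    "short_exact A s t" "Cod A s = Cod A b"
    "short_exact A n c" "Cod A n = Dom A y" "Dom A n = Dom A y1" "Cod A c = Dom A s"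
    "short_exact A m d" "Cod A m = Cod A z" "Dom A m = Cod A e" "Cod A d = Cod A t"
proof -
  note Y = short_exactD[OF yz] and B = short_exactD[OF ab]
  have za: "z \<bullet> a \<in> Ar A" using Y B X by simp
  \<comment> \<open>\<open>Dom A m\<close> is the image of the subobject \<open>Dom A a\<close> in
    \<open>Cod A z\<close>. The kernel \<open>y1\<close> of \<open>e\<close> plays the part of the
    intersection of \<open>Dom A a\<close> with \<open>Dom A y\<close>.\<close>
  obtain e m where em: "epic A e" "monic A m" "Dom A e = Dom A a" "Cod A m = Cod A z" "Cod A e = Dom A m" "m \<bullet> e = z \<bullet> a"
    using image_factorization[OF za] Y B X by auto
  have eA: "e \<in> Ar A" and mA: "m \<in> Ar A" using em by auto
  obtain y1 where y1: "is_kernel A e y1" using kernel_ex[OF eA] by blast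
  note S1 = epic_short_exact[OF em(1) y1] note y1' = is_kernelD[OF y1]
  obtain d where d: "is_cokernel A m d" using cokernel_ex[OF mA] by blast
  note S4 = monic_short_exact[OF em(2) d] note d' = is_cokernelD[OF d]
  have "z \<bullet> a \<bullet> y1 = m \<bullet> e \<bullet> y1" using cmp_eq[OF em(6), of y1] eA mA em y1' Y B X by simp
  then have zay: "z \<bullet> a \<bullet> y1 = Nul A (Dom A y1) (Cod A z)" using y1' eA mA em by simp
  obtain n where n: "n \<in> Hom A (Dom A y1) (Dom A y)" "y \<bullet> n = a \<bullet> y1"
    using kernel_lift[OF Y(1), of "a \<bullet> y1"] zay y1' Y B X em(3) by auto
  have nm: "monic A n"
    by (rule monic_cmpD[of y]) (use n Y monic_cmp[OF kernel_monic[OF y1] B(3)] y1' em(3) in simp_all)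
  have nA: "n \<in> Ar A" using n by simp
  obtain c where c: "is_cokernel A n c" using cokernel_ex[OF nA] by blast
  note S3 = monic_short_exact[OF nm c] note c' = is_cokernelD[OF c]
  have "(b \<bullet> y) \<bullet> n = (b \<bullet> a) \<bullet> y1" using n(1) Y(5-7) B(5-7) X y1'(2,3) em(3) by (simp add: n(2) del: B(8))
  then have "(b \<bullet> y) \<bullet> n = Nul A (Dom A n) (Cod A b)" unfolding B(8) using n y1' B em by simp
  then obtain s where s: "s \<in> Hom A (Cod A c) (Cod A b)" "s \<bullet> c = b \<bullet> y"
    using cokernel_desc[OF c, of "b \<bullet> y"] n Y B X by auto
  have "(d \<bullet> z) \<bullet> a = (d \<bullet> m) \<bullet> e" using d'(2,3) Y(5-7) B(5-7) X em(3-5) mA eA by (simp add: em(6))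
  then have "(d \<bullet> z) \<bullet> a = Nul A (Dom A a) (Cod A d)" unfolding d'(4) using em eA d' by simp
  then obtain t where t: "t \<in> Hom A (Cod A b) (Cod A d)" "t \<bullet> b = d \<bullet> z"
    using cokernel_desc[OF B(2), of "d \<bullet> z"] d' em B X Y by auto
  have te: "epic A t"
    by (rule epic_cmpD[of t b]) (use t B epic_cmp[OF Y(4) cokernel_epic[OF d]] d' em in simp_all)
  \<comment> \<open>Write an element \<open>w\<close> killed by \<open>s\<close> as
    \<open>c \<bullet> u\<close>. Then \<open>y \<bullet> u\<close> lies in \<open>Dom A a\<close>
    and has zero image in \<open>Cod A z\<close>, so \<open>u\<close> comes from the intersection
    and \<open>c\<close> kills it.\<close>
  have sm: "monic A s"
  proof (rule monicI)
    fix T w assume w: "T \<in> Ob A" "w \<in> Hom A T (Dom A s)" "s \<bullet> w = Nul A T (Cod A s)"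
    have wA: "w \<in> Ar A" "Cod A w = Cod A c" "Dom A w = T" using w s by auto
    obtain e1 u where u: "epic A e1" "Cod A e1 = Dom A w" "u \<in> Hom A (Dom A e1) (Dom A c)" "c \<bullet> u = w \<bullet> e1"
      using cover[OF cokernel_epic[OF c] wA(1,2)] .
    have e1: "e1 \<in> Ar A" using u by simp
    have "b \<bullet> y \<bullet> u = s \<bullet> c \<bullet> u" using cmp_eq[OF s(2), of u] s(1) u(3) c'(2,3) Y B X n by simp
    also have "\<dots> = Nul A (Dom A e1) (Cod A b)" using cmp_eq[OF w(3), of e1] u s w e1 B(6) by simp
    finally have "b \<bullet> y \<bullet> u = Nul A (Dom A e1) (Cod A b)" .
    then obtain v where v: "v \<in> Hom A (Dom A e1) (Dom A a)" "a \<bullet> v = y \<bullet> u"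
      using kernel_lift[OF B(1), of "y \<bullet> u"] u c' n Y X B by auto
    have "m \<bullet> e \<bullet> v = z \<bullet> a \<bullet> v" using cmp_eq[OF em(6), of v] v em mA eA Y B X by simp
    also have "\<dots> = Nul A (Dom A e1) (Cod A z)" unfolding v(2) using cmp_eq[OF Y(8), of u] u c' n Y by simp
    finally have "e \<bullet> v = Nul A (Dom A e1) (Cod A e)"
      using monic_nulD[OF em(2), of "e \<bullet> v"] v em eA by simp
    then obtain v2 where v2: "v2 \<in> Hom A (Dom A e1) (Dom A y1)" "y1 \<bullet> v2 = v"
      using kernel_lift[OF y1, of v] v em by auto
    have "y \<bullet> u = y \<bullet> n \<bullet> v2" using cmp_eq[OF n(2), of v2] v v2 n Y B y1' em by simp
    then have "u = n \<bullet> v2" using monicD[OF Y(3), of u "n \<bullet> v2"] u v2 n c' by simp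
    then have "w \<bullet> e1 = Nul A (Dom A e1) (Cod A c)" using u(4) cmp_eq[OF c'(4), of v2] v2 n c' by simp
    then show "w = Nul A T (Dom A s)" using epic_nulD[OF u(1), of w] wA u s by simp
  qed (use s in simp)
  have "is_kernel A t s"
  proof (rule kernel_local[OF sm])
    have "(t \<bullet> s) \<bullet> c = d \<bullet> z \<bullet> y"
      using s(1) t(1) c'(2,3) Y(5-7) B(5-7) X d'(2,3) em(4) n(1) cmp_eq[OF t(2), of y] by (simp add: s(2))
    also have "\<dots> = Nul A (Dom A c) (Cod A d)" using Y d' em n c' by simp
    finally show "t \<bullet> s = Nul A (Dom A s) (Cod A t)"
      using epic_nulD[OF cokernel_epic[OF c], of "t \<bullet> s"] s t c' by simp
    fix x assume x: "x \<in> Ar A" "Cod A x = Dom A t" "t \<bullet> x = Nul A (Dom A x) (Cod A t)"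
    obtain e1 u where u: "epic A e1" "Cod A e1 = Dom A x" "u \<in> Hom A (Dom A e1) (Dom A b)" "b \<bullet> u = x \<bullet> e1"
      using cover[OF B(4) x(1)] x t by auto
    have e1: "e1 \<in> Ar A" using u by simp
    have "d \<bullet> z \<bullet> u = t \<bullet> x \<bullet> e1" using cmp_eq[OF t(2), of u] t(1) u(2,3) e1 B(5-7) Y(5-7) X d'(2,3) em(4) by (simp add: u(4))
    also have "\<dots> = Nul A (Dom A e1) (Cod A d)" using cmp_eq[OF x(3), of e1] x t u e1 by simp
    finally have "d \<bullet> z \<bullet> u = Nul A (Dom A e1) (Cod A d)" .
    then obtain z1 where z1: "z1 \<in> Hom A (Dom A e1) (Dom A m)" "m \<bullet> z1 = z \<bullet> u"
      using kernel_lift[OF short_exactD(1)[OF S4], of "z \<bullet> u"] u Y B X d' em by auto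
    obtain e2 x1 where x1: "epic A e2" "Cod A e2 = Dom A z1" "x1 \<in> Hom A (Dom A e2) (Dom A e)" "e \<bullet> x1 = z1 \<bullet> e2"
      using cover[OF em(1), of z1] z1 em by auto
    have e2: "e2 \<in> Ar A" using x1 by simp
    \<comment> \<open>\<open>u\<close> lifts \<open>x\<close>, and its image in
      \<open>Cod A z\<close> is also the image of an element \<open>x1\<close> of
      \<open>Dom A a\<close>. Subtracting \<open>a \<bullet> x1\<close> does not change the image
      under \<open>b\<close> and moves the lift into \<open>Dom A y\<close>.\<close>
    let ?D = "Diff A (u \<bullet> e2) (a \<bullet> x1)"
    have h1: "u \<bullet> e2 \<in> Hom A (Dom A e2) (Cod A a)" "a \<bullet> x1 \<in> Hom A (Dom A e2) (Cod A a)"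
      using u x1 e1 e2 z1 B X em by simp_all
    have D: "?D \<in> Hom A (Dom A e2) (Cod A a)" using Diff_hom(1)[OF h1] .
    have "z \<bullet> a \<bullet> x1 = m \<bullet> e \<bullet> x1" using cmp_eq[OF em(6), of x1] x1 em mA eA Y B X by simp
    also have "\<dots> = z \<bullet> u \<bullet> e2" using cmp_eq[OF z1(2), of e2] z1 x1(1,2) e2 u(3) em mA Y B X by (simp add: x1(4))
    finally have "z \<bullet> u \<bullet> e2 = z \<bullet> a \<bullet> x1" ..
    then have "z \<bullet> ?D = Nul A (Dom A e2) (Cod A z)"
      using cmp_Diff[OF h1, of z "Cod A z"] Y X B x1 em by simp
    then obtain w where w: "w \<in> Hom A (Dom A e2) (Dom A y)" "y \<bullet> w = ?D"
      using kernel_lift[OF Y(1), of ?D] D Y X by auto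
    have "b \<bullet> a \<bullet> x1 = Nul A (Dom A e2) (Cod A b)" using cmp_eq[OF B(8), of x1] x1 B em by simp
    then have "b \<bullet> ?D = b \<bullet> u \<bullet> e2"
      using cmp_Diff[OF h1, of b "Cod A b"] B h1 u z1 x1 e2 by simp
    also have "\<dots> = x \<bullet> e1 \<bullet> e2" using cmp_eq[OF u(4), of e2] u(1-3) x1(1,2) z1 e1 e2 B x by simp
    finally have bD: "b \<bullet> ?D = x \<bullet> e1 \<bullet> e2" .
    have "s \<bullet> c \<bullet> w = b \<bullet> y \<bullet> w" using cmp_eq[OF s(2), of w] s(1) w(1) c' Y B X n by simp
    then have "s \<bullet> c \<bullet> w = x \<bullet> e1 \<bullet> e2" using w(2) bD by simp
    moreover have "epic A (e1 \<bullet> e2)" using epic_cmp[OF x1(1) u(1)] x1 z1 by simp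
    ultimately show "\<exists>e y. epic A e \<and> Cod A e = Dom A x \<and> y \<in> Hom A (Dom A e) (Dom A s) \<and> s \<bullet> y = x \<bullet> e"
      by (intro exI[of _ "e1 \<bullet> e2"] exI[of _ "c \<bullet> w"]) (use e1 e2 x1 z1 u w c' s n in simp)
  qed (use s t in simp_all)
  then have S2: "short_exact A s t" by (rule epic_short_exact[OF te])
  show thesis by (rule that[OF S1 _ S2 _ S3 _ _ _ S4]) (use y1' em s c' n d' t in simp_all)
qed

text \<open>This is the half of additivity with content: every filtration of the middle term induces
  filtrations of the ends with the same total count. A simple middle term goes to one end, and an
  extension is cut into two by \<open>nine\<close>.\<close>

lemma flt_split:
  "flt A P n X \<Longrightarrow> simple_class A P \<Longrightarrow> short_exact A f g \<Longrightarrow> Cod A f = X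
    \<Longrightarrow> \<exists>a b. n = a + b \<and> flt A P a (Dom A f) \<and> flt A P b (Cod A g)"
proof (induction arbitrary: f g rule: flt.induct)
  case (zero X)
  note D = short_exactD[OF zero.prems(2)]
  have "flt A P 0 (Dom A f)" "flt A P 0 (Cod A g)" using D(5,6) by (simp_all add: flt.zero)
  then show ?case by (metis add_0)
next
  case (one X)
  note D = short_exactD[OF one.prems(2)]
  have "simple_object A X" using simple_classD[OF one.prems(1) one.hyps(2)] by blast
  then have "zero_object A (Dom A f) \<or> isomorphism A f"
    using one.prems(3) D(3) unfolding simple_object_def by blast
  then show ?case
  proof
    assume z: "zero_object A (Dom A f)"
    then have i: "isomorphic A (Cod A f) (Cod A g)" using isomorphicI[OF zero_epic_kernel(1)[OF one.prems(2) z]] D(7) by simp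
    have "flt A P 0 (Dom A f)" using D(5) by (simp add: flt.zero)
    moreover have "flt A P 1 (Cod A g)"
      using flt_iso[OF flt.one[where P=P, OF one.hyps] i[unfolded one.prems(3)]] .
    ultimately show ?case by (metis add_0)
  next
    assume i: "isomorphism A f"
    have "flt A P 0 (Cod A g)" using D(6) by (simp add: flt.zero)
    moreover have "flt A P 1 (Dom A f)"
      using flt_iso[OF flt.one[where P=P, OF one.hyps] isomorphic_sym[OF isomorphicI[OF i, unfolded one.prems(3)]]] .
    ultimately show ?case by (metis add_0_right)
  qed
next
  case (ext a b n m)
  obtain y1 e nn c mm d s t where N:
    "short_exact A y1 e" "Cod A y1 = Dom A a"
    "short_exact A s t" "Cod A s = Cod A b"
    "short_exact A nn c" "Cod A nn = Dom A f" "Dom A nn = Dom A y1" "Cod A c = Dom A s"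
    "short_exact A mm d" "Cod A mm = Cod A g" "Dom A mm = Cod A e" "Cod A d = Cod A t"
    by (rule nine[OF ext.prems(2) ext.hyps(1) ext.prems(3)]) blast
  obtain a1 b1 where 1: "n = a1 + b1" "flt A P a1 (Dom A y1)" "flt A P b1 (Cod A e)"
    using ext.IH(1)[OF ext.prems(1) N(1,2)] by blast
  obtain a2 b2 where 2: "m = a2 + b2" "flt A P a2 (Dom A s)" "flt A P b2 (Cod A t)"
    using ext.IH(2)[OF ext.prems(1) N(3,4)] by blast
  have "flt A P (a1 + a2) (Dom A f)" using flt.ext[OF N(5), of P a1 a2] 1 2 N by simp
  moreover have "flt A P (b1 + b2) (Cod A g)" using flt.ext[OF N(9), of P b1 b2] 1 2 N by simp
  ultimately show ?case using 1 2 by (intro exI[of _ "a1 + a2"] exI[of _ "b1 + b2"]) simp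
qed

text \<open>\<open>q'\<close> divides \<open>Cod A f\<close> by the image of the kernel of
  \<open>q\<close>. Since the same subobject is divided out on both sides, nothing more is
  identified in the quotient of the subobject.\<close>

lemma quotient_of_subobject:
  assumes f: "monic A f" and q: "epic A q" "Dom A q = Dom A f"
  obtains q' h where "epic A q'" "Dom A q' = Cod A f" "monic A h" "h \<in> Hom A (Cod A q) (Cod A q')" "q' \<bullet> f = h \<bullet> q"
proof -
  have fA: "f \<in> Ar A" and qA: "q \<in> Ar A" using f q by auto
  obtain k where k: "is_kernel A q k" using kernel_ex[OF qA] by blast
  note k' = is_kernelD[OF k]
  have fk: "monic A (f \<bullet> k)" by (rule monic_cmp[OF kernel_monic[OF k] f]) (use k' q in simp)
  then have fkA: "f \<bullet> k \<in> Ar A" by simp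
  obtain q' where q': "is_cokernel A (f \<bullet> k) q'" using cokernel_ex[OF fkA] by blast
  note q'' = is_cokernelD[OF q'] 
  have cd: "Cod A (f \<bullet> k) = Cod A f" "Dom A (f \<bullet> k) = Dom A k" using fA k' q by simp_all
  note ker = short_exactD(1)[OF monic_short_exact[OF fk q']]
  have "(q' \<bullet> f) \<bullet> k = Nul A (Dom A k) (Cod A q')" using q'' cd fA k' q by simp
  then obtain h where h: "h \<in> Hom A (Cod A q) (Cod A q')" "h \<bullet> q = q' \<bullet> f"
    using cokernel_desc[OF short_exactD(2)[OF epic_short_exact[OF q(1) k]], of "q' \<bullet> f"] q'' cd fA k' q by auto
  have "monic A h"
  proof (rule monicI)
    fix T z assume z: "T \<in> Ob A" "z \<in> Hom A T (Dom A h)" "h \<bullet> z = Nul A T (Cod A h)"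
    have zA: "z \<in> Ar A" "Cod A z = Cod A q" "Dom A z = T" using z h by auto
    obtain e y where y: "epic A e" "Cod A e = Dom A z" "y \<in> Hom A (Dom A e) (Dom A q)" "q \<bullet> y = z \<bullet> e"
      using cover[OF q(1) zA(1,2)] .
    have eA: "e \<in> Ar A" using y by simp
    have "q' \<bullet> f \<bullet> y = h \<bullet> z \<bullet> e" using cmp_eq[OF h(2), of y] h(1) y(1-3) qA q q'' cd fA by (simp add: y(4))
    also have "\<dots> = Nul A (Dom A e) (Cod A q')" using cmp_eq[OF z(3), of e] z h y eA q''(2) by simp
    finally obtain w where w: "w \<in> Hom A (Dom A e) (Dom A k)" "(f \<bullet> k) \<bullet> w = f \<bullet> y"
      using kernel_lift[OF ker, of "f \<bullet> y"] y q fA q'' cd by auto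
    have "y = k \<bullet> w" by (rule monicD[OF f]) (use w y q k' fA in simp_all)
    then have "z \<bullet> e = Nul A (Dom A e) (Cod A q)" using y(4) cmp_eq[OF k'(4), of w] w k' by simp
    then show "z = Nul A T (Dom A h)" using epic_nulD[OF y(1), of z] zA y h by simp
  qed (use h in simp)
  then show thesis using that[of q' h] cokernel_epic[OF q'] q'' cd h by simp
qed

text \<open>Turns a positive count into an actual factor, placed as a subobject of a quotient. A
  factor found in the subobject of an extension is brought to this form by
  \<open>quotient_of_subobject\<close>.\<close>

lemma flt_subquotient:
  "flt A P n X \<Longrightarrow> n > 0 \<Longrightarrow> simple_class A P
    \<Longrightarrow> \<exists>q s. epic A q \<and> Dom A q = X \<and> monic A s \<and> Cod A s = Cod A q \<and> P (Dom A s)"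
proof (induction rule: flt.induct)
  case (one X)
  then show ?case
    by (intro exI[of _ "Idn A X"]) (simp add: isomorphism_monic isomorphism_epic isomorphism_idn)
next
  case (ext f g n m)
  note D = short_exactD[OF ext.hyps(1)]
  show ?case
  proof (cases "n > 0")
    case True
    then obtain q s where q: "epic A q" "Dom A q = Dom A f" "monic A s" "Cod A s = Cod A q" "P (Dom A s)"
      using ext.IH(1) ext.prems by blast
    obtain q' h where h: "epic A q'" "Dom A q' = Cod A f" "monic A h" "h \<in> Hom A (Cod A q) (Cod A q')"
      using quotient_of_subobject[OF D(3) q(1,2)] by metis
    show ?thesis
      by (intro exI[of _ q'] exI[of _ "h \<bullet> s"]) (use h q monic_cmp[OF q(3) h(3)] in simp)
  next
    case False
    then obtain q s where q: "epic A q" "Dom A q = Cod A g" "monic A s" "Cod A s = Cod A q" "P (Dom A s)"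
      using ext.IH(2) ext.prems by auto
    show ?thesis
      by (intro exI[of _ "q \<bullet> g"] exI[of _ s]) (use q D epic_cmp[OF D(4) q(1)] in simp)
  qed
qed simp

text \<open>One inequality is \<open>flt_split\<close>, the other is the constructor
  \<open>ext\<close>. For the second, finiteness of the total forces both ends to have finite
  length, and finite lengths are attained by filtrations that can be spliced.\<close>

lemma len_ses:
  assumes P: "simple_class A P" and S: "short_exact A f g"
  shows "len A P (Cod A f) = len A P (Dom A f) + len A P (Cod A g)"
proof (rule order_antisym)
  note D = short_exactD[OF S]
  have "enat n \<le> len A P (Dom A f) + len A P (Cod A g)" if n: "flt A P n (Cod A f)" for n
  proof -
    obtain a b where ab: "n = a + b" "flt A P a (Dom A f)" "flt A P b (Cod A g)"
      using flt_split[OF n P S refl] by blast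
    have "enat a + enat b \<le> len A P (Dom A f) + len A P (Cod A g)"
      by (intro add_mono flt_le_len ab)
    then show ?thesis using ab(1) by simp
  qed
  then show "len A P (Cod A f) \<le> len A P (Dom A f) + len A P (Cod A g)"
    unfolding len_def[of A P "Cod A f"] by (intro SUP_least) simp
  have ob: "Dom A f \<in> Ob A" "Cod A g \<in> Ob A" using D(5,6) by simp_all
  have *: "enat (a + b) \<le> len A P (Cod A f)" if "flt A P a (Dom A f)" "flt A P b (Cod A g)" for a b
    using flt_le_len[OF flt.ext[OF S that]] .
  show "len A P (Dom A f) + len A P (Cod A g) \<le> len A P (Cod A f)"
  proof (cases "len A P (Cod A f)")
    case (enat N)
    have "len A P (Dom A f) \<noteq> \<infinity>"
    proof
      assume "len A P (Dom A f) = \<infinity>"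
      then obtain m where "m \<ge> Suc N" "flt A P m (Dom A f)" using len_infinite_attained[of A P "Dom A f" "Suc N"] by blast
      then show False using *[OF _ flt.zero[OF ob(2)], of m] by (simp add: enat)
    qed
    then obtain a where a: "len A P (Dom A f) = enat a" by blast
    have "len A P (Cod A g) \<noteq> \<infinity>"
    proof
      assume "len A P (Cod A g) = \<infinity>"
      then obtain m where "m \<ge> Suc N" "flt A P m (Cod A g)" using len_infinite_attained[of A P "Cod A g" "Suc N"] by blast
      then show False using *[OF flt.zero[OF ob(1)], of m] by (simp add: enat)
    qed
    then obtain b where b: "len A P (Cod A g) = enat b" by blast
    show ?thesis using *[OF len_finite_attained[OF a ob(1)] len_finite_attained[OF b ob(2)]] by (simp only: a b plus_enat_simps)
  qed simp
qed

lemma len_zero: "simple_class A P \<Longrightarrow> zero_object A X \<Longrightarrow> len A P X = 0"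
proof -
  assume "simple_class A P" "zero_object A X"
  then have "len A P X \<le> 0" using flt_zero[of P _ X]
    unfolding len_def by (intro SUP_least) (simp add: zero_enat_def)
  then show ?thesis by simp
qed

lemma len_iso: 
  assumes "isomorphic A X Y" shows "len A P X = len A P Y"
proof -
  have "flt A P n X \<longleftrightarrow> flt A P n Y" for n
    using flt_iso[OF _ assms] flt_iso[OF _ isomorphic_sym[OF assms]] by blast
  then show ?thesis by (simp add: len_def)
qed

lemma len_simple:
  assumes P: "simple_class A P" and X: "simple_object A X"
  shows "len A P X = (if P X then 1 else 0)"
proof (rule order_antisym)
  show "len A P X \<le> (if P X then 1 else 0)"
    unfolding len_def using flt_simple[OF _ P X] 
    by (intro SUP_least) (auto simp: one_enat_def zero_enat_def split: if_splits)
  show "(if P X then 1 else 0) \<le> len A P X"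
    using flt_le_len[OF flt.one[of X A P]] X by (auto simp: one_enat_def simple_object_def)
qed

lemma len_monic:
  assumes "simple_class A P" "monic A m" shows "len A P (Dom A m) \<le> len A P (Cod A m)"
proof -
  have mA: "m \<in> Ar A" using assms(2) by simp
  obtain c where "is_cokernel A m c" using cokernel_ex[OF mA] by blast
  then show ?thesis using len_ses[OF assms(1) monic_short_exact[OF assms(2)]] by simp
qed

lemma len_epic:
  assumes "simple_class A P" "epic A e" shows "len A P (Cod A e) \<le> len A P (Dom A e)"
proof -
  have eA: "e \<in> Ar A" using assms(2) by simp
  obtain k where k: "is_kernel A e k" using kernel_ex[OF eA] by blast
  then show ?thesis using len_ses[OF assms(1) epic_short_exact[OF assms(2) k]] is_kernelD[OF k] by simp
qed

lemma len_nonzero_subquotient: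
  assumes "simple_class A P" "len A P X \<noteq> 0"
  obtains q s where "epic A q" "Dom A q = X" "monic A s" "Cod A s = Cod A q" "P (Dom A s)"
proof -
  have "\<exists>n>0. flt A P n X"
  proof (rule ccontr)
    assume "\<not> ?thesis"
    then have "len A P X \<le> 0" unfolding len_def by (intro SUP_least) (auto simp: zero_enat_def)
    then show False using assms(2) by simp
  qed
  then show thesis using flt_subquotient[OF _ _ assms(1)] that by blast
qed

end

text \<open>Reversing arrows exchanges subobject and quotient in every extension step and keeps the
  count.\<close>

lemma flt_op: "flt A P n X \<Longrightarrow> flt (op_cat A) P n X"
proof (induction rule: flt.induct)
  case (ext f g n m)
  have "flt (op_cat A) P (m + n) (Cod (op_cat A) g)"
    by (rule flt.ext[of _ g f]) (use ext in simp_all)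
  then show ?case using ext(1) by (simp add: add.commute short_exact_def is_kernel_def)
qed (simp_all add: flt.zero flt.one[simplified])

lemma len_op [simp]: "len (op_cat A) P X = len A P X"
proof -
  have "flt (op_cat A) P n X \<longleftrightarrow> flt A P n X" for n using flt_op[of A P n X] flt_op[of "op_cat A" P n X] by auto
  then show ?thesis by (simp add: len_def)
qed

lemma isomorphic_op [simp]: "isomorphic (op_cat A) X Y \<longleftrightarrow> isomorphic A Y X"
  by (simp add: isomorphic_def)

section \<open>Products and biproducts of families\<close>

lemma is_productD:
  assumes "is_product A J X P \<pi>"
  shows "j \<in> J \<Longrightarrow> X j \<in> Ob A" "P \<in> Ob A" "j \<in> J \<Longrightarrow> \<pi> j \<in> Hom A P (X j)"
  using assms unfolding is_product_def by blast+

lemma product_ex1: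
  assumes "is_product A J X P \<pi>" "T \<in> Ob A" "\<And>j. j \<in> J \<Longrightarrow> q j \<in> Hom A T (X j)"
  shows "\<exists>!h. h \<in> Hom A T P \<and> (\<forall>j\<in>J. \<pi> j \<bullet>\<^bsub>A\<^esub> h = q j)"
  using assms unfolding is_product_def by blast

lemma product_tuple:
  assumes "is_product A J X P \<pi>" "T \<in> Ob A" "\<And>j. j \<in> J \<Longrightarrow> q j \<in> Hom A T (X j)"
  obtains h where "h \<in> Hom A T P" "\<And>j. j \<in> J \<Longrightarrow> \<pi> j \<bullet>\<^bsub>A\<^esub> h = q j"
  using product_ex1[OF assms] by blast

lemma (in preadditive_category) product_eq:
  assumes "is_product A J X P \<pi>" "g \<in> Hom A T P" "h \<in> Hom A T P" "\<And>j. j \<in> J \<Longrightarrow> \<pi> j \<bullet> g = \<pi> j \<bullet> h"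
  shows "g = h"
proof -
  have T: "T \<in> Ob A" using assms(2) by auto
  have "\<exists>!k. k \<in> Hom A T P \<and> (\<forall>j\<in>J. \<pi> j \<bullet> k = \<pi> j \<bullet> h)"
    by (rule product_ex1[OF assms(1) T]) (use is_productD[OF assms(1)] assms(3) in simp)
  then show ?thesis using assms by blast
qed

lemma productI:
  assumes "\<And>j. j \<in> J \<Longrightarrow> X j \<in> Ob A" "P \<in> Ob A" "\<And>j. j \<in> J \<Longrightarrow> \<pi> j \<in> Hom A P (X j)"
    "\<And>T q. T \<in> Ob A \<Longrightarrow> (\<And>j. j \<in> J \<Longrightarrow> q j \<in> Hom A T (X j))
      \<Longrightarrow> \<exists>h. h \<in> Hom A T P \<and> (\<forall>j\<in>J. \<pi> j \<bullet>\<^bsub>A\<^esub> h = q j)"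
    "\<And>T g h. T \<in> Ob A \<Longrightarrow> g \<in> Hom A T P \<Longrightarrow> h \<in> Hom A T P
      \<Longrightarrow> (\<And>j. j \<in> J \<Longrightarrow> \<pi> j \<bullet>\<^bsub>A\<^esub> g = \<pi> j \<bullet>\<^bsub>A\<^esub> h) \<Longrightarrow> g = h"
  shows "is_product A J X P \<pi>"
  unfolding is_product_def
proof (intro conjI ballI allI impI)
  fix T q assume T: "T \<in> Ob A" and q: "\<forall>j\<in>J. q j \<in> Hom A T (X j)"
  then obtain h where h: "h \<in> Hom A T P \<and> (\<forall>j\<in>J. \<pi> j \<bullet>\<^bsub>A\<^esub> h = q j)" using assms(4)[OF T, of q] by blast
  show "\<exists>!h. h \<in> Hom A T P \<and> (\<forall>j\<in>J. \<pi> j \<bullet>\<^bsub>A\<^esub> h = q j)"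
  proof (rule ex1I[of _ h])
    fix g assume "g \<in> Hom A T P \<and> (\<forall>j\<in>J. \<pi> j \<bullet>\<^bsub>A\<^esub> g = q j)"
    then show "g = h" using assms(5)[OF T, of g h] h by metis
  qed (rule h)
qed (use assms(1-3) in blast)+

text \<open>The bijection on hom sets says that the projections form a product cone. In this
  symmetric form the notion is visibly self-dual.\<close>

lemma (in preadditive_category) biproduct_iff:
  "is_biproduct A J Y B \<iota> p \<longleftrightarrow> is_coproduct A J Y B \<iota> \<and> is_product A J Y B p \<and>
     (\<forall>i\<in>J. \<forall>j\<in>J. p j \<bullet>\<^bsub>A\<^esub> \<iota> i = (if i = j then Idn A (Y j) else Nul A (Y i) (Y j)))"
proof
  assume b: "is_biproduct A J Y B \<iota> p"
  then have c: "is_coproduct A J Y B \<iota>" and p: "\<forall>j\<in>J. p j \<in> Hom A B (Y j)"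
    and d: "\<forall>i\<in>J. \<forall>j\<in>J. p j \<bullet>\<^bsub>A\<^esub> \<iota> i = (if i = j then Idn A (Y j) else Nul A (Y i) (Y j))"
    and bij: "\<And>T. T \<in> Ob A \<Longrightarrow> bij_betw (\<lambda>g. \<lambda>j\<in>J. p j \<bullet>\<^bsub>A\<^esub> g) (Hom A T B) (\<Pi>\<^sub>E j\<in>J. Hom A T (Y j))"
    unfolding is_biproduct_def by blast+
  have "is_product A J Y B p"
  proof (rule productI)
    fix T q assume T: "T \<in> Ob A" and q: "\<And>j. j \<in> J \<Longrightarrow> q j \<in> Hom A T (Y j)"
    then have "restrict q J \<in> (\<Pi>\<^sub>E j\<in>J. Hom A T (Y j))" by auto
    then obtain g where "g \<in> Hom A T B" "restrict q J = (\<lambda>j\<in>J. p j \<bullet>\<^bsub>A\<^esub> g)"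
      using bij_betw_imp_surj_on[OF bij[OF T]] by blast
    then show "\<exists>h. h \<in> Hom A T B \<and> (\<forall>j\<in>J. p j \<bullet>\<^bsub>A\<^esub> h = q j)" by (metis restrict_apply')
  next
    fix T g h assume T: "T \<in> Ob A" and gh: "g \<in> Hom A T B" "h \<in> Hom A T B"
      and e: "\<And>j. j \<in> J \<Longrightarrow> p j \<bullet>\<^bsub>A\<^esub> g = p j \<bullet>\<^bsub>A\<^esub> h"
    have "(\<lambda>j\<in>J. p j \<bullet>\<^bsub>A\<^esub> g) = (\<lambda>j\<in>J. p j \<bullet>\<^bsub>A\<^esub> h)" using e by (simp cong: restrict_cong)
    then show "g = h" using inj_onD[OF bij_betw_imp_inj_on[OF bij[OF T]] _ gh] by blast
  qed (use c p in \<open>unfold is_coproduct_def, blast+\<close>)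
  then show "is_coproduct A J Y B \<iota> \<and> is_product A J Y B p \<and>
     (\<forall>i\<in>J. \<forall>j\<in>J. p j \<bullet>\<^bsub>A\<^esub> \<iota> i = (if i = j then Idn A (Y j) else Nul A (Y i) (Y j)))" using c d by blast
next
  assume a: "is_coproduct A J Y B \<iota> \<and> is_product A J Y B p \<and>
     (\<forall>i\<in>J. \<forall>j\<in>J. p j \<bullet>\<^bsub>A\<^esub> \<iota> i = (if i = j then Idn A (Y j) else Nul A (Y i) (Y j)))"
  then have p: "is_product A J Y B p" by blast
  have "bij_betw (\<lambda>g. \<lambda>j\<in>J. p j \<bullet>\<^bsub>A\<^esub> g) (Hom A T B) (\<Pi>\<^sub>E j\<in>J. Hom A T (Y j))" (is "bij_betw ?F _ _") if T: "T \<in> Ob A" for T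
    unfolding bij_betw_def
  proof
    have ex1: "\<exists>!h. h \<in> Hom A T B \<and> ?F h = q" if q: "q \<in> (\<Pi>\<^sub>E j\<in>J. Hom A T (Y j))" for q
    proof -
      have *: "(\<forall>j\<in>J. p j \<bullet> h = q j) \<longleftrightarrow> ?F h = q" for h
        using q by (auto simp: fun_eq_iff PiE_def extensional_def restrict_def)
      have "\<exists>!h. h \<in> Hom A T B \<and> (\<forall>j\<in>J. p j \<bullet> h = q j)"
        by (rule product_ex1[OF p T]) (rule PiE_mem[OF q])
      then show ?thesis by (simp only: *)
    qed
    have F: "?F h \<in> (\<Pi>\<^sub>E j\<in>J. Hom A T (Y j))" if h: "h \<in> Hom A T B" for h
      using is_productD(3)[OF p] h by (intro restrict_PiE_iff[THEN iffD2] ballI cmp_hom[OF h]) blast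
    show "inj_on ?F (Hom A T B)" using ex1 F by (intro inj_onI) blast
    show "?F ` Hom A T B = (\<Pi>\<^sub>E j\<in>J. Hom A T (Y j))" using ex1 F by blast
  qed
  then show "is_biproduct A J Y B \<iota> p" unfolding is_biproduct_def using a is_productD[OF p] by blast
qed

section \<open>Limits of sequences\<close>

text \<open>The universal property alone, without the product and the arrow \<open>1 - f\<close>
  that occur in \<open>is_lim\<close>. This form is stable under shifting the sequence, and in the
  opposite category it describes colimits.\<close>

definition lim_cone ::
  "('o, 'm) cat \<Rightarrow> (nat \<Rightarrow> 'o) \<Rightarrow> (nat \<Rightarrow> 'm) \<Rightarrow> 'o \<Rightarrow> (nat \<Rightarrow> 'm) \<Rightarrow> bool" where
  "lim_cone A X f L p \<longleftrightarrow> L \<in> Ob A \<and> (\<forall>r. p r \<in> Hom A L (X r) \<and> f r \<bullet>\<^bsub>A\<^esub> p (Suc r) = p r) \<and>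
     (\<forall>T t. (\<forall>r. t r \<in> Hom A T (X r) \<and> f r \<bullet>\<^bsub>A\<^esub> t (Suc r) = t r) \<longrightarrow>
       (\<exists>!h. h \<in> Hom A T L \<and> (\<forall>r. p r \<bullet>\<^bsub>A\<^esub> h = t r)))"

lemma lim_coneD:
  assumes "lim_cone A X f L p"
  shows "L \<in> Ob A" "p r \<in> Hom A L (X r)" "f r \<bullet>\<^bsub>A\<^esub> p (Suc r) = p r"
  using assms unfolding lim_cone_def by blast+

lemma lim_cone_ex1:
  assumes "lim_cone A X f L p" "\<And>r. t r \<in> Hom A T (X r)" "\<And>r. f r \<bullet>\<^bsub>A\<^esub> t (Suc r) = t r"
  shows "\<exists>!h. h \<in> Hom A T L \<and> (\<forall>r. p r \<bullet>\<^bsub>A\<^esub> h = t r)"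
  using assms unfolding lim_cone_def by blast

lemma lim_cone_tuple:
  assumes "lim_cone A X f L p" "\<And>r. t r \<in> Hom A T (X r)" "\<And>r. f r \<bullet>\<^bsub>A\<^esub> t (Suc r) = t r"
  obtains h where "h \<in> Hom A T L" "\<And>r. p r \<bullet>\<^bsub>A\<^esub> h = t r"
  using lim_cone_ex1[OF assms] by blast

lemma inverse_sequenceD:
  assumes "inverse_sequence A X f" shows "X r \<in> Ob A" "f r \<in> Hom A (X (Suc r)) (X r)"
  using assms unfolding inverse_sequence_def by blast+

context preadditive_category
begin

lemma lim_cone_eq:
  assumes L: "lim_cone A X f L p" and X: "inverse_sequence A X f"
    and gh: "g \<in> Hom A T L" "h \<in> Hom A T L" "\<And>r. p r \<bullet> g = p r \<bullet> h"
  shows "g = h"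
proof -
  note D = lim_coneD[OF L] inverse_sequenceD[OF X]
  have "\<exists>!k. k \<in> Hom A T L \<and> (\<forall>r. p r \<bullet> k = p r \<bullet> h)"
  proof (rule lim_cone_ex1[OF L])
    fix r
    have p: "p r \<in> Ar A" "Dom A (p r) = L" "Cod A (p r) = X r" for r using D(2)[of r] by auto
    have f: "f r \<in> Ar A" "Dom A (f r) = X (Suc r)" "Cod A (f r) = X r" using D(5)[of r] by auto
    show "p r \<bullet> h \<in> Hom A T (X r)" using p gh(2) by simp
    show "f r \<bullet> p (Suc r) \<bullet> h = p r \<bullet> h"
      using cmp_eq[OF D(3)[of r], of h] p f gh(2) by simp
  qed
  then show ?thesis using gh by blast
qed

text \<open>The reason why the kernel of \<open>1 - f\<close> is the limit: the component at
  \<open>r\<close> of the composite is the defect of compatibility at \<open>r\<close>.\<close>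

lemma prod_Diff_zero_iff:
  assumes X: "inverse_sequence A X f" and P: "is_product A UNIV X P \<pi>" and d: "one_minus_prod A f P \<pi> d"
    and h: "h \<in> Hom A T P"
  shows "d \<bullet> h = Nul A T P \<longleftrightarrow> (\<forall>r. f r \<bullet> \<pi> (Suc r) \<bullet> h = \<pi> r \<bullet> h)"
proof -
  have p: "\<pi> r \<in> Ar A" "Dom A (\<pi> r) = P" "Cod A (\<pi> r) = X r" for r using is_productD(3)[OF P, of r] by auto
  have f: "f r \<in> Ar A" "Dom A (f r) = X (Suc r)" "Cod A (f r) = X r" for r using inverse_sequenceD(2)[OF X, of r] by auto
  have dd: "d \<in> Ar A" "Dom A d = P" "Cod A d = P" and de: "\<And>r. \<pi> r \<bullet> d = Diff A (\<pi> r) (f r \<bullet> \<pi> (Suc r))"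
    using d unfolding one_minus_prod_def by auto
  have T: "T \<in> Ob A" "P \<in> Ob A" using h by auto
  have *: "\<pi> r \<bullet> d \<bullet> h = Diff A (\<pi> r \<bullet> h) (f r \<bullet> \<pi> (Suc r) \<bullet> h)" for r
  proof -
    have "\<pi> r \<bullet> d \<bullet> h = Diff A (\<pi> r) (f r \<bullet> \<pi> (Suc r)) \<bullet> h"
      using cmp_eq[OF de, of h] p dd h by simp
    also have "\<dots> = Diff A (\<pi> r \<bullet> h) ((f r \<bullet> \<pi> (Suc r)) \<bullet> h)"
      by (rule Diff_cmp[OF h, of _ "X r"]) (use p f in simp_all)
    finally show ?thesis using p f h by simp
  qed
  have "d \<bullet> h = Nul A T P \<longleftrightarrow> (\<forall>r. \<pi> r \<bullet> d \<bullet> h = Nul A T (X r))"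
  proof
    assume "d \<bullet> h = Nul A T P" then show "\<forall>r. \<pi> r \<bullet> d \<bullet> h = Nul A T (X r)" using p T by simp
  next
    assume a: "\<forall>r. \<pi> r \<bullet> d \<bullet> h = Nul A T (X r)"
    show "d \<bullet> h = Nul A T P"
      by (rule product_eq[OF P, of _ T]) (use a p dd h T in simp_all)
  qed
  also have "\<dots> \<longleftrightarrow> (\<forall>r. \<pi> r \<bullet> h = f r \<bullet> \<pi> (Suc r) \<bullet> h)"
    unfolding * by (intro all_cong1 Diff_nul_iff) (use p f h in simp_all)
  finally show ?thesis by metis
qed

lemma is_lim_cone:
  assumes "is_lim A X f L p" shows "inverse_sequence A X f" "lim_cone A X f L p"
proof -
  obtain P \<pi> d k where X: "inverse_sequence A X f" and P: "is_product A UNIV X P \<pi>"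
    and d: "one_minus_prod A f P \<pi> d" and k: "is_kernel A d k" and L: "Dom A k = L" and p: "\<And>r. p r = \<pi> r \<bullet> k"
    using assms unfolding is_lim_def by blast
  show "inverse_sequence A X f" by (rule X)
  have pi: "\<pi> r \<in> Ar A" "Dom A (\<pi> r) = P" "Cod A (\<pi> r) = X r" for r using is_productD(3)[OF P, of r] by auto
  have dd: "d \<in> Ar A" "Dom A d = P" "Cod A d = P" using d unfolding one_minus_prod_def by auto
  note k' = is_kernelD[OF k]
  have kh: "k \<in> Hom A L P" using k' L dd by simp
  show "lim_cone A X f L p" unfolding lim_cone_def
  proof (intro conjI allI impI)
    show "L \<in> Ob A" using L k' by auto
    fix r
    show "p r \<in> Hom A L (X r)" using p pi kh by simp
    have "d \<bullet> k = Nul A L P" using k' L dd by simp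
    then show "f r \<bullet> p (Suc r) = p r" unfolding prod_Diff_zero_iff[OF X P d kh] p by blast
  next
    fix T t assume t: "\<forall>r. t r \<in> Hom A T (X r) \<and> f r \<bullet> t (Suc r) = t r"
    then have T: "T \<in> Ob A" using ob_dom[of "t 0"] by auto
    obtain h where h: "h \<in> Hom A T P" "\<And>r. \<pi> r \<bullet> h = t r"
      by (rule product_tuple[OF P T, of t]) (use t in \<open>simp, blast\<close>)
    have "d \<bullet> h = Nul A T P" unfolding prod_Diff_zero_iff[OF X P d h(1)] using h(2) t by simp
    then obtain g where g: "g \<in> Hom A T L" "k \<bullet> g = h"
      using kernel_lift[OF k, of h] h(1) dd L by auto
    show "\<exists>!h. h \<in> Hom A T L \<and> (\<forall>r. p r \<bullet> h = t r)"
    proof (rule ex1I[of _ g])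
      show "g \<in> Hom A T L \<and> (\<forall>r. p r \<bullet> g = t r)" using g h(2) p pi kh by simp
      fix g' assume g': "g' \<in> Hom A T L \<and> (\<forall>r. p r \<bullet> g' = t r)"
      have "\<pi> r \<bullet> k \<bullet> g' = t r" for r
      proof -
        have "p r \<bullet> g' = t r" using g' by blast
        then show ?thesis using g' p[of r] pi[of r] kh cmp_assoc'[of g' k "\<pi> r"] by simp
      qed
      then have "k \<bullet> g' = h"
        by (intro product_eq[OF P, of "k \<bullet> g'" T h]) (use g' h kh in simp_all)
      then show "g' = g" using monicD[OF kernel_monic[OF k], of g' g] g g' kh by simp
    qed
  qed
qed

lemma one_minus_ex:
  assumes X: "inverse_sequence A X f" and P: "is_product A UNIV X P \<pi>"
  obtains d where "one_minus_prod A f P \<pi> d"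
proof -
  have p: "\<pi> r \<in> Ar A" "Dom A (\<pi> r) = P" "Cod A (\<pi> r) = X r" for r using is_productD(3)[OF P, of r] by auto
  have f: "f r \<in> Ar A" "Dom A (f r) = X (Suc r)" "Cod A (f r) = X r" for r using inverse_sequenceD(2)[OF X, of r] by auto
  obtain d where "d \<in> Hom A P P" "\<And>r. \<pi> r \<bullet> d = Diff A (\<pi> r) (f r \<bullet> \<pi> (Suc r))"
    by (rule product_tuple[OF P is_productD(2)[OF P], of "\<lambda>r. Diff A (\<pi> r) (f r \<bullet> \<pi> (Suc r))"])
      (use p f in simp, blast)
  then show thesis using that unfolding one_minus_prod_def by blast
qed

lemma cone_is_lim:
  assumes X: "inverse_sequence A X f" and L: "lim_cone A X f L p" and P: "is_product A UNIV X P \<pi>"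
  shows "is_lim A X f L p"
proof -
  obtain d where d: "one_minus_prod A f P \<pi> d" using one_minus_ex[OF X P] .
  have pi: "\<pi> r \<in> Ar A" "Dom A (\<pi> r) = P" "Cod A (\<pi> r) = X r" for r using is_productD(3)[OF P, of r] by auto
  have dd: "d \<in> Ar A" "Dom A d = P" "Cod A d = P" using d unfolding one_minus_prod_def by auto
  note LD = lim_coneD[OF L]
  obtain k where k: "k \<in> Hom A L P" "\<And>r. \<pi> r \<bullet> k = p r"
    by (rule product_tuple[OF P LD(1), of p]) (rule LD(2), blast)
  have kA: "k \<in> Ar A" "Dom A k = L" "Cod A k = P" using k by auto
  have "is_kernel A d k"
  proof (rule kernelI)
    show "monic A k" unfolding monic_def
    proof (intro conjI ballI impI)
      fix T g h assume "T \<in> Ob A" and g: "g \<in> Hom A T (Dom A k)" "h \<in> Hom A T (Dom A k)" "k \<bullet> g = k \<bullet> h"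
      show "g = h"
      proof (rule lim_cone_eq[OF L X, of _ T])
        fix r
        have "\<pi> r \<bullet> k \<bullet> g = \<pi> r \<bullet> k \<bullet> h" using g by simp
        then show "p r \<bullet> g = p r \<bullet> h"
          using cmp_eq[OF k(2)[of r], of g] cmp_eq[OF k(2)[of r], of h] g(1,2) kA pi by simp
      qed (use g kA in simp_all)
    qed (rule kA)
    show "d \<bullet> k = Nul A (Dom A k) (Cod A d)"
      unfolding kA dd prod_Diff_zero_iff[OF X P d k(1)] k(2) using LD(3) by blast
    fix g assume g: "g \<in> Ar A" "Cod A g = Dom A d" "d \<bullet> g = Nul A (Dom A g) (Cod A d)"
    have gh: "g \<in> Hom A (Dom A g) P" using g dd by simp
    have c: "f r \<bullet> \<pi> (Suc r) \<bullet> g = \<pi> r \<bullet> g" for r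
      using g(3) unfolding dd prod_Diff_zero_iff[OF X P d gh] by blast
    obtain h where h: "h \<in> Hom A (Dom A g) L" "\<And>r. p r \<bullet> h = \<pi> r \<bullet> g"
      by (rule lim_cone_tuple[OF L, of "\<lambda>r. \<pi> r \<bullet> g" "Dom A g"]) (use c gh pi in simp_all)
    have "k \<bullet> h = g"
    proof (rule product_eq[OF P, of _ "Dom A g"])
      fix r show "\<pi> r \<bullet> k \<bullet> h = \<pi> r \<bullet> g" using cmp_eq[OF k(2)[of r], of h] h kA pi by simp
    qed (use h kA gh in simp_all)
    then show "\<exists>h. h \<in> Hom A (Dom A g) (Dom A k) \<and> k \<bullet> h = g" using h kA by metis
  qed (use kA dd in simp_all)
  then show ?thesis unfolding is_lim_def using X P d kA k(2) by metis
qed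

text \<open>A compatible family that starts at index 1 extends uniquely to index 0 by composition
  with \<open>f 0\<close>.\<close>

lemma lim_cone_Suc:
  assumes X: "inverse_sequence A X f" and L: "lim_cone A X f L p"
  shows "lim_cone A (\<lambda>r. X (Suc r)) (\<lambda>r. f (Suc r)) L (\<lambda>r. p (Suc r))"
  unfolding lim_cone_def
proof (intro conjI allI impI)
  note LD = lim_coneD[OF L]
  show "L \<in> Ob A" by (rule LD)
  fix r show "p (Suc r) \<in> Hom A L (X (Suc r))" "f (Suc r) \<bullet> p (Suc (Suc r)) = p (Suc r)" by (rule LD)+
next
  note LD = lim_coneD[OF L]
  fix T t assume t: "\<forall>r. t r \<in> Hom A T (X (Suc r)) \<and> f (Suc r) \<bullet> t (Suc r) = t r"
  define t' where "t' r = (case r of 0 \<Rightarrow> f 0 \<bullet> t 0 | Suc r \<Rightarrow> t r)" for r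
  have "\<exists>!h. h \<in> Hom A T L \<and> (\<forall>r. p r \<bullet> h = t' r)"
  proof (rule lim_cone_ex1[OF L])
    fix r
    show "t' r \<in> Hom A T (X r)"
      using t cmp_hom[of "t 0" T "X (Suc 0)" "f 0" "X 0"] inverse_sequenceD(2)[OF X, of 0]
      by (cases r) (simp_all add: t'_def)
    show "f r \<bullet> t' (Suc r) = t' r" using t by (cases r) (simp_all add: t'_def)
  qed
  moreover have "(\<forall>r. p (Suc r) \<bullet> h = t r) \<longleftrightarrow> (\<forall>r. p r \<bullet> h = t' r)" if h: "h \<in> Hom A T L" for h
  proof
    assume a: "\<forall>r. p (Suc r) \<bullet> h = t r"
    have "p 0 \<bullet> h = f 0 \<bullet> p (Suc 0) \<bullet> h"
      using cmp_eq[OF LD(3)[of 0], of h] h LD(2)[of "Suc 0"] LD(2)[of 0] inverse_sequenceD(2)[OF X, of 0] by simp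
    then show "\<forall>r. p r \<bullet> h = t' r" using a by (auto simp: t'_def split: nat.split)
  next
    assume a: "\<forall>r. p r \<bullet> h = t' r"
    show "\<forall>r. p (Suc r) \<bullet> h = t r" using a[rule_format, of "Suc _"] by (simp add: t'_def)
  qed
  ultimately show "\<exists>!h. h \<in> Hom A T L \<and> (\<forall>r. p (Suc r) \<bullet> h = t r)" by (smt (verit, best))
qed

lemma inverse_sequence_shift: "inverse_sequence A X f \<Longrightarrow> inverse_sequence A (\<lambda>r. X (n + r)) (\<lambda>r. f (n + r))"
  unfolding inverse_sequence_def by simp

lemma lim_cone_shift:
  assumes X: "inverse_sequence A X f" and L: "lim_cone A X f L p"
  shows "lim_cone A (\<lambda>r. X (n + r)) (\<lambda>r. f (n + r)) L (\<lambda>r. p (n + r))"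
proof (induction n)
  case (Suc n)
  show ?case using lim_cone_Suc[OF inverse_sequence_shift[OF X, of n] Suc] by simp
qed (use L in simp)

lemma lim_cone_const: "Z \<in> Ob A \<Longrightarrow> lim_cone A (\<lambda>_. Z) (\<lambda>_. Idn A Z) Z (\<lambda>_. Idn A Z)"
  unfolding lim_cone_def
proof (intro conjI allI impI)
  fix T t assume Z: "Z \<in> Ob A" and t: "\<forall>r::nat. t r \<in> Hom A T Z \<and> Idn A Z \<bullet> t (Suc r) = t r"
  have "t (Suc r) = t r" for r
  proof -
    have "Idn A Z \<bullet> t (Suc r) = t (Suc r)" by (rule idn_cmp') (use t in auto)
    then show ?thesis using t by simp
  qed
  then have e: "t r = t 0" for r by (induction r) simp_all
  show "\<exists>!h. h \<in> Hom A T Z \<and> (\<forall>r. Idn A Z \<bullet> h = t r)"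
  proof (rule ex1I[of _ "t 0"])
    have "t 0 \<in> Hom A T Z" using t by blast
    then show "t 0 \<in> Hom A T Z \<and> (\<forall>r. Idn A Z \<bullet> t 0 = t r)" using e[symmetric] by simp
    fix h assume "h \<in> Hom A T Z \<and> (\<forall>r. Idn A Z \<bullet> h = t r)"
    then have "h \<in> Hom A T Z" "Idn A Z \<bullet> h = t 0" by blast+
    then show "h = t 0" by simp
  qed
qed simp_all

text \<open>A vanishing limit may be represented by any zero object. This is needed because the
  limit in a relation of \<open>J_lim\<close> must be an object of \<open>C\<close>.\<close>

lemma lim_cone_zero_object:
  assumes "lim_cone A X f L p" "zero_object A L" "zero_object A Z" "inverse_sequence A X f"
  shows "lim_cone A X f Z (\<lambda>r. Nul A Z (X r))"
  unfolding lim_cone_def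
proof (intro conjI allI impI)
  note LD = lim_coneD[OF assms(1)] note X = inverse_sequenceD[OF assms(4)]
  show Z: "Z \<in> Ob A" using assms(3) by (simp add: zero_object_iff)
  fix r show "Nul A Z (X r) \<in> Hom A Z (X r)" using Z X by simp
  show "f r \<bullet> Nul A Z (X (Suc r)) = Nul A Z (X r)" using Z X(2)[of r] by simp
next
  note LD = lim_coneD[OF assms(1)] note X = inverse_sequenceD[OF assms(4)]
  fix T t assume t: "\<forall>r. t r \<in> Hom A T (X r) \<and> f r \<bullet> t (Suc r) = t r"
  then have T: "T \<in> Ob A" using ob_dom[of "t 0"] by auto
  obtain h where h: "h \<in> Hom A T L" "\<And>r. p r \<bullet> h = t r"
    by (rule lim_cone_tuple[OF assms(1), of t T]) (use t in \<open>simp, simp, blast\<close>)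
  have Z: "Z \<in> Ob A" using assms(3) by (simp add: zero_object_iff)
  have "h = Nul A T L" using to_zero[OF assms(2), of h] h by simp
  then have tr: "t r = Nul A T (X r)" for r using h(2)[of r] LD(2)[of r] T by simp
  show "\<exists>!h. h \<in> Hom A T Z \<and> (\<forall>r. Nul A Z (X r) \<bullet> h = t r)"
  proof (rule ex1I[of _ "Nul A T Z"])
    show "Nul A T Z \<in> Hom A T Z \<and> (\<forall>r. Nul A Z (X r) \<bullet> Nul A T Z = t r)" using T Z X(1) tr by simp
    fix g assume "g \<in> Hom A T Z \<and> (\<forall>r. Nul A Z (X r) \<bullet> g = t r)"
    then show "g = Nul A T Z" using to_zero[OF assms(3), of g] by simp
  qed
qed

end

context abelian_category
begin

lemma lim_exists:
  assumes X: "inverse_sequence A X f" and P: "is_product A UNIV X P \<pi>"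
  obtains L p where "is_lim A X f L p"
proof -
  obtain d where d: "one_minus_prod A f P \<pi> d" using one_minus_ex[OF X P] .
  then have dA: "d \<in> Ar A" unfolding one_minus_prod_def by simp
  obtain k where "is_kernel A d k" using kernel_ex[OF dA] by blast
  then show thesis using that[of "Dom A k" "\<lambda>r. \<pi> r \<bullet> k"] X P d unfolding is_lim_def by blast
qed

end

primrec down :: "('o, 'm) cat \<Rightarrow> (nat \<Rightarrow> 'o) \<Rightarrow> (nat \<Rightarrow> 'm) \<Rightarrow> nat \<Rightarrow> 'm" where
  "down A X f 0 = Idn A (X 0)"
| "down A X f (Suc r) = down A X f r \<bullet>\<^bsub>A\<^esub> f r"

context preadditive_category
begin

lemma down_hom:
  assumes X: "inverse_sequence A X f" shows "down A X f r \<in> Hom A (X r) (X 0)"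
proof (induction r)
  case (Suc r)
  then show ?case using inverse_sequenceD(2)[OF X, of r] by simp
qed (use inverse_sequenceD(1)[OF X] in simp)

lemma down_lim:
  assumes X: "inverse_sequence A X f" and L: "lim_cone A X f L p"
  shows "down A X f r \<bullet> p r = p 0"
proof (induction r)
  case (Suc r)
  then show ?case
    using lim_coneD(3)[OF L, of r] lim_coneD(2)[OF L, of "Suc r"] inverse_sequenceD(2)[OF X, of r] down_hom[OF X, of r]
    by simp
qed (use lim_coneD(2)[OF L, of 0] in simp)

end

lemma is_coproductD:
  assumes "is_coproduct A J X P \<iota>"
  shows "j \<in> J \<Longrightarrow> X j \<in> Ob A" "P \<in> Ob A" "j \<in> J \<Longrightarrow> \<iota> j \<in> Hom A (X j) P"
  using assms unfolding is_coproduct_def by blast+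

lemma coproduct_cotuple:
  assumes "is_coproduct A J X P \<iota>" "T \<in> Ob A" "\<And>j. j \<in> J \<Longrightarrow> q j \<in> Hom A (X j) T"
  obtains h where "h \<in> Hom A P T" "\<And>j. j \<in> J \<Longrightarrow> h \<bullet>\<^bsub>A\<^esub> \<iota> j = q j"
  using product_tuple[of "op_cat A" J X P \<iota> T q] assms by (auto simp del: in_Hom)

lemma (in preadditive_category) coproduct_eq:
  assumes "is_coproduct A J X P \<iota>" "g \<in> Hom A P T" "h \<in> Hom A P T" "\<And>j. j \<in> J \<Longrightarrow> g \<bullet> \<iota> j = h \<bullet> \<iota> j"
  shows "g = h"
  using preadditive_category.product_eq[OF op, of J X P \<iota> g T h] assms by simp

lemma coproductI:
  assumes "\<And>j. j \<in> J \<Longrightarrow> X j \<in> Ob A" "P \<in> Ob A" "\<And>j. j \<in> J \<Longrightarrow> \<iota> j \<in> Hom A (X j) P"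
    "\<And>T q. T \<in> Ob A \<Longrightarrow> (\<And>j. j \<in> J \<Longrightarrow> q j \<in> Hom A (X j) T)
      \<Longrightarrow> \<exists>h. h \<in> Hom A P T \<and> (\<forall>j\<in>J. h \<bullet>\<^bsub>A\<^esub> \<iota> j = q j)"
    "\<And>T g h. T \<in> Ob A \<Longrightarrow> g \<in> Hom A P T \<Longrightarrow> h \<in> Hom A P T
      \<Longrightarrow> (\<And>j. j \<in> J \<Longrightarrow> g \<bullet>\<^bsub>A\<^esub> \<iota> j = h \<bullet>\<^bsub>A\<^esub> \<iota> j) \<Longrightarrow> g = h"
  shows "is_coproduct A J X P \<iota>"
proof -
  have "is_product (op_cat A) J X P \<iota>"
    by (rule productI) (use assms in \<open>simp_all del: in_Hom\<close>)
  then show ?thesis by simp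
qed

lemma biproduct_zero:
  assumes "preadditive_category A" "zero_object A Z"
  shows "is_biproduct A J (\<lambda>_. Z) Z (\<lambda>_. Idn A Z) (\<lambda>_. Idn A Z)"
proof -
  interpret preadditive_category A by fact
  have Z: "Z \<in> Ob A" "Idn A Z = Nul A Z Z" using assms(2) by (simp_all add: zero_object_iff)
  have p: "is_product B J (\<lambda>_. Z) Z (\<lambda>_. Idn B Z)" if B: "preadditive_category B" "zero_object B Z" for B :: "('a, 'b) cat"
  proof (rule productI)
    interpret B: preadditive_category B by fact
    have Z: "Z \<in> Ob B" "Idn B Z = Nul B Z Z" using B(2) by (simp_all add: B.zero_object_iff)
    fix j :: 'c
    show "Z \<in> Ob B" "Z \<in> Ob B" "Idn B Z \<in> Hom B Z Z" using B.idn_hom[OF Z(1)] Z(1) by blast+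
  next
    interpret B: preadditive_category B by fact
    fix T and q :: "'c \<Rightarrow> 'b" assume T: "T \<in> Ob B" "\<And>j. j \<in> J \<Longrightarrow> q j \<in> Hom B T Z"
    have Z: "Z \<in> Ob B" "Idn B Z = Nul B Z Z" using B(2) by (simp_all add: B.zero_object_iff)
    have "q j = Nul B T Z" if "j \<in> J" for j using B.to_zero[OF B(2), of "q j"] T(2)[OF that] by simp
    then show "\<exists>h. h \<in> Hom B T Z \<and> (\<forall>j\<in>J. Idn B Z \<bullet>\<^bsub>B\<^esub> h = q j)"
      using Z T(1) by (intro exI[of _ "Nul B T Z"]) simp
  next
    interpret B: preadditive_category B by fact
    fix T g h assume g: "g \<in> Hom B T Z" and h: "h \<in> Hom B T Z"
    then show "g = h" using B.to_zero[OF B(2), of g] B.to_zero[OF B(2), of h] by simp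
  qed
  have "is_coproduct A J (\<lambda>_. Z) Z (\<lambda>_. Idn A Z)"
    using p[OF op] assms(2) by simp
  then show ?thesis unfolding biproduct_iff using p[OF assms] Z by simp
qed

section \<open>Full abelian subcategories\<close>

locale subabelian = A: abelian_category A + C: abelian_category C
  for A :: "('o, 'm) cat" (structure) and C :: "('o, 'm) cat" +
  assumes full: "full_abelian_subcategory C A"
begin

lemma C_eq: "C = full_subcategory A (Ob C)" and Ob_C [simp]: "X \<in> Ob C \<Longrightarrow> X \<in> Ob A"
  and C_exact: "short_exact C f g \<Longrightarrow> short_exact A f g"
  using full unfolding full_abelian_subcategory_def by blast+

lemma C_simps [simp]: "Dom C = Dom A" "Cod C = Cod A" "Cmp C = Cmp A" "Idn C = Idn A" "Nul C = Nul A" "Add C = Add A"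
  by (subst C_eq, simp add: full_subcategory_def)+

lemma Ar_C [simp]: "f \<in> Ar C \<longleftrightarrow> f \<in> Ar A \<and> Dom A f \<in> Ob C \<and> Cod A f \<in> Ob C"
  by (subst C_eq) (simp add: full_subcategory_def)

lemma Hom_C: "X \<in> Ob C \<Longrightarrow> Y \<in> Ob C \<Longrightarrow> Hom C X Y = Hom A X Y"
  by (auto simp: Hom_def)

lemma op_subabelian: "subabelian (op_cat A) (op_cat C)"
proof -
  have "op_cat C = full_subcategory (op_cat A) (Ob C)"
    by (subst C_eq) (simp add: full_subcategory_def op_cat_def conj_commute)
  then have "full_abelian_subcategory (op_cat C) (op_cat A)"
    unfolding full_abelian_subcategory_def op_cat_simps short_exact_op
    using C.op_abelian C_exact Ob_C by blast
  then show ?thesis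
    by (intro subabelian.intro A.op_abelian C.op_abelian subabelian_axioms.intro)
qed

text \<open>A monic of \<open>C\<close> begins a short exact sequence of \<open>C\<close>, and the
  inclusion preserves short exact sequences.\<close>

lemma monic_C: "monic C f \<longleftrightarrow> monic A f \<and> Dom A f \<in> Ob C \<and> Cod A f \<in> Ob C"
proof
  assume f: "monic C f"
  then have fC: "f \<in> Ar C" by (rule C.monic_ar)
  obtain c where "is_cokernel C f c" using C.cokernel_ex[OF fC] by blast
  then have "short_exact A f c" using C_exact[OF C.monic_short_exact[OF f]] by blast
  then show "monic A f \<and> Dom A f \<in> Ob C \<and> Cod A f \<in> Ob C" using A.short_exactD(3) fC by simp
next
  assume f: "monic A f \<and> Dom A f \<in> Ob C \<and> Cod A f \<in> Ob C"
  show "monic C f"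
    by (rule C.monicI) (use f A.monic_nulD[of f] in auto)
qed

lemma epic_C: "epic C f \<longleftrightarrow> epic A f \<and> Dom A f \<in> Ob C \<and> Cod A f \<in> Ob C"
  using subabelian.monic_C[OF op_subabelian, of f] by auto

lemma zero_object_C: "zero_object C Z \<longleftrightarrow> zero_object A Z \<and> Z \<in> Ob C"
  unfolding A.zero_object_iff C.zero_object_iff C_simps using Ob_C by blast

lemma isomorphism_C: "isomorphism C f \<longleftrightarrow> isomorphism A f \<and> Dom A f \<in> Ob C \<and> Cod A f \<in> Ob C"
  by (cases "Dom A f \<in> Ob C \<and> Cod A f \<in> Ob C") (auto simp: isomorphism_def Hom_C simp del: in_Hom)

lemma isomorphic_C: "isomorphic C X Y \<longleftrightarrow> isomorphic A X Y \<and> X \<in> Ob C \<and> Y \<in> Ob C"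
  unfolding isomorphic_def isomorphism_C by (auto simp: Hom_def)

text \<open>Exactness of the inclusion concerns short exact sequences only, so a kernel in
  \<open>C\<close> is reached through the image factorization of \<open>f\<close> in
  \<open>C\<close>. It is the kernel of the epic part, which completes it to a short exact sequence,
  and the monic part stays monic in \<open>A\<close>.\<close>

lemma is_kernel_C: "is_kernel C f k \<longleftrightarrow> is_kernel A f k \<and> Dom A f \<in> Ob C \<and> Cod A f \<in> Ob C \<and> Dom A k \<in> Ob C"
proof
  assume k: "is_kernel C f k"
  note k' = C.is_kernelD[OF k]
  obtain e m where em: "epic C e" "monic C m" "Dom A e = Dom A f" "Cod A m = Cod A f" "Cod A e = Dom A m" "m \<bullet> e = f"
    using C.image_factorization[of f] k' by (auto simp del: Ar_C)
  have em': "epic A e" "monic A m" "e \<in> Ar A" "m \<in> Ar A" "Dom A m \<in> Ob C" using em(1,2) by (simp_all add: epic_C monic_C)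
  have "is_kernel C e k"
  proof (rule C.kernelI)
    show "monic C k" by (rule C.kernel_monic[OF k])
    have "m \<bullet> e \<bullet> k = Nul A (Dom A k) (Cod A m)" 
      using k' em em' A.cmp_eq[OF em(6), of k] by simp
    then show "e \<bullet>\<^bsub>C\<^esub> k = Nul C (Dom C k) (Cod C e)"
      using k' em em' A.monic_nulD[OF em'(2), of "e \<bullet> k"] by simp
    fix g assume g: "g \<in> Ar C" "Cod C g = Dom C e" "e \<bullet>\<^bsub>C\<^esub> g = Nul C (Dom C g) (Cod C e)"
    have "f \<bullet> g = m \<bullet> e \<bullet> g" using A.cmp_eq[OF em(6), of g] g em em' by simp
    then have "f \<bullet> g = Nul A (Dom A g) (Cod A f)" using g em em' by simp
    then obtain h where "h \<in> Hom C (Dom C g) (Dom C k)" "k \<bullet>\<^bsub>C\<^esub> h = g"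
      by (rule_tac C.kernel_lift[OF k g(1)]) (use g em in simp_all)
    then show "\<exists>h. h \<in> Hom C (Dom C g) (Dom C k) \<and> k \<bullet>\<^bsub>C\<^esub> h = g" by blast
  qed (use k' em in \<open>simp_all add: epic_C\<close>)
  then have "short_exact A k e" using C_exact C.epic_short_exact[OF em(1)] by blast
  then have ke: "is_kernel A e k" by (rule A.short_exactD(1))
  have "is_kernel A f k"
  proof (rule A.kernelI)
    show "monic A k" by (rule A.kernel_monic[OF ke])
    fix g assume g: "g \<in> Ar A" "Cod A g = Dom A f" "f \<bullet> g = Nul A (Dom A g) (Cod A f)"
    have "m \<bullet> e \<bullet> g = Nul A (Dom A g) (Cod A m)" using A.cmp_eq[OF em(6), of g] g em em' by simp
    then have "e \<bullet> g = Nul A (Dom A g) (Cod A e)" using A.monic_nulD[OF em'(2), of "e \<bullet> g"] g em em' by simp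
    then obtain h where "h \<in> Hom A (Dom A g) (Dom A k)" "k \<bullet> h = g"
      by (rule_tac A.kernel_lift[OF ke g(1)]) (use g em in simp_all)
    then show "\<exists>h. h \<in> Hom A (Dom A g) (Dom A k) \<and> k \<bullet> h = g" by blast
  qed (use k' in simp_all)
  then show "is_kernel A f k \<and> Dom A f \<in> Ob C \<and> Cod A f \<in> Ob C \<and> Dom A k \<in> Ob C" using k' by simp
next
  assume k: "is_kernel A f k \<and> Dom A f \<in> Ob C \<and> Cod A f \<in> Ob C \<and> Dom A k \<in> Ob C"
  then have kA: "is_kernel A f k" by blast
  note k' = A.is_kernelD[OF kA]
  show "is_kernel C f k"
  proof (rule C.kernelI)
    show "monic C k" using A.kernel_monic[OF kA] k k' by (simp add: monic_C)
    fix g assume g: "g \<in> Ar C" "Cod C g = Dom C f" "f \<bullet>\<^bsub>C\<^esub> g = Nul C (Dom C g) (Cod C f)"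
    obtain h where "h \<in> Hom A (Dom A g) (Dom A k)" "k \<bullet> h = g"
      by (rule A.kernel_lift[OF kA, of g]) (use g in simp_all)
    then show "\<exists>h. h \<in> Hom C (Dom C g) (Dom C k) \<and> k \<bullet>\<^bsub>C\<^esub> h = g"
      using k g by (intro exI[of _ h]) simp
  qed (use k k' in simp_all)
qed

lemma is_cokernel_C: "is_cokernel C f c \<longleftrightarrow> is_cokernel A f c \<and> Dom A f \<in> Ob C \<and> Cod A f \<in> Ob C \<and> Cod A c \<in> Ob C"
  using subabelian.is_kernel_C[OF op_subabelian, of f c] by auto

lemma short_exact_C: "short_exact C f g \<longleftrightarrow> short_exact A f g \<and> Dom A f \<in> Ob C \<and> Cod A f \<in> Ob C \<and> Cod A g \<in> Ob C"
  unfolding short_exact_def is_kernel_C is_cokernel_C using A.is_kernelD(3)[of g f] by metis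

lemma kernel_ex_C:
  assumes "f \<in> Ar A" "Dom A f \<in> Ob C" "Cod A f \<in> Ob C"
  obtains k where "is_kernel A f k" "Dom A k \<in> Ob C"
  using C.kernel_ex[of f] assms is_kernel_C by auto

lemma cokernel_ex_C:
  assumes "f \<in> Ar A" "Dom A f \<in> Ob C" "Cod A f \<in> Ob C"
  obtains c where "is_cokernel A f c" "Cod A c \<in> Ob C"
  using C.cokernel_ex[of f] assms is_cokernel_C by auto

lemma zero_ex_C: obtains Z where "zero_object A Z" "Z \<in> Ob C"
  using C.zero_ex zero_object_C by blast

text \<open>Schur's argument: the kernel can be chosen in \<open>C\<close>, where simplicity makes
  it zero or everything. The object need not be simple in \<open>A\<close>.\<close>

lemma simple_object_C_monic:
  assumes "simple_object C S" "g \<in> Ar A" "Dom A g = S" "Cod A g \<in> Ob C" "g \<noteq> Nul A S (Cod A g)"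
  shows "monic A g"
proof -
  have S: "S \<in> Ob C" using assms(1) by (simp add: simple_object_def)
  obtain k where k: "is_kernel A g k" "Dom A k \<in> Ob C" using kernel_ex_C[of g] assms S by auto
  note k' = A.is_kernelD[OF k(1)]
  have "monic C k" using A.kernel_monic[OF k(1)] k(2) k' S assms(3) by (simp add: monic_C)
  then have "zero_object C (Dom A k) \<or> isomorphism C k"
    using assms(1,3) k' unfolding simple_object_def by simp
  then show ?thesis
  proof
    assume "zero_object C (Dom A k)"
    then show ?thesis using A.monic_iff_kernel_zero[OF k(1)] by (simp add: zero_object_C)
  next
    assume "isomorphism C k"
    then have "epic A k" using A.isomorphism_epic by (simp add: isomorphism_C)
    then have "g = Nul A S (Cod A g)" using A.epic_nulD[of k g] k' assms(2,3) by simp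
    then show ?thesis using assms(5) by blast
  qed
qed

text \<open>The tail is the kernel of the projection to the summand 0. As the kernel of an arrow of
  \<open>C\<close> it can be chosen in \<open>C\<close>, so the biproduct of the shifted family
  exists in \<open>C\<close>.\<close>

lemma biproduct_tail:
  assumes B: "biproduct_in A C UNIV K B" and K: "K 0 \<in> Ob C"
  obtains B' k p where "biproduct_in A C UNIV (\<lambda>r. K (Suc r)) B'"
    "short_exact C k p" "Cod A k = B" "Dom A k = B'" "Cod A p = K (0::nat)"
proof -
  obtain \<iota> p where BC: "B \<in> Ob C" and bi: "is_biproduct A UNIV K B \<iota> p"
    using B unfolding biproduct_in_def by blast
  have co: "is_coproduct A UNIV K B \<iota>" and pr: "is_product A UNIV K B p"
    and \<delta>: "\<And>i j. p j \<bullet> \<iota> i = (if i = j then Idn A (K j) else Nul A (K i) (K j))"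
    using bi unfolding A.biproduct_iff by blast+
  have i: "\<iota> r \<in> Ar A" "Dom A (\<iota> r) = K r" "Cod A (\<iota> r) = B" for r using is_coproductD(3)[OF co, of r] by auto
  have p: "p r \<in> Ar A" "Dom A (p r) = B" "Cod A (p r) = K r" for r using is_productD(3)[OF pr, of r] by auto
  have Kob: "K r \<in> Ob A" for r using is_productD(1)[OF pr, of r] by simp
  obtain k where k: "is_kernel A (p 0) k" "Dom A k \<in> Ob C" using kernel_ex_C[of "p 0"] p K BC by auto
  note k' = A.is_kernelD[OF k(1)] note km = A.kernel_monic[OF k(1)]
  have "epic A (p 0)"
    by (rule A.epic_of_local[of _ "Idn A (K 0)" "\<iota> 0"]) (use p i K \<delta> A.isomorphism_epic A.isomorphism_idn in simp_all)
  then have S: "short_exact C k (p 0)" using A.epic_short_exact[OF _ k(1)] k k' p BC K by (simp add: short_exact_C)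
  let ?B = "Dom A k"
  have kh: "k \<in> Ar A" "Cod A k = B" using k' p by simp_all
  have "\<forall>r. \<exists>j. j \<in> Hom A (K (Suc r)) ?B \<and> k \<bullet> j = \<iota> (Suc r)"
  proof
    fix r
    have "p 0 \<bullet> \<iota> (Suc r) = Nul A (K (Suc r)) (K 0)" using \<delta>[of 0 "Suc r"] by simp
    then obtain j where "j \<in> Hom A (Dom A (\<iota> (Suc r))) ?B" "k \<bullet> j = \<iota> (Suc r)"
      using A.kernel_lift[OF k(1), of "\<iota> (Suc r)"] i p by metis
    then show "\<exists>j. j \<in> Hom A (K (Suc r)) ?B \<and> k \<bullet> j = \<iota> (Suc r)" using i by metis
  qed
  then have "\<exists>\<iota>'. \<forall>r. \<iota>' r \<in> Hom A (K (Suc r)) ?B \<and> k \<bullet> \<iota>' r = \<iota> (Suc r)"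
    by (rule choice)
  then obtain \<iota>' where "\<forall>r. \<iota>' r \<in> Hom A (K (Suc r)) ?B \<and> k \<bullet> \<iota>' r = \<iota> (Suc r)" ..
  then have \<iota>': "\<And>r. \<iota>' r \<in> Hom A (K (Suc r)) ?B" "\<And>r. k \<bullet> \<iota>' r = \<iota> (Suc r)" by blast+
  \<comment> \<open>The idempotent that removes the summand 0. Its lift \<open>s\<close> along
    \<open>k\<close> is a retraction onto the tail, through which arrows out of the tail are
    compared on \<open>B\<close>.\<close>
  let ?D = "Diff A (Idn A B) (\<iota> 0 \<bullet> p 0)"
  have Bob: "B \<in> Ob A" using BC by simp
  have h1: "Idn A B \<in> Hom A B B" "\<iota> 0 \<bullet> p 0 \<in> Hom A B B" using Bob i p by simp_all
  have D: "?D \<in> Hom A B B" by (rule A.Diff_hom(1)[OF h1])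
  have "p 0 \<bullet> \<iota> 0 \<bullet> p 0 = p 0" using A.cmp_eq[OF \<delta>[of 0 0], of "p 0"] i p by simp
  then have "p 0 \<bullet> ?D = Nul A B (K 0)" using A.cmp_Diff[OF h1, of "p 0" "K 0"] p Bob by simp
  then obtain s where s: "s \<in> Hom A B ?B" "k \<bullet> s = ?D"
    using A.kernel_lift[OF k(1), of ?D] D p by auto
  have Di: "?D \<bullet> \<iota> r = (if r = 0 then Nul A (K 0) B else \<iota> r)" for r
  proof -
    have "\<iota> 0 \<bullet> p 0 \<bullet> \<iota> r = (if r = 0 then \<iota> 0 else Nul A (K r) B)" using \<delta>[of 0 r] i Kob by simp
    then show ?thesis using A.Diff_cmp[of "\<iota> r" "K r" B "Idn A B" B "\<iota> 0 \<bullet> p 0"] h1 i p by simp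
  qed
  have si: "s \<bullet> \<iota> r = (case r of 0 \<Rightarrow> Nul A (K 0) ?B | Suc r \<Rightarrow> \<iota>' r)" for r
  proof (rule A.monicD[OF km])
    have "k \<bullet> s \<bullet> \<iota> r = ?D \<bullet> \<iota> r" using A.cmp_eq[OF s(2), of "\<iota> r"] s i kh by simp
    then show "k \<bullet> s \<bullet> \<iota> r = k \<bullet> (case r of 0 \<Rightarrow> Nul A (K 0) ?B | Suc r \<Rightarrow> \<iota>' r)"
      unfolding Di using \<iota>' kh Kob by (simp split: nat.split)
    show "(case r of 0 \<Rightarrow> Nul A (K 0) ?B | Suc r \<Rightarrow> \<iota>' r) \<in> Ar A"
      "Cod A (case r of 0 \<Rightarrow> Nul A (K 0) ?B | Suc r \<Rightarrow> \<iota>' r) = Dom A k"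
      "Dom A (s \<bullet> \<iota> r) = Dom A (case r of 0 \<Rightarrow> Nul A (K 0) ?B | Suc r \<Rightarrow> \<iota>' r)"
      using \<iota>'(1) kh Kob i s by (auto split: nat.split)
  qed (use s i in simp_all)
  have sk: "s \<bullet> k = Idn A ?B"
  proof (rule A.monicD[OF km])
    have "k \<bullet> s \<bullet> k = ?D \<bullet> k" using A.cmp_eq[OF s(2), of k] s kh by simp
    also have "\<dots> = Diff A k (\<iota> 0 \<bullet> p 0 \<bullet> k)"
      using A.Diff_cmp[of k ?B B "Idn A B" B "\<iota> 0 \<bullet> p 0"] h1 kh i p by simp
    also have "\<dots> = k \<bullet> Idn A ?B" using k' i p kh by simp
    finally show "k \<bullet> s \<bullet> k = k \<bullet> Idn A ?B" .
  qed (use s kh in simp_all)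
  have "is_biproduct A UNIV (\<lambda>r. K (Suc r)) ?B \<iota>' (\<lambda>r. p (Suc r) \<bullet> k)"
    unfolding A.biproduct_iff
  proof (intro conjI ballI)
    show "is_coproduct A UNIV (\<lambda>r. K (Suc r)) ?B \<iota>'"
    proof (rule coproductI)
      fix T q assume T: "T \<in> Ob A" and q: "\<And>j. j \<in> UNIV \<Longrightarrow> q j \<in> Hom A (K (Suc j)) T"
      obtain h where h: "h \<in> Hom A B T" "\<And>r. h \<bullet> \<iota> r = (case r of 0 \<Rightarrow> Nul A (K 0) T | Suc r \<Rightarrow> q r)"
        by (rule coproduct_cotuple[OF co T, of "\<lambda>r. case r of 0 \<Rightarrow> Nul A (K 0) T | Suc r \<Rightarrow> q r"])
          (use q T Kob in \<open>auto split: nat.split\<close>)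
      have "(h \<bullet> k) \<bullet> \<iota>' r = q r" for r using h \<iota>'[of r] kh h(2)[of "Suc r"] by simp
      then show "\<exists>h. h \<in> Hom A ?B T \<and> (\<forall>j\<in>UNIV. h \<bullet> \<iota>' j = q j)"
        using h kh by (intro exI[of _ "h \<bullet> k"]) simp
    next
      fix T g h assume T: "T \<in> Ob A" and g: "g \<in> Hom A ?B T" and h: "h \<in> Hom A ?B T"
        and e: "\<And>j. j \<in> UNIV \<Longrightarrow> g \<bullet> \<iota>' j = h \<bullet> \<iota>' j"
      have "g \<bullet> s = h \<bullet> s"
      proof (rule A.coproduct_eq[OF co, of _ T])
        fix r show "(g \<bullet> s) \<bullet> \<iota> r = (h \<bullet> s) \<bullet> \<iota> r"
          using si[of r] g h s i e Kob by (simp split: nat.splits)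
      qed (use g h s in simp_all)
      then have "(g \<bullet> s) \<bullet> k = (h \<bullet> s) \<bullet> k" by simp
      then show "g = h" using g h s kh sk by simp
    qed (use Kob \<iota>'(1) kh(1) in simp_all)
    show "is_product A UNIV (\<lambda>r. K (Suc r)) ?B (\<lambda>r. p (Suc r) \<bullet> k)"
    proof (rule productI)
      fix T q assume T: "T \<in> Ob A" and q: "\<And>j. j \<in> UNIV \<Longrightarrow> q j \<in> Hom A T (K (Suc j))"
      obtain h where h: "h \<in> Hom A T B" "\<And>r. p r \<bullet> h = (case r of 0 \<Rightarrow> Nul A T (K 0) | Suc r \<Rightarrow> q r)"
        by (rule product_tuple[OF pr T, of "\<lambda>r. case r of 0 \<Rightarrow> Nul A T (K 0) | Suc r \<Rightarrow> q r"])
          (use q T Kob in \<open>auto split: nat.split\<close>)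
      obtain g where g: "g \<in> Hom A T ?B" "k \<bullet> g = h"
        using A.kernel_lift[OF k(1), of h] h(1) h(2)[of 0] p by auto
      have "(p (Suc r) \<bullet> k) \<bullet> g = q r" for r using g kh p h(2)[of "Suc r"] by simp
      then show "\<exists>h. h \<in> Hom A T ?B \<and> (\<forall>j\<in>UNIV. (p (Suc j) \<bullet> k) \<bullet> h = q j)"
        using g by blast
    next
      fix T g h assume T: "T \<in> Ob A" and g: "g \<in> Hom A T ?B" and h: "h \<in> Hom A T ?B"
        and e: "\<And>j. j \<in> UNIV \<Longrightarrow> (p (Suc j) \<bullet> k) \<bullet> g = (p (Suc j) \<bullet> k) \<bullet> h"
      have "k \<bullet> g = k \<bullet> h"
      proof (rule A.product_eq[OF pr, of _ T])
        fix r show "p r \<bullet> k \<bullet> g = p r \<bullet> k \<bullet> h"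
        proof (cases r)
          case 0 then show ?thesis using A.cmp_eq[OF k'(4), of g] A.cmp_eq[OF k'(4), of h] g h kh p Kob by simp
        next
          case (Suc j) then show ?thesis using e[of j] g h kh p by simp
        qed
      qed (use g h kh in simp_all)
      then show "g = h" using A.monicD[OF km, of g h] g h by simp
    qed (use Kob p kh in simp_all)
    fix i j
    show "(p (Suc j) \<bullet> k) \<bullet> \<iota>' i = (if i = j then Idn A (K (Suc j)) else Nul A (K (Suc i)) (K (Suc j)))"
      using \<iota>'[of i] kh p \<delta>[of "Suc j" "Suc i"] by simp
  qed
  then have "biproduct_in A C UNIV (\<lambda>r. K (Suc r)) ?B" unfolding biproduct_in_def using k(2) by blast
  then show thesis by (rule that[OF _ S]) (use kh p in simp_all)
qed

lemma biproduct_shift: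
  assumes "biproduct_in A C UNIV K B" "\<And>r. K r \<in> Ob C"
  shows "\<exists>B. biproduct_in A C UNIV (\<lambda>r. K (n + r :: nat)) B"
proof (induction n)
  case (Suc n)
  then obtain B' where "biproduct_in A C UNIV (\<lambda>r. K (n + r)) B'" by blast
  then obtain B'' where "biproduct_in A C UNIV (\<lambda>r. K (n + Suc r)) B''"
    by (rule biproduct_tail) (rule assms(2))
  then have "biproduct_in A C UNIV (\<lambda>r. K (Suc n + r)) B''" by simp
  then show ?case ..
qed (use assms(1) in \<open>simp, blast\<close>)

lemma acceptable_inverse_iff:
  "acceptable_inverse A C X f \<longleftrightarrow> inverse_sequence A X f \<and> (\<forall>r. X r \<in> Ob C) \<and>
     (\<exists>c B. (\<forall>r. is_cokernel A (f r) (c r) \<and> Cod A (c r) \<in> Ob C) \<and> biproduct_in A C UNIV (\<lambda>r. Cod A (c r)) B) \<and>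
     (\<exists>k B. (\<forall>r. is_kernel A (f r) (k r) \<and> Dom A (k r) \<in> Ob C) \<and> biproduct_in A C UNIV (\<lambda>r. Dom A (k r)) B)"
proof -
  have 1: "inverse_sequence C X f \<longleftrightarrow> inverse_sequence A X f \<and> (\<forall>r. X r \<in> Ob C)"
    unfolding inverse_sequence_def by auto
  show ?thesis
  proof (cases "inverse_sequence C X f")
    case True
    then have "Cod A (f r) \<in> Ob C" "Dom A (f r) \<in> Ob C" for r
      unfolding inverse_sequence_def by auto
    then show ?thesis using True 1
      unfolding acceptable_inverse_def summable_ker_cok_def is_cokernel_C is_kernel_C C_simps by (simp only: simp_thms)
  next
    case False
    then show ?thesis using 1 unfolding acceptable_inverse_def by blast
  qed
qed

lemma acceptable_shift:
  assumes "acceptable_inverse A C X f"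
  shows "acceptable_inverse A C (\<lambda>r. X (n + r)) (\<lambda>r. f (n + r))"
proof -
  obtain c B k B' where "inverse_sequence A X f" "\<And>r. X r \<in> Ob C"
    and c: "\<And>r. is_cokernel A (f r) (c r)" "\<And>r. Cod A (c r) \<in> Ob C" "biproduct_in A C UNIV (\<lambda>r. Cod A (c r)) B"
    and k: "\<And>r. is_kernel A (f r) (k r)" "\<And>r. Dom A (k r) \<in> Ob C" "biproduct_in A C UNIV (\<lambda>r. Dom A (k r)) B'"
    using assms unfolding acceptable_inverse_iff by blast
  moreover obtain B1 where "biproduct_in A C UNIV (\<lambda>r. Cod A (c (n + r))) B1"
    using biproduct_shift[OF c(3,2)] by blast
  moreover obtain B2 where "biproduct_in A C UNIV (\<lambda>r. Dom A (k (n + r))) B2"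
    using biproduct_shift[OF k(3,2)] by blast
  ultimately show ?thesis unfolding acceptable_inverse_iff
    by (intro conjI allI A.inverse_sequence_shift exI[of _ "\<lambda>r. c (n + r)"] exI[of _ B1]
        exI[of _ "\<lambda>r. k (n + r)"] exI[of _ B2])
qed

text \<open>Constant sequences serve as targets when local AB5* is applied. Their kernels and
  cokernels are zero, with zero biproduct.\<close>

lemma acceptable_const:
  assumes "Z \<in> Ob C" shows "acceptable_inverse A C (\<lambda>_. Z) (\<lambda>_. Idn A Z)"
proof -
  obtain Z0 where Z0: "zero_object A Z0" "Z0 \<in> Ob C" by (rule zero_ex_C)
  have b: "biproduct_in A C (UNIV :: nat set) (\<lambda>_. Z0) Z0"
    unfolding biproduct_in_def using biproduct_zero[OF A.preadditive_category_axioms Z0(1)] Z0(2) by blast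
  have i: "isomorphism A (Idn A Z)" using assms A.isomorphism_idn by simp
  obtain c k where c: "is_cokernel A (Idn A Z) c" and k: "is_kernel A (Idn A Z) k"
    using A.cokernel_ex A.kernel_ex assms by (meson A.idn_ar Ob_C)
  have c': "is_cokernel A (Idn A Z) (Nul A Z Z0)"
  proof (rule A.cokernelI)
    show "epic A (Nul A Z Z0)"
      by (rule A.epicI) (use assms Z0 A.from_zero[OF Z0(1)] in auto)
    fix g assume "g \<in> Ar A" "Dom A g = Cod A (Idn A Z)" "g \<bullet> Idn A Z = Nul A (Dom A (Idn A Z)) (Cod A g)"
    then show "\<exists>h. h \<in> Hom A (Cod A (Nul A Z Z0)) (Cod A g) \<and> h \<bullet> Nul A Z Z0 = g"
      using assms Z0 by (intro exI[of _ "Nul A Z0 (Cod A g)"]) simp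
  qed (use assms Z0 in simp_all)
  have k': "is_kernel A (Idn A Z) (Nul A Z0 Z)"
  proof (rule A.kernelI)
    show "monic A (Nul A Z0 Z)"
      by (rule A.monicI) (use assms Z0 A.to_zero[OF Z0(1)] in auto)
    fix g assume "g \<in> Ar A" "Cod A g = Dom A (Idn A Z)" "Idn A Z \<bullet> g = Nul A (Dom A g) (Cod A (Idn A Z))"
    then show "\<exists>h. h \<in> Hom A (Dom A g) (Dom A (Nul A Z0 Z)) \<and> Nul A Z0 Z \<bullet> h = g"
      using assms Z0 by (intro exI[of _ "Nul A (Dom A g) Z0"]) simp
  qed (use assms Z0 in simp_all)
  show ?thesis unfolding acceptable_inverse_iff
  proof (intro conjI)
    show "inverse_sequence A (\<lambda>_. Z) (\<lambda>_. Idn A Z)" unfolding inverse_sequence_def using assms by simp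
    show "\<exists>c B. (\<forall>r. is_cokernel A (Idn A Z) (c r) \<and> Cod A (c r) \<in> Ob C) \<and> biproduct_in A C UNIV (\<lambda>r::nat. Cod A (c r)) B"
      by (intro exI[of _ "\<lambda>_. Nul A Z Z0"] exI[of _ Z0]) (use assms Z0 c' b in simp)
    show "\<exists>k B. (\<forall>r. is_kernel A (Idn A Z) (k r) \<and> Dom A (k r) \<in> Ob C) \<and> biproduct_in A C UNIV (\<lambda>r::nat. Dom A (k r)) B"
      by (intro exI[of _ "\<lambda>_. Nul A Z0 Z"] exI[of _ Z0]) (use assms Z0 k' b in simp)
  qed (use assms in simp)
qed

end

context abelian_category
begin

text \<open>The kernel of the cokernel of \<open>g\<close> is the image of \<open>g\<close>, and
  elements of the image lift to \<open>Dom A g\<close> after an epic cover.\<close>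

lemma cokernel_local:
  assumes v: "is_cokernel A g v" and t: "t \<in> Ar A" "Cod A t = Cod A g" "v \<bullet> t = Nul A (Dom A t) (Cod A v)"
  obtains e s where "epic A e" "Cod A e = Dom A t" "s \<in> Hom A (Dom A e) (Dom A g)" "g \<bullet> s = t \<bullet> e"
proof -
  note v' = is_cokernelD[OF v]
  obtain c m where cm: "epic A c" "monic A m" "Dom A c = Dom A g" "Cod A m = Cod A g" "Cod A c = Dom A m" "m \<bullet> c = g"
    by (rule image_factorization[OF v'(1)])
  have cA: "c \<in> Ar A" and mA: "m \<in> Ar A" using cm by simp_all
  obtain v2 where v2: "is_cokernel A m v2" using cokernel_ex[OF mA] by blast
  note v2' = is_cokernelD[OF v2]
  have "v2 \<bullet> g = (v2 \<bullet> m) \<bullet> c" unfolding cm(6)[symmetric] using v2'(2,3) mA cA cm(5) by simp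
  also have "\<dots> = Nul A (Dom A g) (Cod A v2)" unfolding v2'(4) using cA v2'(2) cm(3,5) by simp
  finally obtain w where w: "w \<in> Hom A (Cod A v) (Cod A v2)" "w \<bullet> v = v2"
    by (rule_tac cokernel_desc[OF v, of v2]) (use v2' cm in simp_all)
  have "v2 \<bullet> t = w \<bullet> v \<bullet> t" using cmp_eq[OF w(2), of t] w v' t by simp
  also have "\<dots> = Nul A (Dom A t) (Cod A v2)" unfolding t(3) using w(1) t(1) v'(2) by simp
  finally obtain t' where t': "t' \<in> Hom A (Dom A t) (Dom A m)" "m \<bullet> t' = t"
    by (rule_tac kernel_lift[OF short_exactD(1)[OF monic_short_exact[OF cm(2) v2]], of t]) (use t v2' cm in simp_all)
  have t'A: "t' \<in> Ar A" "Cod A t' = Cod A c" using t' cm by simp_all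
  obtain e s where e: "epic A e" "Cod A e = Dom A t'" "s \<in> Hom A (Dom A e) (Dom A c)" "c \<bullet> s = t' \<bullet> e"
    by (rule cover[OF cm(1) t'A])
  have eA: "e \<in> Ar A" using e(1) by simp
  have "g \<bullet> s = m \<bullet> c \<bullet> s" using cmp_eq[OF cm(6), of s] e(3) cA mA cm(5) by simp
  also have "\<dots> = t \<bullet> e" unfolding e(4) using cmp_eq[OF t'(2), of e] t' e(2) eA mA by simp
  finally show thesis using that[of e s] e(1-3) t'(1) cm(3) by simp
qed

end

text \<open>\<open>down\<close> grows at the far end of the sequence; here the arrow next to index 0
  is split off instead.\<close>

lemma down_front:
  fixes A :: "('o, 'm) cat" (structure)
  assumes "preadditive_category A" "inverse_sequence A X f"
  shows "down A X f (Suc k) = f 0 \<bullet> down A (\<lambda>r. X (Suc r)) (\<lambda>r. f (Suc r)) k"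
proof -
  interpret preadditive_category A by fact
  have f: "f r \<in> Ar A" "Dom A (f r) = X (Suc r)" "Cod A (f r) = X r" for r
    using inverse_sequenceD(2)[OF assms(2), of r] by simp_all
  have X: "X r \<in> Ob A" for r by (rule inverse_sequenceD(1)[OF assms(2)])
  have i: "inverse_sequence A (\<lambda>r. X (Suc r)) (\<lambda>r. f (Suc r))"
    using assms(2) unfolding inverse_sequence_def by blast
  show ?thesis
  proof (induction k)
    case (Suc k)
    have "down A (\<lambda>r. X (Suc r)) (\<lambda>r. f (Suc r)) k \<in> Hom A (X (Suc k)) (X (Suc 0))"
      by (rule down_hom[OF i])
    then have d: "down A (\<lambda>r. X (Suc r)) (\<lambda>r. f (Suc r)) k \<in> Ar A"
       "Dom A (down A (\<lambda>r. X (Suc r)) (\<lambda>r. f (Suc r)) k) = X (Suc k)"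
       "Cod A (down A (\<lambda>r. X (Suc r)) (\<lambda>r. f (Suc r)) k) = X (Suc 0)" by simp_all
    have "down A X f (Suc (Suc k)) = down A X f (Suc k) \<bullet> f (Suc k)" by (rule down.simps)
    also have "\<dots> = f 0 \<bullet> down A (\<lambda>r. X (Suc r)) (\<lambda>r. f (Suc r)) k \<bullet> f (Suc k)"
      unfolding Suc using f d by simp
    finally show ?case by simp
  qed (use f X in simp)
qed

section \<open>Local AB5* and derived limits\<close>

text \<open>Only the consequences of AB4* for sequences are kept, together with local AB5*. The
  opposite pair then satisfies the same axioms by AB4 and local AB5, so each result below is also
  one on colimits.\<close>

locale lim_setting = subabelian A C
  for A :: "('o, 'm) cat" (structure) and C :: "('o, 'm) cat" +
  assumes nat_product: "(\<And>j::nat. X j \<in> Ob A) \<Longrightarrow> \<exists>P \<pi>. is_product A UNIV X P \<pi>"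
    and nat_product_epic: "(\<And>j::nat. epic A (e j)) \<Longrightarrow> is_product A UNIV (\<lambda>j. Dom A (e j)) P \<pi>
      \<Longrightarrow> is_product A UNIV (\<lambda>j. Cod A (e j)) Q \<kappa> \<Longrightarrow> F \<in> Hom A P Q
      \<Longrightarrow> (\<And>j. \<kappa> j \<bullet> F = e j \<bullet> \<pi> j) \<Longrightarrow> epic A F"
    and AB5_star: "locally_AB5_star A C"
begin

lemma acceptableD:
  assumes "acceptable_inverse A C X f"
  shows "inverse_sequence A X f" "X r \<in> Ob C" "f r \<in> Ar A" "Dom A (f r) = X (Suc r)" "Cod A (f r) = X r"
  using assms inverse_sequenceD(2)[of A X f r] unfolding acceptable_inverse_iff by simp_all

lemma is_lim_iff: "is_lim A X f L p \<longleftrightarrow> inverse_sequence A X f \<and> lim_cone A X f L p"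
proof
  assume "is_lim A X f L p" then show "inverse_sequence A X f \<and> lim_cone A X f L p"
    using A.is_lim_cone by blast
next
  assume a: "inverse_sequence A X f \<and> lim_cone A X f L p"
  then obtain P \<pi> where "is_product A UNIV X P \<pi>" using nat_product inverse_sequenceD(1) by metis
  then show "is_lim A X f L p" using A.cone_is_lim a by blast
qed

lemma lim_cone_exists:
  assumes "inverse_sequence A X f"
  obtains L p where "lim_cone A X f L p"
proof -
  obtain P \<pi> where "is_product A UNIV X P \<pi>" using nat_product[of X] inverse_sequenceD(1)[OF assms] by blast
  then show thesis using A.lim_exists[OF assms] that A.is_lim_cone(2) by metis
qed

text \<open>Local AB5* applied to the composites \<open>u \<circ> down X f r\<close> as maps into a constant sequence.\<close>

lemma lim_cokernel:
  assumes acc: "acceptable_inverse A C X f" and L: "lim_cone A X f L p"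
    and Z: "Z \<in> Ob C" and u: "u \<in> Hom A (X 0) Z"
    and \<gamma>: "\<And>r. is_cokernel A (u \<bullet> down A X f r) (\<gamma> r)" "\<And>r. Cod A (\<gamma> r) \<in> Ob C"
  obtains N n v h where
    "\<And>r. h r \<in> Hom A (Cod A (\<gamma> (Suc r))) (Cod A (\<gamma> r))" "\<And>r. h r \<bullet> \<gamma> (Suc r) = \<gamma> r"
    "lim_cone A (\<lambda>r. Cod A (\<gamma> r)) h N n" "is_cokernel A (u \<bullet> p 0) v" "v \<in> Hom A Z N" "\<And>r. n r \<bullet> v = \<gamma> r"
proof -
  note X = acceptableD[OF acc]
  have D: "down A X f r \<in> Ar A" "Dom A (down A X f r) = X r" "Cod A (down A X f r) = X 0" for r
    using A.down_hom[OF X(1), of r] by simp_all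
  have p: "p r \<in> Ar A" "Dom A (p r) = L" "Cod A (p r) = X r" for r
    using lim_coneD(2)[OF L, of r] by simp_all
  have ZA: "Z \<in> Ob A" using Z by simp
  have g: "\<gamma> r \<in> Ar A" "Dom A (\<gamma> r) = Z" "\<gamma> r \<bullet> u \<bullet> down A X f r = Nul A (X r) (Cod A (\<gamma> r))" for r
    using A.is_cokernelD[OF \<gamma>(1)[of r]] u D[of r] by simp_all
  have "\<exists>h. h \<in> Hom A (Cod A (\<gamma> (Suc r))) (Cod A (\<gamma> r)) \<and> h \<bullet> \<gamma> (Suc r) = \<gamma> r" for r
  proof -
    have "\<gamma> r \<bullet> u \<bullet> down A X f (Suc r) = (\<gamma> r \<bullet> u \<bullet> down A X f r) \<bullet> f r"
      using g(1,2)[of r] u D[of r] X(3-5) by simp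
    also have "\<dots> = Nul A (X (Suc r)) (Cod A (\<gamma> r))"
      unfolding g(3) using X(3-5)[of r] g(1)[of r] by simp
    finally obtain h where "h \<in> Hom A (Cod A (\<gamma> (Suc r))) (Cod A (\<gamma> r))" "h \<bullet> \<gamma> (Suc r) = \<gamma> r"
      by (rule_tac A.cokernel_desc[OF \<gamma>(1)[of "Suc r"], of "\<gamma> r"])
        (use g(1,2)[of r] u D(1-3)[of "Suc r"] in simp_all)
    then show ?thesis by blast
  qed
  then have "\<forall>r. \<exists>h. h \<in> Hom A (Cod A (\<gamma> (Suc r))) (Cod A (\<gamma> r)) \<and> h \<bullet> \<gamma> (Suc r) = \<gamma> r" by blast
  then have "\<exists>h. \<forall>r. h r \<in> Hom A (Cod A (\<gamma> (Suc r))) (Cod A (\<gamma> r)) \<and> h r \<bullet> \<gamma> (Suc r) = \<gamma> r"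
    by (rule choice)
  then obtain h where h0: "\<forall>r. h r \<in> Hom A (Cod A (\<gamma> (Suc r))) (Cod A (\<gamma> r)) \<and> h r \<bullet> \<gamma> (Suc r) = \<gamma> r" ..
  then have h: "\<And>r. h r \<in> Hom A (Cod A (\<gamma> (Suc r))) (Cod A (\<gamma> r))" "\<And>r. h r \<bullet> \<gamma> (Suc r) = \<gamma> r" by blast+
  have isq: "inverse_sequence A (\<lambda>r. Cod A (\<gamma> r)) h" unfolding inverse_sequence_def
  proof (intro allI conjI)
    fix r show "Cod A (\<gamma> r) \<in> Ob A" using \<gamma>(2) by simp
  qed (rule h)
  obtain N n where N: "lim_cone A (\<lambda>r. Cod A (\<gamma> r)) h N n" by (rule lim_cone_exists[OF isq])
  obtain v where v: "v \<in> Hom A Z N" "\<And>r. n r \<bullet> v = \<gamma> r"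
    by (rule lim_cone_tuple[OF N, of \<gamma> Z]) (use g(1,2) h(2) in \<open>simp, simp, blast\<close>)
  have cst: "is_lim A (\<lambda>_. Z) (\<lambda>_. Idn A Z) Z (\<lambda>_. Idn A Z)"
    unfolding is_lim_iff using A.lim_cone_const[OF ZA] acceptableD(1)[OF acceptable_const[OF Z]] by blast
  have up: "u \<bullet> p 0 \<in> Hom A L Z" using u p[of 0] by simp
  have "is_cokernel A (u \<bullet> p 0) v"
  proof (rule AB5_star[unfolded locally_AB5_star_def, rule_format, of X f "\<lambda>_. Z" "\<lambda>_. Idn A Z"
        "\<lambda>r. u \<bullet> down A X f r" L p Z "\<lambda>_. Idn A Z" "u \<bullet> p 0" \<gamma> h N n v], intro conjI allI)
    show "acceptable_inverse A C X f" by (rule acc)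
    show "acceptable_inverse A C (\<lambda>_. Z) (\<lambda>_. Idn A Z)" by (rule acceptable_const[OF Z])
    show "is_lim A X f L p" unfolding is_lim_iff using X(1) L by blast
    show "is_lim A (\<lambda>_. Z) (\<lambda>_. Idn A Z) Z (\<lambda>_. Idn A Z)" by (rule cst)
    show "is_lim A (\<lambda>r. Cod C (\<gamma> r)) h N n" unfolding is_lim_iff C_simps using isq N by blast
    show "u \<bullet> p 0 \<in> Hom A L Z" by (rule up)
    show "v \<in> Hom A Z N" by (rule v)
    fix r
    show "u \<bullet> down A X f r \<in> Hom C (X r) Z" using u D[of r] X(2) Z by simp
    show "(u \<bullet> down A X f r) \<bullet>\<^bsub>C\<^esub> f r = Idn A Z \<bullet>\<^bsub>C\<^esub> u \<bullet> down A X f (Suc r)"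
      using u D[of r] X(3-5)[of r] Z by simp
    show "Idn A Z \<bullet> u \<bullet> p 0 = (u \<bullet> down A X f r) \<bullet> p r"
      using u D[of r] p A.down_lim[OF X(1) L, of r] Z by simp
    show "is_cokernel C (u \<bullet> down A X f r) (\<gamma> r)"
      using \<gamma> u D[of r] X(2) Z unfolding is_cokernel_C by simp
    show "h r \<in> Hom C (Cod C (\<gamma> (Suc r))) (Cod C (\<gamma> r))" using h(1)[of r] \<gamma>(2) by simp
    show "h r \<bullet>\<^bsub>C\<^esub> \<gamma> (Suc r) = \<gamma> r \<bullet>\<^bsub>C\<^esub> Idn A Z" using h(2) g(1,2) by simp
    show "n r \<bullet> v = \<gamma> r \<bullet> Idn A Z" using v(2) g(1,2) by simp
  qed
  then show thesis using that[OF h N _ v] by blast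
qed

text \<open>An element that dies in the cokernel of every finite stage dies in their limit. By
  \<open>lim_cokernel\<close> this limit is the cokernel of \<open>u \<bullet> p 0\<close>, so the
  element lifts to \<open>L\<close> after a cover.\<close>

lemma lim_detect:
  assumes acc: "acceptable_inverse A C X f" and L: "lim_cone A X f L p"
    and Z: "Z \<in> Ob C" and u: "u \<in> Hom A (X 0) Z"
    and \<gamma>: "\<And>r. is_cokernel A (u \<bullet> down A X f r) (\<gamma> r)" "\<And>r. Cod A (\<gamma> r) \<in> Ob C"
    and t: "t \<in> Hom A T Z" "\<And>r. \<gamma> r \<bullet> t = Nul A T (Cod A (\<gamma> r))"
  obtains e s where "epic A e" "Cod A e = T" "s \<in> Hom A (Dom A e) L" "(u \<bullet> p 0) \<bullet> s = t \<bullet> e"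
proof -
  obtain N n v h where h: "\<And>r. h r \<in> Hom A (Cod A (\<gamma> (Suc r))) (Cod A (\<gamma> r))" "\<And>r. h r \<bullet> \<gamma> (Suc r) = \<gamma> r"
    and N: "lim_cone A (\<lambda>r. Cod A (\<gamma> r)) h N n" and v: "is_cokernel A (u \<bullet> p 0) v" "v \<in> Hom A Z N" "\<And>r. n r \<bullet> v = \<gamma> r"
    by (rule lim_cokernel[OF acc L Z u \<gamma>]) blast
  have p: "p 0 \<in> Ar A" "Dom A (p 0) = L" "Cod A (p 0) = X 0" using lim_coneD(2)[OF L, of 0] by simp_all
  have n: "n r \<in> Ar A" "Dom A (n r) = N" "Cod A (n r) = Cod A (\<gamma> r)" for r
    using lim_coneD(2)[OF N, of r] by simp_all
  have T: "T \<in> Ob A" "N \<in> Ob A" using t(1) v(2) by auto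
  have isq: "inverse_sequence A (\<lambda>r. Cod A (\<gamma> r)) h" unfolding inverse_sequence_def
  proof (intro allI conjI)
    fix r show "Cod A (\<gamma> r) \<in> Ob A" using \<gamma>(2) by simp
  qed (rule h)
  have "v \<bullet> t = Nul A T N"
  proof (rule A.lim_cone_eq[OF N isq, of _ T])
    fix r
    have "n r \<bullet> v \<bullet> t = \<gamma> r \<bullet> t" using A.cmp_eq[OF v(3), of t] v(2) n t(1) by simp
    then show "n r \<bullet> v \<bullet> t = n r \<bullet> Nul A T N" using t(2) n T by simp
  qed (use v t T in simp_all)
  then obtain e s where "epic A e" "Cod A e = Dom A t" "s \<in> Hom A (Dom A e) (Dom A (u \<bullet> p 0))" "(u \<bullet> p 0) \<bullet> s = t \<bullet> e"
    by (rule_tac A.cokernel_local[OF v(1), of t]) (use t(1) v(2) u p in simp_all)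
  then show thesis using that[of e s] t(1) u p by simp
qed

text \<open>Let \<open>N r\<close> be the cokernel of \<open>p r : L \<rightarrow> Y r\<close>.  By local AB5* it is the limit of the quotients of \<open>Y r\<close> by the images
  of the \<open>Y (r + k)\<close>, in which the partial sums \<open>s r k\<close> of the geometric series for the inverse of \<open>1 - f\<close> become stationary.
  So \<open>1 - f\<close> is locally surjective up to a family \<open>y\<close> in the images of the \<open>p r\<close>; such a family lifts to the
  constant sequence \<open>L\<close>, where it telescopes.\<close>

lemma lim1_epic:
  assumes acc: "acceptable_inverse A C Y f" and P: "is_product A UNIV Y P \<pi>" and d: "one_minus_prod A f P \<pi> d"
  shows "epic A d"
proof -
  note Y = acceptableD[OF acc]
  obtain L p where L: "lim_cone A Y f L p" by (rule lim_cone_exists[OF Y(1)])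
  \<comment> \<open>\<open>D r k\<close> is the composite \<open>Y (r + k) -> Y r\<close>, the k-th
    power of the shift in the geometric series below.\<close>
  define D where "D r = down A (\<lambda>k. Y (r + k)) (\<lambda>k. f (r + k))" for r
  have accr: "acceptable_inverse A C (\<lambda>k. Y (r + k)) (\<lambda>k. f (r + k))" for r by (rule acceptable_shift[OF acc])
  have Yob: "Y r \<in> Ob A" for r using Y(2) by simp
  have Dh: "D r k \<in> Ar A" "Dom A (D r k) = Y (r + k)" "Cod A (D r k) = Y r" for r k
    using A.down_hom[OF acceptableD(1)[OF accr[of r]], of k] by (simp_all add: D_def)
  have D0: "D r 0 = Idn A (Y r)" and DS: "D r (Suc k) = D r k \<bullet> f (r + k)" for r k by (simp_all add: D_def)
  have DF: "D r (Suc k) = f r \<bullet> D (Suc r) k" for r k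
    using down_front[OF A.preadditive_category_axioms acceptableD(1)[OF accr[of r]], of k] by (simp add: D_def)
  have \<pi>: "\<pi> r \<in> Ar A" "Dom A (\<pi> r) = P" "Cod A (\<pi> r) = Y r" for r using is_productD(3)[OF P, of r] by simp_all
  have Pob: "P \<in> Ob A" by (rule is_productD(2)[OF P])
  have pp: "p r \<in> Ar A" "Dom A (p r) = L" "Cod A (p r) = Y r" "f r \<bullet> p (Suc r) = p r" for r
    using lim_coneD(2,3)[OF L, of r] by simp_all
  have Lob: "L \<in> Ob A" by (rule lim_coneD(1)[OF L])
  have dh: "d \<in> Ar A" "Dom A d = P" "Cod A d = P" and d\<pi>: "\<And>r. \<pi> r \<bullet> d = Diff A (\<pi> r) (f r \<bullet> \<pi> (Suc r))"
    using d unfolding one_minus_prod_def by simp_all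
  have d\<pi>x: "\<pi> r \<bullet> d \<bullet> x = Diff A (\<pi> r \<bullet> x) (f r \<bullet> \<pi> (Suc r) \<bullet> x)" if "x \<in> Hom A T P" for r x T
  proof -
    have "\<pi> r \<bullet> d \<bullet> x = Diff A (\<pi> r) (f r \<bullet> \<pi> (Suc r)) \<bullet> x"
      using A.cmp_eq[OF d\<pi>, of x] \<pi> dh that by simp
    also have "\<dots> = Diff A (\<pi> r \<bullet> x) ((f r \<bullet> \<pi> (Suc r)) \<bullet> x)"
      by (rule A.Diff_cmp[OF that, of _ "Y r"]) (use \<pi> Y(3-5) in simp_all)
    finally show ?thesis using \<pi> Y(3-5) that by simp
  qed
  \<comment> \<open>The identity is kept in the composite so that it has the shape required by
    \<open>lim_cokernel\<close>, which is applied to the sequence starting at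
    \<open>r\<close>.\<close>
  have "\<exists>c. is_cokernel A (Idn A (Y r) \<bullet> D r k) c \<and> Cod A c \<in> Ob C" for r k
    using cokernel_ex_C[of "D r k"] Dh[of r k] Y(2) by simp metis
  then have "\<forall>rk. \<exists>c. is_cokernel A (Idn A (Y (fst rk)) \<bullet> D (fst rk) (snd rk)) c \<and> Cod A c \<in> Ob C" by blast
  then have "\<exists>c. \<forall>rk. is_cokernel A (Idn A (Y (fst rk)) \<bullet> D (fst rk) (snd rk)) (c rk) \<and> Cod A (c rk) \<in> Ob C"
    by (rule choice)
  then obtain c where c: "\<forall>rk. is_cokernel A (Idn A (Y (fst rk)) \<bullet> D (fst rk) (snd rk)) (c rk) \<and> Cod A (c rk) \<in> Ob C" ..
  define \<gamma> where "\<gamma> r k = c (r, k)" for r k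
  have \<gamma>: "is_cokernel A (Idn A (Y r) \<bullet> D r k) (\<gamma> r k)" "Cod A (\<gamma> r k) \<in> Ob C" for r k
    using c[rule_format, of "(r, k)"] by (simp_all add: \<gamma>_def)
  have \<gamma>A: "\<gamma> r k \<in> Ar A" "Dom A (\<gamma> r k) = Y r" "\<gamma> r k \<bullet> D r k = Nul A (Y (r + k)) (Cod A (\<gamma> r k))" for r k
    using A.is_cokernelD[OF \<gamma>(1)[of r k]] Dh[of r k] by simp_all
  have \<gamma>ob: "Cod A (\<gamma> r k) \<in> Ob A" for r k using \<gamma>(2) by simp
  have ex: "\<exists>N n v h. (\<forall>k. h k \<in> Hom A (Cod A (\<gamma> r (Suc k))) (Cod A (\<gamma> r k))) \<and> (\<forall>k. h k \<bullet> \<gamma> r (Suc k) = \<gamma> r k) \<and>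
      lim_cone A (\<lambda>k. Cod A (\<gamma> r k)) h N n \<and> is_cokernel A (p r) v \<and> v \<in> Hom A (Y r) N \<and> (\<forall>k. n k \<bullet> v = \<gamma> r k)" for r
  proof -
    have i: "Idn A (Y r) \<in> Hom A (Y (r + 0)) (Y r)" using Yob by simp
    obtain N n v h where "\<And>k. h k \<in> Hom A (Cod A (\<gamma> r (Suc k))) (Cod A (\<gamma> r k))" "\<And>k. h k \<bullet> \<gamma> r (Suc k) = \<gamma> r k"
      "lim_cone A (\<lambda>k. Cod A (\<gamma> r k)) h N n" "is_cokernel A (Idn A (Y r) \<bullet> p (r + 0)) v" "v \<in> Hom A (Y r) N" "\<And>k. n k \<bullet> v = \<gamma> r k"
      by (rule lim_cokernel[OF accr[of r] A.lim_cone_shift[OF Y(1) L, of r] Y(2) i \<gamma>(1)[unfolded D_def] \<gamma>(2)]) blast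
    then show ?thesis using pp(1-3)[of r] by (intro exI[of _ N] exI[of _ n] exI[of _ v] exI[of _ h]) simp
  qed
  define R where "R r q = (case q of (N, n, v, h) \<Rightarrow> (\<forall>k. h k \<in> Hom A (Cod A (\<gamma> r (Suc k))) (Cod A (\<gamma> r k))) \<and> (\<forall>k. h k \<bullet> \<gamma> r (Suc k) = \<gamma> r k) \<and>
      lim_cone A (\<lambda>k. Cod A (\<gamma> r k)) h N n \<and> is_cokernel A (p r) v \<and> v \<in> Hom A (Y r) N \<and> (\<forall>k. n k \<bullet> v = \<gamma> r k))" for r q
  have "\<forall>r. \<exists>q. R r q" unfolding R_def using ex by auto
  then have "\<exists>q. \<forall>r. R r (q r)" by (rule choice)
  then obtain q where q: "\<forall>r. R r (q r)" ..
  define N n v h where "N r = fst (q r)" and "n r = fst (snd (q r))" and "v r = fst (snd (snd (q r)))"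
    and "h r = snd (snd (snd (q r)))" for r
  have Q: "(\<forall>k. h r k \<in> Hom A (Cod A (\<gamma> r (Suc k))) (Cod A (\<gamma> r k))) \<and> (\<forall>k. h r k \<bullet> \<gamma> r (Suc k) = \<gamma> r k) \<and>
      lim_cone A (\<lambda>k. Cod A (\<gamma> r k)) (h r) (N r) (n r) \<and> is_cokernel A (p r) (v r) \<and> v r \<in> Hom A (Y r) (N r) \<and> (\<forall>k. n r k \<bullet> v r = \<gamma> r k)" for r
    using q[rule_format, of r] by (simp add: R_def N_def n_def v_def h_def case_prod_beta)
  have h: "h r k \<in> Ar A" "Dom A (h r k) = Cod A (\<gamma> r (Suc k))" "Cod A (h r k) = Cod A (\<gamma> r k)" "h r k \<bullet> \<gamma> r (Suc k) = \<gamma> r k" for r k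
    using Q[of r] by simp_all
  have Nl: "lim_cone A (\<lambda>k. Cod A (\<gamma> r k)) (h r) (N r) (n r)" for r using Q[of r] by blast
  have v: "is_cokernel A (p r) (v r)" "v r \<in> Ar A" "Dom A (v r) = Y r" "Cod A (v r) = N r" and nv: "n r k \<bullet> v r = \<gamma> r k" for r k
    using Q[of r] by simp_all
  have n: "n r k \<in> Ar A" "Dom A (n r k) = N r" "Cod A (n r k) = Cod A (\<gamma> r k)" for r k
    using lim_coneD(2)[OF Nl, of r k] by simp_all
  have Nob: "N r \<in> Ob A" for r by (rule lim_coneD(1)[OF Nl])
  have his: "inverse_sequence A (\<lambda>k. Cod A (\<gamma> r k)) (h r)" for r
    unfolding inverse_sequence_def using h \<gamma>ob by simp

  \<comment> \<open>The partial sum of \<open>D r j \<bullet> \<pi> (r + j)\<close> over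
    \<open>j < k\<close>, from the geometric series for the inverse of \<open>1 - f\<close>.\<close>
  define s where "s r = rec_nat (Nul A P (Y r)) (\<lambda>k x. Add A x (D r k \<bullet> \<pi> (r + k)))" for r
  have s0: "s r 0 = Nul A P (Y r)" and sS: "s r (Suc k) = Add A (s r k) (D r k \<bullet> \<pi> (r + k))" for r k
    by (simp_all add: s_def)
  have sh0: "s r k \<in> Hom A P (Y r)" for r k
    by (induction k) (use s0 sS Dh \<pi> Pob Yob in simp_all)
  then have sh: "s r k \<in> Ar A" "Dom A (s r k) = P" "Cod A (s r k) = Y r" for r k by simp_all
  \<comment> \<open>The recursion read from the other end: one more term equals the leading term
    plus \<open>f r\<close> applied to the partial sum at the next index. This is what makes
    \<open>1 - f\<close> act as an inverse of the series.\<close>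
  have sF: "s r (Suc k) = Add A (\<pi> r) (f r \<bullet> s (Suc r) k)" for r k
  proof (induction k)
    case 0 show ?case using s0 sS D0 \<pi> Pob Yob Y(3-5) by simp
  next
    case (Suc k)
    have "s r (Suc (Suc k)) = Add A (Add A (\<pi> r) (f r \<bullet> s (Suc r) k)) (D r (Suc k) \<bullet> \<pi> (Suc r + k))"
      using sS[of r "Suc k"] Suc by simp
    also have "\<dots> = Add A (Add A (\<pi> r) (f r \<bullet> s (Suc r) k)) (f r \<bullet> D (Suc r) k \<bullet> \<pi> (Suc r + k))"
      unfolding DF using Dh[of "Suc r" k] \<pi> Y(3-5) by simp
    also have "\<dots> = Add A (\<pi> r) (Add A (f r \<bullet> s (Suc r) k) (f r \<bullet> D (Suc r) k \<bullet> \<pi> (Suc r + k)))"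
      by (rule A.add_assoc[of _ P "Y r"]) (use Dh \<pi> Y(3-5) sh in simp_all)
    also have "Add A (f r \<bullet> s (Suc r) k) (f r \<bullet> D (Suc r) k \<bullet> \<pi> (Suc r + k)) = f r \<bullet> s (Suc r) (Suc k)"
      unfolding sS by (rule A.cmp_add[symmetric, of _ P "Y (Suc r)" _ _ "Y r"]) (use Dh \<pi> Y(3-5) sh in simp_all)
    finally show ?case .
  qed
  \<comment> \<open>The k-th term of the series lies in the image of \<open>Y (r + k)\<close>, so
    the classes of the partial sums modulo these images are compatible and define an arrow
    \<open>z r\<close> into \<open>N r\<close>.\<close>
  have zex: "\<exists>z. z \<in> Hom A P (N r) \<and> (\<forall>k. n r k \<bullet> z = \<gamma> r k \<bullet> s r k)" for r
  proof -
    have "h r k \<bullet> \<gamma> r (Suc k) \<bullet> s r (Suc k) = \<gamma> r k \<bullet> s r k" for k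
    proof -
      have "h r k \<bullet> \<gamma> r (Suc k) \<bullet> s r (Suc k) = \<gamma> r k \<bullet> s r (Suc k)"
        using A.cmp_eq[OF h(4)[of r k], of "s r (Suc k)"] h[of r k] \<gamma>A[of r] sh[of r] by simp
      also have "\<dots> = Add A (\<gamma> r k \<bullet> s r k) (\<gamma> r k \<bullet> D r k \<bullet> \<pi> (r + k))"
        unfolding sS by (rule A.cmp_add[of _ P "Y r" _ _ "Cod A (\<gamma> r k)"]) (use Dh \<pi> sh \<gamma>A in simp_all)
      also have "\<gamma> r k \<bullet> D r k \<bullet> \<pi> (r + k) = Nul A P (Cod A (\<gamma> r k))"
        using A.cmp_eq[OF \<gamma>A(3)[of r k], of "\<pi> (r + k)"] \<gamma>A[of r k] \<pi> Dh \<gamma>ob by simp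
      finally show ?thesis using \<gamma>A[of r k] sh[of r k] by simp
    qed
    then obtain z where "z \<in> Hom A P (N r)" "\<And>k. n r k \<bullet> z = \<gamma> r k \<bullet> s r k"
      by (rule_tac lim_cone_tuple[OF Nl[of r], of "\<lambda>k. \<gamma> r k \<bullet> s r k" P]) (use \<gamma>A sh in simp_all)
    then show ?thesis by blast
  qed
  then have "\<forall>r. \<exists>z. z \<in> Hom A P (N r) \<and> (\<forall>k. n r k \<bullet> z = \<gamma> r k \<bullet> s r k)" by blast
  then have "\<exists>z. \<forall>r. z r \<in> Hom A P (N r) \<and> (\<forall>k. n r k \<bullet> z r = \<gamma> r k \<bullet> s r k)" by (rule choice)
  then obtain z where z0: "\<forall>r. z r \<in> Hom A P (N r) \<and> (\<forall>k. n r k \<bullet> z r = \<gamma> r k \<bullet> s r k)" ..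
  have z: "z r \<in> Ar A" "Dom A (z r) = P" "Cod A (z r) = N r" "n r k \<bullet> z r = \<gamma> r k \<bullet> s r k" for r k
    using z0[rule_format, of r] by simp_all

  obtain PN \<kappa> where PN: "is_product A UNIV N PN \<kappa>" using nat_product[of N] Nob by blast
  have \<kappa>: "\<kappa> r \<in> Ar A" "Dom A (\<kappa> r) = PN" "Cod A (\<kappa> r) = N r" for r using is_productD(3)[OF PN, of r] by simp_all
  obtain V where V: "V \<in> Hom A P PN" "\<And>r. r \<in> UNIV \<Longrightarrow> \<kappa> r \<bullet> V = v r \<bullet> \<pi> r"
    by (rule product_tuple[OF PN Pob, of "\<lambda>r. v r \<bullet> \<pi> r"]) (use v \<pi> in simp_all)
  obtain W where W: "W \<in> Hom A P PN" "\<And>r. r \<in> UNIV \<Longrightarrow> \<kappa> r \<bullet> W = z r"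
    by (rule product_tuple[OF PN Pob, of z]) (use z in simp_all)
  \<comment> \<open>A product of epics is epic, so all the \<open>z r\<close> lift simultaneously to
    one \<open>x\<close> into \<open>P\<close> on a single cover \<open>e\<close>.\<close>
  have Ve: "epic A V"
    by (rule nat_product_epic[of v P \<pi> PN \<kappa>]) (use A.cokernel_epic[OF v(1)] v P PN V in simp_all)
  have WA: "W \<in> Ar A" "Cod A W = Cod A V" using W V by simp_all
  obtain e x where e: "epic A e" "Cod A e = Dom A W" "x \<in> Hom A (Dom A e) (Dom A V)" "V \<bullet> x = W \<bullet> e"
    by (rule A.cover[OF Ve WA])
  define T where "T = Dom A e"
  have eh: "e \<in> Hom A T P" and xh: "x \<in> Hom A T P" using e W V by (simp_all add: T_def)
  have Tob: "T \<in> Ob A" using eh by auto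
  have vx: "v r \<bullet> \<pi> r \<bullet> x = z r \<bullet> e" for r
  proof -
    have "v r \<bullet> \<pi> r \<bullet> x = \<kappa> r \<bullet> V \<bullet> x"
      using A.cmp_eq[OF V(2)[of r], of x] v(2-4) \<pi> \<kappa> V(1) xh by simp
    also have "\<dots> = z r \<bullet> e" unfolding e(4) using A.cmp_eq[OF W(2)[of r], of e] \<kappa> W eh by simp
    finally show ?thesis .
  qed
  \<comment> \<open>The error of the approximate preimage \<open>x\<close> of \<open>e\<close>. It
    remains to show that each component of \<open>y\<close> lies in the image of the corresponding
    \<open>p r\<close>.\<close>
  define y where "y = Diff A e (d \<bullet> x)"
  have dx: "d \<bullet> x \<in> Hom A T P" using dh xh by simp
  have yh: "y \<in> Hom A T P" unfolding y_def by (rule A.Diff_hom(1)[OF eh dx])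
  \<comment> \<open>The index is \<open>Suc k\<close> at \<open>r\<close> because \<open>f r\<close>
    carries the image of \<open>Y (Suc r + k)\<close> in \<open>Y (Suc r)\<close> into the image of
    \<open>Y (r + Suc k)\<close> in \<open>Y r\<close>. Modulo this image, \<open>sF\<close> cancels
    the error.\<close>
  have gy: "\<gamma> r (Suc k) \<bullet> \<pi> r \<bullet> y = Nul A T (Cod A (\<gamma> r (Suc k)))" for r k
  proof -
    let ?g = "\<gamma> r (Suc k)"
    let ?G = "Cod A ?g"
    have g: "?g \<in> Hom A (Y r) ?G" using \<gamma>A[of r "Suc k"] by simp
    have "?g \<bullet> f r \<bullet> D (Suc r) k = Nul A (Y (Suc r + k)) ?G"
      using \<gamma>A(3)[of r "Suc k"] unfolding DF by simp
    then obtain w where w: "w \<in> Hom A (Cod A (\<gamma> (Suc r) k)) ?G" "w \<bullet> \<gamma> (Suc r) k = ?g \<bullet> f r"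
      by (rule_tac A.cokernel_desc[OF \<gamma>(1)[of "Suc r" k], of "?g \<bullet> f r"]) (use g Y(3-5) Dh Yob in simp_all)
    have gx: "\<gamma> r' k' \<bullet> \<pi> r' \<bullet> x = \<gamma> r' k' \<bullet> s r' k' \<bullet> e" for r' k'
    proof -
      have "\<gamma> r' k' \<bullet> \<pi> r' \<bullet> x = n r' k' \<bullet> v r' \<bullet> \<pi> r' \<bullet> x"
        using A.cmp_eq[OF nv[of r' k'], of "\<pi> r' \<bullet> x"] n[of r' k'] v(2-4)[of r'] \<pi> xh by simp
      also have "\<dots> = n r' k' \<bullet> z r' \<bullet> e" unfolding vx ..
      also have "\<dots> = \<gamma> r' k' \<bullet> s r' k' \<bullet> e"
        using A.cmp_eq[OF z(4)[of r' k'], of e] n[of r' k'] z(1-3)[of r'] eh \<gamma>A[of r' k'] sh[of r' k'] by simp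
      finally show ?thesis .
    qed
    have gfx: "?g \<bullet> f r \<bullet> \<pi> (Suc r) \<bullet> x = ?g \<bullet> f r \<bullet> s (Suc r) k \<bullet> e"
    proof -
      have "?g \<bullet> f r \<bullet> \<pi> (Suc r) \<bullet> x = w \<bullet> \<gamma> (Suc r) k \<bullet> \<pi> (Suc r) \<bullet> x"
        using A.cmp_eq[OF w(2), of "\<pi> (Suc r) \<bullet> x"] w(1) \<gamma>A[of "Suc r" k] g Y(3-5)[of r] \<pi> xh by simp
      also have "\<dots> = w \<bullet> \<gamma> (Suc r) k \<bullet> s (Suc r) k \<bullet> e" unfolding gx ..
      also have "\<dots> = ?g \<bullet> f r \<bullet> s (Suc r) k \<bullet> e"
        using A.cmp_eq[OF w(2), of "s (Suc r) k \<bullet> e"] w(1) \<gamma>A[of "Suc r" k] g Y(3-5)[of r] sh[of "Suc r" k] eh by simp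
      finally show ?thesis .
    qed
    have h1: "?g \<bullet> \<pi> r \<bullet> x \<in> Hom A T ?G" "?g \<bullet> f r \<bullet> \<pi> (Suc r) \<bullet> x \<in> Hom A T ?G" "?g \<bullet> \<pi> r \<bullet> e \<in> Hom A T ?G"
      using g \<pi> xh eh Y(3-5)[of r] by simp_all
    have "?g \<bullet> \<pi> r \<bullet> d \<bullet> x = Diff A (?g \<bullet> \<pi> r \<bullet> x) (?g \<bullet> f r \<bullet> \<pi> (Suc r) \<bullet> x)"
      unfolding d\<pi>x[OF xh] by (rule A.cmp_Diff[OF _ _ g]) (use \<pi> xh Y(3-5)[of r] in simp_all)
    also have "\<dots> = ?g \<bullet> \<pi> r \<bullet> e"
    proof (subst A.Diff_eq_iff[OF h1])
      have "?g \<bullet> \<pi> r \<bullet> x = ?g \<bullet> (s r (Suc k) \<bullet> e)" by (rule gx)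
      also have "s r (Suc k) \<bullet> e = Add A (\<pi> r \<bullet> e) ((f r \<bullet> s (Suc r) k) \<bullet> e)"
        unfolding sF by (rule A.add_cmp[OF eh, of _ "Y r"]) (use \<pi> sh Y(3-5)[of r] in simp_all)
      also have "?g \<bullet> Add A (\<pi> r \<bullet> e) ((f r \<bullet> s (Suc r) k) \<bullet> e) = Add A (?g \<bullet> \<pi> r \<bullet> e) (?g \<bullet> (f r \<bullet> s (Suc r) k) \<bullet> e)"
        by (rule A.cmp_add[OF _ _ g, of _ T]) (use \<pi> sh Y(3-5)[of r] eh in simp_all)
      also have "?g \<bullet> (f r \<bullet> s (Suc r) k) \<bullet> e = ?g \<bullet> f r \<bullet> \<pi> (Suc r) \<bullet> x"
        unfolding gfx using sh[of "Suc r" k] Y(3-5)[of r] eh by simp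
      finally show "?g \<bullet> \<pi> r \<bullet> x = Add A (?g \<bullet> \<pi> r \<bullet> e) (?g \<bullet> f r \<bullet> \<pi> (Suc r) \<bullet> x)" .
    qed
    finally have eq: "?g \<bullet> \<pi> r \<bullet> e = ?g \<bullet> \<pi> r \<bullet> d \<bullet> x" ..
    have "\<pi> r \<bullet> y = Diff A (\<pi> r \<bullet> e) (\<pi> r \<bullet> d \<bullet> x)"
      unfolding y_def by (rule A.cmp_Diff[OF eh dx, of _ "Y r"]) (use \<pi> in simp)
    then have "?g \<bullet> \<pi> r \<bullet> y = Diff A (?g \<bullet> \<pi> r \<bullet> e) (?g \<bullet> \<pi> r \<bullet> d \<bullet> x)"
      using A.cmp_Diff[of "\<pi> r \<bullet> e" T "Y r" "\<pi> r \<bullet> d \<bullet> x" ?g ?G] g \<pi> eh dx dh xh by simp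
    then show ?thesis using eq h1(3) g \<pi> dh xh by simp
  qed
  have vy: "v r \<bullet> \<pi> r \<bullet> y = Nul A T (N r)" for r
  proof (rule A.lim_cone_eq[OF Nl his, of _ T])
    fix k
    have "n r k \<bullet> v r \<bullet> \<pi> r \<bullet> y = \<gamma> r k \<bullet> \<pi> r \<bullet> y"
      using A.cmp_eq[OF nv[of r k], of "\<pi> r \<bullet> y"] n[of r k] v(2-4)[of r] \<pi> yh by simp
    also have "\<dots> = h r k \<bullet> \<gamma> r (Suc k) \<bullet> \<pi> r \<bullet> y"
      using A.cmp_eq[OF h(4)[of r k], of "\<pi> r \<bullet> y"] h(1-3)[of r k] \<gamma>A[of r] \<pi> yh by simp
    also have "\<dots> = n r k \<bullet> Nul A T (N r)" unfolding gy using h(1-3)[of r k] n[of r k] Tob Nob \<gamma>ob by simp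
    finally show "n r k \<bullet> v r \<bullet> \<pi> r \<bullet> y = n r k \<bullet> Nul A T (N r)" .
  qed (use v \<pi> yh Tob Nob in simp_all)

  \<comment> \<open>\<open>m\<close> is the image of \<open>p r\<close> and \<open>c\<close> the
    epic onto it. The cokernel \<open>v r\<close> kills the component of \<open>y\<close>, so this
    component factors through the image, by \<open>i\<close>.\<close>
  have "\<forall>r. \<exists>b. case b of (m, c, i) \<Rightarrow> epic A c \<and> monic A m \<and> Dom A c = L \<and> Cod A m = Y r \<and> Cod A c = Dom A m \<and> m \<bullet> c = p r
     \<and> i \<in> Hom A T (Dom A m) \<and> m \<bullet> i = \<pi> r \<bullet> y"
  proof
    fix r
    obtain c m where cm: "epic A c" "monic A m" "Dom A c = Dom A (p r)" "Cod A m = Cod A (p r)" "Cod A c = Dom A m" "m \<bullet> c = p r"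
      by (rule A.image_factorization[OF pp(1)])
    have cA: "c \<in> Ar A" and mA: "m \<in> Ar A" using cm by simp_all
    have vm: "v r \<bullet> m = Nul A (Dom A m) (N r)"
    proof (rule A.epicD[OF cm(1)])
      have "(v r \<bullet> m) \<bullet> c = v r \<bullet> p r" using cm v(2,3)[of r] cA mA pp(3)[of r] by simp
      then show "(v r \<bullet> m) \<bullet> c = Nul A (Dom A m) (N r) \<bullet> c"
        using A.is_cokernelD(4)[OF v(1)[of r]] v(4)[of r] cm cA Nob by simp
    qed (use v cm mA pp Nob in simp_all)
    obtain v2 where v2: "is_cokernel A m v2" using A.cokernel_ex[OF mA] by blast
    note v2' = A.is_cokernelD[OF v2]
    have "(v2 \<bullet> m) \<bullet> c = Nul A (Dom A c) (Cod A v2)" unfolding v2'(4) using cA v2'(2) cm by simp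
    then have "v2 \<bullet> p r = Nul A (Dom A (p r)) (Cod A v2)" using cm v2'(2,3) cA mA by simp
    then obtain w where w: "w \<in> Hom A (Cod A (v r)) (Cod A v2)" "w \<bullet> v r = v2"
      by (rule_tac A.cokernel_desc[OF v(1)[of r], of v2]) (use v2' cm in simp_all)
    have "v2 \<bullet> \<pi> r \<bullet> y = w \<bullet> v r \<bullet> \<pi> r \<bullet> y"
      using A.cmp_eq[OF w(2), of "\<pi> r \<bullet> y"] w(1) v(2-4)[of r] \<pi> yh by simp
    also have "\<dots> = Nul A T (Cod A v2)" unfolding vy using w(1) Tob v(4) v2' by simp
    finally obtain i where "i \<in> Hom A (Dom A (\<pi> r \<bullet> y)) (Dom A m)" "m \<bullet> i = \<pi> r \<bullet> y"
      by (rule_tac A.kernel_lift[OF A.short_exactD(1)[OF A.monic_short_exact[OF cm(2) v2]], of "\<pi> r \<bullet> y"])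
        (use \<pi> yh v2' cm pp in simp_all)
    then show "\<exists>b. case b of (m, c, i) \<Rightarrow> epic A c \<and> monic A m \<and> Dom A c = L \<and> Cod A m = Y r \<and> Cod A c = Dom A m \<and> m \<bullet> c = p r
     \<and> i \<in> Hom A T (Dom A m) \<and> m \<bullet> i = \<pi> r \<bullet> y"
      using cm pp \<pi> yh by (intro exI[of _ "(m, c, i)"]) simp
  qed
  then have "\<exists>b. \<forall>r. case b r of (m, c, i) \<Rightarrow> epic A c \<and> monic A m \<and> Dom A c = L \<and> Cod A m = Y r \<and> Cod A c = Dom A m \<and> m \<bullet> c = p r
     \<and> i \<in> Hom A T (Dom A m) \<and> m \<bullet> i = \<pi> r \<bullet> y" by (rule choice)
  then obtain b where b: "\<forall>r. case b r of (m, c, i) \<Rightarrow> epic A c \<and> monic A m \<and> Dom A c = L \<and> Cod A m = Y r \<and> Cod A c = Dom A m \<and> m \<bullet> c = p r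
     \<and> i \<in> Hom A T (Dom A m) \<and> m \<bullet> i = \<pi> r \<bullet> y" ..
  define m cc i where "m r = fst (b r)" and "cc r = fst (snd (b r))" and "i r = snd (snd (b r))" for r
  have B: "epic A (cc r)" "monic A (m r)" "Dom A (cc r) = L" "Cod A (m r) = Y r" "Cod A (cc r) = Dom A (m r)" "m r \<bullet> cc r = p r"
     "i r \<in> Hom A T (Dom A (m r))" "m r \<bullet> i r = \<pi> r \<bullet> y" for r
    using b[rule_format, of r] by (simp_all add: m_def cc_def i_def case_prod_beta)
  have BA: "cc r \<in> Ar A" "m r \<in> Ar A" "i r \<in> Ar A" "Dom A (i r) = T" "Cod A (i r) = Dom A (m r)" for r using B[of r] by simp_all
  obtain PL \<rho> where PL: "is_product A (UNIV :: nat set) (\<lambda>_. L) PL \<rho>" using nat_product[of "\<lambda>_. L"] Lob by blast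
  have \<rho>: "\<rho> r \<in> Ar A" "Dom A (\<rho> r) = PL" "Cod A (\<rho> r) = L" for r using is_productD(3)[OF PL, of r] by simp_all
  obtain PI \<sigma> where PI: "is_product A UNIV (\<lambda>r. Dom A (m r)) PI \<sigma>" using nat_product[of "\<lambda>r. Dom A (m r)"] BA by auto
  have \<sigma>: "\<sigma> r \<in> Ar A" "Dom A (\<sigma> r) = PI" "Cod A (\<sigma> r) = Dom A (m r)" for r using is_productD(3)[OF PI, of r] by simp_all
  obtain E where E: "E \<in> Hom A PL PI" "\<And>r. r \<in> UNIV \<Longrightarrow> \<sigma> r \<bullet> E = cc r \<bullet> \<rho> r"
    by (rule product_tuple[OF PI is_productD(2)[OF PL], of "\<lambda>r. cc r \<bullet> \<rho> r"]) (use B BA \<rho> in simp_all)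
  have Ee: "epic A E"
    by (rule nat_product_epic[of cc PL \<rho> PI \<sigma>]) (use B PL PI E in simp_all)
  obtain J where J: "J \<in> Hom A T PI" "\<And>r. r \<in> UNIV \<Longrightarrow> \<sigma> r \<bullet> J = i r"
    by (rule product_tuple[OF PI Tob, of i]) (use B in simp_all)
  have JA: "J \<in> Ar A" "Cod A J = Cod A E" using J E by simp_all
  obtain e2 w where e2: "epic A e2" "Cod A e2 = Dom A J" "w \<in> Hom A (Dom A e2) (Dom A E)" "E \<bullet> w = J \<bullet> e2"
    by (rule A.cover[OF Ee JA])
  define T2 where "T2 = Dom A e2"
  have e2h: "e2 \<in> Hom A T2 T" and wh: "w \<in> Hom A T2 PL" using e2 J E by (simp_all add: T2_def)
  have T2ob: "T2 \<in> Ob A" using e2h by auto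
  have pw: "p r \<bullet> \<rho> r \<bullet> w = \<pi> r \<bullet> y \<bullet> e2" for r
  proof -
    have "p r \<bullet> \<rho> r \<bullet> w = m r \<bullet> cc r \<bullet> \<rho> r \<bullet> w"
      using A.cmp_eq[OF B(6)[of r], of "\<rho> r \<bullet> w"] B(3-5)[of r] BA[of r] \<rho> wh by simp
    also have "cc r \<bullet> \<rho> r \<bullet> w = \<sigma> r \<bullet> E \<bullet> w"
      using A.cmp_eq[OF E(2)[of r], of w] B(3-5)[of r] BA[of r] \<rho> \<sigma> E(1) wh by simp
    also have "\<dots> = i r \<bullet> e2" unfolding e2(4) using A.cmp_eq[OF J(2)[of r], of e2] \<sigma> J(1) e2h by simp
    also have "m r \<bullet> i r \<bullet> e2 = \<pi> r \<bullet> y \<bullet> e2"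
      using A.cmp_eq[OF B(8)[of r], of e2] BA[of r] e2h \<pi> yh by simp
    finally show ?thesis .
  qed
  \<comment> \<open>The negated partial sums of the \<open>\<rho> r \<bullet> w\<close>. Their
    successive differences are the given family, which solves the equation for the constant sequence
    \<open>L\<close>.\<close>
  define t where "t = rec_nat (Nul A T2 L) (\<lambda>r x. Diff A x (\<rho> r \<bullet> w))"
  have t0: "t 0 = Nul A T2 L" and tS: "t (Suc r) = Diff A (t r) (\<rho> r \<bullet> w)" for r by (simp_all add: t_def)
  have rw: "\<rho> r \<bullet> w \<in> Hom A T2 L" for r using \<rho> wh by simp
  have th0: "t r \<in> Hom A T2 L" for r
  proof (induction r)
    case (Suc r) show ?case unfolding tS by (rule A.Diff_hom(1)[OF Suc rw])
  qed (use t0 T2ob Lob in simp)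
  then have th: "t r \<in> Ar A" "Dom A (t r) = T2" "Cod A (t r) = L" for r by simp_all
  have td: "Diff A (t r) (t (Suc r)) = \<rho> r \<bullet> w" for r
    unfolding A.Diff_eq_iff[OF th0 th0 rw]
    using A.Diff_hom(2)[OF th0[of r] rw[of r]] A.add_commute[OF th0[of "Suc r"] rw[of r]] by (simp add: tS)
  obtain q where q: "q \<in> Hom A T2 P" "\<And>r. r \<in> UNIV \<Longrightarrow> \<pi> r \<bullet> q = p r \<bullet> t r"
    by (rule product_tuple[OF P T2ob, of "\<lambda>r. p r \<bullet> t r"]) (use pp th in simp_all)
  \<comment> \<open>Because \<open>f r \<bullet> p (Suc r) = p r\<close>, the arrow
    \<open>1 - f\<close> on the family \<open>p r \<bullet> t r\<close> becomes the difference
    \<open>t r - t (Suc r)\<close> and gives back \<open>y\<close> on the cover. Adding the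
    approximate preimage \<open>x\<close> yields an exact preimage of an epic.\<close>
  have dq: "d \<bullet> q = y \<bullet> e2"
  proof (rule A.product_eq[OF P, of _ T2])
    fix r
    have "\<pi> r \<bullet> d \<bullet> q = Diff A (p r \<bullet> t r) (f r \<bullet> p (Suc r) \<bullet> t (Suc r))"
      unfolding d\<pi>x[OF q(1)] using q(2) by simp
    also have "f r \<bullet> p (Suc r) \<bullet> t (Suc r) = p r \<bullet> t (Suc r)"
      using A.cmp_eq[OF pp(4)[of r], of "t (Suc r)"] pp(1-3) th Y(3-5)[of r] by simp
    also have "Diff A (p r \<bullet> t r) (p r \<bullet> t (Suc r)) = p r \<bullet> \<rho> r \<bullet> w"
      unfolding td[symmetric] by (rule A.cmp_Diff[symmetric, OF th0 th0, of _ "Y r"]) (use pp in simp)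
    finally show "\<pi> r \<bullet> d \<bullet> q = \<pi> r \<bullet> y \<bullet> e2" unfolding pw .
  qed (use dh q yh e2h in simp_all)
  have "Add A y (d \<bullet> x) = e" unfolding y_def by (rule A.Diff_hom(2)[OF eh dx])
  then have "e \<bullet> e2 = Add A (y \<bullet> e2) ((d \<bullet> x) \<bullet> e2)"
    using A.add_cmp[OF e2h yh dx] by simp
  also have "\<dots> = Add A (d \<bullet> q) (d \<bullet> x \<bullet> e2)" unfolding dq using dh xh e2h by simp
  also have "\<dots> = d \<bullet> Add A q (x \<bullet> e2)"
    by (rule A.cmp_add[symmetric, OF q(1), of _ _ P]) (use dh xh e2h in simp_all)
  finally have fin: "d \<bullet> Add A q (x \<bullet> e2) = e \<bullet> e2" ..
  have "Add A q (x \<bullet> e2) \<in> Hom A T2 P" using q(1) xh e2h by simp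
  then show ?thesis
    by (intro A.epic_of_local[OF dh(1) A.epic_cmp[OF e2(1) e(1)] _ fin]) (use eh e2h dh in simp_all)
qed

end

section \<open>Lengths along acceptable sequences\<close>

lemma enat_sum_bounded_finite:
  fixes g :: "nat \<Rightarrow> enat"
  assumes "\<And>n. (\<Sum>r<n. g r) \<le> enat N"
  shows "finite {r. g r \<noteq> 0}"
proof (rule ccontr)
  assume "infinite {r. g r \<noteq> 0}"
  then obtain F where F: "F \<subseteq> {r. g r \<noteq> 0}" "finite F" "card F = Suc N"
    using infinite_arbitrarily_large by metis
  obtain n where n: "F \<subseteq> {..<n}" using finite_nat_iff_bounded[of F] F(2) by blast
  have "enat (Suc N) = (\<Sum>r\<in>F. 1)" using F by (simp add: of_nat_eq_enat)
  also have "\<dots> \<le> (\<Sum>r\<in>F. g r)"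
    by (rule sum_mono) (use F(1) in \<open>auto simp: one_enat_def ileI1 zero_less_iff_neq_zero Suc_ile_eq zero_enat_def[symmetric]\<close>)
  also have "\<dots> \<le> (\<Sum>r<n. g r)" by (rule sum_mono2) (use n in auto)
  also have "\<dots> \<le> enat N" by (rule assms)
  finally show False by simp
qed

context abelian_category
begin

text \<open>The image splits the exact sequence from kernel to cokernel into two short ones. The
  identity is stated with sums on both sides because infinite lengths are not excluded.\<close>

lemma len_exact4:
  assumes P: "simple_class A P" and k: "is_kernel A f k" and c: "is_cokernel A f c"
  shows "len A P (Dom A f) + len A P (Cod A c) = len A P (Cod A f) + len A P (Dom A k)"
proof -
  note k' = is_kernelD[OF k] note c' = is_cokernelD[OF c]
  obtain e m where em: "epic A e" "monic A m" "Dom A e = Dom A f" "Cod A m = Cod A f" "Cod A e = Dom A m" "m \<bullet> e = f"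
    by (rule image_factorization[OF k'(1)])
  have eA: "e \<in> Ar A" and mA: "m \<in> Ar A" using em by simp_all
  have ke: "is_kernel A e k"
  proof (rule kernelI)
    show "monic A k" by (rule kernel_monic[OF k])
    have "m \<bullet> e \<bullet> k = Nul A (Dom A k) (Cod A m)" using cmp_eq[OF em(6), of k] k' em eA mA by simp
    then show "e \<bullet> k = Nul A (Dom A k) (Cod A e)" using monic_nulD[OF em(2), of "e \<bullet> k"] k' em eA by simp
    fix g assume g: "g \<in> Ar A" "Cod A g = Dom A e" "e \<bullet> g = Nul A (Dom A g) (Cod A e)"
    have "f \<bullet> g = m \<bullet> e \<bullet> g" using cmp_eq[OF em(6), of g] g em eA mA by simp
    then have "f \<bullet> g = Nul A (Dom A g) (Cod A f)" using g em mA by simp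
    then obtain h where "h \<in> Hom A (Dom A g) (Dom A k)" "k \<bullet> h = g"
      by (rule_tac kernel_lift[OF k g(1)]) (use g em in simp_all)
    then show "\<exists>h. h \<in> Hom A (Dom A g) (Dom A k) \<and> k \<bullet> h = g" by blast
  qed (use k' em eA in simp_all)
  have mc: "is_cokernel A m c"
  proof (rule cokernelI)
    show "epic A c" by (rule cokernel_epic[OF c])
    have "(c \<bullet> m) \<bullet> e = Nul A (Dom A e) (Cod A c)" using c' em eA mA by simp
    then show "c \<bullet> m = Nul A (Dom A m) (Cod A c)" using epic_nulD[OF em(1), of "c \<bullet> m"] c' em mA by simp
    fix g assume g: "g \<in> Ar A" "Dom A g = Cod A m" "g \<bullet> m = Nul A (Dom A m) (Cod A g)"
    have "g \<bullet> f = (g \<bullet> m) \<bullet> e" using g(1,2) em eA mA by simp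
    then have "g \<bullet> f = Nul A (Dom A f) (Cod A g)" unfolding g(3) using g(1) em eA by simp
    then obtain h where "h \<in> Hom A (Cod A c) (Cod A g)" "h \<bullet> c = g"
      by (rule_tac cokernel_desc[OF c g(1)]) (use g em in simp_all)
    then show "\<exists>h. h \<in> Hom A (Cod A c) (Cod A g) \<and> h \<bullet> c = g" by blast
  qed (use c' em mA in simp_all)
  have 1: "len A P (Dom A f) = len A P (Dom A k) + len A P (Dom A m)"
    using len_ses[OF P epic_short_exact[OF em(1) ke]] k' em by simp
  have 2: "len A P (Cod A f) = len A P (Dom A m) + len A P (Cod A c)"
    using len_ses[OF P monic_short_exact[OF em(2) mc]] em by simp
  show ?thesis unfolding 1 2 by (simp add: ac_simps)
qed

text \<open>The cokernel of the composite contains the image \<open>Dom A m\<close> of the cokernel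
  of \<open>f\<close>, and what remains is a quotient of the cokernel of \<open>g\<close>.\<close>

lemma len_cokernel_cmp:
  assumes P: "simple_class A P" and c1: "is_cokernel A f c1" and c2: "is_cokernel A g c2"
    and c3: "is_cokernel A (g \<bullet> f) c3" and gf: "Dom A g = Cod A f"
  shows "len A P (Cod A c3) \<le> len A P (Cod A c1) + len A P (Cod A c2)"
proof -
  note c1' = is_cokernelD[OF c1] note c2' = is_cokernelD[OF c2] note c3' = is_cokernelD[OF c3]
  have d3: "Dom A c3 = Cod A g" "Dom A (g \<bullet> f) = Dom A f" using c1'(1) c2'(1) c3'(3) gf by simp_all
  have "(c3 \<bullet> g) \<bullet> f = Nul A (Dom A f) (Cod A c3)" using c3'(2,4) c1'(1) c2'(1) gf d3 by simp
  then obtain h where h: "h \<in> Hom A (Cod A c1) (Cod A c3)" "h \<bullet> c1 = c3 \<bullet> g"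
    by (rule_tac cokernel_desc[OF c1, of "c3 \<bullet> g"]) (use c3'(2) c2'(1) gf d3 in simp_all)
  have hA: "h \<in> Ar A" using h by simp
  obtain e m where em: "epic A e" "monic A m" "Dom A e = Dom A h" "Cod A m = Cod A h" "Cod A e = Dom A m" "m \<bullet> e = h"
    by (rule image_factorization[OF hA])
  have eA: "e \<in> Ar A" and mA: "m \<in> Ar A" using em by simp_all
  obtain w where w: "is_cokernel A m w" using cokernel_ex[OF mA] by blast
  note w' = is_cokernelD[OF w]
  have "w \<bullet> h = (w \<bullet> m) \<bullet> e" unfolding em(6)[symmetric] using w'(2,3) mA eA em(5) by simp
  also have "\<dots> = Nul A (Cod A c1) (Cod A w)" unfolding w'(4) using eA w'(2) em(3,5) h(1) by simp
  finally have wh: "w \<bullet> h = Nul A (Cod A c1) (Cod A w)" .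
  have "(w \<bullet> c3) \<bullet> g = w \<bullet> h \<bullet> c1" unfolding h(2) using w'(2,3) c3'(2) c2'(1) d3 em h(1) by simp
  also have "\<dots> = Nul A (Dom A g) (Cod A w)"
    using cmp_eq[OF wh, of c1] h(1) c1'(2,3) w'(2,3) em gf by simp
  finally obtain v where v: "v \<in> Hom A (Cod A c2) (Cod A w)" "v \<bullet> c2 = w \<bullet> c3"
    by (rule_tac cokernel_desc[OF c2, of "w \<bullet> c3"]) (use c3'(2) w'(2,3) em h(1) d3 in simp_all)
  have "epic A (w \<bullet> c3)" by (rule epic_cmp[OF cokernel_epic[OF c3] cokernel_epic[OF w]]) (use w' em h in simp)
  then have ve: "epic A v" by (rule_tac epic_cmpD[of v c2]) (use v c2' in simp_all)
  have "len A P (Cod A c3) = len A P (Dom A m) + len A P (Cod A w)"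
    using len_ses[OF P monic_short_exact[OF em(2) w]] em h by simp
  also have "len A P (Dom A m) \<le> len A P (Cod A c1)" using len_epic[OF P em(1)] em h by simp
  also have "len A P (Cod A w) \<le> len A P (Cod A c2)" using len_epic[OF P ve] v by simp
  finally show ?thesis by (simp add: add_mono)
qed

end

lemma simple_object_op:
  assumes "abelian_category A" "simple_object A S" shows "simple_object (op_cat A) S"
proof -
  interpret abelian_category A by fact
  show ?thesis unfolding simple_object_def
  proof (intro conjI allI impI)
    show "S \<in> Ob (op_cat A)" "\<not> zero_object (op_cat A) S" using assms(2) by (simp_all add: simple_object_def)
    fix e assume "monic (op_cat A) e \<and> Cod (op_cat A) e = S"
    then have e: "epic A e" "Dom A e = S" by simp_all
    then have eA: "e \<in> Ar A" by simp
    obtain k where k: "is_kernel A e k" using kernel_ex[OF eA] by blast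
    have "zero_object A (Dom A k) \<or> isomorphism A k"
      using assms(2) kernel_monic[OF k] is_kernelD(3)[OF k] e(2) unfolding simple_object_def by simp
    then show "zero_object (op_cat A) (Dom (op_cat A) e) \<or> isomorphism (op_cat A) e"
      using zero_epic_kernel[OF epic_short_exact[OF e(1) k]]
        epic_iff_cokernel_zero[OF short_exactD(2)[OF epic_short_exact[OF e(1) k]]] isomorphism_epic[of k] by auto
  qed
qed

lemma simple_class_op:
  assumes "abelian_category A" "simple_class A P" shows "simple_class (op_cat A) P"
  unfolding simple_class_def
proof (intro conjI allI impI)
  interpret abelian_category A by fact
  fix X assume "P X"
  show "simple_object (op_cat A) X"
    by (rule simple_object_op[OF assms(1) simple_classD(1)[OF assms(2) \<open>P X\<close>]])
  fix Y assume "isomorphic (op_cat A) X Y"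
  then have "isomorphic A Y X" by simp
  then have "isomorphic A X Y" by (rule isomorphic_sym)
  then show "P Y" using simple_classD(4)[OF assms(2) \<open>P X\<close>] by blast
qed

context lim_setting
begin

lemma len_exact4_C:
  assumes "simple_class C P" "is_kernel A f k" "is_cokernel A f c" "Dom A f \<in> Ob C" "Cod A f \<in> Ob C" "Dom A k \<in> Ob C" "Cod A c \<in> Ob C"
  shows "len C P (Dom A f) + len C P (Cod A c) = len C P (Cod A f) + len C P (Dom A k)"
  using C.len_exact4[OF assms(1), of f k c] assms(2-) by (simp add: is_kernel_C is_cokernel_C)

lemma len_ses_C:
  assumes "simple_class C P" "short_exact A f g" "Dom A f \<in> Ob C" "Cod A f \<in> Ob C" "Cod A g \<in> Ob C"
  shows "len C P (Cod A f) = len C P (Dom A f) + len C P (Cod A g)"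
  using C.len_ses[OF assms(1), of f g] assms(2-) by (simp add: short_exact_C)

lemma down_C:
  assumes "acceptable_inverse A C X f"
  shows "down A X f r \<in> Ar A" "Dom A (down A X f r) = X r" "Cod A (down A X f r) = X 0"
  using A.down_hom[OF acceptableD(1)[OF assms], of r] by simp_all

text \<open>Used with \<open>b = 0\<close> to exclude a factor at all finite stages, and with
  \<open>b = 1\<close> to bound the length of a finite stage of a chain with simple
  quotients.\<close>

lemma len_cokernel_down:
  assumes P: "simple_class C P" and f: "inverse_sequence A X f" "\<And>r. X r \<in> Ob C"
    and c: "is_cokernel A (down A X f r) c" "Cod A c \<in> Ob C"
    and bound: "\<And>r c. is_cokernel A (f r) c \<Longrightarrow> Cod A c \<in> Ob C \<Longrightarrow> len C P (Cod A c) \<le> b"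
  shows "len C P (Cod A c) \<le> of_nat r * b"
  using c
proof (induction r arbitrary: c)
  case 0
  have "zero_object A (Cod A c)"
    using A.epic_iff_cokernel_zero[OF 0(1)] A.isomorphism_epic A.isomorphism_idn inverse_sequenceD(1)[OF f(1)] by simp
  then show ?case using C.len_zero[OF P] 0(2) by (simp add: zero_object_C)
next
  case (Suc r)
  have D: "down A X f r \<in> Ar A" "Dom A (down A X f r) = X r" "Cod A (down A X f r) = X 0"
    using A.down_hom[OF f(1), of r] by simp_all
  have F: "f r \<in> Ar A" "Dom A (f r) = X (Suc r)" "Cod A (f r) = X r" using inverse_sequenceD(2)[OF f(1), of r] by simp_all
  obtain c2 where c2: "is_cokernel A (down A X f r) c2" "Cod A c2 \<in> Ob C"
    by (rule cokernel_ex_C[OF D(1)]) (use D f(2) in simp_all)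
  obtain c1 where c1: "is_cokernel A (f r) c1" "Cod A c1 \<in> Ob C"
    by (rule cokernel_ex_C[OF F(1)]) (use F f(2) in simp_all)
  have "len C P (Cod C c) \<le> len C P (Cod C c1) + len C P (Cod C c2)"
    by (rule C.len_cokernel_cmp[OF P, of "f r" c1 "down A X f r"])
      (use c1 c2 Suc.prems D F f(2) in \<open>simp_all add: is_cokernel_C\<close>)
  also have "\<dots> \<le> b + of_nat r * b"
    using bound[OF c1] Suc.IH[OF c2] by (simp add: add_mono)
  finally show ?case by (simp add: distrib_right)
qed

text \<open>A simple subquotient of \<open>Z\<close> that survives in the cokernel of \<open>lim X \<rightarrow> X 0\<close> is already seen
  at a finite stage, by local AB5*.\<close>

lemma lim_quotient_zero:
  assumes P: "simple_class C P" and acc: "acceptable_inverse A C X f" and L: "lim_cone A X f L p"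
    and cok: "\<And>r c. is_cokernel A (f r) c \<Longrightarrow> Cod A c \<in> Ob C \<Longrightarrow> len C P (Cod A c) = 0"
    and q: "epic A q" "Dom A q = X 0" "Cod A q \<in> Ob C" "q \<bullet> p 0 = Nul A L (Cod A q)"
  shows "len C P (Cod A q) = 0"
proof (rule ccontr)
  assume "len C P (Cod A q) \<noteq> 0"
  then obtain q' s where q': "epic C q'" "Dom C q' = Cod A q" "monic C s" "Cod C s = Cod C q'" "P (Dom C s)"
    by (rule C.len_nonzero_subquotient[OF P])
  note X = acceptableD[OF acc] note D = down_C[OF acc]
  have p: "p 0 \<in> Ar A" "Dom A (p 0) = L" "Cod A (p 0) = X 0" using lim_coneD(2)[OF L, of 0] by simp_all
  have qA: "q \<in> Ar A" using q by simp
  have q'': "epic A q'" "q' \<in> Ar A" "Dom A q' = Cod A q" "Cod A q' \<in> Ob C" using q'(1,2) by (simp_all add: epic_C)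
  have s: "monic A s" "s \<in> Ar A" "Cod A s = Cod A q'" "Dom A s \<in> Ob C" using q'(3,4) by (simp_all add: monic_C)
  \<comment> \<open>\<open>u\<close> maps \<open>X 0\<close> onto a quotient that contains the
    simple object \<open>Dom A s\<close> and still kills the limit.\<close>
  define u where "u = q' \<bullet> q"
  have u: "u \<in> Ar A" "Dom A u = X 0" "Cod A u = Cod A q'" "epic A u"
    using qA q q'' A.epic_cmp[OF q(1) q''(1)] by (simp_all add: u_def)
  have uh: "u \<in> Hom A (X 0) (Cod A q')" using u by simp
  have up: "u \<bullet> p 0 = Nul A L (Cod A q')" using q q'' qA p lim_coneD(1)[OF L] by (simp add: u_def)
  have "\<forall>r. \<exists>c. is_cokernel A (u \<bullet> down A X f r) c \<and> Cod A c \<in> Ob C"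
  proof
    fix r
    obtain c where "is_cokernel A (u \<bullet> down A X f r) c" "Cod A c \<in> Ob C"
      by (rule cokernel_ex_C[of "u \<bullet> down A X f r"]) (use u D X(2) q'' in simp_all)
    then show "\<exists>c. is_cokernel A (u \<bullet> down A X f r) c \<and> Cod A c \<in> Ob C" by blast
  qed
  then have "\<exists>\<gamma>. \<forall>r. is_cokernel A (u \<bullet> down A X f r) (\<gamma> r) \<and> Cod A (\<gamma> r) \<in> Ob C" by (rule choice)
  then obtain \<gamma> where \<gamma>0: "\<forall>r. is_cokernel A (u \<bullet> down A X f r) (\<gamma> r) \<and> Cod A (\<gamma> r) \<in> Ob C" ..
  then have \<gamma>: "\<And>r. is_cokernel A (u \<bullet> down A X f r) (\<gamma> r)" "\<And>r. Cod A (\<gamma> r) \<in> Ob C" by blast+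
  have \<gamma>A: "\<gamma> r \<in> Ar A" "Dom A (\<gamma> r) = Cod A q'" "\<gamma> r \<bullet> u \<bullet> down A X f r = Nul A (X r) (Cod A (\<gamma> r))" for r
    using A.is_cokernelD[OF \<gamma>(1)[of r]] u D[of r] by simp_all
  have S: "simple_object C (Dom A s)" using C.simple_classD(1)[OF P q'(5)] by simp
  \<comment> \<open>If \<open>s\<close> vanished in every finite-stage cokernel, then
    \<open>lim_detect\<close> would lift it to the limit, which \<open>u \<bullet> p 0\<close>
    kills. Then \<open>s\<close> would be zero.\<close>
  have "\<exists>r. \<gamma> r \<bullet> s \<noteq> Nul A (Dom A s) (Cod A (\<gamma> r))"
  proof (rule ccontr)
    assume "\<not> ?thesis"
    then have n: "\<And>r. \<gamma> r \<bullet> s = Nul A (Dom A s) (Cod A (\<gamma> r))" by blast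
    have sh: "s \<in> Hom A (Dom A s) (Cod A q')" using s by simp
    obtain e t where e: "epic A e" "Cod A e = Dom A s" "t \<in> Hom A (Dom A e) L" "(u \<bullet> p 0) \<bullet> t = s \<bullet> e"
      by (rule lim_detect[OF acc L q''(4) uh \<gamma> sh n]) blast
    have eA: "e \<in> Ar A" using e by simp
    have "s \<bullet> e = Nul A (Dom A e) (Cod A s)" using e(3) e(4)[symmetric] s q'' unfolding up by simp
    then have "s = Nul A (Dom A s) (Cod A s)" using A.epic_nulD[OF e(1), of s] e(2) s by simp
    then have "s \<bullet> Idn A (Dom A s) = s \<bullet> Nul A (Dom A s) (Dom A s)" using s by simp
    then have "Idn A (Dom A s) = Nul A (Dom A s) (Dom A s)" using A.monicD[OF s(1)] s by simp
    then have "zero_object C (Dom A s)" using s by (simp add: zero_object_C A.zero_object_iff)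
    then show False using S by (simp add: simple_object_def)
  qed
  then obtain r where r: "\<gamma> r \<bullet> s \<noteq> Nul A (Dom A s) (Cod A (\<gamma> r))" by blast
  have "monic A (\<gamma> r \<bullet> s)"
    by (rule simple_object_C_monic[OF S]) (use \<gamma>A \<gamma>(2) s r in simp_all)
  \<comment> \<open>A nonzero arrow from a simple object is monic, so this cokernel contains a
    factor. But it is also a quotient of the cokernel of \<open>down A X f r\<close>, which has
    length zero.\<close>
  then have "1 \<le> len C P (Cod A (\<gamma> r))"
    using C.len_monic[OF P, of "\<gamma> r \<bullet> s"] C.len_simple[OF P S] q'(5) \<gamma>A \<gamma>(2) s by (simp add: monic_C)
  moreover have "len C P (Cod A (\<gamma> r)) = 0"
  proof -
    obtain c where c: "is_cokernel A (down A X f r) c" "Cod A c \<in> Ob C"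
      by (rule cokernel_ex_C[OF D(1)[of r]]) (use D X(2) in simp_all)
    note c' = A.is_cokernelD[OF c(1)]
    have c0: "len C P (Cod A c) = 0"
      using len_cokernel_down[OF P X(1,2) c, of 0] cok by simp
    obtain t where t: "t \<in> Hom A (Cod A c) (Cod A (\<gamma> r))" "t \<bullet> c = \<gamma> r \<bullet> u"
      by (rule A.cokernel_desc[OF c(1), of "\<gamma> r \<bullet> u"]) (use \<gamma>A u D in simp_all)
    have "epic A (\<gamma> r \<bullet> u)" by (rule A.epic_cmp[OF u(4) A.cokernel_epic[OF \<gamma>(1)]]) (use \<gamma>A u in simp)
    then have "epic A t" by (rule_tac A.epic_cmpD[of t c]) (use t c' in simp_all)
    then have "len C P (Cod A t) \<le> len C P (Dom A t)"
      using C.len_epic[OF P, of t] t(1) c(2) \<gamma>(2) by (simp add: epic_C)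
    then show ?thesis using t(1) c0 by simp
  qed
  ultimately show False by simp
qed

lemma zero_lim_coneI:
  assumes X: "inverse_sequence A X f" and Z: "zero_object A Z"
    and 0: "\<And>T t r. (\<And>r. t r \<in> Hom A T (X r)) \<Longrightarrow> (\<And>r. f r \<bullet> t (Suc r) = t r) \<Longrightarrow> t r = Nul A T (X r)"
  shows "lim_cone A X f Z (\<lambda>r. Nul A Z (X r))"
  unfolding lim_cone_def
proof (intro conjI allI impI)
  show Zob: "Z \<in> Ob A" using Z by (simp add: A.zero_object_iff)
  fix r show "Nul A Z (X r) \<in> Hom A Z (X r)" using Zob inverse_sequenceD(1)[OF X] by simp
  show "f r \<bullet> Nul A Z (X (Suc r)) = Nul A Z (X r)" using Zob inverse_sequenceD(2)[OF X, of r] by simp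
next
  have Zob: "Z \<in> Ob A" using Z by (simp add: A.zero_object_iff)
  fix T t assume t: "\<forall>r. t r \<in> Hom A T (X r) \<and> f r \<bullet> t (Suc r) = t r"
  then have T: "T \<in> Ob A" using A.ob_dom[of "t 0"] by auto
  have t0: "t r = Nul A T (X r)" for r by (rule 0) (use t in blast)+
  show "\<exists>!h. h \<in> Hom A T Z \<and> (\<forall>r. Nul A Z (X r) \<bullet> h = t r)"
  proof (rule ex1I[of _ "Nul A T Z"])
    show "Nul A T Z \<in> Hom A T Z \<and> (\<forall>r. Nul A Z (X r) \<bullet> Nul A T Z = t r)"
      using T Zob t0 inverse_sequenceD(1)[OF X] by simp
    fix g assume "g \<in> Hom A T Z \<and> (\<forall>r. Nul A Z (X r) \<bullet> g = t r)"
    then show "g = Nul A T Z" using A.to_zero[OF Z, of g] by simp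
  qed
qed

lemma zero_biproduct: obtains Z0 where "zero_object A Z0" "Z0 \<in> Ob C" "biproduct_in A C (UNIV :: nat set) (\<lambda>_. Z0) Z0"
proof -
  obtain Z0 where Z0: "zero_object A Z0" "Z0 \<in> Ob C" by (rule zero_ex_C)
  show thesis by (rule that[OF Z0])
    (use biproduct_zero[OF A.preadditive_category_axioms Z0(1)] Z0(2) in \<open>unfold biproduct_in_def, blast\<close>)
qed

lemma monic_zero_kernel:
  assumes "monic A f" "zero_object A Z" shows "is_kernel A f (Nul A Z (Dom A f))"
proof (rule A.kernelI)
  have Z: "Z \<in> Ob A" using assms(2) by (simp add: A.zero_object_iff)
  show "monic A (Nul A Z (Dom A f))"
    by (rule A.monicI) (use assms Z A.to_zero[OF assms(2)] in simp_all)
  show "f \<bullet> Nul A Z (Dom A f) = Nul A (Dom A (Nul A Z (Dom A f))) (Cod A f)" using assms(1) Z by simp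
  show "f \<in> Ar A" "Cod A (Nul A Z (Dom A f)) = Dom A f" using assms(1) Z by simp_all
  fix g assume g: "g \<in> Ar A" "Cod A g = Dom A f" "f \<bullet> g = Nul A (Dom A g) (Cod A f)"
  then have "g = Nul A (Dom A g) (Dom A f)" using A.monic_nulD[OF assms(1), of g] by simp
  then have "Nul A Z (Dom A f) \<bullet> Nul A (Dom A g) Z = g" using assms(1) Z g(1) by simp
  then show "\<exists>h. h \<in> Hom A (Dom A g) (Dom A (Nul A Z (Dom A f))) \<and> Nul A Z (Dom A f) \<bullet> h = g"
    using g(1) Z assms(1) by (intro exI[of _ "Nul A (Dom A g) Z"]) simp
qed

text \<open>For monic arrows the kernels are zero objects and have a zero biproduct, so only the sum
  of the cokernels has to be supplied.\<close>

lemma acceptable_monicI: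
  assumes "inverse_sequence A X f" "\<And>r. X r \<in> Ob C" "\<And>r. monic A (f r)"
    "\<And>r. is_cokernel A (f r) (c r)" "\<And>r. Cod A (c r) \<in> Ob C" "biproduct_in A C UNIV (\<lambda>r. Cod A (c r)) B"
  shows "acceptable_inverse A C X f"
proof -
  obtain Z0 where Z0: "zero_object A Z0" "Z0 \<in> Ob C" "biproduct_in A C (UNIV :: nat set) (\<lambda>_. Z0) Z0"
    by (rule zero_biproduct)
  have f: "Dom A (f r) \<in> Ob A" for r using assms(3) A.monic_ar by simp
  show ?thesis unfolding acceptable_inverse_iff
    by (intro conjI allI exI[of _ c] exI[of _ B] exI[of _ "\<lambda>r. Nul A Z0 (Dom A (f r))"] exI[of _ Z0])
      (use assms Z0 f monic_zero_kernel in simp_all)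
qed

text \<open>Additivity alone handles finite sums only. The tails of \<open>B\<close> form a
  descending sequence with quotients \<open>K n\<close> and zero limit, and it is acceptable because
  the sum of the quotients is \<open>B\<close> itself. So \<open>lim_quotient_zero\<close> applies
  to the identity of \<open>B\<close>.\<close>

lemma biproduct_len_zero:
  fixes K :: "nat \<Rightarrow> 'o"
  assumes P: "simple_class C P" and B: "biproduct_in A C UNIV K B" and K: "\<And>r. K r \<in> Ob C" "\<And>r. len C P (K r) = 0"
  shows "len C P B = 0"
proof -
  obtain \<iota> p where BC: "B \<in> Ob C" and bi: "is_biproduct A UNIV K B \<iota> p"
    using B unfolding biproduct_in_def by blast
  have co: "is_coproduct A UNIV K B \<iota>" and pr: "is_product A UNIV K B p"
    and \<delta>: "\<And>i j. p j \<bullet> \<iota> i = (if i = j then Idn A (K j) else Nul A (K i) (K j))"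
    using bi unfolding A.biproduct_iff by blast+
  have i: "\<iota> r \<in> Ar A" "Dom A (\<iota> r) = K r" "Cod A (\<iota> r) = B" for r using is_coproductD(3)[OF co, of r] by simp_all
  have p: "p r \<in> Ar A" "Dom A (p r) = B" "Cod A (p r) = K r" for r using is_productD(3)[OF pr, of r] by simp_all
  have Kob: "K r \<in> Ob A" for r using K(1) by simp
  \<comment> \<open>\<open>x n\<close> is the inclusion of the tail from index \<open>n\<close> on,
    built as an iterated kernel: \<open>k n\<close> removes the summand \<open>K n\<close>.\<close>
  define x where "x = rec_nat (Idn A B) (\<lambda>n x. x \<bullet> (SOME k. is_kernel A (p n \<bullet> x) k \<and> Dom A k \<in> Ob C))"
  define k where "k n = (SOME k. is_kernel A (p n \<bullet> x n) k \<and> Dom A k \<in> Ob C)" for n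
  have x0: "x 0 = Idn A B" and xS: "x (Suc n) = x n \<bullet> k n" for n by (simp_all add: x_def k_def)
  have kx: "is_kernel A (p n \<bullet> x n) (k n) \<and> Dom A (k n) \<in> Ob C" if a: "x n \<in> Ar A" "Cod A (x n) = B" "Dom A (x n) \<in> Ob C" for n
  proof -
    obtain k' where "is_kernel A (p n \<bullet> x n) k'" "Dom A k' \<in> Ob C"
      by (rule kernel_ex_C[of "p n \<bullet> x n"]) (use a p K(1) in simp_all)
    then have "\<exists>k. is_kernel A (p n \<bullet> x n) k \<and> Dom A k \<in> Ob C" by blast
    then show ?thesis unfolding k_def by (rule someI_ex)
  qed
  have xm: "monic A (x n) \<and> Cod A (x n) = B \<and> Dom A (x n) \<in> Ob C" for n
  proof (induction n)
    case 0 show ?case using x0 BC A.isomorphism_monic A.isomorphism_idn by simp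
  next
    case (Suc n)
    then have xn: "x n \<in> Ar A" "Cod A (x n) = B" "Dom A (x n) \<in> Ob C" by simp_all
    have kn: "is_kernel A (p n \<bullet> x n) (k n)" "Dom A (k n) \<in> Ob C" using kx[OF xn] by simp_all
    note k' = A.is_kernelD[OF kn(1)]
    have ck: "Cod A (k n) = Dom A (x n)" using k'(3) xn p by simp
    have "monic A (x n \<bullet> k n)" by (rule A.monic_cmp[OF A.kernel_monic[OF kn(1)]]) (use Suc ck in simp_all)
    then show ?case unfolding xS using xn ck k'(2) kn(2) by simp
  qed
  have xA: "x n \<in> Ar A" "Cod A (x n) = B" "Dom A (x n) \<in> Ob C" "monic A (x n)" for n using xm[of n] by simp_all
  have kn: "is_kernel A (p n \<bullet> x n) (k n)" "Dom A (k n) \<in> Ob C" for n using kx[OF xA(1-3)] by simp_all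
  have kA: "k n \<in> Ar A" "Cod A (k n) = Dom A (x n)" "p n \<bullet> x n \<bullet> k n = Nul A (Dom A (k n)) (K n)" for n
    using A.is_kernelD[OF kn(1)[of n]] xA[of n] p[of n] by simp_all
  have dx: "Dom A (x (Suc n)) = Dom A (k n)" for n unfolding xS using xA kA by simp
  \<comment> \<open>The summands from index \<open>n\<close> on lie in the tail. In particular
    \<open>K n\<close> does, so the projection of the tail to \<open>K n\<close> is a split
    epic.\<close>
  have xi: "\<exists>j. j \<in> Hom A (K m) (Dom A (x n)) \<and> x n \<bullet> j = \<iota> m" if "n \<le> m" for n m
    using that
  proof (induction n)
    case 0 show ?case using x0 BC i by (intro exI[of _ "\<iota> m"]) simp
  next
    case (Suc n)
    then obtain j where j: "j \<in> Hom A (K m) (Dom A (x n))" "x n \<bullet> j = \<iota> m" by auto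
    have "p n \<bullet> \<iota> m = Nul A (K m) (K n)" using \<delta>[of n m] Suc.prems by simp
    then obtain h where h: "h \<in> Hom A (Dom A j) (Dom A (k n))" "k n \<bullet> h = j"
      by (rule_tac A.kernel_lift[OF kn(1)[of n], of j]) (use j xA[of n] p[of n] in simp_all)
    have "x (Suc n) \<bullet> h = \<iota> m" unfolding xS using h j xA[of n] kA[of n] by simp
    then show ?case unfolding dx using h j by (intro exI[of _ h]) simp
  qed
  have pe: "epic A (p n \<bullet> x n)" for n
  proof -
    obtain j where j: "j \<in> Hom A (K n) (Dom A (x n))" "x n \<bullet> j = \<iota> n" using xi[of n n] by blast
    show ?thesis
      by (rule A.epic_of_local[of _ "Idn A (K n)" j])
        (use j xA[of n] p[of n] \<delta>[of n n] Kob A.isomorphism_epic A.isomorphism_idn in simp_all)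
  qed
  have cok: "is_cokernel A (k n) (p n \<bullet> x n)" for n by (rule A.short_exactD(2)[OF A.epic_short_exact[OF pe kn(1)]])
  have isq: "inverse_sequence A (\<lambda>n. Dom A (x n)) k"
    unfolding inverse_sequence_def using xA kA dx by simp
  have acc: "acceptable_inverse A C (\<lambda>n. Dom A (x n)) k"
    by (rule acceptable_monicI[OF isq _ _ cok, of B]) (use xA p K B A.kernel_monic[OF kn(1)] in simp_all)
  obtain Z0 where Z0: "zero_object A Z0" "Z0 \<in> Ob C" by (rule zero_ex_C)
  have Z0ob: "Z0 \<in> Ob A" using Z0 by simp
  \<comment> \<open>An element of all tails has zero component in every \<open>K n\<close>, and the
    components determine an arrow into the product \<open>B\<close>.\<close>
  have L: "lim_cone A (\<lambda>n. Dom A (x n)) k Z0 (\<lambda>n. Nul A Z0 (Dom A (x n)))"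
  proof (rule zero_lim_coneI[OF isq Z0(1)])
    fix T t r assume t: "\<And>r. t r \<in> Hom A T (Dom A (x r))" "\<And>r. k r \<bullet> t (Suc r) = t r"
    have tA: "t r \<in> Ar A" "Dom A (t r) = T" "Cod A (t r) = Dom A (x r)" for r using t(1)[of r] by simp_all
    have T: "T \<in> Ob A" using tA(1,2)[of 0] by auto
    have e: "x n \<bullet> t n = x (Suc n) \<bullet> t (Suc n)" for n
      unfolding xS using t(2)[of n] tA[of "Suc n"] xA[of n] kA[of n] dx by simp
    have c: "x n \<bullet> t n = x 0 \<bullet> t 0" for n by (induction n) (simp_all add: e[symmetric])
    have pz: "p n \<bullet> x n \<bullet> t n = Nul A T (K n)" for n
    proof -
      have "p n \<bullet> x n \<bullet> t n = (p n \<bullet> x n \<bullet> k n) \<bullet> t (Suc n)"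
        unfolding t(2)[of n, symmetric] using tA[of "Suc n"] xA[of n] kA(1,2)[of n] p dx[of n] by simp
      also have "\<dots> = Nul A T (K n)" unfolding kA(3) using tA[of "Suc n"] dx[of n] Kob by simp
      finally show ?thesis .
    qed
    have "p n \<bullet> x 0 \<bullet> t 0 = Nul A T (K n)" for n using pz[of n] unfolding c[of n] .
    then have "x 0 \<bullet> t 0 = Nul A T B"
      by (intro A.product_eq[OF pr, of "x 0 \<bullet> t 0" T]) (use xA tA T p BC in simp_all)
    then have "x r \<bullet> t r = Nul A T B" using c[of r] by (rule trans[rotated])
    then show "t r = Nul A T (Dom A (x r))" using A.monic_nulD[OF xA(4)[of r], of "t r"] tA xA by simp
  qed
  have "len C P (Cod A (x 0)) = 0"
  proof (rule lim_quotient_zero[OF P acc L])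
    fix r c assume c: "is_cokernel A (k r) c" "Cod A c \<in> Ob C"
    have "isomorphic C (Cod A c) (K r)"
      using A.cokernel_isomorphic[OF c(1) cok[of r]] c(2) K(1) xA[of r] p[of r] by (simp add: isomorphic_C)
    then show "len C P (Cod A c) = 0" using C.len_iso[where P=P] K(2) by metis
  next
    show "epic A (x 0)" using x0 BC A.isomorphism_epic A.isomorphism_idn by simp
  qed (use x0 BC xA Z0ob in simp_all)
  then show ?thesis using xA by simp
qed

lemma biproduct_len_shift:
  fixes K :: "nat \<Rightarrow> 'o"
  assumes P: "simple_class C P" and K: "\<And>r. K r \<in> Ob C" and B: "biproduct_in A C UNIV K B"
  shows "\<exists>B'. biproduct_in A C UNIV (\<lambda>r. K (n + r)) B' \<and> len C P B = (\<Sum>r<n. len C P (K r)) + len C P B'"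
proof (induction n)
  case 0 show ?case using B by (intro exI[of _ B]) simp
next
  case (Suc n)
  then obtain B' where B': "biproduct_in A C UNIV (\<lambda>r. K (n + r)) B'" "len C P B = (\<Sum>r<n. len C P (K r)) + len C P B'" by blast
  obtain B'' k p where B'': "biproduct_in A C UNIV (\<lambda>r. K (n + Suc r)) B''"
    "short_exact C k p" "Cod A k = B'" "Dom A k = B''" "Cod A p = K (n + 0)"
    by (rule biproduct_tail[OF B'(1) K])
  have "len C P B' = len C P B'' + len C P (K n)" using C.len_ses[OF P B''(2)] B''(3-) by simp
  then have "len C P B = (\<Sum>r<Suc n. len C P (K r)) + len C P B''" using B'(2) by (simp add: ac_simps)
  then show ?case using B''(1) by (intro exI[of _ B'']) simp
qed

lemma biproduct_len_eventually_zero: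
  fixes K :: "nat \<Rightarrow> 'o"
  assumes P: "simple_class C P" and K: "\<And>r. K r \<in> Ob C" and B: "biproduct_in A C UNIV K B" and fin: "len C P B \<noteq> \<infinity>"
  obtains n where "\<And>r. r \<ge> n \<Longrightarrow> len C P (K r) = 0"
proof -
  obtain N where N: "len C P B = enat N" using fin by auto
  have "finite {r. len C P (K r) \<noteq> 0}"
  proof (rule enat_sum_bounded_finite)
    fix n
    obtain B' where "len C P B = (\<Sum>r<n. len C P (K r)) + len C P B'"
      using biproduct_len_shift[OF P K B, of n] by blast
    then show "(\<Sum>r<n. len C P (K r)) \<le> enat N" unfolding N by simp
  qed
  then obtain n where "{r. len C P (K r) \<noteq> 0} \<subseteq> {..<n}" using finite_nat_iff_bounded by blast
  then show thesis using that[of n] by (auto simp: subset_iff not_less[symmetric])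
qed

text \<open>Only finitely many of the \<open>K r\<close> and \<open>D r\<close> have nonzero length, and peeling off these indices leaves
  the case in which all of them have length zero.\<close>

lemma lim_len:
  fixes K D :: "nat \<Rightarrow> 'o"
  assumes P: "simple_class C P" and fin: "\<And>X. X \<in> Ob C \<Longrightarrow> len C P X \<noteq> \<infinity>"
    and base: "\<And>Y f L p. acceptable_inverse A C Y f \<Longrightarrow> lim_cone A Y f L p \<Longrightarrow> L \<in> Ob C
      \<Longrightarrow> (\<And>r k. is_kernel A (f r) k \<Longrightarrow> Dom A k \<in> Ob C \<Longrightarrow> len C P (Dom A k) = 0)
      \<Longrightarrow> (\<And>r c. is_cokernel A (f r) c \<Longrightarrow> Cod A c \<in> Ob C \<Longrightarrow> len C P (Cod A c) = 0)
      \<Longrightarrow> len C P L = len C P (Y 0)"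
    and acc: "acceptable_inverse A C Y f" and L: "lim_cone A Y f L p" "L \<in> Ob C"
    and K: "\<And>r. K r \<in> Ob C" "\<And>r k. is_kernel A (f r) k \<Longrightarrow> Dom A k \<in> Ob C \<Longrightarrow> len C P (Dom A k) = len C P (K r)"
    and D: "\<And>r. D r \<in> Ob C" "\<And>r c. is_cokernel A (f r) c \<Longrightarrow> Cod A c \<in> Ob C \<Longrightarrow> len C P (Cod A c) = len C P (D r)"
    and BK: "biproduct_in A C UNIV K BK" and BD: "biproduct_in A C UNIV D BD"
  shows "len C P L + len C P BD = len C P (Y 0) + len C P BK"
proof -
  have "BK \<in> Ob C" "BD \<in> Ob C" using BK BD by (simp_all add: biproduct_in_def)
  then obtain n1 n2 where n1: "\<And>r. r \<ge> n1 \<Longrightarrow> len C P (K r) = 0" and n2: "\<And>r. r \<ge> n2 \<Longrightarrow> len C P (D r) = 0"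
    using biproduct_len_eventually_zero[OF P K(1) BK fin] biproduct_len_eventually_zero[OF P D(1) BD fin] by metis
  define n where "n = max n1 n2"
  have n: "len C P (K r) = 0" "len C P (D r) = 0" if "r \<ge> n" for r using n1 n2 that by (simp_all add: n_def)
  \<comment> \<open>The sequence varies in the induction while \<open>L\<close> is fixed, since
    every shifted sequence has the same limit. The arrow \<open>f 0\<close> is accounted for by
    \<open>len_exact4_C\<close>.\<close>
  from n acc L K D BK BD show ?thesis
  proof (induction n arbitrary: Y f p K D BK BD)
    case 0
    \<comment> \<open>The case without factors is left as the premise \<open>base\<close>, because
      limits and colimits settle it by different arguments.\<close>
    have "len C P L = len C P (Y 0)" by (rule base[OF 0(3,4,5)]) (use 0 in simp_all)
    moreover have "len C P BK = 0" by (rule biproduct_len_zero[OF P 0(10)]) (use 0 in simp_all)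
    moreover have "len C P BD = 0" by (rule biproduct_len_zero[OF P 0(11)]) (use 0 in simp_all)
    ultimately show ?case by simp
  next
    case (Suc n)
    note acc = Suc(4) note L = Suc(5,6) note K = Suc(7,8) note D = Suc(9,10) note BK = Suc(11) note BD = Suc(12)
    note Y = acceptableD[OF acc]
    obtain BK' k p' where BK': "biproduct_in A C UNIV (\<lambda>r. K (Suc r)) BK'"
      "short_exact C k p'" "Cod A k = BK" "Dom A k = BK'" "Cod A p' = K 0" by (rule biproduct_tail[OF BK K(1)])
    obtain BD' k' p'' where BD': "biproduct_in A C UNIV (\<lambda>r. D (Suc r)) BD'"
      "short_exact C k' p''" "Cod A k' = BD" "Dom A k' = BD'" "Cod A p'' = D 0" by (rule biproduct_tail[OF BD D(1)])
    have 1: "len C P BK = len C P BK' + len C P (K 0)" using C.len_ses[OF P BK'(2)] BK'(3-) by simp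
    have 2: "len C P BD = len C P BD' + len C P (D 0)" using C.len_ses[OF P BD'(2)] BD'(3-) by simp
    have 3: "len C P L + len C P BD' = len C P (Y (Suc 0)) + len C P BK'"
    proof (rule Suc.IH[OF _ _ _ _ L(2) _ _ _ _ BK'(1) BD'(1)])
      show "acceptable_inverse A C (\<lambda>r. Y (Suc r)) (\<lambda>r. f (Suc r))" using acceptable_shift[OF acc, of 1] by simp
      show "lim_cone A (\<lambda>r. Y (Suc r)) (\<lambda>r. f (Suc r)) L (\<lambda>r. p (Suc r))" by (rule A.lim_cone_Suc[OF Y(1) L(1)])
    qed (use Suc in simp_all)
    obtain kk where kk: "is_kernel A (f 0) kk" "Dom A kk \<in> Ob C" by (rule kernel_ex_C[OF Y(3)[of 0]]) (use Y in simp_all)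
    obtain cc where cc: "is_cokernel A (f 0) cc" "Cod A cc \<in> Ob C" by (rule cokernel_ex_C[OF Y(3)[of 0]]) (use Y in simp_all)
    have 4: "len C P (Y (Suc 0)) + len C P (D 0) = len C P (Y 0) + len C P (K 0)"
      using len_exact4_C[OF P kk(1) cc(1)] kk(2) cc(2) Y(2-5) K(2)[OF kk] D(2)[OF cc] by simp
    have "len C P L + len C P BD = (len C P L + len C P BD') + len C P (D 0)" unfolding 2 by (simp add: ac_simps)
    also have "\<dots> = (len C P (Y (Suc 0)) + len C P (D 0)) + len C P BK'" unfolding 3 by (simp add: ac_simps)
    also have "\<dots> = len C P (Y 0) + len C P BK" unfolding 4 1 by (simp add: ac_simps)
    finally show ?case .
  qed
qed

end

section \<open>Chains with simple quotients\<close>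

text \<open>A composition series reduced to its sequence of inclusions, without reference to an
  ambient object. Modified chains with other subobjects then fit the same definition.\<close>

definition simple_chain :: "('o, 'm) cat \<Rightarrow> ('o, 'm) cat \<Rightarrow> (nat \<Rightarrow> 'o) \<Rightarrow> (nat \<Rightarrow> 'm) \<Rightarrow> bool" where
  "simple_chain A C W f \<longleftrightarrow> inverse_sequence A W f \<and> (\<forall>r. W r \<in> Ob C \<and> monic A (f r)) \<and>
     (\<exists>Z p. lim_cone A W f Z p \<and> zero_object A Z) \<and>
     (\<forall>r c. is_cokernel A (f r) c \<longrightarrow> Cod A c \<in> Ob C \<longrightarrow> zero_object A (Cod A c) \<or> simple_object C (Cod A c))"

text \<open>Cokernels are formed in \<open>A\<close>, but only representatives in \<open>C\<close>
  are considered, since \<open>C\<close> need not be closed under isomorphism in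
  \<open>A\<close>.\<close>

definition chain_occurrences :: "('o, 'm) cat \<Rightarrow> ('o, 'm) cat \<Rightarrow> (nat \<Rightarrow> 'm) \<Rightarrow> 'o \<Rightarrow> nat set" where
  "chain_occurrences A C f T = {r. \<exists>c. is_cokernel A (f r) c \<and> Cod A c \<in> Ob C \<and> isomorphic A (Cod A c) T}"

definition loc_finite_chain :: "('o, 'm) cat \<Rightarrow> ('o, 'm) cat \<Rightarrow> (nat \<Rightarrow> 'm) \<Rightarrow> bool" where
  "loc_finite_chain A C f \<longleftrightarrow> (\<forall>T. simple_object C T \<longrightarrow> finite (chain_occurrences A C f T))"

text \<open>For epics this is the order of quotients: the kernel of \<open>b\<close> is contained in
  the kernel of \<open>a\<close>.\<close>

definition factors_through :: "('o, 'm) cat \<Rightarrow> 'm \<Rightarrow> 'm \<Rightarrow> bool" where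
  "factors_through A a b \<longleftrightarrow> a \<in> Ar A \<and> b \<in> Ar A \<and> (\<exists>t. t \<in> Hom A (Cod A b) (Cod A a) \<and> t \<bullet>\<^bsub>A\<^esub> b = a)"

context preadditive_category
begin

lemma factors_through_refl: "a \<in> Ar A \<Longrightarrow> factors_through A a a"
  unfolding factors_through_def by (intro conjI exI[of _ "Idn A (Cod A a)"]) simp_all

lemma factors_through_trans:
  assumes "factors_through A a b" "factors_through A b c" shows "factors_through A a c"
proof -
  obtain t s where t: "a \<in> Ar A" "b \<in> Ar A" "t \<in> Hom A (Cod A b) (Cod A a)" "t \<bullet> b = a"
    and s: "c \<in> Ar A" "s \<in> Hom A (Cod A c) (Cod A b)" "s \<bullet> c = b"
    using assms unfolding factors_through_def by blast
  show ?thesis unfolding factors_through_def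
    using t(1,3,4) s by (intro conjI exI[of _ "t \<bullet> s"]) simp_all
qed

lemma factors_through_cmp: "t \<in> Ar A \<Longrightarrow> b \<in> Ar A \<Longrightarrow> Dom A t = Cod A b \<Longrightarrow> factors_through A (t \<bullet> b) b"
  unfolding factors_through_def by (intro conjI exI[of _ t]) simp_all

lemma factors_through_kill:
  assumes "factors_through A a b" "x \<in> Ar A" "Cod A x = Dom A b" "b \<bullet> x = Nul A (Dom A x) (Cod A b)"
  shows "a \<bullet> x = Nul A (Dom A x) (Cod A a)"
proof -
  obtain t where t: "a \<in> Ar A" "b \<in> Ar A" "t \<in> Hom A (Cod A b) (Cod A a)" "t \<bullet> b = a"
    using assms(1) unfolding factors_through_def by blast
  have "a \<bullet> x = t \<bullet> b \<bullet> x" using cmp_eq[OF t(4), of x] t(2,3) assms(2,3) by simp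
  then show ?thesis using assms(2,4) t(3) by simp
qed

end

context lim_setting
begin

lemma simple_chainD:
  assumes "simple_chain A C W f"
  shows "inverse_sequence A W f" "W r \<in> Ob C" "monic A (f r)" "f r \<in> Ar A" "Dom A (f r) = W (Suc r)" "Cod A (f r) = W r"
proof -
  show 1: "inverse_sequence A W f" "W r \<in> Ob C" "monic A (f r)" using assms unfolding simple_chain_def by blast+
  show "f r \<in> Ar A" "Dom A (f r) = W (Suc r)" "Cod A (f r) = W r" using inverse_sequenceD(2)[OF 1(1), of r] by simp_all
qed

lemma simple_chain_lim:
  assumes "simple_chain A C W f"
  obtains Z p where "lim_cone A W f Z p" "zero_object A Z"
  using assms unfolding simple_chain_def by blast

lemma simple_chain_quotient:
  "simple_chain A C W f \<Longrightarrow> is_cokernel A (f r) c \<Longrightarrow> Cod A c \<in> Ob C \<Longrightarrow> zero_object A (Cod A c) \<or> simple_object C (Cod A c)"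
  unfolding simple_chain_def by blast

lemma cokernel_choice:
  assumes "inverse_sequence A W f" "\<And>r. W r \<in> Ob C"
  obtains c where "\<And>r. is_cokernel A (f r) (c r)" "\<And>r. Cod A (c r) \<in> Ob C"
proof -
  have "\<forall>r. \<exists>c. is_cokernel A (f r) c \<and> Cod A c \<in> Ob C"
  proof
    fix r
    obtain c where "is_cokernel A (f r) c" "Cod A c \<in> Ob C"
      by (rule cokernel_ex_C[of "f r"]) (use inverse_sequenceD(2)[OF assms(1), of r] assms(2) in simp_all)
    then show "\<exists>c. is_cokernel A (f r) c \<and> Cod A c \<in> Ob C" by blast
  qed
  then have "\<exists>c. \<forall>r. is_cokernel A (f r) (c r) \<and> Cod A (c r) \<in> Ob C" by (rule choice)
  then show thesis using that by blast
qed

lemma chain_len_sum: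
  assumes P: "simple_class C P" and W: "inverse_sequence A W f" "\<And>r. W r \<in> Ob C" "\<And>r. monic A (f r)"
    and c: "\<And>r. is_cokernel A (f r) (c r)" "\<And>r. Cod A (c r) \<in> Ob C"
  shows "len C P (W 0) = (\<Sum>r<n. len C P (Cod A (c r))) + len C P (W n)"
proof (induction n)
  case (Suc n)
  have "len C P (W n) = len C P (W (Suc n)) + len C P (Cod A (c n))"
    using len_ses_C[OF P A.monic_short_exact[OF W(3) c(1)], of n] inverse_sequenceD(2)[OF W(1), of n] W(2) c(2) by simp
  then show ?case using Suc by (simp add: ac_simps)
qed simp

lemma chain_quotient_len:
  assumes T: "simple_object C T" and W: "simple_chain A C W f" and c: "is_cokernel A (f r) c" "Cod A c \<in> Ob C"
  shows "len C (\<lambda>X. isomorphic C X T) (Cod A c) = (if r \<in> chain_occurrences A C f T then 1 else 0)"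
proof -
  note P = C.simple_class_iso[OF T]
  have TC: "T \<in> Ob C" using T by (simp add: simple_object_def)
  have occ: "r \<in> chain_occurrences A C f T \<longleftrightarrow> isomorphic C (Cod A c) T"
  proof
    assume "r \<in> chain_occurrences A C f T"
    then obtain c' where c': "is_cokernel A (f r) c'" "Cod A c' \<in> Ob C" "isomorphic A (Cod A c') T"
      unfolding chain_occurrences_def by blast
    have "isomorphic A (Cod A c) T"
      by (rule A.isomorphic_trans[OF A.cokernel_isomorphic[OF c(1) c'(1)] c'(3)])
    then show "isomorphic C (Cod A c) T" using c(2) TC by (simp add: isomorphic_C)
  next
    assume "isomorphic C (Cod A c) T"
    then show "r \<in> chain_occurrences A C f T" unfolding chain_occurrences_def isomorphic_C using c by blast
  qed
  from simple_chain_quotient[OF W c] show ?thesis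
  proof
    assume z: "zero_object A (Cod A c)"
    then have l: "len C (\<lambda>X. isomorphic C X T) (Cod A c) = 0" using C.len_zero[OF P] c(2) by (simp add: zero_object_C)
    have "\<not> isomorphic C (Cod A c) T"
    proof
      assume i: "isomorphic C (Cod A c) T"
      have "len C (\<lambda>X. isomorphic C X T) T = 1" using C.len_simple[OF P T] C.isomorphic_refl[OF TC] by simp
      then show False using C.len_iso[OF i, of "\<lambda>X. isomorphic C X T"] l by simp
    qed
    then show ?thesis using l occ by simp
  next
    assume "simple_object C (Cod A c)"
    then show ?thesis using C.len_simple[OF P] occ by simp
  qed
qed

text \<open>Beyond some \<open>n\<close> no quotient is isomorphic to \<open>T\<close>, and the
  limit is zero, so \<open>lim_quotient_zero\<close> for the identity of \<open>W n\<close> shows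
  that \<open>W n\<close> has length zero. The quotients up to \<open>n\<close> then account for the
  whole length.\<close>

lemma chain_len:
  assumes T: "simple_object C T" and W: "simple_chain A C W f" and acc: "acceptable_inverse A C W f"
    and fin: "finite (chain_occurrences A C f T)"
  shows "len C (\<lambda>X. isomorphic C X T) (W 0) = enat (card (chain_occurrences A C f T))"
proof -
  let ?P = "\<lambda>X. isomorphic C X T"
  note P = C.simple_class_iso[OF T] note W' = simple_chainD[OF W]
  obtain c where c: "\<And>r. is_cokernel A (f r) (c r)" "\<And>r. Cod A (c r) \<in> Ob C"
    using cokernel_choice[OF W'(1,2)] by blast
  obtain n where n: "chain_occurrences A C f T \<subseteq> {..<n}" using fin finite_nat_iff_bounded by blast
  obtain Z p where L: "lim_cone A W f Z p" and Z: "zero_object A Z" by (rule simple_chain_lim[OF W])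
  have "len C ?P (Cod A (Idn A (W (n + 0)))) = 0"
  proof (rule lim_quotient_zero[OF P acceptable_shift[OF acc, of n] A.lim_cone_shift[OF W'(1) L, of n]])
    fix r c assume c: "is_cokernel A (f (n + r)) c" "Cod A c \<in> Ob C"
    have "n + r \<notin> chain_occurrences A C f T" using n by auto
    then show "len C ?P (Cod A c) = 0" using chain_quotient_len[OF T W c] by simp
  next
    have p: "p n \<in> Ar A" "Dom A (p n) = Z" "Cod A (p n) = W n" using lim_coneD(2)[OF L, of n] by simp_all
    have "p n = Nul A Z (W n)" using A.from_zero[OF Z p(1,2)] p by simp
    then show "Idn A (W (n + 0)) \<bullet> p (n + 0) = Nul A Z (Cod A (Idn A (W (n + 0))))"
      using W'(2)[of n] p by simp
  qed (use W'(2)[of n] A.isomorphism_epic A.isomorphism_idn in simp_all)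
  then have 0: "len C ?P (W n) = 0" using W'(2)[of n] by simp
  have "(\<Sum>r<n. len C ?P (Cod A (c r))) = (\<Sum>r<n. if r \<in> chain_occurrences A C f T then 1 else 0)"
    using chain_quotient_len[OF T W c] by simp
  also have "\<dots> = (\<Sum>r\<in>chain_occurrences A C f T. 1)"
    using n by (subst sum.inter_restrict[symmetric]) (simp_all add: Int_absorb1)
  also have "\<dots> = enat (card (chain_occurrences A C f T))" by (simp add: of_nat_eq_enat)
  finally show ?thesis using chain_len_sum[OF P W'(1-3) c, of n] 0 by simp
qed

end

text \<open>What is used of the Jordan-Hoelder property and of the locally finite sums.
  Acceptability is demanded of every locally finite chain, because the proof constructs chains that
  are not given in advance.\<close>

locale jh_setting = lim_setting A C for A :: "('o, 'm) cat" (structure) and C :: "('o, 'm) cat" +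
  assumes chain_ex: "X \<in> Ob C \<Longrightarrow> \<exists>W f. simple_chain A C W f \<and> loc_finite_chain A C f \<and> isomorphic A (W 0) X"
    and chain_acceptable: "simple_chain A C W f \<Longrightarrow> loc_finite_chain A C f \<Longrightarrow> acceptable_inverse A C W f"
begin

lemma chain_obtain:
  assumes "X \<in> Ob C"
  obtains W f \<theta> where "simple_chain A C W f" "loc_finite_chain A C f" "isomorphism A \<theta>" "Dom A \<theta> = W 0" "Cod A \<theta> = X"
proof -
  obtain W f where W: "simple_chain A C W f" "loc_finite_chain A C f" "isomorphic A (W 0) X" using chain_ex[OF assms] by blast
  obtain \<theta> where "\<theta> \<in> Hom A (W 0) X" "isomorphism A \<theta>" by (rule A.isomorphicE[OF W(3)])
  then show thesis using that[OF W(1,2)] by simp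
qed

lemma len_iso_arrow: 
  assumes "isomorphism A \<theta>" "Dom A \<theta> \<in> Ob C" "Cod A \<theta> \<in> Ob C"
  shows "len C P (Dom A \<theta>) = len C P (Cod A \<theta>)"
  using C.len_iso[OF C.isomorphicI, of \<theta> P] assms by (simp add: isomorphism_C)

lemma finite_len:
  assumes T: "simple_object C T" and X: "X \<in> Ob C" shows "len C (\<lambda>X. isomorphic C X T) X \<noteq> \<infinity>"
proof -
  obtain W f \<theta> where W: "simple_chain A C W f" "loc_finite_chain A C f" "isomorphism A \<theta>" "Dom A \<theta> = W 0" "Cod A \<theta> = X"
    by (rule chain_obtain[OF X])
  have "finite (chain_occurrences A C f T)" using W(2) T unfolding loc_finite_chain_def by blast
  from chain_len[OF T W(1) chain_acceptable[OF W(1,2)] this]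
  show ?thesis using len_iso_arrow[OF W(3), of "\<lambda>X. isomorphic C X T"] W(4,5) X simple_chainD(2)[OF W(1), of 0]
    by (simp del: not_infinity_eq) (metis enat.distinct(1))
qed

text \<open>Without simple factors all arrows of a chain are epic, so the finite-stage cokernels
  vanish. By \<open>lim_detect\<close> the identity of \<open>W 0\<close> then factors, on a cover,
  through the zero limit.\<close>

lemma nonzero_length:
  assumes X: "X \<in> Ob C" and 0: "len C (simple_object C) X = 0" shows "zero_object A X"
proof -
  note P = C.simple_class_simple
  obtain W f \<theta> where W: "simple_chain A C W f" "loc_finite_chain A C f" "isomorphism A \<theta>" "Dom A \<theta> = W 0" "Cod A \<theta> = X"
    by (rule chain_obtain[OF X])
  note W' = simple_chainD[OF W(1)]
  have acc: "acceptable_inverse A C W f" by (rule chain_acceptable[OF W(1,2)])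
  obtain Z p where L: "lim_cone A W f Z p" and Z: "zero_object A Z" by (rule simple_chain_lim[OF W(1)])
  have Wob: "W r \<in> Ob A" for r using W'(2) by simp
  have 1: "len C (simple_object C) (W 0) = 0" using len_iso_arrow[OF W(3), of "simple_object C"] W(4,5) W'(2) X 0 by simp
  have D: "down A W f r \<in> Ar A" "Dom A (down A W f r) = W r" "Cod A (down A W f r) = W 0" for r using down_C[OF acc, of r] by simp_all
  have fe: "epic A (f r)" for r
  proof -
    obtain c where c: "\<And>r. is_cokernel A (f r) (c r)" "\<And>r. Cod A (c r) \<in> Ob C"
      using cokernel_choice[OF W'(1,2)] by blast
    have "len C (simple_object C) (Cod A (c r)) = 0"
      using chain_len_sum[OF P W'(1-3) c, of "Suc r"] 1 by simp
    then have "\<not> simple_object C (Cod A (c r))" using C.len_simple[OF P, of "Cod A (c r)"] by auto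
    then have "zero_object A (Cod A (c r))" using simple_chain_quotient[OF W(1) c] by blast
    then show ?thesis using A.epic_iff_cokernel_zero[OF c(1)] by blast
  qed
  have De: "epic A (down A W f r)" for r
  proof (induction r)
    case 0 show ?case using A.isomorphism_epic A.isomorphism_idn Wob by simp
  next
    case (Suc r) show ?case using A.epic_cmp[OF fe Suc] D W' by simp
  qed
  obtain Z0 where Z0: "zero_object A Z0" "Z0 \<in> Ob C" by (rule zero_ex_C)
  have \<gamma>0: "is_cokernel A (Idn A (W 0) \<bullet> down A W f r) (Nul A (W 0) Z0)" for r
  proof (rule A.cokernelI)
    have Zob: "Z0 \<in> Ob A" using Z0 by simp
    show "epic A (Nul A (W 0) Z0)" by (rule A.epicI) (use Wob Zob A.from_zero[OF Z0(1)] in simp_all)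
    show "Idn A (W 0) \<bullet> down A W f r \<in> Ar A" "Dom A (Nul A (W 0) Z0) = Cod A (Idn A (W 0) \<bullet> down A W f r)"
      "Nul A (W 0) Z0 \<bullet> Idn A (W 0) \<bullet> down A W f r = Nul A (Dom A (Idn A (W 0) \<bullet> down A W f r)) (Cod A (Nul A (W 0) Z0))"
      using D[of r] Wob Zob by simp_all
    fix g assume g: "g \<in> Ar A" "Dom A g = Cod A (Idn A (W 0) \<bullet> down A W f r)"
      "g \<bullet> Idn A (W 0) \<bullet> down A W f r = Nul A (Dom A (Idn A (W 0) \<bullet> down A W f r)) (Cod A g)"
    then have "g = Nul A (W 0) (Cod A g)" using A.epic_nulD[OF De[of r], of g] D[of r] Wob by simp
    then have "Nul A Z0 (Cod A g) \<bullet> Nul A (W 0) Z0 = g" using g(1) Zob Wob by simp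
    then show "\<exists>h. h \<in> Hom A (Cod A (Nul A (W 0) Z0)) (Cod A g) \<and> h \<bullet> Nul A (W 0) Z0 = g"
      using g(1) Zob Wob by (intro exI[of _ "Nul A Z0 (Cod A g)"]) simp
  qed
  have i: "Idn A (W 0) \<in> Hom A (W 0) (W 0)" using Wob by simp
  obtain e s where e: "epic A e" "Cod A e = W 0" "s \<in> Hom A (Dom A e) Z" "(Idn A (W 0) \<bullet> p 0) \<bullet> s = Idn A (W 0) \<bullet> e"
    by (rule lim_detect[OF acc L W'(2) i \<gamma>0 _ i]) (use Wob Z0 in simp_all)
  have eA: "e \<in> Ar A" using e by simp
  have p: "p 0 \<in> Ar A" "Dom A (p 0) = Z" "Cod A (p 0) = W 0" using lim_coneD(2)[OF L, of 0] by simp_all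
  have "p 0 = Nul A Z (W 0)" using A.from_zero[OF Z p(1,2)] p by simp
  then have "e = Nul A (Dom A e) (W 0)" using e(2-4) eA Wob lim_coneD(1)[OF L] by simp
  then have "Idn A (W 0) \<bullet> e = Nul A (W 0) (W 0) \<bullet> e" using e(2) eA Wob by simp
  then have "Idn A (W 0) = Nul A (W 0) (W 0)" using A.epicD[OF e(1)] e(2) Wob by simp
  then have "zero_object A (W 0)" using Wob by (simp add: A.zero_object_iff)
  then show ?thesis using A.zero_epic[OF A.isomorphism_epic[OF W(3)]] W(4,5) by simp
qed

text \<open>The kernel of such an epic has length zero for the class of all simple objects, hence it
  is zero. This turns bounded lengths into stationary sequences of quotients.\<close>

lemma epic_len_iso:
  assumes t: "epic A t" "Dom A t \<in> Ob C" "Cod A t \<in> Ob C"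
    and e: "len C (simple_object C) (Dom A t) \<le> len C (simple_object C) (Cod A t)" "len C (simple_object C) (Cod A t) \<noteq> \<infinity>"
  shows "isomorphism A t"
proof -
  have tA: "t \<in> Ar A" using t by simp
  obtain k where k: "is_kernel A t k" "Dom A k \<in> Ob C" by (rule kernel_ex_C[OF tA t(2,3)])
  have "len C (simple_object C) (Dom A t) = len C (simple_object C) (Dom A k) + len C (simple_object C) (Cod A t)"
    using len_ses_C[OF C.simple_class_simple A.epic_short_exact[OF t(1) k(1)]] A.is_kernelD[OF k(1)] k(2) t(2,3) by simp
  then have "len C (simple_object C) (Dom A k) = 0"
    using e by (cases "len C (simple_object C) (Cod A t)"; cases "len C (simple_object C) (Dom A k)") (auto simp: zero_enat_def)
  then have "zero_object A (Dom A k)" by (rule nonzero_length[OF k(2)])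
  then show ?thesis using A.monic_epic_iso[OF _ t(1)] A.monic_iff_kernel_zero[OF k(1)] by blast
qed

lemma chain_quotient_length:
  assumes W: "simple_chain A C W f" and c: "is_cokernel A (down A W f i) c" "Cod A c \<in> Ob C"
  shows "len C (simple_object C) (Cod A c) \<le> enat i"
proof -
  have "len C (simple_object C) (Cod A c) \<le> of_nat i * 1"
  proof (rule len_cokernel_down[OF C.simple_class_simple simple_chainD(1,2)[OF W] c])
    fix r c assume c: "is_cokernel A (f r) c" "Cod A c \<in> Ob C"
    from simple_chain_quotient[OF W c] show "len C (simple_object C) (Cod A c) \<le> 1"
    proof
      assume "zero_object A (Cod A c)"
      then show ?thesis using C.len_zero[OF C.simple_class_simple] c(2) by (simp add: zero_object_C)
    next
      assume "simple_object C (Cod A c)"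
      then show ?thesis using C.len_simple[OF C.simple_class_simple] by simp
    qed
  qed
  then show ?thesis by (simp add: of_nat_eq_enat)
qed

end

lemma le_enat_not_infinity: "x \<le> enat n \<Longrightarrow> x \<noteq> \<infinity>"
  by (cases x) simp_all

section \<open>Jointly monic quotients, jointly epic arrows and absent simple factors\<close>

context jh_setting
begin

text \<open>Because \<open>W 0 / W i\<close> has finite length, the intersection \<open>V i\<close> of the subobjects \<open>ker (q r) + W i\<close>
  over all \<open>r\<close> is one of them, so \<open>W 0 / V i\<close> is a quotient of some \<open>Cod (q r)\<close>.  The \<open>V i\<close> form a
  simple chain again, whose limit is zero by local AB5*.\<close>

lemma jointly_monic_len_zero_chain:
  assumes S: "simple_object C S" and W: "simple_chain A C W f" "loc_finite_chain A C f"
    and q: "\<And>r. epic A (q r)" "\<And>r. Dom A (q r) = W 0" "\<And>r. Cod A (q r) \<in> Ob C"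
    and fac: "\<And>r. factors_through A (q r) (q (Suc r))"
    and joint: "\<And>t. t \<in> Ar A \<Longrightarrow> Cod A t = W 0 \<Longrightarrow> (\<And>r. q r \<bullet> t = Nul A (Dom A t) (Cod A (q r))) \<Longrightarrow> t = Nul A (Dom A t) (W 0)"
    and 0: "\<And>r. len C (\<lambda>X. isomorphic C X S) (Cod A (q r)) = 0"
  shows "len C (\<lambda>X. isomorphic C X S) (W 0) = 0"
proof -
  let ?P = "\<lambda>X. isomorphic C X S"
  note P = C.simple_class_iso[OF S]
  note W' = simple_chainD[OF W(1)]
  have acc: "acceptable_inverse A C W f" by (rule chain_acceptable[OF W])
  obtain Z p where L: "lim_cone A W f Z p" and Z: "zero_object A Z" by (rule simple_chain_lim[OF W(1)])
  have qA: "q r \<in> Ar A" for r using q(1) by simp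
  have Wob: "W r \<in> Ob A" for r using W'(2) by simp
  define F where "F = down A W f"
  have F: "F r \<in> Ar A" "Dom A (F r) = W r" "Cod A (F r) = W 0" "F (Suc r) = F r \<bullet> f r" for r
    using down_C[OF acc, of r] by (simp_all add: F_def)
  have "\<forall>x. \<exists>c. is_cokernel A (q (snd x) \<bullet> F (fst x)) c \<and> Cod A c \<in> Ob C"
  proof
    fix x :: "nat \<times> nat"
    obtain c where "is_cokernel A (q (snd x) \<bullet> F (fst x)) c" "Cod A c \<in> Ob C"
      by (rule cokernel_ex_C[of "q (snd x) \<bullet> F (fst x)"]) (use qA q F W'(2) in simp_all)
    then show "\<exists>c. is_cokernel A (q (snd x) \<bullet> F (fst x)) c \<and> Cod A c \<in> Ob C" by blast
  qed
  then have "\<exists>c. \<forall>x. is_cokernel A (q (snd x) \<bullet> F (fst x)) (c x) \<and> Cod A (c x) \<in> Ob C" by (rule choice)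
  then obtain c where c: "\<forall>x. is_cokernel A (q (snd x) \<bullet> F (fst x)) (c x) \<and> Cod A (c x) \<in> Ob C" ..
  define \<gamma> where "\<gamma> i r = c (i, r)" for i r
  have \<gamma>: "is_cokernel A (q r \<bullet> F i) (\<gamma> i r)" "Cod A (\<gamma> i r) \<in> Ob C" for i r
    using c[rule_format, of "(i, r)"] by (simp_all add: \<gamma>_def)
  have \<gamma>A: "\<gamma> i r \<in> Ar A" "Dom A (\<gamma> i r) = Cod A (q r)" "\<gamma> i r \<bullet> q r \<bullet> F i = Nul A (W i) (Cod A (\<gamma> i r))" for i r
    using A.is_cokernelD[OF \<gamma>(1)[of r i]] qA[of r] q(2)[of r] F[of i] by simp_all
  \<comment> \<open>In terms of subobjects, the kernel of \<open>\<rho> i r\<close> is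
    \<open>ker (q r) + W i\<close>.\<close>
  define \<rho> where "\<rho> i r = \<gamma> i r \<bullet> q r" for i r
  have \<rho>: "\<rho> i r \<in> Ar A" "Dom A (\<rho> i r) = W 0" "Cod A (\<rho> i r) = Cod A (\<gamma> i r)" for i r
    using \<gamma>A[of i r] qA[of r] q(2)[of r] by (simp_all add: \<rho>_def)
  have \<rho>e: "epic A (\<rho> i r)" for i r
    unfolding \<rho>_def by (rule A.epic_cmp[OF q(1) A.cokernel_epic[OF \<gamma>(1)]]) (use \<gamma>A in simp)
  have \<rho>F: "\<rho> i r \<bullet> F i = Nul A (W i) (Cod A (\<gamma> i r))" for i r
    using \<gamma>A[of i r] qA[of r] q(2)[of r] F[of i] by (simp add: \<rho>_def)
  have \<rho>q: "factors_through A (\<rho> i r) (q r)" for i r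
    unfolding \<rho>_def by (rule A.factors_through_cmp) (use \<gamma>A qA in simp_all)
  \<comment> \<open>The pushout property: a quotient of \<open>W 0\<close> that kills
    \<open>W i\<close> and factors through \<open>q r\<close> factors through
    \<open>\<rho> i r\<close>. It yields monotonicity in both indices.\<close>
  have univ: "factors_through A t (\<rho> i r)"
    if t: "t \<bullet> F i = Nul A (W i) (Cod A t)" "factors_through A t (q r)" for t i r
  proof -
    obtain t' where t': "t \<in> Ar A" "t' \<in> Hom A (Cod A (q r)) (Cod A t)" "t' \<bullet> q r = t"
      using t(2) unfolding factors_through_def by blast
    have "t' \<bullet> q r \<bullet> F i = t \<bullet> F i" using A.cmp_eq[OF t'(3), of "F i"] t'(2) qA[of r] q(2)[of r] F[of i] by simp
    then have "t' \<bullet> q r \<bullet> F i = Nul A (Dom A (q r \<bullet> F i)) (Cod A t')"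
      unfolding t(1) using t'(2) qA[of r] q(2)[of r] F[of i] by simp
    then obtain s where s: "s \<in> Hom A (Cod A (\<gamma> i r)) (Cod A t')" "s \<bullet> \<gamma> i r = t'"
      by (rule_tac A.cokernel_desc[OF \<gamma>(1)[of r i], of t']) (use t'(2) qA[of r] q(2)[of r] F[of i] in simp_all)
    have "s \<bullet> \<rho> i r = t" unfolding \<rho>_def using A.cmp_eq[OF s(2), of "q r"] s(1) t'(3) \<gamma>A[of i r] qA[of r] by simp
    then show ?thesis unfolding factors_through_def using t'(1,2) \<rho>[of i r] s(1) by (intro conjI exI[of _ s]) simp_all
  qed
  have mono_i: "factors_through A (\<rho> i r) (\<rho> (Suc i) r)" for i r
  proof (rule univ[OF _ \<rho>q])
    have "\<rho> i r \<bullet> F (Suc i) = (\<rho> i r \<bullet> F i) \<bullet> f i" unfolding F(4) using \<rho>[of i r] F(1-3)[of i] W'(4-6)[of i] by simp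
    then show "\<rho> i r \<bullet> F (Suc i) = Nul A (W (Suc i)) (Cod A (\<rho> i r))"
      unfolding \<rho>F using \<rho>[of i r] W'(4-6)[of i] \<gamma>(2)[of i r] by simp
  qed
  have mono_r1: "factors_through A (\<rho> i r) (\<rho> i (Suc r))" for i r
    by (rule univ[OF _ A.factors_through_trans[OF \<rho>q fac]]) (use \<rho>F \<rho> in simp)
  have mono_r: "factors_through A (\<rho> i r) (\<rho> i r')" if "r \<le> r'" for i r r'
    using that by (induction r' rule: dec_induct)
      (use A.factors_through_refl[OF \<rho>(1)] A.factors_through_trans[OF _ mono_r1] in blast)+
  have bound: "len C (simple_object C) (Cod A (\<rho> i r)) \<le> enat i" for i r
  proof -
    obtain b where b: "is_cokernel A (down A W f i) b" "Cod A b \<in> Ob C"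
      by (rule cokernel_ex_C[OF F(1)[of i, unfolded F_def]]) (use F[of i] W'(2) in \<open>simp_all add: F_def\<close>)
    note b' = A.is_cokernelD[OF b(1)]
    obtain t where t: "t \<in> Hom A (Cod A b) (Cod A (\<rho> i r))" "t \<bullet> b = \<rho> i r"
      by (rule A.cokernel_desc[OF b(1), of "\<rho> i r"]) (use \<rho>[of i r] \<rho>F[of i r] F[of i] in \<open>simp_all add: F_def\<close>)
    have "epic A t" by (rule A.epic_cmpD[of t b]) (use t b' \<rho>e in simp_all)
    then have "len C (simple_object C) (Cod A t) \<le> len C (simple_object C) (Dom A t)"
      using C.len_epic[OF C.simple_class_simple, of t] t(1) b(2) \<gamma>(2) \<rho>(3) by (simp add: epic_C)
    also have "\<dots> \<le> enat i" using chain_quotient_length[OF W(1) b] t(1) by simp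
    finally show ?thesis using t(1) by simp
  qed
  \<comment> \<open>For fixed \<open>i\<close> the targets of \<open>\<rho> i r\<close> grow with
    \<open>r\<close> and have length at most \<open>i\<close>. A largest one dominates all others,
    since an epic between targets of equal finite length is an isomorphism.\<close>
  have "\<forall>i. \<exists>r0. \<forall>r. factors_through A (\<rho> i r) (\<rho> i r0)"
  proof
    fix i
    let ?m = "\<lambda>r. the_enat (len C (simple_object C) (Cod A (\<rho> i r)))"
    have m: "len C (simple_object C) (Cod A (\<rho> i r)) = enat (?m r)" for r
      using bound[of i r] by (cases "len C (simple_object C) (Cod A (\<rho> i r))") simp_all
    have "?m r < Suc i" for r using bound[of i r] m[of r] by (metis enat_ord_simps(1) le_imp_less_Suc)
    then obtain r0 where r0: "\<forall>r. ?m r \<le> ?m r0"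
      using ex_has_greatest_nat[of "\<lambda>_. True" 0 ?m "Suc i"] by blast
    have "factors_through A (\<rho> i r) (\<rho> i r0)" for r
    proof (cases "r \<le> r0")
      case False
      then have "factors_through A (\<rho> i r0) (\<rho> i r)" using mono_r by simp
      then obtain t where t: "t \<in> Hom A (Cod A (\<rho> i r)) (Cod A (\<rho> i r0))" "t \<bullet> \<rho> i r = \<rho> i r0"
        unfolding factors_through_def by blast
      have te: "epic A t" by (rule A.epic_cmpD[of t "\<rho> i r"]) (use t \<rho> \<rho>e in simp_all)
      have ti: "isomorphism A t"
      proof (rule epic_len_iso[OF te])
        show "len C (simple_object C) (Dom A t) \<le> len C (simple_object C) (Cod A t)"
        proof -
          have "enat (?m r) \<le> enat (?m r0)" using r0 by simp
          then have "len C (simple_object C) (Cod A (\<rho> i r)) \<le> len C (simple_object C) (Cod A (\<rho> i r0))"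
            by (simp only: m[symmetric])
          then show ?thesis using t(1) by simp
        qed
        show "len C (simple_object C) (Cod A t) \<noteq> \<infinity>" using t(1) le_enat_not_infinity[OF bound[of i r0]] by simp
      qed (use t(1) \<rho>(3) \<gamma>(2) in simp_all)
      obtain t' where t': "t' \<in> Hom A (Cod A t) (Dom A t)" "t' \<bullet> t = Idn A (Dom A t)"
        by (rule A.isomorphism_inverse[OF ti])
      have "t' \<bullet> \<rho> i r0 = \<rho> i r"
        unfolding t(2)[symmetric] using A.cmp_eq[OF t'(2), of "\<rho> i r"] t'(1) t(1) \<rho>[of i r] by simp
      then show ?thesis unfolding factors_through_def using \<rho> t'(1) t(1) by (intro conjI exI[of _ t']) simp_all
    qed (rule mono_r)
    then show "\<exists>r0. \<forall>r. factors_through A (\<rho> i r) (\<rho> i r0)" by blast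
  qed
  then have "\<exists>rr. \<forall>i. \<forall>r. factors_through A (\<rho> i r) (\<rho> i (rr i))" by (rule choice)
  then obtain rr where rr: "\<And>i r. factors_through A (\<rho> i r) (\<rho> i (rr i))" by blast
  \<comment> \<open>The kernel \<open>v i\<close> is the inclusion of \<open>V i\<close>, the
    intersection over all \<open>r\<close> of the subobjects \<open>ker (q r) + W i\<close>.\<close>
  have "\<forall>i. \<exists>k. is_kernel A (\<rho> i (rr i)) k \<and> Dom A k \<in> Ob C"
  proof
    fix i
    obtain k where "is_kernel A (\<rho> i (rr i)) k" "Dom A k \<in> Ob C"
      by (rule kernel_ex_C[of "\<rho> i (rr i)"]) (use \<rho> W'(2) \<gamma>(2) in simp_all)
    then show "\<exists>k. is_kernel A (\<rho> i (rr i)) k \<and> Dom A k \<in> Ob C" by blast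
  qed
  then have "\<exists>v. \<forall>i. is_kernel A (\<rho> i (rr i)) (v i) \<and> Dom A (v i) \<in> Ob C" by (rule choice)
  then obtain v where v: "\<And>i. is_kernel A (\<rho> i (rr i)) (v i)" "\<And>i. Dom A (v i) \<in> Ob C" by blast
  have vA: "v i \<in> Ar A" "Cod A (v i) = W 0" "\<rho> i (rr i) \<bullet> v i = Nul A (Dom A (v i)) (Cod A (\<gamma> i (rr i)))" for i
    using A.is_kernelD[OF v(1)[of i]] \<rho>[of i "rr i"] by simp_all
  have vm: "monic A (v i)" for i by (rule A.kernel_monic[OF v(1)])
  have \<rho>v: "\<rho> i r \<bullet> v i = Nul A (Dom A (v i)) (Cod A (\<gamma> i r))" for i r
    using A.factors_through_kill[OF rr[of i r], of "v i"] vA[of i] \<rho> by simp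
  have "\<forall>i. \<exists>h. h \<in> Hom A (Dom A (v (Suc i))) (Dom A (v i)) \<and> v i \<bullet> h = v (Suc i)"
  proof
    fix i
    have "\<rho> i (rr i) \<bullet> v (Suc i) = Nul A (Dom A (v (Suc i))) (Cod A (\<rho> i (rr i)))"
      using A.factors_through_kill[OF A.factors_through_trans[OF mono_i[of i "rr i"] rr[of "Suc i" "rr i"]], of "v (Suc i)"]
        vA[of "Suc i"] \<rho> by simp
    then obtain h where "h \<in> Hom A (Dom A (v (Suc i))) (Dom A (v i))" "v i \<bullet> h = v (Suc i)"
      by (rule_tac A.kernel_lift[OF v(1)[of i], of "v (Suc i)"]) (use vA[of "Suc i"] \<rho> in simp_all)
    then show "\<exists>h. h \<in> Hom A (Dom A (v (Suc i))) (Dom A (v i)) \<and> v i \<bullet> h = v (Suc i)" by blast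
  qed
  then have "\<exists>\<phi>. \<forall>i. \<phi> i \<in> Hom A (Dom A (v (Suc i))) (Dom A (v i)) \<and> v i \<bullet> \<phi> i = v (Suc i)" by (rule choice)
  then obtain \<phi> where \<phi>0: "\<forall>i. \<phi> i \<in> Hom A (Dom A (v (Suc i))) (Dom A (v i)) \<and> v i \<bullet> \<phi> i = v (Suc i)" ..
  have \<phi>: "\<phi> i \<in> Ar A" "Dom A (\<phi> i) = Dom A (v (Suc i))" "Cod A (\<phi> i) = Dom A (v i)" "v i \<bullet> \<phi> i = v (Suc i)" for i
    using \<phi>0[rule_format, of i] by simp_all
  have \<phi>m: "monic A (\<phi> i)" for i by (rule A.monic_cmpD[of "v i"]) (use \<phi> vA vm in simp_all)
  have isq: "inverse_sequence A (\<lambda>i. Dom A (v i)) \<phi>" unfolding inverse_sequence_def using vA \<phi> by simp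
  \<comment> \<open>\<open>V i = V (i + 1) + W i\<close>, so the quotient
    \<open>V i / V (i + 1)\<close> is a quotient of \<open>W i / W (i + 1)\<close> and hence simple
    or zero.\<close>
  have quot: "zero_object A (Cod A e) \<or> simple_object C (Cod A e)"
    if e: "is_cokernel A (\<phi> i) e" "Cod A e \<in> Ob C" for i e
  proof -
    note e' = A.is_cokernelD[OF e(1)]
    have a_ex: "\<exists>a. a \<in> Hom A (W j) (Dom A (v j)) \<and> v j \<bullet> a = F j" for j
    proof -
      obtain a where "a \<in> Hom A (Dom A (F j)) (Dom A (v j))" "v j \<bullet> a = F j"
        by (rule A.kernel_lift[OF v(1)[of j], of "F j"]) (use \<rho>F \<rho> F in simp_all)
      then show ?thesis using F by auto
    qed
    obtain a where a: "a \<in> Hom A (W i) (Dom A (v i))" "v i \<bullet> a = F i" using a_ex by blast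
    obtain a' where a': "a' \<in> Hom A (W (Suc i)) (Dom A (v (Suc i)))" "v (Suc i) \<bullet> a' = F (Suc i)" using a_ex by blast
    have "a \<bullet> f i = \<phi> i \<bullet> a'"
    proof (rule A.monicD[OF vm[of i]])
      have "v i \<bullet> a \<bullet> f i = F (Suc i)" using A.cmp_eq[OF a(2), of "f i"] a(1) W'(4-6)[of i] vA[of i] F(4)[of i] by simp
      also have "\<dots> = v i \<bullet> \<phi> i \<bullet> a'" using A.cmp_eq[OF \<phi>(4)[of i], of a'] a' \<phi>[of i] vA[of i] by simp
      finally show "v i \<bullet> a \<bullet> f i = v i \<bullet> \<phi> i \<bullet> a'" .
    qed (use a(1) a'(1) \<phi>[of i] W'(4-6)[of i] in simp_all)
    then have "e \<bullet> a \<bullet> f i = Nul A (W (Suc i)) (Cod A e)"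
      using A.cmp_eq[OF e'(4), of a'] a'(1) e'(2,3) \<phi>[of i] e(2) by simp
    moreover obtain cf where cf: "is_cokernel A (f i) cf" "Cod A cf \<in> Ob C"
      by (rule cokernel_ex_C[OF W'(4)[of i]]) (use W'(2,5,6) in simp_all)
    note cf' = A.is_cokernelD[OF cf(1)]
    ultimately obtain g where g: "g \<in> Hom A (Cod A cf) (Cod A e)" "g \<bullet> cf = e \<bullet> a"
      by (rule_tac A.cokernel_desc[OF cf(1), of "e \<bullet> a"]) (use a(1) e'(2,3) \<phi>[of i] W'(5,6)[of i] in simp_all)
    have "epic A (e \<bullet> a)"
    proof (rule A.epicI)
      show "e \<bullet> a \<in> Ar A" using a(1) e'(2,3) \<phi>[of i] by simp
      fix T b assume b0: "T \<in> Ob A" "b \<in> Hom A (Cod A (e \<bullet> a)) T" "b \<bullet> e \<bullet> a = Nul A (Dom A (e \<bullet> a)) T"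
      have b: "b \<in> Ar A" "Dom A b = Cod A e" "Cod A b = T" "b \<bullet> e \<bullet> a = Nul A (W i) T"
        using b0 a(1) e'(2,3) \<phi>[of i] by simp_all
      \<comment> \<open>With this choice \<open>ker (q ?r)\<close> is contained in
        \<open>V (i + 1)\<close>. An element of \<open>V i\<close> lies in
        \<open>ker (q ?r) + W i\<close>, so after subtracting a part from \<open>W i\<close> it lies
        in \<open>V (i + 1)\<close>.\<close>
      let ?r = "rr (Suc i)"
      have qv: "q ?r \<bullet> v i \<in> Ar A" "Cod A (q ?r \<bullet> v i) = Cod A (q ?r \<bullet> F i)" "Dom A (q ?r \<bullet> v i) = Dom A (v i)"
        using qA q(2) vA[of i] F[of i] by simp_all
      have "\<gamma> i ?r \<bullet> q ?r \<bullet> v i = Nul A (Dom A (q ?r \<bullet> v i)) (Cod A (\<gamma> i ?r))"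
        using \<rho>v[of i ?r] \<gamma>A[of i ?r] qA q(2) vA[of i] by (simp add: \<rho>_def)
      then obtain e1 w where w: "epic A e1" "Cod A e1 = Dom A (q ?r \<bullet> v i)" "w \<in> Hom A (Dom A e1) (Dom A (q ?r \<bullet> F i))"
        "(q ?r \<bullet> F i) \<bullet> w = (q ?r \<bullet> v i) \<bullet> e1"
        by (rule A.cokernel_local[OF \<gamma>(1)[of ?r i] qv(1,2)])
      have w': "e1 \<in> Ar A" "Cod A e1 = Dom A (v i)" "w \<in> Hom A (Dom A e1) (W i)"
        using w qv qA q(2) F[of i] by simp_all
      let ?y = "Diff A (v i \<bullet> e1) (F i \<bullet> w)"
      have h: "v i \<bullet> e1 \<in> Hom A (Dom A e1) (W 0)" "F i \<bullet> w \<in> Hom A (Dom A e1) (W 0)" using w' vA[of i] F[of i] by simp_all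
      have y: "?y \<in> Hom A (Dom A e1) (W 0)" by (rule A.Diff_hom(1)[OF h])
      have E1ob: "Dom A e1 \<in> Ob A" using w'(1) by simp
      have "q ?r \<bullet> ?y = Diff A (q ?r \<bullet> v i \<bullet> e1) (q ?r \<bullet> F i \<bullet> w)"
        by (rule A.cmp_Diff[OF h, of _ "Cod A (q ?r)"]) (use qA q(2) in simp)
      also have "\<dots> = Nul A (Dom A e1) (Cod A (q ?r))"
        using w(4) qA q(2) w' vA[of i] F[of i] by simp
      finally have "\<rho> (Suc i) ?r \<bullet> ?y = Nul A (Dom A ?y) (Cod A (\<rho> (Suc i) ?r))"
        using A.factors_through_kill[OF \<rho>q[of "Suc i" ?r], of ?y] y q(2) by simp
      then obtain x where x: "x \<in> Hom A (Dom A ?y) (Dom A (v (Suc i)))" "v (Suc i) \<bullet> x = ?y"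
        by (rule_tac A.kernel_lift[OF v(1)[of "Suc i"], of ?y]) (use y \<rho> in simp_all)
      have xh: "x \<in> Hom A (Dom A e1) (Dom A (v (Suc i)))" using x(1) y by simp
      have "v i \<bullet> e1 = Add A (v (Suc i) \<bullet> x) (F i \<bullet> w)" unfolding x(2) by (rule A.Diff_hom(2)[OF h, symmetric])
      also have "v (Suc i) \<bullet> x = v i \<bullet> \<phi> i \<bullet> x" using A.cmp_eq[OF \<phi>(4)[of i], of x] xh \<phi>[of i] vA[of i] by simp
      also have "F i \<bullet> w = v i \<bullet> a \<bullet> w" using A.cmp_eq[OF a(2), of w] a(1) w'(3) vA[of i] by simp
      also have "Add A (v i \<bullet> \<phi> i \<bullet> x) (v i \<bullet> a \<bullet> w) = v i \<bullet> Add A (\<phi> i \<bullet> x) (a \<bullet> w)"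
        by (rule A.cmp_add[symmetric, of _ "Dom A e1" "Dom A (v i)" _ _ "W 0"]) (use xh \<phi>[of i] a(1) w'(3) vA[of i] in simp_all)
      finally have "e1 = Add A (\<phi> i \<bullet> x) (a \<bullet> w)"
        by (rule_tac A.monicD[OF vm[of i]]) (use xh \<phi>[of i] a(1) w' vA[of i] in simp_all)
      then have "b \<bullet> e \<bullet> e1 = (b \<bullet> e) \<bullet> Add A (\<phi> i \<bullet> x) (a \<bullet> w)" using b e'(2,3) w'(1,2) \<phi>[of i] by simp
      also have "\<dots> = Add A ((b \<bullet> e) \<bullet> \<phi> i \<bullet> x) ((b \<bullet> e) \<bullet> a \<bullet> w)"
        by (rule A.cmp_add[of _ "Dom A e1" "Dom A (v i)" _ _ T]) (use xh \<phi>[of i] a(1) w'(3) b e'(2,3) in simp_all)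
      also have "(b \<bullet> e) \<bullet> \<phi> i \<bullet> x = Nul A (Dom A e1) T"
        using A.cmp_eq[OF e'(4), of x] xh \<phi>[of i] b(1-3) e'(2,3) e(2) E1ob b0(1) by simp
      also have "(b \<bullet> e) \<bullet> a \<bullet> w = (b \<bullet> e \<bullet> a) \<bullet> w" using a(1) w'(3) b(1-3) e'(2,3) \<phi>[of i] by simp
      also have "\<dots> = Nul A (Dom A e1) T" unfolding b(4) using w'(3) b0(1) by simp
      finally have "(b \<bullet> e) \<bullet> e1 = Nul A (Dom A e1) T" using E1ob b0(1) b e'(2,3) w' \<phi>[of i] by simp
      then have "b \<bullet> e = Nul A (Dom A e) T" using A.epic_nulD[OF w(1), of "b \<bullet> e"] b e'(2,3) w' \<phi>[of i] by simp
      then have "b = Nul A (Cod A e) T" using A.epic_nulD[OF A.cokernel_epic[OF e(1)], of b] b by simp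
      then show "b = Nul A (Cod A (e \<bullet> a)) T" using a(1) e'(2,3) \<phi>[of i] by simp
    qed
    then have ge: "epic A g" by (rule_tac A.epic_cmpD[of g cf]) (use g cf' in simp_all)
    from simple_chain_quotient[OF W(1) cf] show ?thesis
    proof
      assume "zero_object A (Cod A cf)"
      then show ?thesis using A.zero_epic[OF ge] g(1) by simp
    next
      assume s: "simple_object C (Cod A cf)"
      show ?thesis
      proof (cases "g = Nul A (Cod A cf) (Cod A e)")
        case True
        then have "Idn A (Cod A e) \<bullet> g = Nul A (Cod A e) (Cod A e) \<bullet> g" using g(1) e(2) by simp
        then have "Idn A (Cod A e) = Nul A (Cod A e) (Cod A e)" using A.epicD[OF ge] g(1) e(2) by simp
        then show ?thesis using e(2) by (simp add: A.zero_object_iff)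
      next
        case False
        have "monic A g" by (rule simple_object_C_monic[OF s]) (use g(1) e(2) False in simp_all)
        then have "isomorphism A g" using A.monic_epic_iso ge by blast
        then have "isomorphic C (Cod A cf) (Cod A e)"
          using A.isomorphicI[of g] g(1) cf(2) e(2) by (simp add: isomorphic_C)
        then show ?thesis using C.simple_iso[OF s] by blast
      qed
    qed
  qed
  \<comment> \<open>An element of all \<open>V i\<close> lies in \<open>ker (q r) + W i\<close> for
    all \<open>i\<close> and \<open>r\<close>. For fixed \<open>r\<close>, \<open>lim_detect\<close>
    and the zero limit of \<open>W\<close> put it into \<open>ker (q r)\<close>, and the
    \<open>q r\<close> are jointly monic.\<close>
  have L0: "lim_cone A (\<lambda>i. Dom A (v i)) \<phi> Z (\<lambda>i. Nul A Z (Dom A (v i)))"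
  proof (rule zero_lim_coneI[OF isq Z])
    fix T t i assume t: "\<And>i. t i \<in> Hom A T (Dom A (v i))" "\<And>i. \<phi> i \<bullet> t (Suc i) = t i"
    have tA: "t i \<in> Ar A" "Dom A (t i) = T" "Cod A (t i) = Dom A (v i)" for i using t(1)[of i] by simp_all
    have T: "T \<in> Ob A" using tA(1,2)[of 0] by auto
    have e: "v (Suc i) \<bullet> t (Suc i) = v i \<bullet> t i" for i
    proof -
      have "v (Suc i) \<bullet> t (Suc i) = v i \<bullet> \<phi> i \<bullet> t (Suc i)"
        using A.cmp_eq[OF \<phi>(4)[of i], of "t (Suc i)"] tA[of "Suc i"] \<phi>[of i] vA[of i] by simp
      then show ?thesis unfolding t(2) .
    qed
    define x where "x = v 0 \<bullet> t 0"
    have x: "v i \<bullet> t i = x" for i by (induction i) (simp_all add: x_def e)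
    have xA: "x \<in> Ar A" "Dom A x = T" "Cod A x = W 0" using tA vA by (simp_all add: x_def)
    have \<rho>x: "\<rho> i r \<bullet> x = Nul A T (Cod A (\<gamma> i r))" for i r
    proof -
      have "\<rho> i r \<bullet> x = \<rho> i r \<bullet> v i \<bullet> t i" using x[of i] by simp
      also have "\<dots> = Nul A T (Cod A (\<gamma> i r))"
        using A.cmp_eq[OF \<rho>v[of i r], of "t i"] tA[of i] vA[of i] \<rho>[of i r] \<gamma>(2) by simp
      finally show ?thesis .
    qed
    have "q r \<bullet> x = Nul A T (Cod A (q r))" for r
    proof -
      have qx: "q r \<bullet> x \<in> Hom A T (Cod A (q r))" using qA q(2) xA by simp
      have qh: "q r \<in> Hom A (W 0) (Cod A (q r))" using qA q(2) by simp
      have n: "\<gamma> i r \<bullet> q r \<bullet> x = Nul A T (Cod A (\<gamma> i r))" for i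
        using \<rho>x[of i r] \<gamma>A[of i r] qA q(2) xA by (simp add: \<rho>_def)
      obtain e s where e: "epic A e" "Cod A e = T" "s \<in> Hom A (Dom A e) Z" "(q r \<bullet> p 0) \<bullet> s = (q r \<bullet> x) \<bullet> e"
        by (rule lim_detect[OF acc L q(3) qh \<gamma>(1)[unfolded F_def] \<gamma>(2) qx n])
      have pp: "p 0 \<in> Ar A" "Dom A (p 0) = Z" "Cod A (p 0) = W 0" using lim_coneD(2)[OF L, of 0] by simp_all
      have "p 0 = Nul A Z (W 0)" using A.from_zero[OF Z pp(1,2)] pp by simp
      then have "(q r \<bullet> x) \<bullet> e = Nul A (Dom A e) (Cod A (q r))"
        unfolding e(4)[symmetric] using e(3) qA q(2,3) lim_coneD(1)[OF L] Wob by simp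
      then show ?thesis using A.epic_nulD[OF e(1), of "q r \<bullet> x"] e(2) qx by simp
    qed
    then have "x = Nul A T (W 0)" using joint[of x] xA by simp
    then have "v i \<bullet> t i = Nul A T (W 0)" unfolding x .
    then show "t i = Nul A T (Dom A (v i))" using A.monic_nulD[OF vm[of i], of "t i"] tA vA by simp
  qed
  have V: "simple_chain A C (\<lambda>i. Dom A (v i)) \<phi>"
    unfolding simple_chain_def using isq v(2) \<phi>m L0 Z quot by blast
  \<comment> \<open>\<open>W 0 / V i\<close> is a quotient of the target of \<open>q (rr i)\<close>,
    so it contains no factor \<open>S\<close>.\<close>
  have lenV: "len C ?P (W 0) = len C ?P (Dom A (v i))" for i
  proof -
    have "len C ?P (W 0) = len C ?P (Dom A (v i)) + len C ?P (Cod A (\<rho> i (rr i)))"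
      using len_ses_C[OF P A.epic_short_exact[OF \<rho>e v(1)], of i] vA v(2) W'(2) \<rho> \<gamma>(2) by simp
    moreover have "len C ?P (Cod A (\<gamma> i (rr i))) \<le> len C ?P (Dom A (\<gamma> i (rr i)))"
      using C.len_epic[OF P, of "\<gamma> i (rr i)"] A.cokernel_epic[OF \<gamma>(1)] \<gamma>A \<gamma>(2) q(3) by (simp add: epic_C)
    ultimately show ?thesis using \<gamma>A 0 \<rho> by simp
  qed
  \<comment> \<open>\<open>V i\<close> and \<open>V (i + 1)\<close> have the same length as
    \<open>W 0\<close>, and this length is finite and can be cancelled.\<close>
  have quot0: "len C ?P (Cod A e) = 0" if e: "is_cokernel A (\<phi> i) e" "Cod A e \<in> Ob C" for i e
  proof -
    have "len C ?P (Dom A (v i)) = len C ?P (Dom A (v (Suc i))) + len C ?P (Cod A e)"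
      using len_ses_C[OF P A.monic_short_exact[OF \<phi>m e(1)]] \<phi> v(2) e(2) by simp
    moreover have "len C ?P (W 0) \<noteq> \<infinity>" by (rule finite_len[OF S W'(2)])
    ultimately show ?thesis using lenV[of i] lenV[of "Suc i"]
      by (cases "len C ?P (W 0)"; cases "len C ?P (Cod A e)") (auto simp: zero_enat_def)
  qed
  \<comment> \<open>Each factor \<open>T\<close> of the new chain contributes 1 to the length of
    \<open>V 0\<close> for \<open>T\<close>, which is finite. Acceptability of the chain depends on
    this.\<close>
  have "loc_finite_chain A C \<phi>" unfolding loc_finite_chain_def
  proof (intro allI impI)
    fix T assume T: "simple_object C T"
    let ?Q = "\<lambda>X. isomorphic C X T"
    obtain e where e: "\<And>r. is_cokernel A (\<phi> r) (e r)" "\<And>r. Cod A (e r) \<in> Ob C"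
      using cokernel_choice[OF isq v(2)] by blast
    obtain N where N: "len C ?Q (Dom A (v 0)) = enat N" using finite_len[OF T v(2)[of 0]] by auto
    have "finite {r. len C ?Q (Cod A (e r)) \<noteq> 0}"
    proof (rule enat_sum_bounded_finite[where N=N])
      fix n show "(\<Sum>r<n. len C ?Q (Cod A (e r))) \<le> enat N"
        using chain_len_sum[OF C.simple_class_iso[OF T] isq v(2) \<phi>m e, of n] N by simp
    qed
    moreover have "chain_occurrences A C \<phi> T \<subseteq> {r. len C ?Q (Cod A (e r)) \<noteq> 0}"
      using chain_quotient_len[OF T V e] by auto
    ultimately show "finite (chain_occurrences A C \<phi> T)" by (rule finite_subset[rotated])
  qed
  then have accV: "acceptable_inverse A C (\<lambda>i. Dom A (v i)) \<phi>" by (rule chain_acceptable[OF V])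
  have "len C ?P (Cod A (Idn A (Dom A (v 0)))) = 0"
    by (rule lim_quotient_zero[OF P accV L0 quot0])
      (use v(2)[of 0] lim_coneD(1)[OF L] A.isomorphism_epic A.isomorphism_idn in simp_all)
  then show ?thesis using lenV[of 0] v(2)[of 0] by simp
qed

end

context abelian_category
begin

lemma factors_through_epicI:
  assumes b: "epic A b" and k: "is_kernel A b k" and a: "a \<in> Ar A" "Dom A a = Dom A b" "a \<bullet> k = Nul A (Dom A k) (Cod A a)"
  shows "factors_through A a b"
proof -
  note k' = is_kernelD[OF k]
  obtain h where "h \<in> Hom A (Cod A b) (Cod A a)" "h \<bullet> b = a"
    by (rule cokernel_desc[OF short_exactD(2)[OF epic_short_exact[OF b k]], of a]) (use a k' in simp_all)
  then show ?thesis unfolding factors_through_def using a(1) b epic_ar by blast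
qed

lemma len_kernel_cmp:
  assumes P: "simple_class A P" and "is_kernel A f k1" "is_kernel A g k2" "is_kernel A (g \<bullet> f) k3" "Dom A g = Cod A f"
  shows "len A P (Dom A k3) \<le> len A P (Dom A k1) + len A P (Dom A k2)"
  using abelian_category.len_cokernel_cmp[OF op_abelian simple_class_op[OF abelian_category_axioms P], of g k2 f k1 k3] assms
  by (simp add: add.commute)

end

context lim_setting
begin

lemma len_kernel_down:
  assumes P: "simple_class C P" and f: "inverse_sequence A X f" "\<And>r. X r \<in> Ob C"
    and k: "is_kernel A (down A X f r) k" "Dom A k \<in> Ob C"
    and zero: "\<And>r k. is_kernel A (f r) k \<Longrightarrow> Dom A k \<in> Ob C \<Longrightarrow> len C P (Dom A k) = 0"
  shows "len C P (Dom A k) = 0"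
  using k
proof (induction r arbitrary: k)
  case 0
  have "zero_object A (Dom A k)"
    using A.monic_iff_kernel_zero[OF 0(1)] A.isomorphism_monic A.isomorphism_idn inverse_sequenceD(1)[OF f(1)] by simp
  then show ?case using C.len_zero[OF P] 0(2) by (simp add: zero_object_C)
next
  case (Suc r)
  have D: "down A X f r \<in> Ar A" "Dom A (down A X f r) = X r" "Cod A (down A X f r) = X 0"
    using A.down_hom[OF f(1), of r] by simp_all
  have F: "f r \<in> Ar A" "Dom A (f r) = X (Suc r)" "Cod A (f r) = X r" using inverse_sequenceD(2)[OF f(1), of r] by simp_all
  obtain k2 where k2: "is_kernel A (down A X f r) k2" "Dom A k2 \<in> Ob C"
    by (rule kernel_ex_C[OF D(1)]) (use D f(2) in simp_all)
  obtain k1 where k1: "is_kernel A (f r) k1" "Dom A k1 \<in> Ob C"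
    by (rule kernel_ex_C[OF F(1)]) (use F f(2) in simp_all)
  have "len C P (Dom C k) \<le> len C P (Dom C k1) + len C P (Dom C k2)"
    by (rule C.len_kernel_cmp[OF P, of "f r" k1 "down A X f r"])
      (use k1 k2 Suc.prems D F f(2) in \<open>simp_all add: is_kernel_C\<close>)
  then show ?case using zero[OF k1] Suc.IH[OF k2] by simp
qed

end

context jh_setting
begin

text \<open>Transport of the chain version along the isomorphism \<open>\<theta>\<close> from the
  top of a chain to \<open>X\<close>.\<close>

lemma jointly_monic_len_zero:
  assumes S: "simple_object C S" and X: "X \<in> Ob C"
    and q: "\<And>r. epic A (q r)" "\<And>r. Dom A (q r) = X" "\<And>r. Cod A (q r) \<in> Ob C"
    and fac: "\<And>r. factors_through A (q r) (q (Suc r))"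
    and joint: "\<And>t. t \<in> Ar A \<Longrightarrow> Cod A t = X \<Longrightarrow> (\<And>r. q r \<bullet> t = Nul A (Dom A t) (Cod A (q r))) \<Longrightarrow> t = Nul A (Dom A t) X"
    and 0: "\<And>r. len C (\<lambda>X. isomorphic C X S) (Cod A (q r)) = 0"
  shows "len C (\<lambda>X. isomorphic C X S) X = 0"
proof -
  obtain W f \<theta> where W: "simple_chain A C W f" "loc_finite_chain A C f" and \<theta>: "isomorphism A \<theta>" "Dom A \<theta> = W 0" "Cod A \<theta> = X"
    by (rule chain_obtain[OF X])
  have WC: "W 0 \<in> Ob C" by (rule simple_chainD(2)[OF W(1)])
  have \<theta>A: "\<theta> \<in> Ar A" using \<theta> by simp
  have qA: "q r \<in> Ar A" for r using q(1) by simp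
  have "len C (\<lambda>X. isomorphic C X S) (W 0) = 0"
  proof (rule jointly_monic_len_zero_chain[OF S W, of "\<lambda>r. q r \<bullet> \<theta>"])
    fix r
    show "epic A (q r \<bullet> \<theta>)" by (rule A.epic_cmp[OF A.isomorphism_epic[OF \<theta>(1)] q(1)]) (use q \<theta> in simp)
    show "Dom A (q r \<bullet> \<theta>) = W 0" "Cod A (q r \<bullet> \<theta>) \<in> Ob C" "len C (\<lambda>X. isomorphic C X S) (Cod A (q r \<bullet> \<theta>)) = 0"
      using qA q \<theta> \<theta>A 0 by simp_all
    obtain t where t: "t \<in> Hom A (Cod A (q (Suc r))) (Cod A (q r))" "t \<bullet> q (Suc r) = q r"
      using fac[of r] unfolding factors_through_def by blast
    have "q r \<bullet> \<theta> = t \<bullet> q (Suc r) \<bullet> \<theta>" using A.cmp_eq[OF t(2), of \<theta>] t(1) qA q(2) \<theta> \<theta>A by simp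
    then show "factors_through A (q r \<bullet> \<theta>) (q (Suc r) \<bullet> \<theta>)"
      using A.factors_through_cmp[of t "q (Suc r) \<bullet> \<theta>"] t(1) qA q(2) \<theta> \<theta>A by simp
  next
    fix t assume t: "t \<in> Ar A" "Cod A t = W 0" "\<And>r. (q r \<bullet> \<theta>) \<bullet> t = Nul A (Dom A t) (Cod A (q r \<bullet> \<theta>))"
    have n: "q r \<bullet> \<theta> \<bullet> t = Nul A (Dom A (\<theta> \<bullet> t)) (Cod A (q r))" for r
      using t(3)[of r] t(1,2) qA q(2) \<theta> \<theta>A by simp
    have "\<theta> \<bullet> t = Nul A (Dom A (\<theta> \<bullet> t)) X" by (rule joint[OF _ _ n]) (use t(1,2) \<theta> \<theta>A in simp_all)
    then show "t = Nul A (Dom A t) (W 0)"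
      using A.monic_nulD[OF A.isomorphism_monic[OF \<theta>(1)], of t] t(1,2) \<theta> \<theta>A by simp
  qed
  then show ?thesis using len_iso_arrow[OF \<theta>(1), of "\<lambda>X. isomorphic C X S"] \<theta>(2,3) WC X by simp
qed

text \<open>The quotients \<open>W 0 / W i\<close> have finite length, so a single \<open>q r\<close> already maps onto each of them.\<close>

lemma jointly_epic_quotient_zero:
  assumes S: "simple_object C S" and W: "simple_chain A C W f"
    and q: "\<And>r. q r \<in> Ar A" "\<And>r. Cod A (q r) = W 0" "\<And>r. Dom A (q r) \<in> Ob C"
    and h: "\<And>r. h r \<in> Hom A (Dom A (q r)) (Dom A (q (Suc r)))" "\<And>r. q (Suc r) \<bullet> h r = q r"
    and joint: "\<And>g. g \<in> Ar A \<Longrightarrow> Dom A g = W 0 \<Longrightarrow> (\<And>r. g \<bullet> q r = Nul A (Dom A (q r)) (Cod A g)) \<Longrightarrow> g = Nul A (W 0) (Cod A g)"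
    and 0: "\<And>r. len C (\<lambda>X. isomorphic C X S) (Dom A (q r)) = 0"
    and c: "is_cokernel A (down A W f i) c" "Cod A c \<in> Ob C"
  shows "len C (\<lambda>X. isomorphic C X S) (Cod A c) = 0"
proof -
  note P = C.simple_class_iso[OF S]
  note W' = simple_chainD[OF W]
  note c' = A.is_cokernelD[OF c(1)]
  have cW: "Dom A c = W 0" using c' A.down_hom[OF W'(1), of i] by simp
  have cq: "c \<bullet> q r \<in> Ar A" "Dom A (c \<bullet> q r) = Dom A (q r)" "Cod A (c \<bullet> q r) = Cod A c" for r
    using c'(2) cW q by simp_all
  \<comment> \<open>\<open>b r\<close> divides \<open>W 0 / W i\<close> by the image of
    \<open>q r\<close>. These images increase with \<open>r\<close>, so the quotients
    shrink.\<close>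
  have "\<forall>r. \<exists>b. is_cokernel A (c \<bullet> q r) b \<and> Cod A b \<in> Ob C"
  proof
    fix r obtain b where "is_cokernel A (c \<bullet> q r) b" "Cod A b \<in> Ob C"
      by (rule cokernel_ex_C[OF cq(1)[of r]]) (use cq q(3) c(2) in simp_all)
    then show "\<exists>b. is_cokernel A (c \<bullet> q r) b \<and> Cod A b \<in> Ob C" by blast
  qed
  then have "\<exists>b. \<forall>r. is_cokernel A (c \<bullet> q r) (b r) \<and> Cod A (b r) \<in> Ob C" by (rule choice)
  then obtain b where b: "\<And>r. is_cokernel A (c \<bullet> q r) (b r)" "\<And>r. Cod A (b r) \<in> Ob C" by blast
  have bA: "b r \<in> Ar A" "Dom A (b r) = Cod A c" "b r \<bullet> c \<bullet> q r = Nul A (Dom A (q r)) (Cod A (b r))" for r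
    using A.is_cokernelD[OF b(1)[of r]] cq[of r] by simp_all
  have be: "epic A (b r)" for r by (rule A.cokernel_epic[OF b(1)])
  have qh: "b r' \<bullet> c \<bullet> q r = Nul A (Dom A (q r)) (Cod A (b r'))" if "r \<le> r'" for r r'
    using that
  proof (induction r rule: inc_induct)
    case base show ?case by (rule bA)
  next
    case (step n)
    have "b r' \<bullet> c \<bullet> q n = (b r' \<bullet> c \<bullet> q (Suc n)) \<bullet> h n"
      using h[of n] bA(1,2)[of r'] c'(2) cW q(1,2)[of "Suc n"] by simp
    also have "\<dots> = Nul A (Dom A (q n)) (Cod A (b r'))" unfolding step(3) using h(1)[of n] b(2) by simp
    finally show ?case .
  qed
  have bb: "factors_through A (b r') (b r)" if le: "r \<le> r'" for r r'
  proof -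
    obtain t where t: "t \<in> Hom A (Cod A (b r)) (Cod A (b r'))" "t \<bullet> b r = b r'"
      by (rule A.cokernel_desc[OF b(1)[of r], of "b r'"]) (use bA[of r'] qh[OF le] cq in simp_all)
    then show ?thesis unfolding factors_through_def using bA by blast
  qed
  let ?m = "\<lambda>r. the_enat (len C (simple_object C) (Cod A (b r)))"
  have bound: "len C (simple_object C) (Cod A (b r)) \<le> enat i" for r
    using C.len_epic[OF C.simple_class_simple, of "b r"] be[of r] bA[of r] b(2) c(2) chain_quotient_length[OF W c]
    by (simp add: epic_C)
  have m: "len C (simple_object C) (Cod A (b r)) = enat (?m r)" for r
    using bound[of r] by (cases "len C (simple_object C) (Cod A (b r))") simp_all
  \<comment> \<open>A quotient of least length. From \<open>r0\<close> on the quotients no longer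
    change, so \<open>b r0\<close> kills the images of all \<open>q r\<close>, and joint epicness
    makes its target zero. Hence \<open>c \<bullet> q r0\<close> is epic.\<close>
  define r0 where "r0 = (ARG_MIN ?m r. True)"
  have r0: "?m r0 \<le> ?m r" for r unfolding r0_def by (rule arg_min_nat_le) simp
  have "b r0 \<bullet> c \<bullet> q r = Nul A (Dom A (q r)) (Cod A (b r0))" for r
  proof (cases "r \<le> r0")
    case False
    then have "factors_through A (b r) (b r0)" using bb by simp
    then obtain t where t: "t \<in> Hom A (Cod A (b r0)) (Cod A (b r))" "t \<bullet> b r0 = b r"
      unfolding factors_through_def by blast
    have te: "epic A t" by (rule A.epic_cmpD[of t "b r0"]) (use t bA be in simp_all)
    have ti: "isomorphism A t"
    proof (rule epic_len_iso[OF te])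
      have "enat (?m r0) \<le> enat (?m r)" using r0 by simp
      then have "len C (simple_object C) (Cod A (b r0)) \<le> len C (simple_object C) (Cod A (b r))"
        by (simp only: m[symmetric])
      then show "len C (simple_object C) (Dom A t) \<le> len C (simple_object C) (Cod A t)" using t(1) by simp
      show "len C (simple_object C) (Cod A t) \<noteq> \<infinity>" using t(1) le_enat_not_infinity[OF bound[of r]] by simp
    qed (use t(1) b(2) in simp_all)
    have "t \<bullet> b r0 \<bullet> c \<bullet> q r = b r \<bullet> c \<bullet> q r"
      using A.cmp_eq[OF t(2), of "c \<bullet> q r"] t(1) bA cq by simp
    then have "t \<bullet> b r0 \<bullet> c \<bullet> q r = Nul A (Dom A (q r)) (Cod A (b r))" unfolding bA(3) .
    then show ?thesis
      using A.monic_nulD[OF A.isomorphism_monic[OF ti], of "b r0 \<bullet> c \<bullet> q r"] t(1) bA(1,2) cq by simp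
  qed (rule qh)
  then have "b r0 \<bullet> c = Nul A (W 0) (Cod A (b r0))"
    using joint[of "b r0 \<bullet> c"] bA(1,2) c'(2) cW q by simp
  then have "b r0 = Nul A (Cod A c) (Cod A (b r0))"
    using A.epic_nulD[OF A.cokernel_epic[OF c(1)], of "b r0"] bA(1,2) cW by simp
  then have "Idn A (Cod A (b r0)) \<bullet> b r0 = Nul A (Cod A (b r0)) (Cod A (b r0)) \<bullet> b r0" using bA(1,2) b(2) by simp
  then have "Idn A (Cod A (b r0)) = Nul A (Cod A (b r0)) (Cod A (b r0))"
    using A.epicD[OF be] b(2) by simp
  then have "zero_object A (Cod A (b r0))" using b(2) by (simp add: A.zero_object_iff)
  then have "epic A (c \<bullet> q r0)" using A.epic_iff_cokernel_zero[OF b(1)] by blast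
  then have "len C (\<lambda>X. isomorphic C X S) (Cod A (c \<bullet> q r0)) \<le> len C (\<lambda>X. isomorphic C X S) (Dom A (c \<bullet> q r0))"
    using C.len_epic[OF P, of "c \<bullet> q r0"] cq c(2) q(3) by (simp add: epic_C)
  then show ?thesis using cq 0 by simp
qed

text \<open>All \<open>W 0 / W i\<close> are free of \<open>S\<close>. By additivity and
  cancellation of finite lengths so are the quotients of the chain, and
  \<open>lim_quotient_zero\<close> with the zero limit passes to \<open>W 0\<close>.\<close>

lemma jointly_epic_len_zero:
  assumes S: "simple_object C S" and X: "X \<in> Ob C"
    and q: "\<And>r. q r \<in> Ar A" "\<And>r. Cod A (q r) = X" "\<And>r. Dom A (q r) \<in> Ob C"
    and h: "\<And>r. h r \<in> Hom A (Dom A (q r)) (Dom A (q (Suc r)))" "\<And>r. q (Suc r) \<bullet> h r = q r"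
    and joint: "\<And>g. g \<in> Ar A \<Longrightarrow> Dom A g = X \<Longrightarrow> (\<And>r. g \<bullet> q r = Nul A (Dom A (q r)) (Cod A g)) \<Longrightarrow> g = Nul A X (Cod A g)"
    and 0: "\<And>r. len C (\<lambda>X. isomorphic C X S) (Dom A (q r)) = 0"
  shows "len C (\<lambda>X. isomorphic C X S) X = 0"
proof -
  let ?P = "\<lambda>X. isomorphic C X S"
  note P = C.simple_class_iso[OF S]
  obtain W f \<theta> where W: "simple_chain A C W f" "loc_finite_chain A C f" and \<theta>: "isomorphism A \<theta>" "Dom A \<theta> = W 0" "Cod A \<theta> = X"
    by (rule chain_obtain[OF X])
  note W' = simple_chainD[OF W(1)]
  obtain \<eta> where \<eta>: "\<eta> \<in> Hom A (Cod A \<theta>) (Dom A \<theta>)" "\<eta> \<bullet> \<theta> = Idn A (Dom A \<theta>)" "\<theta> \<bullet> \<eta> = Idn A (Cod A \<theta>)" "isomorphism A \<eta>"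
    by (rule A.isomorphism_inverse[OF \<theta>(1)])
  have \<eta>A: "\<eta> \<in> Ar A" "Dom A \<eta> = X" "Cod A \<eta> = W 0" using \<eta> \<theta> by simp_all
  have quot: "len C ?P (Cod A c) = 0" if c: "is_cokernel A (down A W f i) c" "Cod A c \<in> Ob C" for i c
  proof (rule jointly_epic_quotient_zero[OF S W(1) _ _ _ _ _ _ _ c, of "\<lambda>r. \<eta> \<bullet> q r" h])
    fix r
    show "\<eta> \<bullet> q r \<in> Ar A" "Cod A (\<eta> \<bullet> q r) = W 0" "Dom A (\<eta> \<bullet> q r) \<in> Ob C"
      "h r \<in> Hom A (Dom A (\<eta> \<bullet> q r)) (Dom A (\<eta> \<bullet> q (Suc r)))" "(\<eta> \<bullet> q (Suc r)) \<bullet> h r = \<eta> \<bullet> q r"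
      "len C ?P (Dom A (\<eta> \<bullet> q r)) = 0"
      using q[of r] q[of "Suc r"] h[of r] \<eta>A 0 by simp_all
  next
    fix g assume g: "g \<in> Ar A" "Dom A g = W 0" "\<And>r. g \<bullet> \<eta> \<bullet> q r = Nul A (Dom A (\<eta> \<bullet> q r)) (Cod A g)"
    have n: "(g \<bullet> \<eta>) \<bullet> q r = Nul A (Dom A (q r)) (Cod A (g \<bullet> \<eta>))" for r
      using g(3)[of r] g(1,2) \<eta>A q by simp
    have "g \<bullet> \<eta> = Nul A X (Cod A (g \<bullet> \<eta>))" by (rule joint[OF _ _ n]) (use g(1,2) \<eta>A in simp_all)
    then show "g = Nul A (W 0) (Cod A g)"
      using A.epic_nulD[OF A.isomorphism_epic[OF \<eta>(4)], of g] g(1,2) \<eta>A by simp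
  qed
  have lenW: "len C ?P (W 0) = len C ?P (W i)" for i
  proof -
    have D: "down A W f i \<in> Ar A" "Dom A (down A W f i) = W i" "Cod A (down A W f i) = W 0"
      using A.down_hom[OF W'(1), of i] by simp_all
    have Dm: "monic A (down A W f i)"
    proof (induction i)
      case 0 show ?case using A.isomorphism_monic A.isomorphism_idn W'(2)[of 0] by simp
    next
      case (Suc i) show ?case using A.monic_cmp[OF W'(3) Suc] A.down_hom[OF W'(1), of i] W'(4-6)[of i] by simp
    qed
    obtain c where c: "is_cokernel A (down A W f i) c" "Cod A c \<in> Ob C"
      by (rule cokernel_ex_C[OF D(1)]) (use D W'(2) in simp_all)
    show ?thesis using len_ses_C[OF P A.monic_short_exact[OF Dm c(1)]] quot[OF c] D W'(2) c(2) by simp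
  qed
  obtain Z p where L: "lim_cone A W f Z p" and Z: "zero_object A Z" by (rule simple_chain_lim[OF W(1)])
  have p: "p 0 \<in> Ar A" "Dom A (p 0) = Z" "Cod A (p 0) = W 0" using lim_coneD(2)[OF L, of 0] by simp_all
  have p0: "p 0 = Nul A Z (W 0)" using A.from_zero[OF Z p(1,2)] p by simp
  have "len C ?P (Cod A (Idn A (W 0))) = 0"
  proof (rule lim_quotient_zero[OF P chain_acceptable[OF W] L])
    fix r c assume c: "is_cokernel A (f r) c" "Cod A c \<in> Ob C"
    have "len C ?P (W r) = len C ?P (W (Suc r)) + len C ?P (Cod A c)"
      using len_ses_C[OF P A.monic_short_exact[OF W'(3) c(1)]] W'(2,5,6) c(2) by simp
    then show "len C ?P (Cod A c) = 0"
      using lenW[of r] lenW[of "Suc r"] finite_len[OF S W'(2)[of 0]]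
      by (cases "len C ?P (W 0)"; cases "len C ?P (Cod A c)") (auto simp: zero_enat_def)
  qed (use p0 W'(2)[of 0] lim_coneD(1)[OF L] A.isomorphism_epic A.isomorphism_idn in simp_all)
  then show ?thesis using len_iso_arrow[OF \<theta>(1), of ?P] \<theta>(2,3) W'(2)[of 0] X by simp
qed

text \<open>Kernel and cokernel of \<open>p 0\<close> are both free of \<open>S\<close>. The
  cokernel is treated by \<open>lim_quotient_zero\<close>. The images of the kernel in the
  \<open>Y r\<close> lie in the kernels of \<open>down A Y f r\<close>, which are free of
  \<open>S\<close>, and they form a jointly monic sequence of quotients of the kernel.\<close>

lemma lim_len_base:
  assumes S: "simple_object C S" and acc: "acceptable_inverse A C Y f" and L: "lim_cone A Y f L p" "L \<in> Ob C"
    and ker: "\<And>r k. is_kernel A (f r) k \<Longrightarrow> Dom A k \<in> Ob C \<Longrightarrow> len C (\<lambda>X. isomorphic C X S) (Dom A k) = 0"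
    and cok: "\<And>r c. is_cokernel A (f r) c \<Longrightarrow> Cod A c \<in> Ob C \<Longrightarrow> len C (\<lambda>X. isomorphic C X S) (Cod A c) = 0"
  shows "len C (\<lambda>X. isomorphic C X S) L = len C (\<lambda>X. isomorphic C X S) (Y 0)"
proof -
  let ?P = "\<lambda>X. isomorphic C X S"
  note P = C.simple_class_iso[OF S]
  note Y = acceptableD[OF acc] note D = down_C[OF acc]
  have p: "p r \<in> Ar A" "Dom A (p r) = L" "Cod A (p r) = Y r" for r using lim_coneD(2)[OF L(1), of r] by simp_all
  obtain c where c: "is_cokernel A (p 0) c" "Cod A c \<in> Ob C" by (rule cokernel_ex_C[OF p(1)]) (use p L Y(2) in simp_all)
  note c' = A.is_cokernelD[OF c(1)]
  have c0: "len C ?P (Cod A c) = 0"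
    by (rule lim_quotient_zero[OF P acc L(1) cok A.cokernel_epic[OF c(1)]]) (use c' c(2) p in simp_all)
  obtain \<kappa> where \<kappa>: "is_kernel A (p 0) \<kappa>" "Dom A \<kappa> \<in> Ob C" by (rule kernel_ex_C[OF p(1)]) (use p L Y(2) in simp_all)
  note \<kappa>' = A.is_kernelD[OF \<kappa>(1)]
  have pk: "p r \<bullet> \<kappa> \<in> Ar A" "Dom A (p r \<bullet> \<kappa>) = Dom A \<kappa>" "Cod A (p r \<bullet> \<kappa>) = Y r" for r
    using p \<kappa>' by simp_all
  have "\<forall>r. \<exists>x. case x of (e, m) \<Rightarrow> epic C e \<and> monic C m \<and> Dom A e = Dom A \<kappa> \<and> Cod A m = Y r \<and> Cod A e = Dom A m \<and> m \<bullet> e = p r \<bullet> \<kappa>"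
  proof
    fix r
    have "p r \<bullet> \<kappa> \<in> Ar C" using pk \<kappa>(2) Y(2) by simp
    then obtain e m where "epic C e" "monic C m" "Dom C e = Dom C (p r \<bullet> \<kappa>)" "Cod C m = Cod C (p r \<bullet> \<kappa>)" "Cod C e = Dom C m" "m \<bullet>\<^bsub>C\<^esub> e = p r \<bullet> \<kappa>"
      by (rule C.image_factorization)
    then show "\<exists>x. case x of (e, m) \<Rightarrow> epic C e \<and> monic C m \<and> Dom A e = Dom A \<kappa> \<and> Cod A m = Y r \<and> Cod A e = Dom A m \<and> m \<bullet> e = p r \<bullet> \<kappa>"
      using pk by (intro exI[of _ "(e, m)"]) simp
  qed
  then have "\<exists>x. \<forall>r. case x r of (e, m) \<Rightarrow> epic C e \<and> monic C m \<and> Dom A e = Dom A \<kappa> \<and> Cod A m = Y r \<and> Cod A e = Dom A m \<and> m \<bullet> e = p r \<bullet> \<kappa>" by (rule choice)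
  then obtain x where x: "\<forall>r. case x r of (e, m) \<Rightarrow> epic C e \<and> monic C m \<and> Dom A e = Dom A \<kappa> \<and> Cod A m = Y r \<and> Cod A e = Dom A m \<and> m \<bullet> e = p r \<bullet> \<kappa>" ..
  define e m where "e r = fst (x r)" and "m r = snd (x r)" for r
  have em: "epic A (e r)" "monic A (m r)" "Dom A (e r) = Dom A \<kappa>" "Cod A (m r) = Y r" "Cod A (e r) = Dom A (m r)" "m r \<bullet> e r = p r \<bullet> \<kappa>"
    "Dom A (m r) \<in> Ob C" for r
    using x[rule_format, of r] by (simp_all add: e_def m_def case_prod_beta epic_C monic_C)
  have emA: "e r \<in> Ar A" "m r \<in> Ar A" for r using em(1,2) by simp_all
  have \<kappa>0: "len C ?P (Dom A \<kappa>) = 0"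
  proof (rule jointly_monic_len_zero[OF S \<kappa>(2) em(1,3)])
    fix r
    show "Cod A (e r) \<in> Ob C" using em by simp
    obtain k where k: "is_kernel A (e (Suc r)) k" using A.kernel_ex[OF emA(1)] by blast
    note k' = A.is_kernelD[OF k]
    have "m r \<bullet> e r = f r \<bullet> m (Suc r) \<bullet> e (Suc r)"
      unfolding em(6) using A.cmp_eq[OF lim_coneD(3)[OF L(1), of r], of \<kappa>] p \<kappa>' Y(3-5)[of r] by simp
    then have "(m r \<bullet> e r) \<bullet> k = f r \<bullet> m (Suc r) \<bullet> e (Suc r) \<bullet> k"
      using k'(2,3) em(3-5) emA Y(3-5)[of r] by simp
    then have "m r \<bullet> e r \<bullet> k = Nul A (Dom A k) (Y r)"
      using k' em(3-5) emA Y(2-5)[of r] by simp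
    then have "e r \<bullet> k = Nul A (Dom A k) (Cod A (e r))"
      using A.monic_nulD[OF em(2)[of r], of "e r \<bullet> k"] k'(2,3) em(3-5) emA by simp
    then show "factors_through A (e r) (e (Suc r))"
      by (rule_tac A.factors_through_epicI[OF em(1) k]) (use em(3) emA in simp_all)
    obtain k2 where k2: "is_kernel A (down A Y f r) k2" "Dom A k2 \<in> Ob C"
      by (rule kernel_ex_C[OF D(1)[of r]]) (use D Y(2) in simp_all)
    have "(down A Y f r \<bullet> m r) \<bullet> e r = p 0 \<bullet> \<kappa>"
      using em(3-6)[of r] emA[of r] D[of r] A.cmp_eq[OF A.down_lim[OF Y(1) L(1), of r], of \<kappa>] p \<kappa>' by simp
    also have "\<dots> = Nul A (Dom A (e r)) (Y 0)" using \<kappa>' em(3) p by simp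
    finally have "down A Y f r \<bullet> m r = Nul A (Dom A (m r)) (Y 0)"
      using A.epic_nulD[OF em(1)[of r], of "down A Y f r \<bullet> m r"] em(4,5)[of r] emA[of r] D[of r] by simp
    then obtain s where s: "s \<in> Hom A (Dom A (m r)) (Dom A k2)" "k2 \<bullet> s = m r"
      by (rule_tac A.kernel_lift[OF k2(1), of "m r"]) (use emA em(4) D in simp_all)
    have "monic A s" by (rule A.monic_cmpD[of k2]) (use s em(2) A.is_kernelD[OF k2(1)] in simp_all)
    then have "len C ?P (Dom A s) \<le> len C ?P (Cod A s)" using C.len_monic[OF P, of s] s(1) k2(2) em(7) by (simp add: monic_C)
    then show "len C ?P (Cod A (e r)) = 0"
      using s(1) em(5) len_kernel_down[OF P Y(1,2) k2 ker] by simp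
  next
    fix t assume t: "t \<in> Ar A" "Cod A t = Dom A \<kappa>" "\<And>r. e r \<bullet> t = Nul A (Dom A t) (Cod A (e r))"
    \<comment> \<open>Arrows into \<open>L\<close> are determined by their composites with the
      \<open>p r\<close>, and these are seen by the images \<open>m r\<close>.\<close>
    have "\<kappa> \<bullet> t = Nul A (Dom A t) L"
    proof (rule A.lim_cone_eq[OF L(1) Y(1), of _ "Dom A t"])
      fix r
      have "p r \<bullet> \<kappa> \<bullet> t = m r \<bullet> e r \<bullet> t"
        using A.cmp_eq[OF em(6)[of r, symmetric, symmetric], of t] t(1,2) p \<kappa>' em(3,5)[of r] emA by simp
      then show "p r \<bullet> \<kappa> \<bullet> t = p r \<bullet> Nul A (Dom A t) L"
        unfolding t(3) using t(1) p[of r] em(4,5)[of r] emA L(2) by simp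
    qed (use t(1,2) \<kappa>' p L(2) in simp_all)
    then show "t = Nul A (Dom A t) (Dom A \<kappa>)"
      using A.monic_nulD[OF A.kernel_monic[OF \<kappa>(1)], of t] t(1,2) \<kappa>' p by simp
  qed
  show ?thesis using len_exact4_C[OF P \<kappa>(1) c(1)] p L(2) Y(2) \<kappa>(2) c(2) c0 \<kappa>0 by simp
qed

end

section \<open>Colimits of acceptable sequences\<close>

locale jh_dual_setting = jh_setting A C + dual: lim_setting "op_cat A" "op_cat C"
  for A :: "('o, 'm) cat" (structure) and C :: "('o, 'm) cat"
begin

text \<open>The kernel of \<open>Y 0 -> colim Y\<close> is covered by the dual of
  \<open>lim_quotient_zero\<close>. The cokernel receives the cokernels of the finite stages
  \<open>Y 0 -> Y r\<close> as a jointly epic sequence. It is handled by the chains of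
  \<open>C\<close> itself, as no chains are available in the opposite category.\<close>

lemma colim_len_base:
  assumes S: "simple_object C S" and acc: "acceptable_inverse (op_cat A) (op_cat C) Y f"
    and L: "lim_cone (op_cat A) Y f L p" "L \<in> Ob C"
    and ker: "\<And>r k. is_kernel A (f r) k \<Longrightarrow> Dom A k \<in> Ob C \<Longrightarrow> len C (\<lambda>X. isomorphic C X S) (Dom A k) = 0"
    and cok: "\<And>r c. is_cokernel A (f r) c \<Longrightarrow> Cod A c \<in> Ob C \<Longrightarrow> len C (\<lambda>X. isomorphic C X S) (Cod A c) = 0"
  shows "len C (\<lambda>X. isomorphic C X S) L = len C (\<lambda>X. isomorphic C X S) (Y 0)"
proof -
  let ?P = "\<lambda>X. isomorphic C X S"
  note P = C.simple_class_iso[OF S]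
  note P' = simple_class_op[OF C.abelian_category_axioms P]
  have Y: "inverse_sequence (op_cat A) Y f" "Y r \<in> Ob C" "f r \<in> Ar A" "Cod A (f r) = Y (Suc r)" "Dom A (f r) = Y r" for r
    using dual.acceptableD[OF acc] by simp_all
  \<comment> \<open>Read in \<open>A\<close>, these are the composites \<open>Y 0 -> Y r\<close>,
    and \<open>l r\<close> below is the cokernel of such a composite.\<close>
  define U where "U = down (op_cat A) Y f"
  have U: "U r \<in> Ar A" "Cod A (U r) = Y r" "Dom A (U r) = Y 0" "U (Suc r) = f r \<bullet> U r" for r
    using dual.down_C[OF acc, of r] by (simp_all add: U_def)
  have p: "p r \<in> Ar A" "Cod A (p r) = L" "Dom A (p r) = Y r" "p (Suc r) \<bullet> f r = p r" for r
    using lim_coneD(2,3)[OF L(1), of r] by simp_all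
  have pU: "p r \<bullet> U r = p 0" for r
    using preadditive_category.down_lim[OF A.op Y(1) L(1), of r] by (simp add: U_def)
  obtain k where k: "is_kernel A (p 0) k" "Dom A k \<in> Ob C" by (rule kernel_ex_C[OF p(1)]) (use p L Y(2) in simp_all)
  note k' = A.is_kernelD[OF k(1)]
  have "len (op_cat C) ?P (Cod (op_cat A) k) = 0"
    by (rule dual.lim_quotient_zero[OF P' acc L(1)]) (use ker A.kernel_monic[OF k(1)] k' k(2) p in simp_all)
  then have k0: "len C ?P (Dom A k) = 0" by simp
  obtain c where c: "is_cokernel A (p 0) c" "Cod A c \<in> Ob C" by (rule cokernel_ex_C[OF p(1)]) (use p L Y(2) in simp_all)
  note c' = A.is_cokernelD[OF c(1)]
  have "\<forall>r. \<exists>l. is_cokernel A (U r) l \<and> Cod A l \<in> Ob C"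
  proof
    fix r obtain l where "is_cokernel A (U r) l" "Cod A l \<in> Ob C"
      by (rule cokernel_ex_C[OF U(1)[of r]]) (use U Y(2) in simp_all)
    then show "\<exists>l. is_cokernel A (U r) l \<and> Cod A l \<in> Ob C" by blast
  qed
  then have "\<exists>l. \<forall>r. is_cokernel A (U r) (l r) \<and> Cod A (l r) \<in> Ob C" by (rule choice)
  then obtain l where l: "\<And>r. is_cokernel A (U r) (l r)" "\<And>r. Cod A (l r) \<in> Ob C" by blast
  have lA: "l r \<in> Ar A" "Dom A (l r) = Y r" "l r \<bullet> U r = Nul A (Y 0) (Cod A (l r))" for r
    using A.is_cokernelD[OF l(1)[of r]] U[of r] by simp_all
  have le: "epic A (l r)" for r by (rule A.cokernel_epic[OF l(1)])
  have l0: "len C ?P (Cod A (l r)) = 0" for r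
    using dual.len_kernel_down[OF P' Y(1), of r "l r"] Y(2) l[of r] cok by (simp add: U_def)
  have "\<forall>r. \<exists>q. q \<in> Hom A (Cod A (l r)) (Cod A c) \<and> q \<bullet> l r = c \<bullet> p r"
  proof
    fix r
    have "c \<bullet> p r \<bullet> U r = Nul A (Y 0) (Cod A c)" unfolding pU using c' p by simp
    then obtain q where "q \<in> Hom A (Cod A (l r)) (Cod A (c \<bullet> p r))" "q \<bullet> l r = c \<bullet> p r"
      by (rule_tac A.cokernel_desc[OF l(1)[of r], of "c \<bullet> p r"]) (use c' p U in simp_all)
    then show "\<exists>q. q \<in> Hom A (Cod A (l r)) (Cod A c) \<and> q \<bullet> l r = c \<bullet> p r" using c' p by (intro exI[of _ q]) simp
  qed
  then have "\<exists>q. \<forall>r. q r \<in> Hom A (Cod A (l r)) (Cod A c) \<and> q r \<bullet> l r = c \<bullet> p r" by (rule choice)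
  then obtain q where q0: "\<forall>r. q r \<in> Hom A (Cod A (l r)) (Cod A c) \<and> q r \<bullet> l r = c \<bullet> p r" ..
  have q: "q r \<in> Ar A" "Dom A (q r) = Cod A (l r)" "Cod A (q r) = Cod A c" "q r \<bullet> l r = c \<bullet> p r" for r
    using q0[rule_format, of r] by simp_all
  have "\<forall>r. \<exists>h. h \<in> Hom A (Cod A (l r)) (Cod A (l (Suc r))) \<and> h \<bullet> l r = l (Suc r) \<bullet> f r"
  proof
    fix r
    have "l (Suc r) \<bullet> f r \<bullet> U r = Nul A (Y 0) (Cod A (l (Suc r)))" using lA(3)[of "Suc r"] unfolding U(4) .
    then obtain h where "h \<in> Hom A (Cod A (l r)) (Cod A (l (Suc r) \<bullet> f r))" "h \<bullet> l r = l (Suc r) \<bullet> f r"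
      by (rule_tac A.cokernel_desc[OF l(1)[of r], of "l (Suc r) \<bullet> f r"]) (use lA U(1-3) Y(3-5) in simp_all)
    then show "\<exists>h. h \<in> Hom A (Cod A (l r)) (Cod A (l (Suc r))) \<and> h \<bullet> l r = l (Suc r) \<bullet> f r"
      using lA Y(3-5) by (intro exI[of _ h]) simp
  qed
  then have "\<exists>h. \<forall>r. h r \<in> Hom A (Cod A (l r)) (Cod A (l (Suc r))) \<and> h r \<bullet> l r = l (Suc r) \<bullet> f r" by (rule choice)
  then obtain h where h0: "\<forall>r. h r \<in> Hom A (Cod A (l r)) (Cod A (l (Suc r))) \<and> h r \<bullet> l r = l (Suc r) \<bullet> f r" ..
  have h: "h r \<in> Ar A" "Dom A (h r) = Cod A (l r)" "Cod A (h r) = Cod A (l (Suc r))" "h r \<bullet> l r = l (Suc r) \<bullet> f r" for r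
    using h0[rule_format, of r] by simp_all
  have c0: "len C ?P (Cod A c) = 0"
  proof (rule jointly_epic_len_zero[OF S c(2), of q h])
    fix r
    show "q r \<in> Ar A" "Cod A (q r) = Cod A c" "Dom A (q r) \<in> Ob C" "len C ?P (Dom A (q r)) = 0"
      "h r \<in> Hom A (Dom A (q r)) (Dom A (q (Suc r)))" using q h l(2) l0 by simp_all
    show "q (Suc r) \<bullet> h r = q r"
    proof (rule A.epicD[OF le[of r]])
      have "(q (Suc r) \<bullet> h r) \<bullet> l r = q (Suc r) \<bullet> l (Suc r) \<bullet> f r" using q h lA by simp
      also have "\<dots> = c \<bullet> p (Suc r) \<bullet> f r" using A.cmp_eq[OF q(4)[of "Suc r"], of "f r"] q(1-3) lA Y(3-5) c'(2,3) p(1-3) by simp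
      finally show "(q (Suc r) \<bullet> h r) \<bullet> l r = q r \<bullet> l r" unfolding p(4) q(4) .
    qed (use q h lA in simp_all)
  next
    fix g assume g: "g \<in> Ar A" "Dom A g = Cod A c" "\<And>r. g \<bullet> q r = Nul A (Dom A (q r)) (Cod A g)"
    have "g \<bullet> c = Nul A L (Cod A g)"
    proof (rule preadditive_category.lim_cone_eq[OF A.op L(1) Y(1), of "g \<bullet> c" "Cod A g" "Nul A L (Cod A g)"])
      fix r
      have "(g \<bullet> q r) \<bullet> l r = g \<bullet> c \<bullet> p r" using g(1,2) q(1-3)[of r] lA(1,2)[of r] by (simp add: q(4))
      then have "g \<bullet> c \<bullet> p r = Nul A (Y r) (Cod A g)" unfolding g(3) using q(1-3)[of r] lA(1,2)[of r] g(1) by simp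
      then show "p r \<bullet>\<^bsub>op_cat A\<^esub> (g \<bullet> c) = p r \<bullet>\<^bsub>op_cat A\<^esub> Nul A L (Cod A g)"
        using g(1,2) c'(2,3) p by simp
    qed (use g(1,2) c'(2,3) p L(2) in simp_all)
    then show "g = Nul A (Cod A c) (Cod A g)"
      using A.epic_nulD[OF A.cokernel_epic[OF c(1)], of g] g(1,2) c'(2,3) p by simp
  qed
  show ?thesis using len_exact4_C[OF P k(1) c(1)] p L(2) Y(2) k(2) c(2) c0 k0 by simp
qed

lemma lim_relation:
  fixes K D :: "nat \<Rightarrow> 'o"
  assumes S: "simple_object C S" and acc: "acceptable_inverse A C Y f" and L: "lim_cone A Y f L p" "L \<in> Ob C"
    and K: "\<And>r. K r \<in> Ob C" "\<And>r k. is_kernel A (f r) k \<Longrightarrow> Dom A k \<in> Ob C \<Longrightarrow> len C (\<lambda>X. isomorphic C X S) (Dom A k) = len C (\<lambda>X. isomorphic C X S) (K r)"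
    and D: "\<And>r. D r \<in> Ob C" "\<And>r c. is_cokernel A (f r) c \<Longrightarrow> Cod A c \<in> Ob C \<Longrightarrow> len C (\<lambda>X. isomorphic C X S) (Cod A c) = len C (\<lambda>X. isomorphic C X S) (D r)"
    and B: "biproduct_in A C UNIV K BK" "biproduct_in A C UNIV D BD"
  shows "len C (\<lambda>X. isomorphic C X S) L + len C (\<lambda>X. isomorphic C X S) BD
    = len C (\<lambda>X. isomorphic C X S) (Y 0) + len C (\<lambda>X. isomorphic C X S) BK"
proof (rule lim_len[where P = "\<lambda>X. isomorphic C X S", OF C.simple_class_iso[OF S] _ _ acc L])
  fix X assume "X \<in> Ob C" then show "len C (\<lambda>X. isomorphic C X S) X \<noteq> \<infinity>" by (rule finite_len[OF S])
next
  fix Y f L p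
  assume "acceptable_inverse A C Y f" "lim_cone A Y f L p" "L \<in> Ob C"
    "\<And>r k. is_kernel A (f r) k \<Longrightarrow> Dom A k \<in> Ob C \<Longrightarrow> len C (\<lambda>X. isomorphic C X S) (Dom A k) = 0"
    "\<And>r c. is_cokernel A (f r) c \<Longrightarrow> Cod A c \<in> Ob C \<Longrightarrow> len C (\<lambda>X. isomorphic C X S) (Cod A c) = 0"
  then show "len C (\<lambda>X. isomorphic C X S) L = len C (\<lambda>X. isomorphic C X S) (Y 0)"
    by (rule lim_len_base[OF S])
qed (fact K D B)+

lemma biproduct_in_op: "biproduct_in (op_cat A) (op_cat C) J K B \<longleftrightarrow> biproduct_in A C J K B"
proof -
  have "is_biproduct (op_cat A) J K B i p \<longleftrightarrow> is_biproduct A J K B p i" for i p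
    unfolding A.biproduct_iff preadditive_category.biproduct_iff[OF A.op] by auto
  then show ?thesis unfolding biproduct_in_def by auto
qed

text \<open>Passage to the opposite category exchanges kernels and cokernels, so \<open>BK\<close>
  and \<open>BD\<close> trade places compared with \<open>lim_relation\<close>.\<close>

lemma colim_relation:
  fixes K D :: "nat \<Rightarrow> 'o"
  assumes S: "simple_object C S" and acc: "acceptable_inverse (op_cat A) (op_cat C) Y f"
    and L: "lim_cone (op_cat A) Y f L p" "L \<in> Ob C"
    and K: "\<And>r. K r \<in> Ob C" "\<And>r k. is_kernel A (f r) k \<Longrightarrow> Dom A k \<in> Ob C \<Longrightarrow> len C (\<lambda>X. isomorphic C X S) (Dom A k) = len C (\<lambda>X. isomorphic C X S) (K r)"
    and D: "\<And>r. D r \<in> Ob C" "\<And>r c. is_cokernel A (f r) c \<Longrightarrow> Cod A c \<in> Ob C \<Longrightarrow> len C (\<lambda>X. isomorphic C X S) (Cod A c) = len C (\<lambda>X. isomorphic C X S) (D r)"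
    and B: "biproduct_in A C UNIV K BK" "biproduct_in A C UNIV D BD"
  shows "len C (\<lambda>X. isomorphic C X S) L + len C (\<lambda>X. isomorphic C X S) BK
    = len C (\<lambda>X. isomorphic C X S) (Y 0) + len C (\<lambda>X. isomorphic C X S) BD"
proof -
  let ?P = "\<lambda>X. isomorphic C X S"
  have "len (op_cat C) ?P L + len (op_cat C) ?P BK = len (op_cat C) ?P (Y 0) + len (op_cat C) ?P BD"
  proof (rule dual.lim_len[where P = ?P, OF simple_class_op[OF C.abelian_category_axioms C.simple_class_iso[OF S]] _ _ acc L(1)])
    show "X \<in> Ob (op_cat C) \<Longrightarrow> len (op_cat C) ?P X \<noteq> \<infinity>" for X using finite_len[OF S, of X] by simp
    show "biproduct_in (op_cat A) (op_cat C) UNIV D BD" "biproduct_in (op_cat A) (op_cat C) UNIV K BK"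
      unfolding biproduct_in_op by (rule B)+
  next
    fix Y f L p
    assume "acceptable_inverse (op_cat A) (op_cat C) Y f" "lim_cone (op_cat A) Y f L p" "L \<in> Ob (op_cat C)"
      "\<And>r k. is_kernel (op_cat A) (f r) k \<Longrightarrow> Dom (op_cat A) k \<in> Ob (op_cat C) \<Longrightarrow> len (op_cat C) ?P (Dom (op_cat A) k) = 0"
      "\<And>r c. is_cokernel (op_cat A) (f r) c \<Longrightarrow> Cod (op_cat A) c \<in> Ob (op_cat C) \<Longrightarrow> len (op_cat C) ?P (Cod (op_cat A) c) = 0"
    then show "len (op_cat C) ?P L = len (op_cat C) ?P (Y 0)"
      using colim_len_base[OF S, of Y f L p] by simp
  qed (use L K D in simp_all)
  then show ?thesis by simp
qed

end

section \<open>Reindexing biproducts, and duality\<close>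

context preadditive_category
begin

lemma product_reindex:
  assumes j: "bij_betw j J J'" and P: "is_product A J' X P \<pi>"
  shows "is_product A J (\<lambda>i. X (j i)) P (\<lambda>i. \<pi> (j i))"
proof (rule productI)
  note D = is_productD[OF P]
  have jJ: "j i \<in> J'" if "i \<in> J" for i using bij_betwE[OF j] that by blast
  show "P \<in> Ob A" by (rule D)
  fix i assume "i \<in> J"
  then show "X (j i) \<in> Ob A" "\<pi> (j i) \<in> Hom A P (X (j i))" using D(1,3) jJ by blast+
next
  have jJ: "j i \<in> J'" if "i \<in> J" for i using bij_betwE[OF j] that by blast
  have ij: "inv_into J j (j i) = i" if "i \<in> J" for i by (rule bij_betw_inv_into_left[OF j that])
  fix T q assume T: "T \<in> Ob A" and q: "\<And>i. i \<in> J \<Longrightarrow> q i \<in> Hom A T (X (j i))"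
  obtain h where h: "h \<in> Hom A T P" "\<And>i. i \<in> J' \<Longrightarrow> \<pi> i \<bullet> h = q (inv_into J j i)"
  proof (rule product_tuple[OF P T, of "\<lambda>i. q (inv_into J j i)"])
    fix i assume "i \<in> J'"
    then have "inv_into J j i \<in> J" "j (inv_into J j i) = i"
      using bij_betw_inv_into_right[OF j] bij_betwE[OF bij_betw_inv_into[OF j]] by blast+
    then show "q (inv_into J j i) \<in> Hom A T (X i)" using q[of "inv_into J j i"] by simp
  qed blast
  have "\<pi> (j i) \<bullet> h = q i" if "i \<in> J" for i using h(2)[OF jJ[OF that]] ij[OF that] by simp
  then show "\<exists>h. h \<in> Hom A T P \<and> (\<forall>i\<in>J. \<pi> (j i) \<bullet> h = q i)" using h(1) by blast
next
  fix T g h assume T: "g \<in> Hom A T P" "h \<in> Hom A T P"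
    and e: "\<And>i. i \<in> J \<Longrightarrow> \<pi> (j i) \<bullet> g = \<pi> (j i) \<bullet> h"
  show "g = h"
  proof (rule product_eq[OF P T])
    fix i assume "i \<in> J'"
    then have "inv_into J j i \<in> J" "j (inv_into J j i) = i"
      using bij_betw_inv_into_right[OF j] bij_betwE[OF bij_betw_inv_into[OF j]] by blast+
    then show "\<pi> i \<bullet> g = \<pi> i \<bullet> h" using e[of "inv_into J j i"] by simp
  qed
qed

lemma product_flatten:
  assumes B: "is_product A I Y B p" and Y: "\<And>i. i \<in> I \<Longrightarrow> is_product A (K i) (X i) (Y i) (p' i)"
  shows "is_product A (Sigma I K) (\<lambda>(i, k). X i k) B (\<lambda>(i, k). p' i k \<bullet> p i)"
proof (rule productI)
  show "B \<in> Ob A" by (rule is_productD(2)[OF B])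
  fix x assume "x \<in> Sigma I K"
  then obtain i k where x: "x = (i, k)" "i \<in> I" "k \<in> K i" by auto
  show "(case x of (i, k) \<Rightarrow> X i k) \<in> Ob A" using is_productD(1)[OF Y[OF x(2)] x(3)] x(1) by simp
  show "(case x of (i, k) \<Rightarrow> p' i k \<bullet> p i) \<in> Hom A B (case x of (i, k) \<Rightarrow> X i k)"
    using cmp_hom[OF is_productD(3)[OF B x(2)] is_productD(3)[OF Y[OF x(2)] x(3)]] x(1) by simp
next
  fix T q assume T: "T \<in> Ob A" and q: "\<And>x. x \<in> Sigma I K \<Longrightarrow> q x \<in> Hom A T (case x of (i, k) \<Rightarrow> X i k)"
  have ex: "\<exists>h. h \<in> Hom A T (Y i) \<and> (\<forall>k\<in>K i. p' i k \<bullet> h = q (i, k))" if i: "i \<in> I" for i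
  proof -
    have qi: "q (i, k) \<in> Hom A T (X i k)" if "k \<in> K i" for k using q[of "(i, k)"] i that by simp
    obtain h where "h \<in> Hom A T (Y i)" "\<And>k. k \<in> K i \<Longrightarrow> p' i k \<bullet> h = q (i, k)"
      by (rule product_tuple[OF Y[OF i] T qi]) blast+
    then show ?thesis by blast
  qed
  then have "\<forall>i. \<exists>h. i \<in> I \<longrightarrow> h \<in> Hom A T (Y i) \<and> (\<forall>k\<in>K i. p' i k \<bullet> h = q (i, k))" by blast
  then have "\<exists>h. \<forall>i. i \<in> I \<longrightarrow> h i \<in> Hom A T (Y i) \<and> (\<forall>k\<in>K i. p' i k \<bullet> h i = q (i, k))" by (rule choice)
  then obtain h where h: "\<And>i. i \<in> I \<Longrightarrow> h i \<in> Hom A T (Y i)" "\<And>i k. i \<in> I \<Longrightarrow> k \<in> K i \<Longrightarrow> p' i k \<bullet> h i = q (i, k)" by blast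
  obtain g where g: "g \<in> Hom A T B" "\<And>i. i \<in> I \<Longrightarrow> p i \<bullet> g = h i" by (rule product_tuple[OF B T h(1)]) blast+
  have "(case x of (i, k) \<Rightarrow> p' i k \<bullet> p i) \<bullet> g = q x" if xS: "x \<in> Sigma I K" for x
  proof -
    obtain i k where x: "x = (i, k)" "i \<in> I" "k \<in> K i" using xS by auto
    have "(p' i k \<bullet> p i) \<bullet> g = p' i k \<bullet> h i"
      using g(2)[OF x(2)] is_productD(3)[OF B x(2)] is_productD(3)[OF Y[OF x(2)] x(3)] g(1) by simp
    then show ?thesis using h(2)[OF x(2,3)] x(1) by simp
  qed
  then show "\<exists>h. h \<in> Hom A T B \<and> (\<forall>x\<in>Sigma I K. (case x of (i, k) \<Rightarrow> p' i k \<bullet> p i) \<bullet> h = q x)" using g(1) by blast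
next
  fix T g h assume T: "g \<in> Hom A T B" "h \<in> Hom A T B"
    and e: "\<And>x. x \<in> Sigma I K \<Longrightarrow> (case x of (i, k) \<Rightarrow> p' i k \<bullet> p i) \<bullet> g = (case x of (i, k) \<Rightarrow> p' i k \<bullet> p i) \<bullet> h"
  show "g = h"
  proof (rule product_eq[OF B T])
    fix i assume i: "i \<in> I"
    show "p i \<bullet> g = p i \<bullet> h"
    proof (rule product_eq[OF Y[OF i]])
      show "p i \<bullet> g \<in> Hom A T (Y i)" "p i \<bullet> h \<in> Hom A T (Y i)" using is_productD(3)[OF B i] T by simp_all
      fix k assume k: "k \<in> K i"
      show "p' i k \<bullet> p i \<bullet> g = p' i k \<bullet> p i \<bullet> h"
        using e[of "(i, k)"] i k is_productD(3)[OF B i] is_productD(3)[OF Y[OF i] k] T by simp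
    qed
  qed
qed

text \<open>Zero objects in the remaining positions do not change a product. With
  \<open>biproduct_flatten\<close> this rewrites a sum with countably many nonzero summands as a sum
  of a sequence, the only form in which acceptability and the length results apply.\<close>

lemma product_pad:
  assumes B: "is_product A J X B p" and \<phi>: "bij_betw \<phi> R J"
    and \<theta>: "\<And>r. r \<in> R \<Longrightarrow> \<theta> r \<in> Hom A (X (\<phi> r)) (Q r)" "\<And>r. r \<in> R \<Longrightarrow> \<eta> r \<in> Hom A (Q r) (X (\<phi> r))"
      "\<And>r. r \<in> R \<Longrightarrow> \<eta> r \<bullet> \<theta> r = Idn A (X (\<phi> r))" "\<And>r. r \<in> R \<Longrightarrow> \<theta> r \<bullet> \<eta> r = Idn A (Q r)"
    and Z: "\<And>r. r \<notin> R \<Longrightarrow> zero_object A (Q r)"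
  shows "is_product A UNIV Q B (\<lambda>r. if r \<in> R then \<theta> r \<bullet> p (\<phi> r) else Nul A B (Q r))"
proof -
  have Bob: "B \<in> Ob A" by (rule is_productD(2)[OF B])
  have P: "is_product A R (\<lambda>r. X (\<phi> r)) B (\<lambda>r. p (\<phi> r))" by (rule product_reindex[OF \<phi> B])
  have p: "p (\<phi> r) \<in> Ar A" "Dom A (p (\<phi> r)) = B" "Cod A (p (\<phi> r)) = X (\<phi> r)" "X (\<phi> r) \<in> Ob A" if "r \<in> R" for r
    using is_productD(3)[OF P that] is_productD(1)[OF P that] by simp_all
  have t: "\<theta> r \<in> Ar A" "Dom A (\<theta> r) = X (\<phi> r)" "Cod A (\<theta> r) = Q r"
    "\<eta> r \<in> Ar A" "Cod A (\<eta> r) = X (\<phi> r)" "Dom A (\<eta> r) = Q r" if "r \<in> R" for r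
    using \<theta>(1,2)[OF that] by simp_all
  have tQ: "Q r \<in> Ob A" if "r \<in> R" for r using ob_cod[OF t(1)[OF that]] t(3)[OF that] by simp
  have z: "Q r \<in> Ob A" if "r \<notin> R" for r using Z[OF that] by (simp add: zero_object_iff)
  show ?thesis
  proof (rule productI)
    show "B \<in> Ob A" by (rule Bob)
    fix r
    show "Q r \<in> Ob A" using tQ z by blast
    show "(if r \<in> R then \<theta> r \<bullet> p (\<phi> r) else Nul A B (Q r)) \<in> Hom A B (Q r)"
      using p[of r] t[of r] tQ[of r] z[of r] Bob by simp
  next
    fix T q assume T: "T \<in> Ob A" and q: "\<And>r. r \<in> UNIV \<Longrightarrow> q r \<in> Hom A T (Q r)"
    obtain h where h: "h \<in> Hom A T B" "\<And>r. r \<in> R \<Longrightarrow> p (\<phi> r) \<bullet> h = \<eta> r \<bullet> q r"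
      by (rule product_tuple[OF P T, of "\<lambda>r. \<eta> r \<bullet> q r"]) (use q t in simp_all)
    have "(if r \<in> R then \<theta> r \<bullet> p (\<phi> r) else Nul A B (Q r)) \<bullet> h = q r" for r
    proof (cases "r \<in> R")
      case True
      have "(\<theta> r \<bullet> p (\<phi> r)) \<bullet> h = \<theta> r \<bullet> \<eta> r \<bullet> q r"
        using h(2)[OF True] h(1) p[OF True] t[OF True] by simp
      also have "\<dots> = q r" using cmp_eq[OF \<theta>(4)[OF True], of "q r"] q[of r] t[OF True] by simp
      finally show ?thesis using True by simp
    next
      case False
      have "q r = Nul A T (Q r)" using to_zero[OF Z[OF False], of "q r"] q[of r] by simp
      then show ?thesis using False h(1) z[OF False] by simp
    qed
    then show "\<exists>h. h \<in> Hom A T B \<and> (\<forall>r\<in>UNIV. (if r \<in> R then \<theta> r \<bullet> p (\<phi> r) else Nul A B (Q r)) \<bullet> h = q r)"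
      using h(1) by blast
  next
    fix T g h assume T: "g \<in> Hom A T B" "h \<in> Hom A T B"
      and e: "\<And>r. r \<in> UNIV \<Longrightarrow> (if r \<in> R then \<theta> r \<bullet> p (\<phi> r) else Nul A B (Q r)) \<bullet> g = (if r \<in> R then \<theta> r \<bullet> p (\<phi> r) else Nul A B (Q r)) \<bullet> h"
    show "g = h"
    proof (rule product_eq[OF P T])
      fix r assume r: "r \<in> R"
      have *: "p (\<phi> r) \<bullet> k = \<eta> r \<bullet> (\<theta> r \<bullet> p (\<phi> r)) \<bullet> k" if "k \<in> Hom A T B" for k
        using cmp_eq[OF \<theta>(3)[OF r], of "p (\<phi> r) \<bullet> k"] that p[OF r] t[OF r] by simp
      have "(\<theta> r \<bullet> p (\<phi> r)) \<bullet> g = (\<theta> r \<bullet> p (\<phi> r)) \<bullet> h" using e[of r] r by simp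
      then show "p (\<phi> r) \<bullet> g = p (\<phi> r) \<bullet> h" unfolding *[OF T(1)] *[OF T(2)] by simp
    qed
  qed
qed

lemma biproduct_flatten:
  assumes B: "is_biproduct A I Y B \<iota> p" and Y: "\<And>i. i \<in> I \<Longrightarrow> is_biproduct A (K i) (X i) (Y i) (\<iota>' i) (p' i)"
  shows "is_biproduct A (Sigma I K) (\<lambda>(i, k). X i k) B (\<lambda>(i, k). \<iota> i \<bullet> \<iota>' i k) (\<lambda>(i, k). p' i k \<bullet> p i)"
proof -
  have b: "is_coproduct A I Y B \<iota>" "is_product A I Y B p"
    "\<And>i j. i \<in> I \<Longrightarrow> j \<in> I \<Longrightarrow> p j \<bullet> \<iota> i = (if i = j then Idn A (Y j) else Nul A (Y i) (Y j))"
    using B unfolding biproduct_iff by blast+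
  have y: "\<And>i. i \<in> I \<Longrightarrow> is_coproduct A (K i) (X i) (Y i) (\<iota>' i)" "\<And>i. i \<in> I \<Longrightarrow> is_product A (K i) (X i) (Y i) (p' i)"
    "\<And>i k l. i \<in> I \<Longrightarrow> k \<in> K i \<Longrightarrow> l \<in> K i \<Longrightarrow> p' i l \<bullet> \<iota>' i k = (if k = l then Idn A (X i l) else Nul A (X i k) (X i l))"
    using Y unfolding biproduct_iff by blast+
  have "is_product (op_cat A) (Sigma I K) (\<lambda>(i, k). X i k) B (\<lambda>(i, k). Cmp (op_cat A) (\<iota>' i k) (\<iota> i))"
    by (rule preadditive_category.product_flatten[OF op]) (use b(1) y(1) in simp_all)
  then have "is_coproduct A (Sigma I K) (\<lambda>(i, k). X i k) B (\<lambda>(i, k). \<iota> i \<bullet> \<iota>' i k)" by simp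
  moreover note product_flatten[OF b(2) y(2)]
  moreover have \<delta>: "(p' j l \<bullet> p j) \<bullet> \<iota> i \<bullet> \<iota>' i k = (if (i, k) = (j, l) then Idn A (X j l) else Nul A (X i k) (X j l))"
    if "i \<in> I" "k \<in> K i" "j \<in> I" "l \<in> K j" for i k j l
  proof -
    have h: "p j \<in> Ar A" "Dom A (p j) = B" "Cod A (p j) = Y j" "\<iota> i \<in> Ar A" "Dom A (\<iota> i) = Y i" "Cod A (\<iota> i) = B"
      "p' j l \<in> Ar A" "Dom A (p' j l) = Y j" "Cod A (p' j l) = X j l" "\<iota>' i k \<in> Ar A" "Dom A (\<iota>' i k) = X i k" "Cod A (\<iota>' i k) = Y i"
      "X i k \<in> Ob A" "X j l \<in> Ob A"
      using is_productD(3)[OF b(2) that(3)] is_coproductD(3)[OF b(1) that(1)] is_productD(3)[OF y(2)[OF that(3)] that(4)]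
        is_coproductD(3)[OF y(1)[OF that(1)] that(2)] is_productD(1)[OF y(2)[OF that(1)] that(2)]
        is_productD(1)[OF y(2)[OF that(3)] that(4)] by simp_all
    have Yob: "Y i \<in> Ob A" "Y j \<in> Ob A" using is_productD(1)[OF b(2)] that by simp_all
    have "(p' j l \<bullet> p j) \<bullet> \<iota> i \<bullet> \<iota>' i k = p' j l \<bullet> (p j \<bullet> \<iota> i) \<bullet> \<iota>' i k" using h by simp
    also have "\<dots> = (if (i, k) = (j, l) then Idn A (X j l) else Nul A (X i k) (X j l))"
      unfolding b(3)[OF that(1,3)] using y(3)[of i k l] that h Yob by auto
    finally show ?thesis .
  qed
  moreover have "(case y of (i, k) \<Rightarrow> p' i k \<bullet> p i) \<bullet> (case x of (i, k) \<Rightarrow> \<iota> i \<bullet> \<iota>' i k)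
    = (if x = y then Idn A (case y of (i, k) \<Rightarrow> X i k) else Nul A (case x of (i, k) \<Rightarrow> X i k) (case y of (i, k) \<Rightarrow> X i k))"
    if xy: "x \<in> Sigma I K" "y \<in> Sigma I K" for x y
  proof -
    obtain i k j l where "x = (i, k)" "i \<in> I" "k \<in> K i" "y = (j, l)" "j \<in> I" "l \<in> K j" using xy by blast
    then show ?thesis using \<delta>[of i k j l] by simp
  qed
  ultimately show ?thesis unfolding biproduct_iff by (intro conjI ballI)
qed

lemma biproduct_pad:
  assumes B: "is_biproduct A J X B \<iota> p" and \<phi>: "bij_betw \<phi> R J"
    and \<theta>: "\<And>r. r \<in> R \<Longrightarrow> \<theta> r \<in> Hom A (X (\<phi> r)) (Q r)" "\<And>r. r \<in> R \<Longrightarrow> \<eta> r \<in> Hom A (Q r) (X (\<phi> r))"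
      "\<And>r. r \<in> R \<Longrightarrow> \<eta> r \<bullet> \<theta> r = Idn A (X (\<phi> r))" "\<And>r. r \<in> R \<Longrightarrow> \<theta> r \<bullet> \<eta> r = Idn A (Q r)"
    and Z: "\<And>r. r \<notin> R \<Longrightarrow> zero_object A (Q r)"
  shows "is_biproduct A UNIV Q B (\<lambda>r. if r \<in> R then \<iota> (\<phi> r) \<bullet> \<eta> r else Nul A (Q r) B) (\<lambda>r. if r \<in> R then \<theta> r \<bullet> p (\<phi> r) else Nul A B (Q r))"
proof -
  have b: "is_coproduct A J X B \<iota>" "is_product A J X B p"
    "\<And>i j. i \<in> J \<Longrightarrow> j \<in> J \<Longrightarrow> p j \<bullet> \<iota> i = (if i = j then Idn A (X j) else Nul A (X i) (X j))"
    using B unfolding biproduct_iff by blast+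
  have "is_product (op_cat A) UNIV Q B (\<lambda>r. if r \<in> R then Cmp (op_cat A) (\<eta> r) (\<iota> (\<phi> r)) else Nul (op_cat A) B (Q r))"
    by (rule preadditive_category.product_pad[OF op _ \<phi>, of _ _ _ _ _ \<theta>]) (use b(1) \<theta> Z in simp_all)
  then have 1: "is_coproduct A UNIV Q B (\<lambda>r. if r \<in> R then \<iota> (\<phi> r) \<bullet> \<eta> r else Nul A (Q r) B)"
    by (simp cong: if_cong)
  have 2: "is_product A UNIV Q B (\<lambda>r. if r \<in> R then \<theta> r \<bullet> p (\<phi> r) else Nul A B (Q r))"
    by (rule product_pad[OF b(2) \<phi> \<theta> Z])
  have Qob: "Q r \<in> Ob A" for r using is_productD(1)[OF 2] by simp
  have Bob: "B \<in> Ob A" by (rule is_productD(2)[OF 2])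
  have jJ: "\<phi> r \<in> J" if "r \<in> R" for r using bij_betwE[OF \<phi>] that by blast
  have "(if s \<in> R then \<theta> s \<bullet> p (\<phi> s) else Nul A B (Q s)) \<bullet> (if r \<in> R then \<iota> (\<phi> r) \<bullet> \<eta> r else Nul A (Q r) B)
    = (if r = s then Idn A (Q s) else Nul A (Q r) (Q s))" (is "?l = ?r") for r s
  proof (cases "r \<in> R \<and> s \<in> R")
    case True
    then have rs: "r \<in> R" "s \<in> R" by auto
    have h: "p (\<phi> s) \<in> Ar A" "Dom A (p (\<phi> s)) = B" "Cod A (p (\<phi> s)) = X (\<phi> s)" "\<iota> (\<phi> r) \<in> Ar A" "Dom A (\<iota> (\<phi> r)) = X (\<phi> r)" "Cod A (\<iota> (\<phi> r)) = B"
      "\<theta> s \<in> Ar A" "Dom A (\<theta> s) = X (\<phi> s)" "Cod A (\<theta> s) = Q s" "\<eta> r \<in> Ar A" "Dom A (\<eta> r) = Q r" "Cod A (\<eta> r) = X (\<phi> r)" "X (\<phi> r) \<in> Ob A" "X (\<phi> s) \<in> Ob A"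
      using is_productD(3)[OF b(2) jJ[OF rs(2)]] is_coproductD(3)[OF b(1) jJ[OF rs(1)]] \<theta>(1)[OF rs(2)] \<theta>(2)[OF rs(1)]
        is_productD(1)[OF b(2) jJ[OF rs(2)]] is_productD(1)[OF b(2) jJ[OF rs(1)]] by simp_all
    have eq: "\<phi> r = \<phi> s \<longleftrightarrow> r = s" using inj_onD[OF bij_betw_imp_inj_on[OF \<phi>] _ rs] by blast
    have "?l = \<theta> s \<bullet> (p (\<phi> s) \<bullet> \<iota> (\<phi> r)) \<bullet> \<eta> r" using rs h by simp
    also have "\<dots> = ?r" unfolding b(3)[OF jJ[OF rs(1)] jJ[OF rs(2)]] eq
      using h \<theta>(4)[OF rs(2)] Qob by auto
    finally show ?thesis .
  next
    case False
    have l: "?l \<in> Ar A" "Dom A ?l = Q r" "Cod A ?l = Q s"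
      using cmp_hom[OF is_coproductD(3)[OF 1, of r] is_productD(3)[OF 2, of s]] by simp_all
    have r: "?r \<in> Ar A" "Dom A ?r = Q r" "Cod A ?r = Q s" using Qob by simp_all
    show ?thesis
    proof (cases "r \<in> R")
      case True
      then have z: "zero_object A (Q s)" using False Z by blast
      show ?thesis using to_zero[OF z l(1,3)] to_zero[OF z r(1,3)] l(2) r(2) by simp
    next
      case False
      then have z: "zero_object A (Q r)" using Z by blast
      show ?thesis using from_zero[OF z l(1,2)] from_zero[OF z r(1,2)] l(3) r(3) by simp
    qed
  qed
  then show ?thesis unfolding biproduct_iff using 1 2 by blast
qed

end

section \<open>Transfer of AB4 and AB4* to sequences and to the opposite category\<close>

lemma AB4_star_product:
  fixes A :: "('o, 'm) cat"
  assumes inf: "infinite (UNIV :: 'u set)" and A: "abelian_category A" and ab: "AB4_star TYPE('u) A"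
  shows "(\<And>j::nat. X j \<in> Ob A) \<Longrightarrow> \<exists>P \<pi>. is_product A UNIV X P \<pi>"
    and "(\<And>j::nat. epic A (e j)) \<Longrightarrow> is_product A UNIV (\<lambda>j. Dom A (e j)) P \<pi>
      \<Longrightarrow> is_product A UNIV (\<lambda>j. Cod A (e j)) Q \<kappa> \<Longrightarrow> F \<in> Hom A P Q
      \<Longrightarrow> (\<And>j. Cmp A (\<kappa> j) F = Cmp A (e j) (\<pi> j)) \<Longrightarrow> epic A F"
proof -
  interpret abelian_category A by fact
  \<comment> \<open>The universe of index sets is infinite, so it contains a copy of the natural
    numbers along which products are reindexed.\<close>
  obtain j :: "nat \<Rightarrow> 'u" where j: "inj j" using infinite_countable_subset[OF inf] by blast
  have bj: "bij_betw j UNIV (range j)" using j by (simp add: bij_betw_def)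
  define g where "g = inv_into UNIV j"
  have bi: "bij_betw g (range j) UNIV" unfolding g_def by (rule bij_betw_inv_into[OF bj])
  have ij: "g (j n) = n" for n unfolding g_def using j by simp
  note prod = ab[unfolded AB4_star_def, THEN conjunct1, rule_format]
  note exact = ab[unfolded AB4_star_def, THEN conjunct2, rule_format]
  show P: "\<exists>P \<pi>. is_product A UNIV X P \<pi>" if X: "\<And>j::nat. X j \<in> Ob A" for X
  proof -
    have "\<exists>P \<pi>. is_product A (range j) (\<lambda>u. X (g u)) P \<pi>" by (rule prod) (rule X)
    then obtain P \<pi> where "is_product A (range j) (\<lambda>u. X (g u)) P \<pi>" by blast
    then have "is_product A UNIV (\<lambda>i. X (g (j i))) P (\<lambda>i. \<pi> (j i))" by (rule product_reindex[OF bj])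
    then show ?thesis unfolding ij by blast
  qed
  assume e: "\<And>j::nat. epic A (e j)" and Pp: "is_product A UNIV (\<lambda>j. Dom A (e j)) P \<pi>"
    and Qp: "is_product A UNIV (\<lambda>j. Cod A (e j)) Q \<kappa>" and F: "F \<in> Hom A P Q" "\<And>j. \<kappa> j \<bullet>\<^bsub>A\<^esub> F = e j \<bullet>\<^bsub>A\<^esub> \<pi> j"
  have eA: "e j \<in> Ar A" for j using e by simp
  \<comment> \<open>AB4* speaks of short exact sequences, so the epics are completed by their
    kernels and the product of the kernels is formed as well.\<close>
  have "\<forall>j. \<exists>k. is_kernel A (e j) k" by (intro allI kernel_ex eA)
  then have "\<exists>k. \<forall>j. is_kernel A (e j) (k j)" by (rule choice)
  then obtain k where k: "\<And>j. is_kernel A (e j) (k j)" by blast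
  have kA: "k j \<in> Ar A" "Cod A (k j) = Dom A (e j)" for j using is_kernelD[OF k[of j]] by simp_all
  have "\<exists>K \<rho>. is_product A UNIV (\<lambda>j. Dom A (k j)) K \<rho>" by (rule P) (rule ob_dom[OF kA(1)])
  then obtain K \<rho> where K: "is_product A UNIV (\<lambda>j. Dom A (k j)) K \<rho>" by blast
  have \<rho>: "\<rho> r \<in> Ar A" "Dom A (\<rho> r) = K" "Cod A (\<rho> r) = Dom A (k r)" for r using is_productD(3)[OF K, of r] by simp_all
  obtain G where G: "G \<in> Hom A K P" "\<And>r. r \<in> UNIV \<Longrightarrow> \<pi> r \<bullet>\<^bsub>A\<^esub> G = k r \<bullet>\<^bsub>A\<^esub> \<rho> r"
    by (rule product_tuple[OF Pp is_productD(2)[OF K], of "\<lambda>r. k r \<bullet>\<^bsub>A\<^esub> \<rho> r"]) (use kA \<rho> in simp_all)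
  have "short_exact A G F"
  proof (rule exact[of "range j" "\<lambda>u. k (g u)" "\<lambda>u. e (g u)" K "\<lambda>u. \<rho> (g u)" P "\<lambda>u. \<pi> (g u)" Q "\<lambda>u. \<kappa> (g u)"], intro conjI ballI)
    show "is_product A (range j) (\<lambda>u. Dom A (k (g u))) K (\<lambda>u. \<rho> (g u))" by (rule product_reindex[OF bi K])
    show "is_product A (range j) (\<lambda>u. Cod A (k (g u))) P (\<lambda>u. \<pi> (g u))"
      using product_reindex[OF bi Pp] by (simp add: kA)
    show "is_product A (range j) (\<lambda>u. Cod A (e (g u))) Q (\<lambda>u. \<kappa> (g u))" by (rule product_reindex[OF bi Qp])
    show "G \<in> Hom A K P" "F \<in> Hom A P Q" by (rule G F)+
    fix u
    show "short_exact A (k (g u)) (e (g u))" by (rule epic_short_exact[OF e k])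
    show "\<pi> (g u) \<bullet>\<^bsub>A\<^esub> G = k (g u) \<bullet>\<^bsub>A\<^esub> \<rho> (g u)" by (rule G(2)) simp
    show "\<kappa> (g u) \<bullet>\<^bsub>A\<^esub> F = e (g u) \<bullet>\<^bsub>A\<^esub> \<pi> (g u)" by (rule F(2))
  qed
  then show "epic A F" by (rule short_exactD(4))
qed

lemma AB4_star_op:
  assumes "AB4 TYPE('u) A" shows "AB4_star TYPE('u) (op_cat A)"
  unfolding AB4_star_def
proof (intro conjI allI impI)
  fix J :: "'u set" and X assume "\<forall>j\<in>J. X j \<in> Ob (op_cat A)"
  then show "\<exists>P \<pi>. is_product (op_cat A) J X P \<pi>"
    using assms[unfolded AB4_def, THEN conjunct1, rule_format, of J X] by simp
next
  fix J :: "'u set" and f g P \<pi> Q \<kappa> R \<rho> F G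
  assume a: "(\<forall>j\<in>J. short_exact (op_cat A) (f j) (g j)) \<and>
       is_product (op_cat A) J (\<lambda>j. Dom (op_cat A) (f j)) P \<pi> \<and>
       is_product (op_cat A) J (\<lambda>j. Cod (op_cat A) (f j)) Q \<kappa> \<and>
       is_product (op_cat A) J (\<lambda>j. Cod (op_cat A) (g j)) R \<rho> \<and>
       F \<in> Hom (op_cat A) P Q \<and> (\<forall>j\<in>J. \<kappa> j \<bullet>\<^bsub>op_cat A\<^esub> F = f j \<bullet>\<^bsub>op_cat A\<^esub> \<pi> j) \<and>
       G \<in> Hom (op_cat A) Q R \<and> (\<forall>j\<in>J. \<rho> j \<bullet>\<^bsub>op_cat A\<^esub> G = g j \<bullet>\<^bsub>op_cat A\<^esub> \<kappa> j)"
  have b: "Cod A (g j) = Dom A (f j)" if "j \<in> J" for j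
    using a that unfolding short_exact_def is_kernel_def by simp
  have c: "is_coproduct A J (\<lambda>j. Cod A (g j)) Q \<kappa>"
  proof -
    have "is_coproduct A J (\<lambda>j. Dom A (f j)) Q \<kappa>" using a by simp
    then show ?thesis unfolding is_coproduct_def using b by simp
  qed
  note exact = assms[unfolded AB4_def, THEN conjunct2, rule_format]
  have "short_exact A G F"
  proof (rule exact[of J g f R \<rho> Q \<kappa> P \<pi>], intro conjI)
    show "is_coproduct A J (\<lambda>j. Cod A (g j)) Q \<kappa>" by (rule c)
  qed (use a in simp_all)
  then show "short_exact (op_cat A) F G" by simp
qed

lemma inverse_sequence_op [simp]: "inverse_sequence (op_cat A) X f \<longleftrightarrow> direct_sequence A X f"
  by (simp add: inverse_sequence_def direct_sequence_def)

lemma is_lim_op: "is_lim (op_cat A) X f L p \<longleftrightarrow> is_colim A X f L p"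
  by (simp add: is_lim_def is_colim_def one_minus_prod_def one_minus_coprod_def)

lemma is_lim1_op: "is_lim1 (op_cat A) X f L \<longleftrightarrow> is_colim1 A X f L"
  by (simp add: is_lim1_def is_colim1_def one_minus_prod_def one_minus_coprod_def)

lemma biproduct_in_op:
  assumes "preadditive_category A" shows "biproduct_in (op_cat A) (op_cat C) J K B \<longleftrightarrow> biproduct_in A C J K B"
proof -
  interpret preadditive_category A by fact
  have "is_biproduct (op_cat A) J K B i p \<longleftrightarrow> is_biproduct A J K B p i" for i p
    unfolding biproduct_iff preadditive_category.biproduct_iff[OF op] by auto
  then show ?thesis unfolding biproduct_in_def by auto
qed

lemma acceptable_op:
  assumes "preadditive_category A"
  shows "acceptable_inverse (op_cat A) (op_cat C) X f \<longleftrightarrow> acceptable_direct A C X f"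
  unfolding acceptable_inverse_def acceptable_direct_def summable_ker_cok_def
    biproduct_in_op[OF assms] inverse_sequence_op is_kernel_op is_cokernel_op op_cat_simps by blast

lemma locally_AB5_star_op:
  assumes A: "preadditive_category A" and ab: "locally_AB5 A C"
  shows "locally_AB5_star (op_cat A) (op_cat C)"
  unfolding locally_AB5_star_def acceptable_op[OF A] is_lim_op Hom_op op_cat_simps is_cokernel_op
proof (intro allI impI, elim conjE)
  fix X f Y g u L p M q w \<gamma> h N n v
  assume a: "acceptable_direct A C X f" "acceptable_direct A C Y g"
    "\<forall>r. u r \<in> Hom C (Y r) (X r) \<and> f r \<bullet>\<^bsub>C\<^esub> u r = u (Suc r) \<bullet>\<^bsub>C\<^esub> g r"
    "is_colim A X f L p" "is_colim A Y g M q" "w \<in> Hom A M L" "\<forall>r. w \<bullet>\<^bsub>A\<^esub> q r = p r \<bullet>\<^bsub>A\<^esub> u r"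
    "\<forall>r. is_kernel C (u r) (\<gamma> r) \<and> h r \<in> Hom C (Dom C (\<gamma> r)) (Dom C (\<gamma> (Suc r))) \<and> \<gamma> (Suc r) \<bullet>\<^bsub>C\<^esub> h r = g r \<bullet>\<^bsub>C\<^esub> \<gamma> r"
    "is_colim A (\<lambda>r. Dom C (\<gamma> r)) h N n" "v \<in> Hom A N M" "\<forall>r. v \<bullet>\<^bsub>A\<^esub> n r = q r \<bullet>\<^bsub>A\<^esub> \<gamma> r"
  show "is_kernel A w v"
    by (rule ab[unfolded locally_AB5_def, rule_format, of Y g X f u M q L p w \<gamma> h N n v])
      (use a in \<open>intro conjI allI; metis\<close>)
qed

lemma lim_settingI:
  fixes A C :: "('o, 'm) cat"
  assumes "infinite (UNIV :: 'u set)" "abelian_category A" "AB4_star TYPE('u) A" "full_abelian_subcategory C A" "locally_AB5_star A C"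
  shows "lim_setting A C"
proof (intro lim_setting.intro subabelian.intro subabelian_axioms.intro lim_setting_axioms.intro)
  show "abelian_category C" using assms(4) unfolding full_abelian_subcategory_def by blast
  show "abelian_category A" "full_abelian_subcategory C A" "locally_AB5_star A C" by (rule assms)+
  fix X :: "nat \<Rightarrow> 'o" assume "\<And>j. X j \<in> Ob A"
  then show "\<exists>P \<pi>. is_product A UNIV X P \<pi>" by (rule AB4_star_product(1)[OF assms(1-3)])
next
  fix e :: "nat \<Rightarrow> 'm" and P \<pi> Q \<kappa> F
  assume "\<And>j. epic A (e j)" "is_product A UNIV (\<lambda>j. Dom A (e j)) P \<pi>" "is_product A UNIV (\<lambda>j. Cod A (e j)) Q \<kappa>"
    "F \<in> Hom A P Q" "\<And>j. \<kappa> j \<bullet>\<^bsub>A\<^esub> F = e j \<bullet>\<^bsub>A\<^esub> \<pi> j"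
  then show "epic A F" by (rule AB4_star_product(2)[OF assms(1-3)])
qed

text \<open>Position \<open>r\<close> holds one copy of \<open>S (idx r)\<close>. An enumeration
  \<open>b i\<close> of the fibre over \<open>i\<close> assigns the \<open>n i\<close> copies of
  \<open>S i\<close> to the positions, and the other positions hold zero objects.\<close>

lemma (in preadditive_category) locally_finite_sum_pad:
  fixes Q :: "nat \<Rightarrow> 'o"
  assumes B: "locally_finite_sum A C I S n B"
    and idx: "\<And>r. r \<in> R \<Longrightarrow> idx r \<in> I" "\<And>r. r \<in> R \<Longrightarrow> isomorphic A (S (idx r)) (Q r)"
    and Z: "\<And>r. r \<notin> R \<Longrightarrow> zero_object A (Q r)"
    and card: "\<And>i. i \<in> I \<Longrightarrow> finite {r \<in> R. idx r = i} \<and> card {r \<in> R. idx r = i} = n i"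
  shows "biproduct_in A C UNIV Q B"
proof -
  obtain Y where Y0: "\<forall>i\<in>I. \<exists>x. is_biproduct A {..<n i} (\<lambda>_. S i) (Y i) (fst x) (snd x)" and B: "biproduct_in A C I Y B"
    using B unfolding locally_finite_sum_def by auto
  obtain x where Y: "\<And>i. i \<in> I \<Longrightarrow> is_biproduct A {..<n i} (\<lambda>_. S i) (Y i) (fst (x i)) (snd (x i))"
    using bchoice[OF Y0] by blast
  obtain \<iota> p where BC: "B \<in> Ob C" and Bi: "is_biproduct A I Y B \<iota> p" using B unfolding biproduct_in_def by blast
  note flat = biproduct_flatten[OF Bi Y]
  have "\<forall>i\<in>I. \<exists>b. bij_betw b {r \<in> R. idx r = i} {..<n i}"
  proof
    fix i assume i: "i \<in> I"
    show "\<exists>b. bij_betw b {r \<in> R. idx r = i} {..<n i}"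
      using ex_bij_betw_finite_nat[of "{r \<in> R. idx r = i}"] card[OF i] by (simp add: atLeast0LessThan)
  qed
  from bchoice[OF this] obtain b where b: "\<And>i. i \<in> I \<Longrightarrow> bij_betw (b i) {r \<in> R. idx r = i} {..<n i}" by blast
  define \<phi> where "\<phi> r = (idx r, b (idx r) r)" for r
  have \<phi>: "bij_betw \<phi> R (Sigma I (\<lambda>i. {..<n i}))"
  proof (rule bij_betw_imageI)
    show "inj_on \<phi> R"
    proof (rule inj_onI)
      fix r s assume rs: "r \<in> R" "s \<in> R" "\<phi> r = \<phi> s"
      then have e: "idx r = idx s" "b (idx r) r = b (idx s) s" unfolding \<phi>_def prod.inject by blast+
      have "b (idx r) r = b (idx r) s" using e(2) unfolding e(1)[symmetric] .
      with e(1) show "r = s" using inj_onD[OF bij_betw_imp_inj_on[OF b[OF idx(1)[OF rs(1)]]], of r s] rs by simp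
    qed
    show "\<phi> ` R = Sigma I (\<lambda>i. {..<n i})"
    proof (intro subset_antisym subsetI)
      fix y assume "y \<in> \<phi> ` R"
      then obtain r where r: "r \<in> R" "y = \<phi> r" by blast
      then show "y \<in> Sigma I (\<lambda>i. {..<n i})" using idx(1)[OF r(1)] bij_betwE[OF b[OF idx(1)[OF r(1)]]] by (simp add: \<phi>_def)
    next
      fix y assume "y \<in> Sigma I (\<lambda>i. {..<n i})"
      then obtain i k where y: "y = (i, k)" "i \<in> I" "k \<in> {..<n i}" by blast
      have "k \<in> b i ` {r \<in> R. idx r = i}" unfolding bij_betw_imp_surj_on[OF b[OF y(2)]] by (rule y(3))
      then obtain r where r: "k = b i r" "r \<in> {r \<in> R. idx r = i}" by (rule imageE)
      then have "y = \<phi> r" "r \<in> R" using y(1) by (simp_all add: \<phi>_def)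
      then show "y \<in> \<phi> ` R" by (rule image_eqI)
    qed
  qed
  have "\<forall>r\<in>R. \<exists>\<theta> \<eta>. \<theta> \<in> Hom A (S (idx r)) (Q r) \<and> \<eta> \<in> Hom A (Q r) (S (idx r))
    \<and> \<eta> \<bullet> \<theta> = Idn A (S (idx r)) \<and> \<theta> \<bullet> \<eta> = Idn A (Q r)"
  proof
    fix r assume r: "r \<in> R"
    obtain f where f: "f \<in> Hom A (S (idx r)) (Q r)" "isomorphism A f" by (rule isomorphicE[OF idx(2)[OF r]])
    obtain g where "g \<in> Hom A (Cod A f) (Dom A f)" "g \<bullet> f = Idn A (Dom A f)" "f \<bullet> g = Idn A (Cod A f)"
      by (rule isomorphism_inverse[OF f(2)])
    then show "\<exists>\<theta> \<eta>. \<theta> \<in> Hom A (S (idx r)) (Q r) \<and> \<eta> \<in> Hom A (Q r) (S (idx r))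
      \<and> \<eta> \<bullet> \<theta> = Idn A (S (idx r)) \<and> \<theta> \<bullet> \<eta> = Idn A (Q r)"
      using f(1) by (intro exI[of _ f] exI[of _ g]) simp
  qed
  from bchoice[OF this] obtain \<theta> where \<theta>0: "\<forall>r\<in>R. \<exists>\<eta>. \<theta> r \<in> Hom A (S (idx r)) (Q r) \<and> \<eta> \<in> Hom A (Q r) (S (idx r))
      \<and> \<eta> \<bullet> \<theta> r = Idn A (S (idx r)) \<and> \<theta> r \<bullet> \<eta> = Idn A (Q r)" by blast
  from bchoice[OF this] obtain \<eta> where \<eta>: "\<forall>r\<in>R. \<theta> r \<in> Hom A (S (idx r)) (Q r) \<and> \<eta> r \<in> Hom A (Q r) (S (idx r))
      \<and> \<eta> r \<bullet> \<theta> r = Idn A (S (idx r)) \<and> \<theta> r \<bullet> \<eta> r = Idn A (Q r)" by blast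
  have "is_biproduct A UNIV Q B
     (\<lambda>r. if r \<in> R then (case \<phi> r of (i, k) \<Rightarrow> \<iota> i \<bullet> fst (x i) k) \<bullet> \<eta> r else Nul A (Q r) B)
     (\<lambda>r. if r \<in> R then \<theta> r \<bullet> (case \<phi> r of (i, k) \<Rightarrow> snd (x i) k \<bullet> p i) else Nul A B (Q r))"
    by (rule biproduct_pad[OF flat \<phi>]) (use \<eta> Z in \<open>simp_all add: \<phi>_def\<close>)
  then show ?thesis unfolding biproduct_in_def using BC by blast
qed

section \<open>Locally finite sums and composition series\<close>

locale sum_setting = lim_setting A C for A :: "('o, 'm) cat" (structure) and C :: "('o, 'm) cat" +
  fixes I :: "'u set" and S :: "'u \<Rightarrow> 'o"
  assumes simples: "full_simple_collection C I S" and sums: "admits_locally_finite_sums A C I S"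
begin

lemma S_simple: "i \<in> I \<Longrightarrow> simple_object C (S i)" and S_Ob: "i \<in> I \<Longrightarrow> S i \<in> Ob C"
  using simples unfolding full_simple_collection_def simple_object_def by blast+

lemma S_index:
  assumes "simple_object C T" obtains i where "i \<in> I" "isomorphic C T (S i)"
proof -
  have "\<exists>!i. i \<in> I \<and> isomorphic C T (S i)" using simples assms unfolding full_simple_collection_def by blast
  then show thesis using that by (elim ex1E) blast
qed

lemma S_inj:
  assumes "isomorphic C T (S i)" "isomorphic C T (S j)" "i \<in> I" "j \<in> I" shows "i = j"
proof -
  have "simple_object C T" using C.simple_iso[OF S_simple[OF assms(3)] C.isomorphic_sym[OF assms(1)]] .
  then have "\<exists>!i. i \<in> I \<and> isomorphic C T (S i)" using simples unfolding full_simple_collection_def by blast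
  then show ?thesis using assms by (elim ex1E) metis
qed

lemma sum_obtain: obtains B where "locally_finite_sum A C I S n B"
  using sums unfolding admits_locally_finite_sums_def by blast

text \<open>The quotients of a chain, in the order of the chain, are a padded enumeration of the
  summands of the locally finite sum with the same multiplicities.\<close>

lemma simple_chain_biproduct:
  assumes W: "simple_chain A C W f" and c: "\<And>r. is_cokernel A (f r) (c r)" "\<And>r. Cod A (c r) \<in> Ob C"
    and fin: "loc_finite_chain A C f"
    and B: "locally_finite_sum A C I S n B" "\<And>i. i \<in> I \<Longrightarrow> n i = card (chain_occurrences A C f (S i))"
  shows "biproduct_in A C UNIV (\<lambda>r. Cod A (c r)) B"
proof -
  define R where "R = {r. \<not> zero_object A (Cod A (c r))}"
  have sim: "simple_object C (Cod A (c r))" if "r \<in> R" for r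
    using W c that unfolding simple_chain_def R_def by blast
  have "\<forall>r\<in>R. \<exists>i. i \<in> I \<and> isomorphic C (Cod A (c r)) (S i)" by (intro ballI) (rule S_index[OF sim], blast+)
  from bchoice[OF this] obtain idx where idx: "\<And>r. r \<in> R \<Longrightarrow> idx r \<in> I" "\<And>r. r \<in> R \<Longrightarrow> isomorphic C (Cod A (c r)) (S (idx r))" by blast
  have occ: "{r \<in> R. idx r = i} = chain_occurrences A C f (S i)" if i: "i \<in> I" for i
  proof (intro subset_antisym subsetI)
    fix r assume "r \<in> {r \<in> R. idx r = i}"
    then have "isomorphic C (Cod A (c r)) (S i)" using idx by blast
    then show "r \<in> chain_occurrences A C f (S i)" unfolding chain_occurrences_def using c by (auto simp: isomorphic_C)
  next
    fix r assume "r \<in> chain_occurrences A C f (S i)"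
    then obtain c' where c': "is_cokernel A (f r) c'" "Cod A c' \<in> Ob C" "isomorphic A (Cod A c') (S i)"
      unfolding chain_occurrences_def by blast
    have "isomorphic A (Cod A (c r)) (Cod A c')" by (rule A.cokernel_isomorphic[OF c(1) c'(1)])
    then have iso: "isomorphic C (Cod A (c r)) (S i)"
      using A.isomorphic_trans[OF _ c'(3)] c(2) S_Ob[OF i] by (simp add: isomorphic_C)
    have "simple_object C (Cod A (c r))" by (rule C.simple_iso[OF S_simple[OF i] C.isomorphic_sym[OF iso]])
    then have r: "r \<in> R" unfolding R_def using c(2) by (simp add: simple_object_def zero_object_C)
    then show "r \<in> {r \<in> R. idx r = i}" using S_inj[OF idx(2)[OF r] iso idx(1)[OF r] i] by simp
  qed
  show ?thesis
  proof (rule A.locally_finite_sum_pad[OF B(1)])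
    fix r assume r: "r \<in> R"
    show "idx r \<in> I" by (rule idx(1)[OF r])
    show "isomorphic A (S (idx r)) (Cod A (c r))" using C.isomorphic_sym[OF idx(2)[OF r]] by (simp add: isomorphic_C)
  next
    fix r assume "r \<notin> R" then show "zero_object A (Cod A (c r))" by (simp add: R_def)
  next
    fix i assume i: "i \<in> I"
    then show "finite {r \<in> R. idx r = i} \<and> card {r \<in> R. idx r = i} = n i"
      unfolding occ[OF i] using fin S_simple[OF i] B(2)[OF i] unfolding loc_finite_chain_def by simp
  qed
qed

text \<open>The existence of locally finite sums in \<open>C\<close> provides the biproduct of the
  quotients; the kernels are zero.\<close>

lemma simple_chain_acceptable:
  assumes W: "simple_chain A C W f" and fin: "loc_finite_chain A C f"
  shows "acceptable_inverse A C W f"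
proof -
  note W' = simple_chainD[OF W]
  obtain c where c: "\<And>r. is_cokernel A (f r) (c r)" "\<And>r. Cod A (c r) \<in> Ob C"
    using cokernel_choice[OF W'(1,2)] by blast
  obtain B where B: "locally_finite_sum A C I S (\<lambda>i. card (chain_occurrences A C f (S i))) B" by (rule sum_obtain)
  show ?thesis
    by (rule acceptable_monicI[OF W'(1,2,3) c simple_chain_biproduct[OF W c fin B refl]])
qed

end

context lim_setting
begin

text \<open>Translation from subobjects of \<open>X\<close> to the sequence of their inclusions. The
  arrow \<open>m 0\<close> is only an isomorphism, so the top of the chain is \<open>X\<close> up to
  isomorphism.\<close>

lemma composition_series_chain:
  fixes m :: "nat \<Rightarrow> 'm"
  assumes X: "X \<in> Ob C" and m: "N_composition_series A C X m"
  defines "W \<equiv> \<lambda>r. Dom C (m r)" and "f \<equiv> \<lambda>r. subobject_incl C (m (Suc r)) (m r)"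
  shows "simple_chain A C W f" "isomorphic C (W 0) X" "\<And>T. T \<in> Ob C \<Longrightarrow> chain_occurrences A C f T = occurrences C m T"
proof -
  have mf: "monic C (m r)" "Cod C (m r) = X" "isomorphism C (m 0)" "subobject_le C (m (Suc r)) (m r)" for r
    using m unfolding N_composition_series_def N_filtration_def by blast+
  have mA: "m r \<in> Ar C" for r using mf(1)[of r] unfolding monic_def by blast
  have f: "f r \<in> Hom C (W (Suc r)) (W r)" "Cmp C (m r) (f r) = m (Suc r)" for r
  proof -
    obtain h where h: "h \<in> Hom C (Dom C (m (Suc r))) (Dom C (m r))" "Cmp C (m r) h = m (Suc r)"
      using mf(4)[of r] unfolding subobject_le_def by blast
    have "subobject_incl C (m (Suc r)) (m r) = h" unfolding subobject_incl_def
    proof (rule the_equality)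
      show "h \<in> Hom C (Dom C (m (Suc r))) (Dom C (m r)) \<and> Cmp C (m r) h = m (Suc r)" using h by blast
      fix h' assume h': "h' \<in> Hom C (Dom C (m (Suc r))) (Dom C (m r)) \<and> Cmp C (m r) h' = m (Suc r)"
      show "h' = h" by (rule C.monicD[OF mf(1)[of r]]) (use h h' mA[of r] mA[of "Suc r"] in simp_all)
    qed
    then show "f r \<in> Hom C (W (Suc r)) (W r)" "Cmp C (m r) (f r) = m (Suc r)" unfolding f_def W_def using h by (simp_all only:)
  qed
  have WC: "W r \<in> Ob C" for r using mA[of r] unfolding W_def by simp
  have fA: "f r \<in> Hom A (W (Suc r)) (W r)" for r using f(1)[of r] Hom_C[OF WC WC] by simp
  have fm: "monic A (f r)" for r
  proof -
    have "monic C (Cmp C (m r) (f r))" unfolding f(2) by (rule mf(1))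
    then have "monic C (f r)" by (rule_tac C.monic_cmpD[of "m r" "f r"]) (use f(1)[of r] mA[of r] mA[of "Suc r"] in \<open>simp_all add: W_def\<close>)
    then show ?thesis by (simp add: monic_C)
  qed
  have fr: "subobject_incl C (m (Suc r)) (m r) = f r" for r by (simp only: f_def)
  have quot: "filtration_quotient C m r Q \<longleftrightarrow> (\<exists>c. is_cokernel A (f r) c \<and> Cod A c \<in> Ob C \<and> Cod A c = Q)" for r Q
    unfolding filtration_quotient_def fr using fA[of r] WC by (auto simp: is_cokernel_C)
  have invW: "inverse_sequence A W f" unfolding inverse_sequence_def using fA WC by simp
  have "\<exists>Z p. is_lim A (\<lambda>i. Dom C (m i)) (\<lambda>i. subobject_incl C (m (Suc i)) (m i)) Z p \<and> zero_object A Z"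
    using m unfolding N_composition_series_def by (elim conjE)
  then obtain Z p where Z: "is_lim A W f Z p" "zero_object A Z"
    unfolding W_def[symmetric] f_def[symmetric] by (elim exE conjE)
  show "simple_chain A C W f" unfolding simple_chain_def
  proof (intro conjI allI impI)
    show "\<exists>Z p. lim_cone A W f Z p \<and> zero_object A Z" using Z unfolding is_lim_iff by blast
    fix r c assume c: "is_cokernel A (f r) c" "Cod A c \<in> Ob C"
    then have q: "filtration_quotient C m r (Cod A c)" unfolding quot by blast
    have "\<forall>i Q. filtration_quotient C m i Q \<longrightarrow> zero_object C Q \<or> simple_object C Q"
      using m unfolding N_composition_series_def by blast
    with q have "zero_object C (Cod A c) \<or> simple_object C (Cod A c)" by blast
    then show "zero_object A (Cod A c) \<or> simple_object C (Cod A c)" by (auto simp: zero_object_C)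
  qed (use invW WC fm in simp_all)
  show "isomorphic C (W 0) X" using C.isomorphicI[OF mf(3)] mf(2) unfolding W_def by simp
  fix T assume T: "T \<in> Ob C"
  show "chain_occurrences A C f T = occurrences C m T"
    unfolding chain_occurrences_def occurrences_def quot isomorphic_C using T by auto
qed

end

lemma (in sum_setting) jh_settingI:
  assumes jh: "locally_Jordan_Hoelder A C" shows "jh_setting A C"
proof (unfold_locales)
  fix X assume X: "X \<in> Ob C"
  then obtain m where m: "N_composition_series A C X m" "locally_finite_series C m"
    using jh unfolding locally_Jordan_Hoelder_def by blast
  note ch = composition_series_chain[OF X m(1)]
  have fin: "loc_finite_chain A C (\<lambda>r. subobject_incl C (m (Suc r)) (m r))"
    unfolding loc_finite_chain_def
  proof (intro allI impI)
    fix T assume T: "simple_object C T"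
    then have "T \<in> Ob C" by (simp add: simple_object_def)
    then show "finite (chain_occurrences A C (\<lambda>r. subobject_incl C (m (Suc r)) (m r)) T)"
      using ch(3)[of T] m(2) T unfolding locally_finite_series_def by simp
  qed
  show "\<exists>W f. simple_chain A C W f \<and> loc_finite_chain A C f \<and> isomorphic A (W 0) X"
    by (intro exI conjI, rule ch(1), rule fin) (use ch(2) in \<open>simp add: isomorphic_C\<close>)
qed (rule simple_chain_acceptable)

text \<open>\<open>len\<close> does not refer to a series, so the value is the same for whichever
  series the choice operator selects.\<close>

lemma (in jh_setting) len_multiplicity:
  assumes jh: "locally_Jordan_Hoelder A C" and X: "X \<in> Ob C" and T: "simple_object C T"
  shows "len C (\<lambda>X. isomorphic C X T) X = enat (simple_multiplicity A C T X)"
proof -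
  let ?P = "\<lambda>m. N_composition_series A C X m \<and> locally_finite_series C m"
  define m where "m = (SOME m. ?P m)"
  have "\<exists>m. ?P m" using jh X unfolding locally_Jordan_Hoelder_def by blast
  then have m: "N_composition_series A C X m" "locally_finite_series C m" using someI_ex[of ?P] unfolding m_def by blast+
  note ch = composition_series_chain[OF X m(1)]
  let ?f = "\<lambda>r. subobject_incl C (m (Suc r)) (m r)"
  have occ: "chain_occurrences A C ?f T = occurrences C m T" if "simple_object C T" for T
    by (rule ch(3)) (use that in \<open>simp add: simple_object_def\<close>)
  have fin: "loc_finite_chain A C ?f" unfolding loc_finite_chain_def
    using m(2) occ unfolding locally_finite_series_def by simp
  have "len C (\<lambda>X. isomorphic C X T) (Dom C (m 0)) = enat (card (chain_occurrences A C ?f T))"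
    by (rule chain_len[OF T ch(1) chain_acceptable[OF ch(1) fin]]) (use fin T in \<open>simp add: loc_finite_chain_def\<close>)
  then have "len C (\<lambda>X. isomorphic C X T) X = enat (card (occurrences C m T))"
    by (simp only: occ[OF T] C.len_iso[OF ch(2)])
  then show ?thesis by (simp only: simple_multiplicity_def m_def)
qed

section \<open>Grothendieck groups\<close>

lemma (in group_hom) generate_subset_kernel:
  assumes "R \<subseteq> carrier G" "\<And>x. x \<in> R \<Longrightarrow> h x = \<one>\<^bsub>H\<^esub>"
  shows "generate G R \<subseteq> kernel G H h"
proof (rule G.generate_subgroup_incl)
  show "R \<subseteq> kernel G H h" unfolding kernel_def using assms by blast
  show "subgroup (kernel G H h) G" by (rule subgroup_kernel)
qed

context abelian_category
begin

lemma free_Ob_group: "comm_group (free_Abelian_group (Ob A))"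
  by (rule abelian_free_Abelian_group)

lemma G0_relations_carrier: "G0_relations A \<subseteq> carrier (free_Abelian_group (Ob A))"
proof
  fix x assume "x \<in> G0_relations A"
  then consider X Y where "x = frag_of X - frag_of Y" "X \<in> Ob A" "Y \<in> Ob A"
    | f g where "x = frag_of (Cod A f) - (frag_of (Dom A f) + frag_of (Cod A g))" "short_exact A f g"
    unfolding G0_relations_def by blast
  then show "x \<in> carrier (free_Abelian_group (Ob A))"
  proof cases
    case 1
    then show ?thesis using keys_diff[of "frag_of X" "frag_of Y"] by (simp add: subset_iff) blast
  next
    case 2
    have ob: "Dom A f \<in> Ob A" "Cod A f \<in> Ob A" "Cod A g \<in> Ob A"
      using is_kernelD(1,2)[OF short_exactD(1)[OF 2(2)]] by simp_all
    then have "Poly_Mapping.keys (frag_of (Dom A f) + frag_of (Cod A g)) \<subseteq> Ob A"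
      using keys_add[of "frag_of (Dom A f)" "frag_of (Cod A g)"] by (simp add: subset_iff) blast
    then show ?thesis
      using keys_diff[of "frag_of (Cod A f)" "frag_of (Dom A f) + frag_of (Cod A g)"] ob(2) 2(1) by (simp add: subset_iff) blast
  qed
qed

lemma G0_kernel_subgroup: "subgroup (G0_kernel A) (free_Abelian_group (Ob A))"
  unfolding G0_kernel_def using comm_group.axioms(2)[OF free_Ob_group] G0_relations_carrier
  by (rule group.generate_is_subgroup)

lemma G0_kernel_normal: "G0_kernel A \<lhd> free_Abelian_group (Ob A)"
  by (rule comm_group.subgroup_imp_normal[OF free_Ob_group G0_kernel_subgroup])

lemma comm_group_G0: "comm_group (G0 A)"
  unfolding G0_def by (rule comm_group.abelian_FactGroup[OF free_Ob_group G0_kernel_subgroup])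

lemma coset_hom: "(\<lambda>x. G0_kernel A #>\<^bsub>free_Abelian_group (Ob A)\<^esub> x) \<in> hom (free_Abelian_group (Ob A)) (G0 A)"
  unfolding G0_def by (rule normal.r_coset_hom_Mod[OF G0_kernel_normal])

lemma G0_class_closed: "X \<in> Ob A \<Longrightarrow> G0_class A X \<in> carrier (G0 A)"
  unfolding G0_class_def by (rule hom_in_carrier[OF coset_hom]) simp

lemma coset_kernel:
  assumes "x \<in> G0_relations A" shows "G0_kernel A #>\<^bsub>free_Abelian_group (Ob A)\<^esub> x = \<one>\<^bsub>G0 A\<^esub>"
proof -
  have "x \<in> G0_kernel A" unfolding G0_kernel_def by (rule generate.incl[OF assms])
  then show ?thesis unfolding G0_def one_FactGroup
    by (rule_tac group.coset_join2[OF group_free_Abelian_group _ G0_kernel_subgroup])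
      (use G0_relations_carrier assms in blast)+
qed

lemma coset_add:
  assumes "x \<in> carrier (free_Abelian_group (Ob A))" "y \<in> carrier (free_Abelian_group (Ob A))"
  shows "G0_kernel A #>\<^bsub>free_Abelian_group (Ob A)\<^esub> (x + y)
    = (G0_kernel A #>\<^bsub>free_Abelian_group (Ob A)\<^esub> x) \<otimes>\<^bsub>G0 A\<^esub> (G0_kernel A #>\<^bsub>free_Abelian_group (Ob A)\<^esub> y)"
  using hom_mult[OF coset_hom assms] by simp

lemma coset_eq:
  assumes "x - y \<in> G0_relations A" "y \<in> carrier (free_Abelian_group (Ob A))"
  shows "G0_kernel A #>\<^bsub>free_Abelian_group (Ob A)\<^esub> x = G0_kernel A #>\<^bsub>free_Abelian_group (Ob A)\<^esub> y"
proof -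
  interpret G: comm_group "G0 A" by (rule comm_group_G0)
  have "x - y \<in> carrier (free_Abelian_group (Ob A))" using assms(1) G0_relations_carrier by blast
  from coset_add[OF this assms(2)]
  show ?thesis unfolding coset_kernel[OF assms(1)] using hom_in_carrier[OF coset_hom assms(2)] by simp
qed

lemma G0_class_iso: "isomorphic A X Y \<Longrightarrow> X \<in> Ob A \<Longrightarrow> Y \<in> Ob A \<Longrightarrow> G0_class A X = G0_class A Y"
  unfolding G0_class_def by (rule coset_eq) (unfold G0_relations_def, blast, simp)

lemma G0_class_ses:
  assumes "short_exact A f g" shows "G0_class A (Cod A f) = G0_class A (Dom A f) \<otimes>\<^bsub>G0 A\<^esub> G0_class A (Cod A g)"
proof -
  have ob: "Dom A f \<in> Ob A" "Cod A f \<in> Ob A" "Cod A g \<in> Ob A"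
    using is_kernelD(1,2)[OF short_exactD(1)[OF assms]] by simp_all
  then have "Poly_Mapping.keys (frag_of (Dom A f) + frag_of (Cod A g)) \<subseteq> Ob A"
    using keys_add[of "frag_of (Dom A f)" "frag_of (Cod A g)"] by (simp add: subset_iff) blast
  then have "G0_class A (Cod A f) = G0_kernel A #>\<^bsub>free_Abelian_group (Ob A)\<^esub> (frag_of (Dom A f) + frag_of (Cod A g))"
    unfolding G0_class_def by (rule_tac coset_eq) (use assms in \<open>unfold G0_relations_def, blast, simp\<close>)
  also have "\<dots> = G0_class A (Dom A f) \<otimes>\<^bsub>G0 A\<^esub> G0_class A (Cod A g)"
    unfolding G0_class_def by (rule coset_add) (use ob in simp_all)
  finally show ?thesis .
qed

lemma G0_class_zero:
  assumes Z: "zero_object A Z" shows "G0_class A Z = \<one>\<^bsub>G0 A\<^esub>"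
proof -
  interpret G: comm_group "G0 A" by (rule comm_group_G0)
  have ZO: "Z \<in> Ob A" using Z by (simp add: zero_object_iff)
  have "short_exact A (Idn A Z) (Idn A Z)" unfolding short_exact_def
  proof
    have m: "monic A (Idn A Z)" "epic A (Idn A Z)" using isomorphism_idn[OF ZO] isomorphism_monic isomorphism_epic by blast+
    have n: "Idn A Z = Nul A Z Z" using Z by (simp add: zero_object_iff)
    show "is_kernel A (Idn A Z) (Idn A Z)"
      by (rule kernelI) (use m ZO n to_zero[OF Z] in \<open>auto intro!: exI\<close>)
    show "is_cokernel A (Idn A Z) (Idn A Z)"
      by (rule cokernelI) (use m ZO n from_zero[OF Z] in \<open>auto intro!: exI\<close>)
  qed
  from G0_class_ses[OF this] have "G0_class A Z = G0_class A Z \<otimes>\<^bsub>G0 A\<^esub> G0_class A Z" using ZO by simp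
  then show ?thesis using G.l_cancel_one'[OF G0_class_closed[OF ZO] G0_class_closed[OF ZO]] by simp
qed

lemma G0_universal:
  assumes H: "comm_group H" and \<phi>: "\<And>X. X \<in> Ob A \<Longrightarrow> \<phi> X \<in> carrier H"
    "\<And>X Y. X \<in> Ob A \<Longrightarrow> Y \<in> Ob A \<Longrightarrow> isomorphic A X Y \<Longrightarrow> \<phi> X = \<phi> Y"
    "\<And>f g. short_exact A f g \<Longrightarrow> \<phi> (Cod A f) = \<phi> (Dom A f) \<otimes>\<^bsub>H\<^esub> \<phi> (Cod A g)"
  obtains h where "h \<in> hom (G0 A) H" "\<And>X. X \<in> Ob A \<Longrightarrow> h (G0_class A X) = \<phi> X"
proof -
  let ?F = "free_Abelian_group (Ob A)"
  interpret H: comm_group H by (rule H)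
  have "\<phi> ` Ob A \<subseteq> carrier H" using \<phi>(1) by blast
  then have "\<exists>k. k \<in> hom ?F H \<and> (\<forall>X\<in>Ob A. k (frag_of X) = \<phi> X)"
    by (rule H.free_Abelian_group_universal) blast
  then obtain k where k: "k \<in> hom ?F H" "\<And>X. X \<in> Ob A \<Longrightarrow> k (frag_of X) = \<phi> X" by blast
  interpret k: group_hom ?F H k unfolding group_hom_def group_hom_axioms_def using k(1) group_free_Abelian_group H.is_group by simp
  have kd: "k (frag_of X - frag_of Y) = \<phi> X \<otimes>\<^bsub>H\<^esub> inv\<^bsub>H\<^esub> \<phi> Y" if "X \<in> Ob A" "Y \<in> Ob A" for X Y
  proof -
    have "k (frag_of X \<otimes>\<^bsub>?F\<^esub> inv\<^bsub>?F\<^esub> frag_of Y) = k (frag_of X) \<otimes>\<^bsub>H\<^esub> k (inv\<^bsub>?F\<^esub> frag_of Y)"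
      by (rule k.hom_mult) (use that in simp_all)
    moreover have "k (inv\<^bsub>?F\<^esub> frag_of Y) = inv\<^bsub>H\<^esub> k (frag_of Y)" by (rule k.hom_inv) (use that in simp)
    ultimately show ?thesis using that k(2) by simp
  qed
  have rel: "k x = \<one>\<^bsub>H\<^esub>" if "x \<in> G0_relations A" for x
  proof -
    from that consider X Y where "x = frag_of X - frag_of Y" "X \<in> Ob A" "Y \<in> Ob A" "isomorphic A X Y"
      | f g where "x = frag_of (Cod A f) - (frag_of (Dom A f) + frag_of (Cod A g))" "short_exact A f g"
      unfolding G0_relations_def by blast
    then show ?thesis
    proof cases
      case 1
      then show ?thesis using kd[OF 1(2,3)] \<phi>(1)[OF 1(3)] \<phi>(2)[OF 1(2,3,4)] by simp
    next
      case 2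
      have ob: "Dom A f \<in> Ob A" "Cod A f \<in> Ob A" "Cod A g \<in> Ob A"
        using is_kernelD(1,2)[OF short_exactD(1)[OF 2(2)]] by simp_all
      have x: "x = (frag_of (Cod A f) - frag_of (Dom A f)) - frag_of (Cod A g)" using 2(1) by simp
      have c: "frag_of (Cod A f) - frag_of (Dom A f) \<in> carrier ?F"
        using keys_diff[of "frag_of (Cod A f)" "frag_of (Dom A f)"] ob by (simp add: subset_iff) blast
      have "x = (frag_of (Cod A f) - frag_of (Dom A f)) \<otimes>\<^bsub>?F\<^esub> inv\<^bsub>?F\<^esub> frag_of (Cod A g)" unfolding x using ob by simp
      also have "k \<dots> = k (frag_of (Cod A f) - frag_of (Dom A f)) \<otimes>\<^bsub>H\<^esub> k (inv\<^bsub>?F\<^esub> frag_of (Cod A g))"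
        by (rule k.hom_mult) (use c ob in simp_all)
      also have "k (inv\<^bsub>?F\<^esub> frag_of (Cod A g)) = inv\<^bsub>H\<^esub> \<phi> (Cod A g)" using k.hom_inv[of "frag_of (Cod A g)"] k(2) ob by simp
      finally have "k x = \<phi> (Cod A f) \<otimes>\<^bsub>H\<^esub> inv\<^bsub>H\<^esub> \<phi> (Dom A f) \<otimes>\<^bsub>H\<^esub> inv\<^bsub>H\<^esub> \<phi> (Cod A g)" unfolding kd[OF ob(2,1)] .
      also have "\<dots> = \<one>\<^bsub>H\<^esub>"
        unfolding \<phi>(3)[OF 2(2)] using \<phi>(1) ob by (simp add: H.m_ac)
      finally show ?thesis .
    qed
  qed
  have "G0_kernel A \<subseteq> kernel ?F H k"
    unfolding G0_kernel_def by (rule k.generate_subset_kernel[OF G0_relations_carrier rel])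
  then obtain h where h: "h \<in> hom (?F Mod G0_kernel A) H" "\<And>x. x \<in> carrier ?F \<Longrightarrow> h (G0_kernel A #>\<^bsub>?F\<^esub> x) = k x"
    using k.FactGroup_universal_kernel[OF G0_kernel_normal] by blast
  show thesis
  proof (rule that)
    show "h \<in> hom (G0 A) H" using h(1) unfolding G0_def .
    fix X assume "X \<in> Ob A"
    then show "h (G0_class A X) = \<phi> X" unfolding G0_class_def using h(2)[of "frag_of X"] k(2) by simp
  qed
qed

text \<open>Every element comes from the free abelian group, which is generated by the objects under
  differences.\<close>

lemma G0_induct:
  assumes x: "x \<in> carrier (G0 A)" and 1: "P \<one>\<^bsub>G0 A\<^esub>"
    and d: "\<And>x y. x \<in> carrier (G0 A) \<Longrightarrow> y \<in> carrier (G0 A) \<Longrightarrow> P x \<Longrightarrow> P y \<Longrightarrow> P (x \<otimes>\<^bsub>G0 A\<^esub> inv\<^bsub>G0 A\<^esub> y)"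
    and c: "\<And>X. X \<in> Ob A \<Longrightarrow> P (G0_class A X)"
  shows "P x"
proof -
  let ?F = "free_Abelian_group (Ob A)"
  interpret G: comm_group "G0 A" by (rule comm_group_G0)
  interpret q: group_hom ?F "G0 A" "\<lambda>x. G0_kernel A #>\<^bsub>?F\<^esub> x" unfolding group_hom_def group_hom_axioms_def using coset_hom group_free_Abelian_group G.is_group by simp
  have "x \<in> (\<lambda>x. G0_kernel A #>\<^bsub>?F\<^esub> x) ` carrier ?F" using x unfolding G0_def carrier_FactGroup .
  then obtain y where y: "x = G0_kernel A #>\<^bsub>?F\<^esub> y" "y \<in> carrier ?F" by (rule imageE)
  have "Poly_Mapping.keys y \<subseteq> Ob A" using y(2) by simp
  then have "P (G0_kernel A #>\<^bsub>?F\<^esub> y)"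
  proof (rule free_Abelian_group_induct)
    show "P (G0_kernel A #>\<^bsub>?F\<^esub> 0)" using 1 q.hom_one by simp
    fix x y
    assume xy: "Poly_Mapping.keys x \<subseteq> Ob A" "Poly_Mapping.keys y \<subseteq> Ob A"
      "P (G0_kernel A #>\<^bsub>?F\<^esub> x)" "P (G0_kernel A #>\<^bsub>?F\<^esub> y)"
    have "G0_kernel A #>\<^bsub>?F\<^esub> (x \<otimes>\<^bsub>?F\<^esub> inv\<^bsub>?F\<^esub> y) = (G0_kernel A #>\<^bsub>?F\<^esub> x) \<otimes>\<^bsub>G0 A\<^esub> inv\<^bsub>G0 A\<^esub> (G0_kernel A #>\<^bsub>?F\<^esub> y)"
      using q.hom_mult[of x "inv\<^bsub>?F\<^esub> y"] q.hom_inv[of y] xy(1,2) by simp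
    moreover have "P ((G0_kernel A #>\<^bsub>?F\<^esub> x) \<otimes>\<^bsub>G0 A\<^esub> inv\<^bsub>G0 A\<^esub> (G0_kernel A #>\<^bsub>?F\<^esub> y))"
      by (rule d) (use xy q.hom_closed in simp_all)
    ultimately show "P (G0_kernel A #>\<^bsub>?F\<^esub> (x - y))" using xy(2) by simp
  next
    fix X assume "X \<in> Ob A"
    then show "P (G0_kernel A #>\<^bsub>?F\<^esub> frag_of X)" using c unfolding G0_class_def by simp
  qed
  then show ?thesis using y(1) by simp
qed

lemma G0_rel_closed:
  assumes "P \<in> Ob A" "P' \<in> Ob A" "Q \<in> Ob A" "R \<in> Ob A" "R' \<in> Ob A"
  shows "G0_rel A P P' Q R R' \<in> carrier (G0 A)"
proof -
  interpret G: comm_group "G0 A" by (rule comm_group_G0)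
  show ?thesis unfolding G0_rel_def using assms G0_class_closed by simp
qed

lemma hom_G0_rel:
  assumes h: "h \<in> hom (G0 A) integer_group" "\<And>X. X \<in> Ob A \<Longrightarrow> h (G0_class A X) = \<phi> X"
    and ob: "P \<in> Ob A" "P' \<in> Ob A" "Q \<in> Ob A" "R \<in> Ob A" "R' \<in> Ob A"
  shows "h (G0_rel A P P' Q R R') = \<phi> P - \<phi> P' - (\<phi> Q + (\<phi> R - \<phi> R'))"
proof -
  interpret G: comm_group "G0 A" by (rule comm_group_G0)
  interpret h: group_hom "G0 A" integer_group h unfolding group_hom_def group_hom_axioms_def using h(1) group_integer_group G.is_group by simp
  note cl = ob[THEN G0_class_closed]
  show ?thesis unfolding G0_rel_def using cl h(2) ob by simp
qed

end

section \<open>The asymptotic Grothendieck group\<close>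

locale jh_sum_setting = jh_dual_setting A C + sum_setting A C I S
  for A :: "('o, 'm) cat" (structure) and C :: "('o, 'm) cat" and I :: "'u set" and S :: "'u \<Rightarrow> 'o" +
  assumes jordan_hoelder: "locally_Jordan_Hoelder A C"
begin

abbreviation mult :: "'u \<Rightarrow> 'o \<Rightarrow> nat" where "mult i X \<equiv> simple_multiplicity A C (S i) X"

abbreviation simple_len :: "'u \<Rightarrow> 'o \<Rightarrow> enat" where "simple_len i X \<equiv> len C (\<lambda>Y. isomorphic C Y (S i)) X"

lemma simple_len: "i \<in> I \<Longrightarrow> X \<in> Ob C \<Longrightarrow> simple_len i X = enat (mult i X)"
  by (rule len_multiplicity[OF jordan_hoelder _ S_simple])

lemma S_class: "i \<in> I \<Longrightarrow> simple_class C (\<lambda>Y. isomorphic C Y (S i))"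
  by (rule C.simple_class_iso[OF S_simple])

lemma mult_zero: "i \<in> I \<Longrightarrow> zero_object A Z \<Longrightarrow> Z \<in> Ob C \<Longrightarrow> mult i Z = 0"
  using C.len_zero[OF S_class, of i Z] simple_len[of i Z] by (simp add: zero_object_C zero_enat_def)

lemma mult_iso: "i \<in> I \<Longrightarrow> isomorphic C X Y \<Longrightarrow> X \<in> Ob C \<Longrightarrow> Y \<in> Ob C \<Longrightarrow> mult i X = mult i Y"
  using C.len_iso[of X Y "\<lambda>Y. isomorphic C Y (S i)"] by (simp add: simple_len)

lemma mult_ses:
  assumes i: "i \<in> I" and fg: "short_exact C f g"
  shows "mult i (Cod A f) = mult i (Dom A f) + mult i (Cod A g)"
proof -
  have ob: "Dom A f \<in> Ob C" "Cod A f \<in> Ob C" "Cod A g \<in> Ob C" using fg by (simp_all add: short_exact_C)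
  show ?thesis using C.len_ses[OF S_class[OF i] fg] ob i by (simp add: simple_len)
qed

lemma mult_simple:
  assumes "i \<in> I" "j \<in> I" shows "mult j (S i) = (if j = i then 1 else 0)"
proof -
  have "isomorphic C (S i) (S j) \<longleftrightarrow> i = j"
    using S_inj[OF C.isomorphic_refl[OF S_Ob[OF assms(1)]] _ assms] C.isomorphic_refl[OF S_Ob[OF assms(1)]] by blast
  then show ?thesis
    using C.len_simple[OF S_class[OF assms(2)] S_simple[OF assms(1)]] simple_len[OF assms(2) S_Ob[OF assms(1)]]
    by (auto simp: one_enat_def zero_enat_def split: if_splits)
qed

text \<open>A position in a chain carries at most one simple factor up to isomorphism, so distinct
  indices have disjoint sets of positions.\<close>

lemma chain_occurrences_inj:
  assumes "r \<in> chain_occurrences A C f (S i)" "r \<in> chain_occurrences A C f (S j)" "i \<in> I" "j \<in> I"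
  shows "i = j"
proof -
  obtain c where c: "is_cokernel A (f r) c" "Cod A c \<in> Ob C" "isomorphic A (Cod A c) (S i)"
    using assms(1) unfolding chain_occurrences_def by blast
  obtain c' where c': "is_cokernel A (f r) c'" "Cod A c' \<in> Ob C" "isomorphic A (Cod A c') (S j)"
    using assms(2) unfolding chain_occurrences_def by blast
  have "isomorphic A (Cod A c) (S j)"
    by (rule A.isomorphic_trans[OF A.cokernel_isomorphic[OF c(1) c'(1)] c'(3)])
  then show ?thesis using S_inj[of "Cod A c" i j] c assms(3,4) S_Ob by (simp add: isomorphic_C)
qed

lemma chain_mult:
  assumes "i \<in> I" "simple_chain A C W f" "loc_finite_chain A C f"
  shows "mult i (W 0) = card (chain_occurrences A C f (S i))"
proof -
  have "finite (chain_occurrences A C f (S i))" using assms(3) S_simple[OF assms(1)] unfolding loc_finite_chain_def by blast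
  from chain_len[OF S_simple[OF assms(1)] assms(2) chain_acceptable[OF assms(2,3)] this]
  show ?thesis using simple_len[OF assms(1) simple_chainD(2)[OF assms(2), of 0]] by simp
qed

lemma locally_finite_sum_Ob: "locally_finite_sum A C I S n B \<Longrightarrow> B \<in> Ob C"
  unfolding locally_finite_sum_def biproduct_in_def by blast

text \<open>A copy of \<open>S j\<close> is a split subobject of \<open>B\<close>, and length is
  monotone on subobjects. This weak bound is enough to make the set of occurring indices
  countable.\<close>

lemma summand_mult:
  assumes B: "locally_finite_sum A C I S n B" and j: "j \<in> I" "n j \<noteq> 0"
  shows "mult j B \<noteq> 0"
proof -
  obtain Y \<iota> p \<iota>' p' where Y: "is_biproduct A {..<n j} (\<lambda>_. S j) (Y j) \<iota>' p'" and Bi: "is_biproduct A I Y B \<iota> p"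
    using B j(1) unfolding locally_finite_sum_def biproduct_in_def by blast
  have 0: "0 \<in> {..<n j}" using j(2) by simp
  have BC: "B \<in> Ob C" by (rule locally_finite_sum_Ob[OF B])
  have a: "\<iota>' 0 \<in> Hom A (S j) (Y j)" "p' 0 \<in> Hom A (Y j) (S j)" "p' 0 \<bullet> \<iota>' 0 = Idn A (S j)"
    using Y 0 unfolding is_biproduct_def is_coproduct_def by (simp_all del: in_Hom)
  have b: "\<iota> j \<in> Hom A (Y j) B" "p j \<in> Hom A B (Y j)" "p j \<bullet> \<iota> j = Idn A (Y j)"
    using Bi j(1) unfolding is_biproduct_def is_coproduct_def by (simp_all del: in_Hom)
  have m1: "monic A (\<iota>' 0)"
    by (rule A.monic_cmpD[of "p' 0"]) (use a S_Ob[OF j(1)] A.isomorphism_monic[OF A.isomorphism_idn] in simp_all)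
  have "Y j \<in> Ob A" using b(1) by (simp, metis A.dom_ob)
  then have m2: "monic A (\<iota> j)"
    by (rule_tac A.monic_cmpD[of "p j"]) (use b A.isomorphism_monic[OF A.isomorphism_idn] in simp_all)
  have "monic A (\<iota> j \<bullet> \<iota>' 0)" by (rule A.monic_cmp[OF m1 m2]) (use a b in simp)
  then have "monic C (\<iota> j \<bullet> \<iota>' 0)" using a b S_Ob[OF j(1)] BC by (simp add: monic_C)
  from C.len_monic[OF S_class[OF j(1)] this] have "simple_len j (S j) \<le> simple_len j B" using a b by simp
  then have "mult j (S j) \<le> mult j B" using simple_len[OF j(1)] S_Ob[OF j(1)] BC by simp
  then show ?thesis using mult_simple[OF j(1,1)] by simp
qed

text \<open>A chain of \<open>B\<close> contains every \<open>S j\<close> with \<open>n j \<noteq> 0\<close>.  Hence only countably many \<open>n j\<close> are nonzero and \<open>B\<close> is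
  the biproduct of a sequence \<open>Q\<close> of simple or zero objects.\<close>

lemma locally_finite_sum_mult:
  assumes B: "locally_finite_sum A C I S n B" and i: "i \<in> I"
  shows "mult i B = n i"
proof -
  have BC: "B \<in> Ob C" by (rule locally_finite_sum_Ob[OF B])
  obtain W f \<theta> where W: "simple_chain A C W f" "loc_finite_chain A C f" "isomorphism A \<theta>" "Dom A \<theta> = W 0" "Cod A \<theta> = B"
    by (rule chain_obtain[OF BC])
  have WB: "mult j (W 0) = mult j B" if "j \<in> I" for j
    by (rule mult_iso[OF that]) (use C.isomorphicI[of \<theta>] W(3,4,5) BC simple_chainD(2)[OF W(1)] in \<open>simp_all add: isomorphism_C\<close>)
  define J where "J = {j \<in> I. n j \<noteq> 0}"
  have "\<forall>j\<in>J. \<exists>r. r \<in> chain_occurrences A C f (S j)"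
  proof
    fix j assume "j \<in> J"
    then have j: "j \<in> I" "n j \<noteq> 0" by (simp_all add: J_def)
    have "card (chain_occurrences A C f (S j)) \<noteq> 0" using summand_mult[OF B j] WB[OF j(1)] chain_mult[OF j(1) W(1,2)] by simp
    then show "\<exists>r. r \<in> chain_occurrences A C f (S j)" by (metis all_not_in_conv card.empty)
  qed
  from bchoice[OF this] obtain \<rho> where \<rho>: "\<And>j. j \<in> J \<Longrightarrow> \<rho> j \<in> chain_occurrences A C f (S j)" by blast
  \<comment> \<open>A copy of \<open>S j\<close> is coded by its number and by the position
    \<open>\<rho> j\<close> of one factor \<open>S j\<close> in a chain of \<open>B\<close>.
    Positions determine the index, so the code is injective.\<close>
  define g where "g x = prod_encode (\<rho> (fst x), snd x)" for x :: "'u \<times> nat"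
  define \<Sigma> where "\<Sigma> = Sigma I (\<lambda>j. {..<n j})"
  have inj: "inj_on g \<Sigma>"
  proof (rule inj_onI)
    fix x y assume x: "x \<in> \<Sigma>" and y: "y \<in> \<Sigma>" and e: "g x = g y"
    have "(\<rho> (fst x), snd x) = (\<rho> (fst y), snd y)" using e unfolding g_def prod_encode_eq .
    then have e: "\<rho> (fst x) = \<rho> (fst y)" "snd x = snd y" unfolding prod.inject by blast+
    have J: "fst x \<in> J" "fst y \<in> J" using x y unfolding \<Sigma>_def J_def by auto
    have "\<rho> (fst x) \<in> chain_occurrences A C f (S (fst y))" using \<rho>[OF J(2)] unfolding e(1) .
    then have "fst x = fst y" by (rule chain_occurrences_inj[OF \<rho>[OF J(1)]]) (use J in \<open>simp_all add: J_def\<close>)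
    then show "x = y" using e(2) by (rule prod_eqI)
  qed
  define R where "R = g ` \<Sigma>"
  define idx where "idx r = fst (inv_into \<Sigma> g r)" for r
  have idx: "idx (g x) = fst x" if "x \<in> \<Sigma>" for x unfolding idx_def inv_into_f_f[OF inj that] ..
  have fibre: "{r \<in> R. idx r = j} = g ` ({j} \<times> {..<n j})" if j: "j \<in> I" for j
  proof (intro subset_antisym subsetI)
    fix r assume "r \<in> {r \<in> R. idx r = j}"
    then obtain x where x: "x \<in> \<Sigma>" "r = g x" "idx (g x) = j" unfolding R_def by blast
    then have "x \<in> {j} \<times> {..<n j}" using idx[OF x(1)] unfolding \<Sigma>_def by auto
    then show "r \<in> g ` ({j} \<times> {..<n j})" using x(2) by blast
  next
    fix r assume "r \<in> g ` ({j} \<times> {..<n j})"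
    then obtain x where x: "x \<in> {j} \<times> {..<n j}" "r = g x" by blast
    then have "x \<in> \<Sigma>" "fst x = j" using j unfolding \<Sigma>_def by auto
    then show "r \<in> {r \<in> R. idx r = j}" using idx[of x] x(2) unfolding R_def by simp
  qed
  have fin: "finite {r \<in> R. idx r = j} \<and> card {r \<in> R. idx r = j} = n j" if j: "j \<in> I" for j
  proof -
    have "{j} \<times> {..<n j} \<subseteq> \<Sigma>" using j unfolding \<Sigma>_def by blast
    then have "inj_on g ({j} \<times> {..<n j})" by (rule inj_on_subset[OF inj])
    then show ?thesis unfolding fibre[OF j] by (simp add: card_image)
  qed
  have RI: "idx r \<in> I" if "r \<in> R" for r
  proof -
    obtain x where "x \<in> \<Sigma>" "r = g x" using \<open>r \<in> R\<close> unfolding R_def by blast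
    then show ?thesis using idx[of x] unfolding \<Sigma>_def by auto
  qed
  obtain Z where Z: "zero_object A Z" "Z \<in> Ob C" by (rule zero_ex_C)
  define Q where "Q r = (if r \<in> R then S (idx r) else Z)" for r :: nat
  have QC: "Q r \<in> Ob C" for r unfolding Q_def using S_Ob RI Z(2) by simp
  have Qb: "biproduct_in A C UNIV Q B"
    by (rule A.locally_finite_sum_pad[OF B, of R idx])
      (use RI fin Z(1) S_Ob A.isomorphic_refl in \<open>simp_all add: Q_def\<close>)
  have Qm: "mult i (Q r) = (if r \<in> R \<and> idx r = i then 1 else 0)" for r
    using mult_simple[OF RI i, of r] mult_zero[OF i Z] unfolding Q_def by auto
  have fi: "finite {r \<in> R. idx r = i}" using fin[OF i] by blast
  \<comment> \<open>From \<open>N\<close> on no summand is \<open>S i\<close>. The tail then has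
    length zero by \<open>biproduct_len_zero\<close>, and the finitely many summands before it are
    counted by additivity.\<close>
  obtain N where N: "{r \<in> R. idx r = i} \<subseteq> {..<N}" using fi finite_nat_iff_bounded by blast
  obtain B' where B': "biproduct_in A C UNIV (\<lambda>r. Q (N + r)) B'" "simple_len i B = (\<Sum>r<N. simple_len i (Q r)) + simple_len i B'"
    using biproduct_len_shift[OF S_class[OF i] QC Qb, of N] by blast
  have "simple_len i B' = 0"
  proof (rule biproduct_len_zero[OF S_class[OF i] B'(1) QC])
    fix r
    have "\<not> (N + r \<in> R \<and> idx (N + r) = i)" using N by auto
    then show "simple_len i (Q (N + r)) = 0" using Qm[of "N + r"] simple_len[OF i QC] by (simp add: zero_enat_def)
  qed
  then have "enat (mult i B) = (\<Sum>r<N. enat (mult i (Q r)))" using B'(2) simple_len[OF i] QC BC by simp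
  also have "\<dots> = enat (\<Sum>r<N. mult i (Q r))" by (induction N) (simp_all add: zero_enat_def)
  also have "(\<Sum>r<N. mult i (Q r)) = card ({..<N} \<inter> {r. r \<in> R \<and> idx r = i})"
    unfolding Qm by (simp add: sum.If_cases)
  also have "{..<N} \<inter> {r. r \<in> R \<and> idx r = i} = {r \<in> R. idx r = i}" using N by blast
  finally show ?thesis using fin[OF i] by simp
qed

lemma zero_lim1:
  assumes "acceptable_inverse A C Y f" "is_lim1 A Y f L" shows "zero_object A L"
proof -
  obtain P \<pi> d c where d: "is_product A UNIV Y P \<pi>" "one_minus_prod A f P \<pi> d" "is_cokernel A d c" "Cod A c = L"
    using assms(2) unfolding is_lim1_def by (elim exE conjE)
  show ?thesis using lim1_epic[OF assms(1) d(1,2)] unfolding A.epic_iff_cokernel_zero[OF d(3)] d(4) .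
qed

lemma acceptable_op_iff: "acceptable_inverse (op_cat A) (op_cat C) X f \<longleftrightarrow> acceptable_direct A C X f"
  by (rule acceptable_op[OF A.preadditive_category_axioms])

lemma zero_colim1:
  assumes "acceptable_direct A C X f" "is_colim1 A X f L" shows "zero_object A L"
proof -
  have 1: "acceptable_inverse (op_cat A) (op_cat C) X f" "is_lim1 (op_cat A) X f L"
    using assms by (simp_all only: acceptable_op_iff is_lim1_op)
  obtain P \<pi> d c where d: "is_product (op_cat A) UNIV X P \<pi>" "one_minus_prod (op_cat A) f P \<pi> d"
    "is_cokernel (op_cat A) d c" "Cod (op_cat A) c = L"
    using 1(2) unfolding is_lim1_def by (elim exE conjE)
  have "zero_object (op_cat A) L"
    using dual.lim1_epic[OF 1(1) d(1,2)] unfolding dual.A.epic_iff_cokernel_zero[OF d(3)] d(4) .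
  then show ?thesis by simp
qed

lemma mult_hom:
  assumes i: "i \<in> I"
  obtains h where "h \<in> hom (G0 C) integer_group" "\<And>X. X \<in> Ob C \<Longrightarrow> h (G0_class C X) = int (mult i X)"
proof (rule C.G0_universal[OF abelian_integer_group, of "\<lambda>X. int (mult i X)"])
  show "isomorphic C X Y \<Longrightarrow> X \<in> Ob C \<Longrightarrow> Y \<in> Ob C \<Longrightarrow> int (mult i X) = int (mult i Y)" for X Y
    using mult_iso[OF i] by simp
  show "short_exact C f g \<Longrightarrow> int (mult i (Cod C f)) = int (mult i (Dom C f)) \<otimes>\<^bsub>integer_group\<^esub> int (mult i (Cod C g))" for f g
    using mult_ses[OF i] by simp
qed (use that in simp_all)

text \<open>The relations prescribe the summands \<open>K r\<close> and \<open>D r\<close> only up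
  to their classes in \<open>G0 C\<close>. Multiplicity is additive, so it is determined by the
  class.\<close>

lemma G0_class_mult:
  assumes "i \<in> I" "X \<in> Ob C" "Y \<in> Ob C" "G0_class C X = G0_class C Y" shows "mult i X = mult i Y"
proof -
  obtain h where "h \<in> hom (G0 C) integer_group" and h: "\<And>X. X \<in> Ob C \<Longrightarrow> h (G0_class C X) = int (mult i X)"
    by (rule mult_hom[OF assms(1)]) blast
  show ?thesis using h[OF assms(2)] h[OF assms(3)] unfolding assms(4) by simp
qed

lemma ker_cok_sums_obtain:
  fixes X :: "nat \<Rightarrow> 'o"
  assumes "ker_cok_sums A C f BK BC"
  obtains K D where "\<And>r. K r \<in> Ob C" "\<And>r. D r \<in> Ob C" "biproduct_in A C UNIV K BK" "biproduct_in A C UNIV D BC"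
    "\<And>i r k. i \<in> I \<Longrightarrow> is_kernel A (f r) k \<Longrightarrow> Dom A k \<in> Ob C \<Longrightarrow> simple_len i (Dom A k) = simple_len i (K r)"
    "\<And>i r c. i \<in> I \<Longrightarrow> is_cokernel A (f r) c \<Longrightarrow> Cod A c \<in> Ob C \<Longrightarrow> simple_len i (Cod A c) = simple_len i (D r)"
proof -
  obtain K D k c where
    K: "\<forall>r. K r \<in> Ob C \<and> is_kernel C (f r) (k r) \<and> G0_class C (K r) = G0_class C (Dom C (k r))" and
    D: "\<forall>r. D r \<in> Ob C \<and> is_cokernel C (f r) (c r) \<and> G0_class C (D r) = G0_class C (Cod C (c r))" and
    B: "biproduct_in A C UNIV K BK" "biproduct_in A C UNIV D BC"
    using assms unfolding ker_cok_sums_def by (elim exE conjE)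
  show thesis
  proof (rule that[OF _ _ B])
    fix r show "K r \<in> Ob C" "D r \<in> Ob C" using K D by blast+
  next
    fix i r k' assume i: "i \<in> I" and k': "is_kernel A (f r) k'" "Dom A k' \<in> Ob C"
    have k: "K r \<in> Ob C" "is_kernel A (f r) (k r)" "Dom A (k r) \<in> Ob C" "G0_class C (K r) = G0_class C (Dom A (k r))"
      using spec[OF K, of r] by (simp_all add: is_kernel_C)
    have "isomorphic C (Dom A k') (Dom A (k r))" using A.kernel_isomorphic[OF k'(1) k(2)] k'(2) k(3) by (simp add: isomorphic_C)
    then show "simple_len i (Dom A k') = simple_len i (K r)"
      using mult_iso[OF i _ k'(2) k(3)] G0_class_mult[OF i k(1,3,4)] simple_len[OF i] k'(2) k(1) by simp
  next
    fix i r c' assume i: "i \<in> I" and c': "is_cokernel A (f r) c'" "Cod A c' \<in> Ob C"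
    have c: "D r \<in> Ob C" "is_cokernel A (f r) (c r)" "Cod A (c r) \<in> Ob C" "G0_class C (D r) = G0_class C (Cod A (c r))"
      using spec[OF D, of r] by (simp_all add: is_cokernel_C)
    have "isomorphic C (Cod A c') (Cod A (c r))" using A.cokernel_isomorphic[OF c'(1) c(2)] c'(2) c(3) by (simp add: isomorphic_C)
    then show "simple_len i (Cod A c') = simple_len i (D r)"
      using mult_iso[OF i _ c'(2) c(3)] G0_class_mult[OF i c(1,3,4)] simple_len[OF i] c'(2) c(1) by simp
  qed
qed

lemma ker_cok_sums_Ob: "ker_cok_sums A C f BK BC \<Longrightarrow> BK \<in> Ob C \<and> BC \<in> Ob C"
  unfolding ker_cok_sums_def biproduct_in_def by blast

lemma lim_mult:
  assumes i: "i \<in> I" and acc: "acceptable_inverse A C Y f" and L: "is_lim A Y f X p" "X \<in> Ob C"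
    and s: "ker_cok_sums A C f BK BC"
  shows "mult i X + mult i BC = mult i (Y 0) + mult i BK"
proof -
  obtain K D where K: "\<And>r. K r \<in> Ob C" "\<And>r. D r \<in> Ob C" "biproduct_in A C UNIV K BK" "biproduct_in A C UNIV D BC"
    "\<And>i r k. i \<in> I \<Longrightarrow> is_kernel A (f r) k \<Longrightarrow> Dom A k \<in> Ob C \<Longrightarrow> simple_len i (Dom A k) = simple_len i (K r)"
    "\<And>i r c. i \<in> I \<Longrightarrow> is_cokernel A (f r) c \<Longrightarrow> Cod A c \<in> Ob C \<Longrightarrow> simple_len i (Cod A c) = simple_len i (D r)"
    by (rule ker_cok_sums_obtain[OF s]) blast
  have "lim_cone A Y f X p" using L(1) unfolding is_lim_iff by blast
  from lim_relation[OF S_simple[OF i] acc this L(2) K(1) K(5)[OF i] K(2) K(6)[OF i] K(3,4)]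
  show ?thesis using simple_len[OF i] L(2) acceptableD(2)[OF acc, of 0] ker_cok_sums_Ob[OF s] by simp
qed

lemma colim_mult:
  assumes i: "i \<in> I" and acc: "acceptable_direct A C X f" and L: "is_colim A X f Y p" "Y \<in> Ob C"
    and s: "ker_cok_sums A C f BK BC"
  shows "mult i Y + mult i BK = mult i (X 0) + mult i BC"
proof -
  obtain K D where K: "\<And>r. K r \<in> Ob C" "\<And>r. D r \<in> Ob C" "biproduct_in A C UNIV K BK" "biproduct_in A C UNIV D BC"
    "\<And>i r k. i \<in> I \<Longrightarrow> is_kernel A (f r) k \<Longrightarrow> Dom A k \<in> Ob C \<Longrightarrow> simple_len i (Dom A k) = simple_len i (K r)"
    "\<And>i r c. i \<in> I \<Longrightarrow> is_cokernel A (f r) c \<Longrightarrow> Cod A c \<in> Ob C \<Longrightarrow> simple_len i (Cod A c) = simple_len i (D r)"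
    by (rule ker_cok_sums_obtain[OF s]) blast
  have acc': "acceptable_inverse (op_cat A) (op_cat C) X f" using acc unfolding acceptable_op_iff .
  have "lim_cone (op_cat A) X f Y p" using L(1) unfolding is_lim_op[symmetric] dual.is_lim_iff by blast
  from colim_relation[OF S_simple[OF i] acc' this L(2) K(1) K(5)[OF i] K(2) K(6)[OF i] K(3,4)]
  show ?thesis using simple_len[OF i] L(2) dual.acceptableD(2)[OF acc', of 0] ker_cok_sums_Ob[OF s] by simp
qed

abbreviation lim_rels :: "('o \<Rightarrow>\<^sub>0 int) set set" where
  "lim_rels \<equiv> {G0_rel C X X' (Y 0) BK BC | Y f X p X' BK BC.
        acceptable_inverse A C Y f \<and> is_lim A Y f X p \<and> is_lim1 A Y f X' \<and>
        X \<in> Ob C \<and> X' \<in> Ob C \<and> ker_cok_sums A C f BK BC}"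

abbreviation colim_rels :: "('o \<Rightarrow>\<^sub>0 int) set set" where
  "colim_rels \<equiv> {G0_rel C Y Y' (X 0) BC BK | X f Y i Y' BK BC.
        acceptable_direct A C X f \<and> is_colim A X f Y i \<and> is_colim1 A X f Y' \<and>
        Y \<in> Ob C \<and> Y' \<in> Ob C \<and> ker_cok_sums A C f BK BC}"

lemma lim_rels_carrier: "lim_rels \<subseteq> carrier (G0 C)"
proof
  fix x assume "x \<in> lim_rels"
  then obtain Y f X p X' BK BC where x: "x = G0_rel C X X' (Y 0) BK BC" "acceptable_inverse A C Y f"
    "X \<in> Ob C" "X' \<in> Ob C" "ker_cok_sums A C f BK BC" by (elim CollectE exE conjE)
  show "x \<in> carrier (G0 C)" unfolding x(1)
    using C.G0_rel_closed[OF x(3,4) acceptableD(2)[OF x(2)]] ker_cok_sums_Ob[OF x(5)] by blast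
qed

lemma colim_rels_carrier: "colim_rels \<subseteq> carrier (G0 C)"
proof
  fix x assume "x \<in> colim_rels"
  then obtain X f Y i Y' BK BC where x: "x = G0_rel C Y Y' (X 0) BC BK" "acceptable_direct A C X f"
    "Y \<in> Ob C" "Y' \<in> Ob C" "ker_cok_sums A C f BK BC" by (elim CollectE exE conjE)
  have "X 0 \<in> Ob C" using x(2) unfolding acceptable_direct_def direct_sequence_def by blast
  then show "x \<in> carrier (G0 C)" unfolding x(1)
    using C.G0_rel_closed[OF x(3,4)] ker_cok_sums_Ob[OF x(5)] by blast
qed

definition relations :: "('o \<Rightarrow>\<^sub>0 int) set set" where "relations = J_colim A C <#>\<^bsub>G0 C\<^esub> J_lim A C"

lemma J_subgroup: "subgroup (J_lim A C) (G0 C)" "subgroup (J_colim A C) (G0 C)"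
  unfolding J_lim_def J_colim_def
  by (rule group.generate_is_subgroup[OF comm_group.axioms(2)[OF C.comm_group_G0]], rule lim_rels_carrier colim_rels_carrier)+

lemma relations_subgroup: "subgroup relations (G0 C)"
  unfolding relations_def by (rule comm_group.mult_subgroups[OF C.comm_group_G0 J_subgroup(2,1)])

lemma relations_normal: "relations \<lhd> G0 C"
  by (rule comm_group.subgroup_imp_normal[OF C.comm_group_G0 relations_subgroup])

lemma comm_group_asymptotic: "comm_group (asymptotic_G0 A C)"
  unfolding asymptotic_G0_def relations_def[symmetric]
  by (rule comm_group.abelian_FactGroup[OF C.comm_group_G0 relations_subgroup])

lemma asymptotic_hom: "(\<lambda>x. relations #>\<^bsub>G0 C\<^esub> x) \<in> hom (G0 C) (asymptotic_G0 A C)"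
  unfolding asymptotic_G0_def relations_def[symmetric] by (rule normal.r_coset_hom_Mod[OF relations_normal])

lemma asymptotic_class_eq: "asymptotic_class A C X = relations #>\<^bsub>G0 C\<^esub> G0_class C X"
  unfolding asymptotic_class_def relations_def ..

lemma asymptotic_class_closed: "X \<in> Ob C \<Longrightarrow> asymptotic_class A C X \<in> carrier (asymptotic_G0 A C)"
  unfolding asymptotic_class_eq by (rule hom_in_carrier[OF asymptotic_hom C.G0_class_closed])

lemma asymptotic_class_iso: "isomorphic C X Y \<Longrightarrow> X \<in> Ob C \<Longrightarrow> Y \<in> Ob C \<Longrightarrow> asymptotic_class A C X = asymptotic_class A C Y"
  unfolding asymptotic_class_eq by (simp add: C.G0_class_iso)

lemma asymptotic_class_ses:
  assumes "short_exact C f g"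
  shows "asymptotic_class A C (Cod A f) = asymptotic_class A C (Dom A f) \<otimes>\<^bsub>asymptotic_G0 A C\<^esub> asymptotic_class A C (Cod A g)"
proof -
  have ob: "Dom A f \<in> Ob C" "Cod A f \<in> Ob C" "Cod A g \<in> Ob C" using assms by (simp_all add: short_exact_C)
  show ?thesis unfolding asymptotic_class_eq
    using C.G0_class_ses[OF assms] hom_mult[OF asymptotic_hom C.G0_class_closed[OF ob(1)] C.G0_class_closed[OF ob(3)]] by simp
qed

lemma asymptotic_class_zero: "zero_object A Z \<Longrightarrow> Z \<in> Ob C \<Longrightarrow> asymptotic_class A C Z = \<one>\<^bsub>asymptotic_G0 A C\<^esub>"
  unfolding asymptotic_class_eq
  using C.G0_class_zero[of Z] hom_one[OF asymptotic_hom comm_group.axioms(2)[OF C.comm_group_G0] comm_group.axioms(2)[OF comm_group_asymptotic]]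
  by (simp add: zero_object_C)

text \<open>The derived limit and colimit in a relation are zero, so each generating relation
  reduces to \<open>lim_mult\<close> or \<open>colim_mult\<close>, and multiplicity factors through
  the quotient.\<close>

lemma asymptotic_mult_hom:
  assumes i: "i \<in> I"
  obtains h where "h \<in> hom (asymptotic_G0 A C) integer_group" "\<And>X. X \<in> Ob C \<Longrightarrow> h (asymptotic_class A C X) = int (mult i X)"
proof -
  interpret G: comm_group "G0 C" by (rule C.comm_group_G0)
  obtain h where h: "h \<in> hom (G0 C) integer_group" "\<And>X. X \<in> Ob C \<Longrightarrow> h (G0_class C X) = int (mult i X)"
    by (rule mult_hom[OF i]) blast
  interpret h: group_hom "G0 C" integer_group h
    unfolding group_hom_def group_hom_axioms_def using h(1) group_integer_group G.is_group by simp
  have 1: "J_lim A C \<subseteq> kernel (G0 C) integer_group h" unfolding J_lim_def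
  proof (rule h.generate_subset_kernel[OF lim_rels_carrier])
    fix x assume "x \<in> lim_rels"
    then obtain Y f X p X' BK BC where x: "x = G0_rel C X X' (Y 0) BK BC" "acceptable_inverse A C Y f" "is_lim A Y f X p" "is_lim1 A Y f X'"
      "X \<in> Ob C" "X' \<in> Ob C" "ker_cok_sums A C f BK BC" by (elim CollectE exE conjE)
    have B: "BK \<in> Ob C" "BC \<in> Ob C" using ker_cok_sums_Ob[OF x(7)] by blast+
    have Y0: "Y 0 \<in> Ob C" by (rule acceptableD(2)[OF x(2)])
    have "h x = int (mult i X) - int (mult i X') - (int (mult i (Y 0)) + (int (mult i BK) - int (mult i BC)))"
      unfolding x(1) by (rule C.hom_G0_rel[OF h x(5,6) Y0 B])
    then show "h x = \<one>\<^bsub>integer_group\<^esub>"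
      using lim_mult[OF i x(2,3,5,7)] mult_zero[OF i zero_lim1[OF x(2,4)] x(6)] by simp
  qed
  have 2: "J_colim A C \<subseteq> kernel (G0 C) integer_group h" unfolding J_colim_def
  proof (rule h.generate_subset_kernel[OF colim_rels_carrier])
    fix x assume "x \<in> colim_rels"
    then obtain X f Y p Y' BK BC where x: "x = G0_rel C Y Y' (X 0) BC BK" "acceptable_direct A C X f" "is_colim A X f Y p" "is_colim1 A X f Y'"
      "Y \<in> Ob C" "Y' \<in> Ob C" "ker_cok_sums A C f BK BC" by (elim CollectE exE conjE)
    have B: "BC \<in> Ob C" "BK \<in> Ob C" using ker_cok_sums_Ob[OF x(7)] by blast+
    have X0: "X 0 \<in> Ob C" using x(2) unfolding acceptable_direct_def direct_sequence_def by blast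
    have "h x = int (mult i Y) - int (mult i Y') - (int (mult i (X 0)) + (int (mult i BC) - int (mult i BK)))"
      unfolding x(1) by (rule C.hom_G0_rel[OF h x(5,6) X0 B])
    then show "h x = \<one>\<^bsub>integer_group\<^esub>"
      using colim_mult[OF i x(2,3,5,7)] mult_zero[OF i zero_colim1[OF x(2,4)] x(6)] by simp
  qed
  have "relations \<subseteq> kernel (G0 C) integer_group h"
  proof
    fix x assume "x \<in> relations"
    then obtain a b where ab: "a \<in> J_colim A C" "b \<in> J_lim A C" "x = a \<otimes>\<^bsub>G0 C\<^esub> b" unfolding relations_def set_mult_def by blast
    then have "a \<in> kernel (G0 C) integer_group h" "b \<in> kernel (G0 C) integer_group h" using 1 2 by blast+
    then show "x \<in> kernel (G0 C) integer_group h" unfolding ab(3) by (rule subgroup.m_closed[OF h.subgroup_kernel])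
  qed
  then have "\<exists>g. g \<in> hom (G0 C Mod relations) integer_group \<and> (\<forall>x\<in>carrier (G0 C). g (relations #>\<^bsub>G0 C\<^esub> x) = h x)"
    by (rule h.FactGroup_universal_kernel[OF relations_normal]) blast
  then obtain g where g: "g \<in> hom (G0 C Mod relations) integer_group" "\<And>x. x \<in> carrier (G0 C) \<Longrightarrow> g (relations #>\<^bsub>G0 C\<^esub> x) = h x" by blast
  show thesis
  proof (rule that)
    show "g \<in> hom (asymptotic_G0 A C) integer_group" using g(1) unfolding asymptotic_G0_def relations_def .
    show "X \<in> Ob C \<Longrightarrow> g (asymptotic_class A C X) = int (mult i X)" for X
      unfolding asymptotic_class_eq using g(2)[OF C.G0_class_closed] h(2) by simp
  qed
qed

lemma asymptotic_class_sum:
  assumes X: "X \<in> Ob C" and B: "locally_finite_sum A C I S n B" and n: "\<And>i. i \<in> I \<Longrightarrow> n i = mult i X"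
  shows "asymptotic_class A C X = asymptotic_class A C B"
proof -
  interpret G: comm_group "G0 C" by (rule C.comm_group_G0)
  have BC: "B \<in> Ob C" by (rule locally_finite_sum_Ob[OF B])
  obtain W f \<theta> where W: "simple_chain A C W f" "loc_finite_chain A C f" "isomorphism A \<theta>" "Dom A \<theta> = W 0" "Cod A \<theta> = X"
    by (rule chain_obtain[OF X])
  note W' = simple_chainD[OF W(1)]
  have WX: "isomorphic C (W 0) X" using C.isomorphicI[of \<theta>] W(3,4,5) X W'(2) by (simp add: isomorphism_C)
  have nW: "n i = card (chain_occurrences A C f (S i))" if i: "i \<in> I" for i
    using n[OF i] mult_iso[OF i WX W'(2) X] chain_mult[OF i W(1,2)] by simp
  obtain c where c: "\<And>r. is_cokernel A (f r) (c r)" "\<And>r. Cod A (c r) \<in> Ob C"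
    by (rule cokernel_choice[OF W'(1,2)]) blast
  have cB: "biproduct_in A C UNIV (\<lambda>r. Cod A (c r)) B" by (rule simple_chain_biproduct[OF W(1) c W(2) B nW])
  have acc: "acceptable_inverse A C W f" by (rule chain_acceptable[OF W(1,2)])
  obtain Z where Z: "zero_object A Z" "Z \<in> Ob C" "biproduct_in A C (UNIV :: nat set) (\<lambda>_. Z) Z" by (rule zero_biproduct)
  obtain L p where L: "lim_cone A W f L p" "zero_object A L" by (rule simple_chain_lim[OF W(1)])
  \<comment> \<open>The limit of the chain is a zero object of \<open>A\<close>; it is replaced by
    the zero object \<open>Z\<close> of \<open>C\<close>, as the relation requires.\<close>
  have lim: "is_lim A W f Z (\<lambda>r. Nul A Z (W r))"
    unfolding is_lim_iff using W'(1) A.lim_cone_zero_object[OF L Z(1) W'(1)] by blast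
  have WA: "W r \<in> Ob A" for r using W'(2) by simp
  obtain P \<pi> where P: "is_product A UNIV W P \<pi>" using nat_product[of W] WA by blast
  obtain d where d: "one_minus_prod A f P \<pi> d" by (rule A.one_minus_ex[OF W'(1) P])
  \<comment> \<open>The arrow \<open>1 - f\<close> is epic, so its cokernel may be taken to be the
    zero arrow to \<open>Z\<close>; this places the derived limit in \<open>C\<close> too.\<close>
  have "is_kernel (op_cat A) d (Nul (op_cat A) Z (Dom (op_cat A) d))"
    by (rule dual.monic_zero_kernel) (use lim1_epic[OF acc P d] Z(1) in simp_all)
  then have dc: "is_cokernel A d (Nul A (Cod A d) Z)" by simp
  have dP: "Cod A d = P" "P \<in> Ob A" using d is_productD(2)[OF P] unfolding one_minus_prod_def by simp_all
  have "Cod A (Nul A (Cod A d) Z) = Z" using dP Z(2) by simp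
  then have lim1: "is_lim1 A W f Z" unfolding is_lim1_def using W'(1) P d dc by blast
  have sums: "ker_cok_sums A C f Z B" unfolding ker_cok_sums_def
  proof (rule exI[of _ "\<lambda>_. Z"], rule exI[of _ "\<lambda>r. Cod A (c r)"], rule exI[of _ "\<lambda>r. Nul A Z (W (Suc r))"], rule exI[of _ c],
      intro conjI allI)
    fix r
    have "is_kernel A (f r) (Nul A Z (Dom A (f r)))" by (rule monic_zero_kernel[OF W'(3) Z(1)])
    then show "is_kernel C (f r) (Nul A Z (W (Suc r)))" using W' Z(2) by (simp add: is_kernel_C)
    show "is_cokernel C (f r) (c r)" using c W' by (simp add: is_cokernel_C)
    show "G0_class C Z = G0_class C (Dom C (Nul A Z (W (Suc r))))" using Z(2) W'(2) by simp
    show "G0_class C (Cod A (c r)) = G0_class C (Cod C (c r))" by simp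
  qed (use Z c cB in simp_all)
  \<comment> \<open>Limit, derived limit and kernels have class zero, so the relation reads
    \<open>0 - 0 = [W 0] + (0 - [B])\<close>.\<close>
  have "G0_rel C Z Z (W 0) Z B \<in> lim_rels" using acc lim lim1 Z(2) sums by blast
  then have J: "G0_rel C Z Z (W 0) Z B \<in> J_lim A C" unfolding J_lim_def by (rule generate.incl)
  note cl = C.G0_class_closed[OF BC] C.G0_class_closed[OF W'(2)[of 0]]
  have Z1: "G0_class C Z = \<one>\<^bsub>G0 C\<^esub>" using C.G0_class_zero Z(1,2) by (simp add: zero_object_C)
  have rel: "G0_rel C Z Z (W 0) Z B = G0_class C B \<otimes>\<^bsub>G0 C\<^esub> inv\<^bsub>G0 C\<^esub> G0_class C (W 0)"
    unfolding G0_rel_def Z1 using cl by (simp add: G.inv_mult G.m_comm)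
  have "\<one>\<^bsub>G0 C\<^esub> \<in> J_colim A C" by (rule subgroup.one_closed[OF J_subgroup(2)])
  then have "\<one>\<^bsub>G0 C\<^esub> \<otimes>\<^bsub>G0 C\<^esub> G0_rel C Z Z (W 0) Z B \<in> relations" unfolding relations_def set_mult_def using J by blast
  then have "G0_class C B \<otimes>\<^bsub>G0 C\<^esub> inv\<^bsub>G0 C\<^esub> G0_class C (W 0) \<in> relations" using cl unfolding rel by simp
  then have "relations #>\<^bsub>G0 C\<^esub> (G0_class C B \<otimes>\<^bsub>G0 C\<^esub> inv\<^bsub>G0 C\<^esub> G0_class C (W 0)) = relations"
    by (rule_tac G.coset_join2[OF _ relations_subgroup]) (use cl in simp_all)
  then have "relations #>\<^bsub>G0 C\<^esub> G0_class C B = relations #>\<^bsub>G0 C\<^esub> G0_class C (W 0)"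
    by (rule G.coset_mult_inv1[OF _ cl subgroup.subset[OF relations_subgroup]])
  then show ?thesis using asymptotic_class_iso[OF WX W'(2) X] unfolding asymptotic_class_eq by simp
qed

end

lemma (in comm_group) mult_inv_eq:
  assumes "x \<otimes> (v \<otimes> z) = (u \<otimes> w) \<otimes> y"
    and "x \<in> carrier G" "y \<in> carrier G" "u \<in> carrier G" "v \<in> carrier G" "w \<in> carrier G" "z \<in> carrier G"
  shows "x \<otimes> inv y = (u \<otimes> inv v) \<otimes> (w \<otimes> inv z)"
proof -
  have "x = x \<otimes> (v \<otimes> z) \<otimes> inv (v \<otimes> z)" using assms(2-) by (simp add: m_assoc)
  then have "x = (u \<otimes> w) \<otimes> y \<otimes> inv (v \<otimes> z)" unfolding assms(1) .
  also have "\<dots> = ((u \<otimes> inv v) \<otimes> (w \<otimes> inv z)) \<otimes> y" using assms(2-) by (simp add: inv_mult m_ac)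
  finally have "x \<otimes> inv y = ((u \<otimes> inv v) \<otimes> (w \<otimes> inv z)) \<otimes> y \<otimes> inv y" by simp
  then show ?thesis using assms(2-) by (simp add: m_assoc)
qed

section \<open>The isomorphism with the product of copies of the integers\<close>

context jh_sum_setting
begin

definition sum_class :: "('u \<Rightarrow> nat) \<Rightarrow> ('o \<Rightarrow>\<^sub>0 int) set set" where
  "sum_class n = asymptotic_class A C (SOME B. locally_finite_sum A C I S n B)"

lemma sum_class_obtain:
  obtains B where "locally_finite_sum A C I S n B" "B \<in> Ob C" "sum_class n = asymptotic_class A C B"
proof -
  obtain B where "locally_finite_sum A C I S n B" by (rule sum_obtain)
  then have "locally_finite_sum A C I S n (SOME B. locally_finite_sum A C I S n B)" by (rule someI)
  then show thesis using that locally_finite_sum_Ob unfolding sum_class_def by blast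
qed

text \<open>By \<open>asymptotic_class_sum\<close> a class depends only on the multiplicities. In
  particular the chosen representative of a locally finite sum is immaterial.\<close>

lemma sum_class_eq:
  assumes "X \<in> Ob C" "\<And>i. i \<in> I \<Longrightarrow> n i = mult i X" shows "sum_class n = asymptotic_class A C X"
proof -
  obtain B where B: "locally_finite_sum A C I S n B" "B \<in> Ob C" "sum_class n = asymptotic_class A C B" by (rule sum_class_obtain)
  show ?thesis unfolding B(3) by (rule asymptotic_class_sum[OF assms(1) B(1) assms(2), symmetric])
qed

lemma sum_class_closed: "sum_class n \<in> carrier (asymptotic_G0 A C)"
proof -
  obtain B where B: "B \<in> Ob C" "sum_class n = asymptotic_class A C B" by (rule sum_class_obtain)
  show ?thesis unfolding B(2) by (rule asymptotic_class_closed[OF B(1)])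
qed

lemma sum_class_zero:
  assumes "\<And>i. i \<in> I \<Longrightarrow> n i = 0" shows "sum_class n = \<one>\<^bsub>asymptotic_G0 A C\<^esub>"
proof -
  obtain Z where Z: "zero_object A Z" "Z \<in> Ob C" by (rule zero_ex_C)
  have "sum_class n = asymptotic_class A C Z"
    by (rule sum_class_eq[OF Z(2)]) (simp add: assms mult_zero[OF _ Z])
  then show ?thesis using asymptotic_class_zero[OF Z] by simp
qed

text \<open>The binary biproduct of the two sums has the added multiplicities by
  \<open>mult_ses\<close>, and equal multiplicities give equal classes.\<close>

lemma sum_class_add:
  assumes "\<And>i. i \<in> I \<Longrightarrow> k i = n i + m i"
  shows "sum_class k = sum_class n \<otimes>\<^bsub>asymptotic_G0 A C\<^esub> sum_class m"
proof -
  obtain B where B: "locally_finite_sum A C I S n B" "B \<in> Ob C" "sum_class n = asymptotic_class A C B" by (rule sum_class_obtain)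
  obtain B' where B': "locally_finite_sum A C I S m B'" "B' \<in> Ob C" "sum_class m = asymptotic_class A C B'" by (rule sum_class_obtain)
  obtain P p q i j where P: "P \<in> Ob C" "q \<in> Hom C P B'" "i \<in> Hom C B P" "j \<in> Hom C B' P" "Cmp C q j = Idn C B'" "is_kernel C q i"
    by (rule C.binary_biproduct[OF B(2) B'(2)]) blast
  have "epic C q"
    by (rule C.epic_cmpD[of q j]) (use P(1,2,4,5) B'(2) C.isomorphism_epic[OF C.isomorphism_idn[OF B'(2)]] in simp_all)
  then have ses: "short_exact C i q" by (rule C.epic_short_exact[OF _ P(6)])
  have c: "Dom A i = B" "Cod A i = P" "Cod A q = B'" using P(2,3) by simp_all
  have "sum_class k = asymptotic_class A C P"
  proof (rule sum_class_eq[OF P(1)])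
    fix l assume l: "l \<in> I"
    show "k l = mult l P" using mult_ses[OF l ses] assms[OF l]
        locally_finite_sum_mult[OF B(1) l] locally_finite_sum_mult[OF B'(1) l] unfolding c by simp
  qed
  then show ?thesis using asymptotic_class_ses[OF ses] unfolding c B(3) B'(3) by simp
qed

lemma class_combination_eq:
  "class_combination A C I S a = sum_class (\<lambda>i. nat (a i)) \<otimes>\<^bsub>asymptotic_G0 A C\<^esub> inv\<^bsub>asymptotic_G0 A C\<^esub> sum_class (\<lambda>i. nat (- a i))"
  unfolding class_combination_def sum_class_def ..

lemma class_combination_hom: "class_combination A C I S \<in> hom (product_group I (\<lambda>_. integer_group)) (asymptotic_G0 A C)"
proof -
  interpret G: comm_group "asymptotic_G0 A C" by (rule comm_group_asymptotic)
  let ?\<Pi> = "product_group I (\<lambda>_::'u. integer_group)"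
  let ?p = "\<lambda>a. sum_class (\<lambda>i. nat (a i))" and ?n = "\<lambda>a. sum_class (\<lambda>i. nat (- a i))"
  show ?thesis
  proof (rule homI)
    fix a show "class_combination A C I S a \<in> carrier (asymptotic_G0 A C)"
      unfolding class_combination_eq using sum_class_closed by simp
    fix b
    define c where "c = a \<otimes>\<^bsub>?\<Pi>\<^esub> b"
    have c: "c i = a i + b i" if "i \<in> I" for i using that by (simp add: c_def)
    \<comment> \<open>Positive and negative parts are not additive separately. The identity of
      naturals \<open>c+ + (a- + b-) = (a+ + b+) + c-\<close> is additive in both sides, and
      \<open>mult_inv_eq\<close> rearranges it into differences.\<close>
    have "?p c \<otimes>\<^bsub>asymptotic_G0 A C\<^esub> (?n a \<otimes>\<^bsub>asymptotic_G0 A C\<^esub> ?n b) = sum_class (\<lambda>i. nat (c i) + (nat (- a i) + nat (- b i)))"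
      by (simp add: sum_class_add[of "\<lambda>i. nat (c i) + (nat (- a i) + nat (- b i))" "\<lambda>i. nat (c i)" "\<lambda>i. nat (- a i) + nat (- b i)"]
          sum_class_add[of "\<lambda>i. nat (- a i) + nat (- b i)" "\<lambda>i. nat (- a i)" "\<lambda>i. nat (- b i)"])
    also have "\<dots> = sum_class (\<lambda>i. nat (a i) + nat (b i)) \<otimes>\<^bsub>asymptotic_G0 A C\<^esub> ?n c"
      by (rule sum_class_add) (simp add: c)
    also have "\<dots> = (?p a \<otimes>\<^bsub>asymptotic_G0 A C\<^esub> ?p b) \<otimes>\<^bsub>asymptotic_G0 A C\<^esub> ?n c"
      by (simp add: sum_class_add[of "\<lambda>i. nat (a i) + nat (b i)" "\<lambda>i. nat (a i)" "\<lambda>i. nat (b i)"])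
    finally show "class_combination A C I S (a \<otimes>\<^bsub>?\<Pi>\<^esub> b)
      = class_combination A C I S a \<otimes>\<^bsub>asymptotic_G0 A C\<^esub> class_combination A C I S b"
      unfolding class_combination_eq c_def[symmetric] by (rule G.mult_inv_eq) (rule sum_class_closed)+
  qed
qed

lemma class_combination_object:
  assumes X: "X \<in> Ob C" and a: "\<And>i. i \<in> I \<Longrightarrow> a i = int (mult i X)"
  shows "class_combination A C I S a = asymptotic_class A C X"
proof -
  interpret G: comm_group "asymptotic_G0 A C" by (rule comm_group_asymptotic)
  have "sum_class (\<lambda>i. nat (a i)) = asymptotic_class A C X" by (rule sum_class_eq[OF X]) (simp add: a)
  moreover have "sum_class (\<lambda>i. nat (- a i)) = \<one>\<^bsub>asymptotic_G0 A C\<^esub>" by (rule sum_class_zero) (simp add: a)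
  ultimately show ?thesis unfolding class_combination_eq using asymptotic_class_closed[OF X] by simp
qed

text \<open>Multiplicity reads off the coefficient from the sums for the positive and the negative
  part, by \<open>locally_finite_sum_mult\<close>. Injectivity follows coordinate by
  coordinate.\<close>

lemma class_combination_coefficient:
  assumes i: "i \<in> I" and h: "h \<in> hom (asymptotic_G0 A C) integer_group" "\<And>X. X \<in> Ob C \<Longrightarrow> h (asymptotic_class A C X) = int (mult i X)"
  shows "h (class_combination A C I S a) = a i"
proof -
  interpret G: comm_group "asymptotic_G0 A C" by (rule comm_group_asymptotic)
  interpret h: group_hom "asymptotic_G0 A C" integer_group h
    unfolding group_hom_def group_hom_axioms_def using h(1) group_integer_group G.is_group by simp
  have s: "h (sum_class n) = int (n i)" for n
  proof -
    obtain B where B: "locally_finite_sum A C I S n B" "B \<in> Ob C" "sum_class n = asymptotic_class A C B" by (rule sum_class_obtain)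
    show ?thesis unfolding B(3) h(2)[OF B(2)] using locally_finite_sum_mult[OF B(1) i] by simp
  qed
  show ?thesis unfolding class_combination_eq using sum_class_closed s by simp
qed

lemma class_combination_inj: "inj_on (class_combination A C I S) (carrier (product_group I (\<lambda>_. integer_group)))"
proof (rule inj_onI)
  fix a b assume ab: "a \<in> carrier (product_group I (\<lambda>_. integer_group))" "b \<in> carrier (product_group I (\<lambda>_. integer_group))"
    and e: "class_combination A C I S a = class_combination A C I S b"
  have "a i = b i" if i: "i \<in> I" for i
  proof -
    obtain h where h: "h \<in> hom (asymptotic_G0 A C) integer_group" "\<And>X. X \<in> Ob C \<Longrightarrow> h (asymptotic_class A C X) = int (mult i X)"
      by (rule asymptotic_mult_hom[OF i]) blast
    show ?thesis using class_combination_coefficient[OF i h, of a] class_combination_coefficient[OF i h, of b] unfolding e by simp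
  qed
  then show "a = b" using ab by (simp, rule_tac PiE_ext)
qed

text \<open>The image is a subgroup that contains the class of every object, with the multiplicities
  as coefficients, and these classes generate.\<close>

lemma class_combination_surj:
  "class_combination A C I S ` carrier (product_group I (\<lambda>_. integer_group)) = carrier (asymptotic_G0 A C)"
proof -
  let ?\<Pi> = "product_group I (\<lambda>_::'u. integer_group)"
  interpret P: group ?\<Pi> by simp
  interpret G: comm_group "asymptotic_G0 A C" by (rule comm_group_asymptotic)
  interpret G0: comm_group "G0 C" by (rule C.comm_group_G0)
  interpret c: group_hom ?\<Pi> "asymptotic_G0 A C" "class_combination A C I S"
    unfolding group_hom_def group_hom_axioms_def using class_combination_hom P.is_group G.is_group by simp
  interpret q: group_hom "G0 C" "asymptotic_G0 A C" "\<lambda>x. relations #>\<^bsub>G0 C\<^esub> x"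
    unfolding group_hom_def group_hom_axioms_def using asymptotic_hom G0.is_group G.is_group by simp
  let ?R = "class_combination A C I S ` carrier ?\<Pi>"
  have R: "subgroup ?R (asymptotic_G0 A C)" by (rule c.img_is_subgroup)
  have "relations #>\<^bsub>G0 C\<^esub> y \<in> ?R" if "y \<in> carrier (G0 C)" for y
    using that
  proof (rule C.G0_induct)
    show "relations #>\<^bsub>G0 C\<^esub> \<one>\<^bsub>G0 C\<^esub> \<in> ?R" unfolding q.hom_one by (rule subgroup.one_closed[OF R])
    fix x y assume xy: "x \<in> carrier (G0 C)" "y \<in> carrier (G0 C)" "relations #>\<^bsub>G0 C\<^esub> x \<in> ?R" "relations #>\<^bsub>G0 C\<^esub> y \<in> ?R"
    show "relations #>\<^bsub>G0 C\<^esub> (x \<otimes>\<^bsub>G0 C\<^esub> inv\<^bsub>G0 C\<^esub> y) \<in> ?R"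
      unfolding q.hom_mult[OF xy(1) G0.inv_closed[OF xy(2)]] q.hom_inv[OF xy(2)]
      by (rule subgroup.m_closed[OF R xy(3) subgroup.m_inv_closed[OF R xy(4)]])
  next
    fix X assume X: "X \<in> Ob C"
    show "relations #>\<^bsub>G0 C\<^esub> G0_class C X \<in> ?R" unfolding asymptotic_class_eq[symmetric]
    proof (rule image_eqI)
      show "asymptotic_class A C X = class_combination A C I S (\<lambda>i\<in>I. int (mult i X))"
        by (rule class_combination_object[OF X, symmetric]) simp
    qed simp
  qed
  then have "(\<lambda>y. relations #>\<^bsub>G0 C\<^esub> y) ` carrier (G0 C) \<subseteq> ?R" by (rule image_subsetI)
  moreover have "carrier (asymptotic_G0 A C) = (\<lambda>x. relations #>\<^bsub>G0 C\<^esub> x) ` carrier (G0 C)"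
    unfolding asymptotic_G0_def relations_def[symmetric] carrier_FactGroup ..
  ultimately have "carrier (asymptotic_G0 A C) \<subseteq> ?R" by simp
  then show ?thesis by (rule subset_antisym[OF subgroup.subset[OF R]])
qed

lemma class_combination_iso: "class_combination A C I S \<in> iso (product_group I (\<lambda>_. integer_group)) (asymptotic_G0 A C)"
  by (rule isoI[OF class_combination_hom bij_betw_imageI[OF class_combination_inj class_combination_surj]])

lemma class_combination_simple:
  assumes i: "i \<in> I"
  shows "class_combination A C I S (\<lambda>j\<in>I. if j = i then 1 else 0) = asymptotic_class A C (S i)"
  by (rule class_combination_object[OF S_Ob[OF i]]) (simp add: mult_simple[OF i])

end

theorem theorem7p20:
  fixes A C :: "('o, 'm) cat" and I :: "'u set" and S :: "'u \<Rightarrow> 'o"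
  assumes "infinite (UNIV :: 'u set)"
    and "abelian_category A" and "AB4 TYPE('u) A" and "AB4_star TYPE('u) A"
    and "full_abelian_subcategory C A"
    and "locally_Jordan_Hoelder A C"
    and "full_simple_collection C I S"
    and "admits_locally_finite_sums A C I S"
  shows "class_combination A C I S
           \<in> iso (product_group I (\<lambda>_. integer_group)) (asymptotic_G0 A C) \<and>
         (\<forall>i\<in>I. class_combination A C I S (\<lambda>j\<in>I. if j = i then 1 else 0) = asymptotic_class A C (S i)) \<and>
         (\<forall>X\<in>Ob C. asymptotic_class A C X =
           class_combination A C I S (\<lambda>i\<in>I. int (simple_multiplicity A C (S i) X)))"
proof -
  have ab: "locally_AB5 A C" "locally_AB5_star A C" using assms(6) unfolding locally_Jordan_Hoelder_def by blast+
  interpret lim_setting A C by (rule lim_settingI[OF assms(1,2,4,5) ab(2)])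
  interpret sum_setting A C I S by (unfold_locales) (rule assms(7,8))+
  interpret jh_setting A C by (rule jh_settingI[OF assms(6)])
  have "lim_setting (op_cat A) (op_cat C)"
    by (rule lim_settingI[OF assms(1) A.op_abelian AB4_star_op[OF assms(3)] subabelian.full[OF op_subabelian]
        locally_AB5_star_op[OF A.preadditive_category_axioms ab(1)]])
  then interpret dual: lim_setting "op_cat A" "op_cat C" .
  interpret jh_sum_setting A C I S by (unfold_locales) (rule assms(6))
  show ?thesis
    using class_combination_iso class_combination_simple class_combination_object by simp
qed

end
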